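(* Let $\alpha\in(0,1/2]$. There exist constants $c,C>0$ depending only on $\alpha$ such that the following holds. Let $G=U(n)$ or $G=SO(n)$, let $H$ be a closed connected Lie subgroup of $G$, let $M=G/H$ be equipped with the metric $\rho_M$, and let $d$ be the real dimension of $M$. Assume that $$\min\{\theta(M),\ \mathrm{diam}\,M,\ \kappa(M)^{-1}\}\ge\alpha ,$$ and that one of the following holds: (a) $\dim H\le(1-\alpha)\dim G$; (b) $H$ acts reducibly on $\mathbf{C}^n$ (resp. $\mathbf{R}^n$ if $G=SO(n)$) and there is a reducing subspace $E$ with $\alpha n\le\dim E\le(1-\alpha)n$; (c) $H$ acts reducibly on $\mathbf{C}^n$ (resp. $\mathbf{R}^n$) and there is a reducing subspace $E$ with $\dim E=k\ge\alpha n$ such that the orthogonal decomposition $\mathbf{C}^n=E\oplus E^\perp$ (resp. $\mathbf{R}^n=E\oplus E^\perp$) induces an isomorphism $H\to U(k)\times H_0$ for some subgroup $H_0$ of $U(n-k)$ (resp. $H\to SO(k)\times H_0$ for some subgroup $H_0$ of $SO(n-k)$). Then, for every $\varepsilon\in(0,\mathrm{diam}\,M]$, $$\left(\frac{c}{\varepsilon}\right)^d\le N(M,\varepsilon)\le\left(\frac{C}{\varepsilon}\right)^d .$$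
   Context: $M(n)$ denotes the $n\times n$ matrices (complex if $G=U(n)$, real if $G=SO(n)$), $\|\cdot\|_\infty$ the operator norm, $\mathcal{G}\subset M(n)$ the Lie algebra of $G$ (skew-Hermitian, resp. real skew-symmetric, matrices), $\mathcal{H}\subset\mathcal{G}$ the Lie algebra of $H$. Dimensions of groups and homogeneous spaces are real dimensions; $\dim E$ is over $\mathbf{C}$ (resp. $\mathbf{R}$). Metrics: $\rho$ is the intrinsic metric on $G$ induced by the operator norm: $\rho(u,v)$ is the infimum of the lengths $\int\|\gamma'(t)\|_\infty dt$ of absolutely continuous curves $\gamma$ in $G$ connecting $u$ and $v$. $M=G/H$ is the space of left cosets of $H$ with the quotient metric $\rho_M(E,F)=\inf\{\rho(u,v):u\in E,\ v\in F\}$; $\mathrm{diam}\,M$ is the diameter with respect to $\rho_M$. Covering number: $N(M,\varepsilon)$ is the smallest number of balls of radius $\varepsilon$ (with respect to $\rho_M$) whose union covers $M$. $\kappa(M)$: let $\mathcal{X}=\mathcal{H}^\perp$ be the orthogonal complement of $\mathcal{H}$ in $\mathcal{G}$ with respect to the real Hilbert–Schmidt inner product $\mathrm{Re}\,\mathrm{tr}(xy^* )$, and let $P_{\mathcal{X}}:\mathcal{G}\to\mathcal{G}$ be the orthogonal projection onto $\mathcal{X}$. Then $\kappa(M)=\|P_{\mathcal{X}}\|$, the norm of $P_{\mathcal{X}}$ as an operator on $(\mathcal{G},\|\cdot\|_\infty)$. $\theta(M)$: for $\theta>0$, $H$ is called $\theta$-woven if for every $u\in H$ with $\rho(u,I)\le\theta$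 there exists $x\in\mathcal{H}$ with $\|x\|_\infty<\pi$ and $u=e^x$. Then $\theta(M)=\sup\{\theta>0: H\text{ is }\theta\text{-woven}\}$ (with $\theta(M)=\pi$ if $H$ is trivial; one always has $\theta(M)\le\pi$). A reducing subspace $E$ for $H$ is one for which $E$ and $E^\perp$ are invariant under all elements of $H$. In (c), the map induced by the decomposition is $u\mapsto(u|_E,u|_{E^\perp})$, after identifying $E$ and $E^\perp$ with Euclidean spaces of dimensions $k$ and $n-k$. *)

theory Defs
  imports
    "HOL-Analysis.Analysis"
    "HOL-Library.Extended_Nat"
    "HOL-Library.Extended_Real"
    "HOL-Algebra.Left_Coset"
    "Jordan_Normal_Form.Schur_Decomposition"
begin

unbundle no vec_syntax
unbundle no inner_syntax

text \<open>
  All notions are polymorphic in the scalar type, which is used at the instances complex and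
  real. On these, \<^const>\<open>conjugate\<close> is complex conjugation resp. the identity, so
  \<^const>\<open>mat_adjoint\<close> is the conjugate transpose resp. the transpose.
\<close>

section \<open>Matrices: norm, topology, exponential\<close>

definition vnorm :: "'a::real_normed_field vec \<Rightarrow> real" where
  "vnorm v = L2_set (\<lambda>i. norm (v $ i)) {..<dim_vec v}"

definition opnorm :: "'a::real_normed_field mat \<Rightarrow> real" where
  "opnorm A = (SUP x\<in>{x \<in> carrier_vec (dim_col A). vnorm x \<le> 1}. vnorm (A *\<^sub>v x))"

text \<open>The usual topology of the $n \times n$ matrices, i.e. that of the entries.\<close>

definition mat_topology :: "nat \<Rightarrow> 'a::real_normed_field mat topology" where
  "mat_topology n =
     pullback_topology (carrier_mat n n)
       (\<lambda>A. \<lambda>ij\<in>{..<n} \<times> {..<n}. A $$ ij)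
       (product_topology (\<lambda>_. euclidean) ({..<n} \<times> {..<n}))"

definition mat_exp :: "'a::real_normed_field mat \<Rightarrow> 'a mat" where
  "mat_exp A = mat (dim_row A) (dim_row A) (\<lambda>ij. \<Sum>k. (A ^\<^sub>m k) $$ ij / fact k)"


section \<open>The groups and their Lie algebras\<close>

definition U_group :: "nat \<Rightarrow> complex mat monoid" where
  "U_group n = \<lparr>carrier = {A \<in> carrier_mat n n. mat_adjoint A * A = 1\<^sub>m n},
                mult = (*), one = 1\<^sub>m n\<rparr>"

definition SO_group :: "nat \<Rightarrow> real mat monoid" where
  "SO_group n = \<lparr>carrier = {A \<in> carrier_mat n n. transpose_mat A * A = 1\<^sub>m n \<and> Determinant.det A = 1},
                 mult = (*), one = 1\<^sub>m n\<rparr>"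

text \<open>Closed subgroups are Lie subgroups, so no smoothness has to be required.\<close>

definition closed_connected_subgroup ::
    "nat \<Rightarrow> 'a::real_normed_field mat monoid \<Rightarrow> 'a mat set \<Rightarrow> bool" where
  "closed_connected_subgroup n G H \<longleftrightarrow>
     subgroup H G \<and>
     closedin (subtopology (mat_topology n) (carrier G)) H \<and>
     connectedin (mat_topology n) H"

definition skew :: "nat \<Rightarrow> 'a::{conjugatable_ordered_field,real_normed_field} mat set" where
  "skew n = {x \<in> carrier_mat n n. mat_adjoint x = - x}"

definition lie_algebra ::
    "nat \<Rightarrow> 'a::{conjugatable_ordered_field,real_normed_field} mat set \<Rightarrow> 'a mat set" where
  "lie_algebra n H = {x \<in> skew n. \<forall>t::real. mat_exp (of_real t \<cdot>\<^sub>m x) \<in> H}"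

text \<open>A set of matrices as a module over the reals, also when the entries are complex.\<close>

definition real_mat_module :: "nat \<Rightarrow> 'a::real_normed_field mat set \<Rightarrow> (real, 'a mat) module" where
  "real_mat_module n W =
     \<lparr>carrier = W, mult = (*), one = 1\<^sub>m n, zero = 0\<^sub>m n n, add = (+),
      smult = (\<lambda>r A. of_real r \<cdot>\<^sub>m A)\<rparr>"

lemma vectorspace_real_mat_module:
  "vectorspace (class_ring :: real ring)
     (real_mat_module n (carrier_mat n n :: 'a::real_normed_field mat set))"
proof -
  interpret abelian_group "real_mat_module n (carrier_mat n n :: 'a mat set)"
  proof (rule abelian_groupI)
    fix x assume "x \<in> carrier (real_mat_module n (carrier_mat n n :: 'a mat set))"
    then have "x \<in> carrier_mat n n" by (simp add: real_mat_module_def)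
    then show "\<exists>y\<in>carrier (real_mat_module n (carrier_mat n n)).
        y \<oplus>\<^bsub>real_mat_module n (carrier_mat n n)\<^esub> x
        = \<zero>\<^bsub>real_mat_module n (carrier_mat n n)\<^esub>"
      by (intro bexI[of _ "- x"]) (auto simp: real_mat_module_def)
  qed (auto simp: real_mat_module_def)
  show ?thesis
    by unfold_locales
      (auto simp: real_mat_module_def class_ring_simps add_smult_distrib_left_mat
        add_smult_distrib_right_mat)
qed

definition real_dim :: "nat \<Rightarrow> 'a::real_normed_field mat set \<Rightarrow> nat" where
  "real_dim n W = vectorspace.dim (class_ring :: real ring) (real_mat_module n W)"

definition group_dim ::
    "nat \<Rightarrow> 'a::{conjugatable_ordered_field,real_normed_field} mat set \<Rightarrow> nat" where
  "group_dim n K = real_dim n (lie_algebra n K)"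

definition quotient_dim ::
    "nat \<Rightarrow> 'a::{conjugatable_ordered_field,real_normed_field} mat monoid \<Rightarrow> 'a mat set \<Rightarrow> nat" where
  "quotient_dim n G H = group_dim n (carrier G) - group_dim n H"


section \<open>The metrics on $G$ and on $G/H$\<close>

definition abs_cont_curve :: "(real \<Rightarrow> 'a::real_normed_field mat) \<Rightarrow> bool" where
  "abs_cont_curve \<gamma> \<longleftrightarrow>
     (\<forall>e>0. \<exists>\<delta>>0. \<forall>(m::nat) (a::nat \<Rightarrow> real) (b::nat \<Rightarrow> real).
        (\<forall>i<m. 0 \<le> a i \<and> a i \<le> b i \<and> b i \<le> 1) \<and>
        disjoint_family_on (\<lambda>i. {a i<..<b i}) {..<m} \<and>
        (\<Sum>i<m. b i - a i) < \<delta>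
        \<longrightarrow> (\<Sum>i<m. opnorm (\<gamma> (b i) - \<gamma> (a i))) < e)"

text \<open>
  An absolutely continuous curve is differentiable almost everywhere; at the remaining points
  \<^const>\<open>vector_derivative\<close> is arbitrary, which does not affect the integral.
\<close>

definition curve_deriv :: "nat \<Rightarrow> (real \<Rightarrow> 'a::real_normed_field mat) \<Rightarrow> real \<Rightarrow> 'a mat" where
  "curve_deriv n \<gamma> t = mat n n (\<lambda>ij. vector_derivative (\<lambda>s. \<gamma> s $$ ij) (at t))"

definition curve_length :: "nat \<Rightarrow> (real \<Rightarrow> 'a::real_normed_field mat) \<Rightarrow> real" where
  "curve_length n \<gamma> = (LINT t:{0..1}|lebesgue. opnorm (curve_deriv n \<gamma> t))"

definition group_dist ::
    "nat \<Rightarrow> 'a::real_normed_field mat monoid \<Rightarrow> 'a mat \<Rightarrow> 'a mat \<Rightarrow> real" where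
  "group_dist n G u v =
     Inf {curve_length n \<gamma> | \<gamma>.
            abs_cont_curve \<gamma> \<and> \<gamma> ` {0..1} \<subseteq> carrier G \<and> \<gamma> 0 = u \<and> \<gamma> 1 = v}"

definition coset_dist ::
    "nat \<Rightarrow> 'a::real_normed_field mat monoid \<Rightarrow> 'a mat set \<Rightarrow> 'a mat set \<Rightarrow> real" where
  "coset_dist n G E F = Inf {group_dist n G u v | u v. u \<in> E \<and> v \<in> F}"

definition quotient_diam :: "nat \<Rightarrow> 'a::real_normed_field mat monoid \<Rightarrow> 'a mat set \<Rightarrow> real" where
  "quotient_diam n G H =
     Sup {coset_dist n G E F | E F. E \<in> lcosets\<^bsub>G\<^esub> H \<and> F \<in> lcosets\<^bsub>G\<^esub> H}"

definition quotient_ball ::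
    "nat \<Rightarrow> 'a::real_normed_field mat monoid \<Rightarrow> 'a mat set \<Rightarrow> 'a mat set \<Rightarrow> real \<Rightarrow> 'a mat set set" where
  "quotient_ball n G H E \<epsilon> = {F \<in> lcosets\<^bsub>G\<^esub> H. coset_dist n G E F < \<epsilon>}"

text \<open>
  Balls are open with centres in $G/H$. The value is \<open>\<infinity>\<close> if there is no finite cover, so an
  upper bound includes finiteness.
\<close>

definition covering_number ::
    "nat \<Rightarrow> 'a::real_normed_field mat monoid \<Rightarrow> 'a mat set \<Rightarrow> real \<Rightarrow> enat" where
  "covering_number n G H \<epsilon> =
     (INF S\<in>{S. finite S \<and> S \<subseteq> lcosets\<^bsub>G\<^esub> H \<and>
                lcosets\<^bsub>G\<^esub> H \<subseteq> (\<Union>E\<in>S. quotient_ball n G H E \<epsilon>)}. enat (card S))"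


section \<open>The invariants $\kappa$ and $\theta$\<close>

definition mat_trace :: "'a::comm_monoid_add mat \<Rightarrow> 'a" where
  "mat_trace A = (\<Sum>i<dim_row A. A $$ (i, i))"

text \<open>On the reals and on the complex numbers, \<open>inner z 1\<close> is the real part of \<open>z\<close>.\<close>

definition hs_inner ::
    "'a::{conjugatable_ordered_field,real_normed_field,real_inner} mat \<Rightarrow> 'a mat \<Rightarrow> real" where
  "hs_inner x y = inner (mat_trace (x * mat_adjoint y)) 1"

definition lie_complement ::
    "nat \<Rightarrow> 'a::{conjugatable_ordered_field,real_normed_field,real_inner} mat set \<Rightarrow> 'a mat set" where
  "lie_complement n H = {x \<in> skew n. \<forall>h\<in>lie_algebra n H. hs_inner x h = 0}"

definition complement_proj ::
    "nat \<Rightarrow> 'a::{conjugatable_ordered_field,real_normed_field,real_inner} mat set \<Rightarrow> 'a mat \<Rightarrow> 'a mat" where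
  "complement_proj n H x =
     (THE y. y \<in> lie_complement n H \<and> (\<forall>z\<in>lie_complement n H. hs_inner (x - y) z = 0))"

definition kappa ::
    "nat \<Rightarrow> 'a::{conjugatable_ordered_field,real_normed_field,real_inner} mat set \<Rightarrow> real" where
  "kappa n H = (SUP x\<in>{x \<in> skew n. opnorm x \<le> 1}. opnorm (complement_proj n H x))"

definition woven ::
    "nat \<Rightarrow> 'a::{conjugatable_ordered_field,real_normed_field} mat monoid \<Rightarrow> 'a mat set \<Rightarrow> real \<Rightarrow> bool" where
  "woven n G H \<theta> \<longleftrightarrow>
     (\<forall>u\<in>H. group_dist n G u (1\<^sub>m n) \<le> \<theta> \<longrightarrow>
        (\<exists>x\<in>lie_algebra n H. opnorm x < pi \<and> u = mat_exp x))"

text \<open>For trivial \<open>H\<close> every \<open>\<theta>\<close> qualifies and the set is unbounded, whence the convention.\<close>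

definition theta ::
    "nat \<Rightarrow> 'a::{conjugatable_ordered_field,real_normed_field} mat monoid \<Rightarrow> 'a mat set \<Rightarrow> real" where
  "theta n G H = (if H = {1\<^sub>m n} then pi else Sup {\<theta>. \<theta> > 0 \<and> woven n G H \<theta>})"


section \<open>Reducing subspaces\<close>

definition vec_subspace :: "nat \<Rightarrow> 'a::field vec set \<Rightarrow> bool" where
  "vec_subspace n E \<longleftrightarrow> VectorSpace.subspace class_ring E (module_vec TYPE('a) n)"

definition vec_subspace_dim :: "nat \<Rightarrow> 'a::field vec set \<Rightarrow> nat" where
  "vec_subspace_dim n E = vectorspace.dim class_ring ((module_vec TYPE('a) n)\<lparr>carrier := E\<rparr>)"

definition orth_compl :: "nat \<Rightarrow> 'a::conjugatable_ordered_field vec set \<Rightarrow> 'a vec set" where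
  "orth_compl n E = {v \<in> carrier_vec n. \<forall>w\<in>E. v \<bullet>c w = 0}"

definition invariant_under :: "'a::field mat set \<Rightarrow> 'a vec set \<Rightarrow> bool" where
  "invariant_under H E \<longleftrightarrow> (\<forall>u\<in>H. \<forall>v\<in>E. u *\<^sub>v v \<in> E)"

definition acts_reducibly :: "nat \<Rightarrow> 'a::field mat set \<Rightarrow> bool" where
  "acts_reducibly n H \<longleftrightarrow>
     (\<exists>E. vec_subspace n E \<and> E \<noteq> {0\<^sub>v n} \<and> E \<noteq> carrier_vec n \<and> invariant_under H E)"

definition reducing_subspace ::
    "nat \<Rightarrow> 'a::conjugatable_ordered_field mat set \<Rightarrow> 'a vec set \<Rightarrow> bool" where
  "reducing_subspace n H E \<longleftrightarrow>
     vec_subspace n E \<and> invariant_under H E \<and> invariant_under H (orth_compl n E)"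

text \<open>
  The columns of \<open>A\<close> and \<open>B\<close> are orthonormal bases of \<open>E\<close> and of its orthogonal complement, so
  they identify these spaces with Euclidean spaces of dimensions \<open>k\<close> and \<open>n - k\<close>. In these
  coordinates the restrictions of \<open>u\<close> are \<open>A\<^sup>* u A\<close> and \<open>B\<^sup>* u B\<close>. The argument \<open>Gr\<close> is one of
  the families \<open>U_group\<close> and \<open>SO_group\<close>.
\<close>

definition splits_full_block ::
    "(nat \<Rightarrow> 'a::conjugatable_ordered_field mat monoid) \<Rightarrow> nat \<Rightarrow> 'a mat set \<Rightarrow> 'a vec set \<Rightarrow> nat \<Rightarrow> bool" where
  "splits_full_block Gr n H E k \<longleftrightarrow>
     (\<exists>A B H0.
        A \<in> carrier_mat n k \<and> mat_adjoint A * A = 1\<^sub>m k \<and> (\<lambda>x. A *\<^sub>v x) ` carrier_vec k = E \<and>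
        B \<in> carrier_mat n (n - k) \<and> mat_adjoint B * B = 1\<^sub>m (n - k) \<and>
        (\<lambda>x. B *\<^sub>v x) ` carrier_vec (n - k) = orth_compl n E \<and>
        subgroup H0 (Gr (n - k)) \<and>
        (\<lambda>u. (mat_adjoint A * u * A, mat_adjoint B * u * B))
          \<in> iso ((Gr n)\<lparr>carrier := H\<rparr>) (Gr k \<times>\<times> (Gr (n - k))\<lparr>carrier := H0\<rparr>))"


section \<open>The hypotheses on $H$\<close>

definition small_dim ::
    "(nat \<Rightarrow> 'a::{conjugatable_ordered_field,real_normed_field} mat monoid) \<Rightarrow> real \<Rightarrow> nat \<Rightarrow> 'a mat set \<Rightarrow> bool" where
  "small_dim Gr \<alpha> n H \<longleftrightarrow>
     real (group_dim n H) \<le> (1 - \<alpha>) * real (group_dim n (carrier (Gr n)))"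

definition balanced_reducing ::
    "real \<Rightarrow> nat \<Rightarrow> 'a::conjugatable_ordered_field mat set \<Rightarrow> bool" where
  "balanced_reducing \<alpha> n H \<longleftrightarrow>
     acts_reducibly n H \<and>
     (\<exists>E. reducing_subspace n H E \<and>
          \<alpha> * real n \<le> real (vec_subspace_dim n E) \<and>
          real (vec_subspace_dim n E) \<le> (1 - \<alpha>) * real n)"

definition full_block_reducing ::
    "(nat \<Rightarrow> 'a::conjugatable_ordered_field mat monoid) \<Rightarrow> real \<Rightarrow> nat \<Rightarrow> 'a mat set \<Rightarrow> bool" where
  "full_block_reducing Gr \<alpha> n H \<longleftrightarrow>
     acts_reducibly n H \<and>
     (\<exists>E k. reducing_subspace n H E \<and> vec_subspace_dim n E = k \<and> \<alpha> * real n \<le> real k \<and>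
            splits_full_block Gr n H E k)"

end

theory Submission
  imports Defs
begin

text \<open>
  Lower bound: for small \<open>x\<close> in the orthogonal complement \<open>X\<close> of the Lie algebra of \<open>H\<close>, the cosets of
  \<open>exp x\<close> are separated like the points \<open>x\<close>: the bound on \<open>\<kappa>\<close> makes \<open>(x, z) \<mapsto> exp x exp z\<close> bi-Lipschitz
  near \<open>0\<close>, and \<open>\<theta>\<close> ensures that elements of \<open>H\<close> close to the identity are of the form \<open>exp z\<close>. Comparing
  volumes in \<open>X\<close> gives \<open>(c / \<epsilon>)\<^sup>d\<close>.

  Upper bound: the same chart and a packing argument in \<open>X\<close> cover a neighbourhood of constant size by
  \<open>(C / \<epsilon>)\<^sup>d\<close> balls. It remains to cover \<open>G / H\<close> by exponentially many (in \<open>d\<close>) neighbourhoods of constant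
  size. Choose a projection \<open>Q\<close> such that all \<open>p \<in> G\<close> that fix the range of \<open>Q\<close> belong to \<open>H\<close>, and such that
  \<open>{M Q}\<close> has dimension \<open>O(d)\<close>; a net of \<open>{g Q | g \<in> G}\<close> induces a net of \<open>G / H\<close>, since an element that almost
  fixes the range of \<open>Q\<close> is close to one that fixes it, by polar decomposition. In cases (a) and (b) one
  takes \<open>Q = 1\<close>, in case (c) the projection onto the complement of \<open>E\<close>.

  The intrinsic metric is bounded below by the operator norm distance, because absolutely continuous
  curves are integrals of their derivatives, and above along products of two exponential curves.
\<close>

section \<open>Absolutely continuous functions of a real variable\<close>

text \<open>The constants must not depend on \<open>n\<close>. All local estimates therefore take
  place in a Banach algebra with the operator norm, and dimensions occur only as exponents of volume
  ratios. An inverse function theorem would not control the size of the chart, so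
  \<open>exp x * exp z = g\<close> is solved as a fixed point problem with constants explicit in
  \<alpha>; as \<open>g - 1\<close> is not skew, it is posed for the skew part of \<open>g\<close>,
  which determines a unitary near 1.

  A norm-attaining vector replaces the spectral theorem: it shows that \<open>exp z\<close> near 1
  and \<open>norm z < pi\<close> force \<open>z\<close> to be small. Iterated square roots give
  logarithms of bounded norm, hence diameters of at most 65.

  A net of all of \<open>G\<close> at constant scale has \<open>exp (O(n\<^sup>2))\<close> points,
  which is admissible if \<open>n\<^sup>2 = O(d)\<close>. This holds in (a) and (b). In (c) one
  merely has \<open>d \<ge> k (n - k)\<close>, while the matrices \<open>M Q\<close> form a space of
  dimension \<open>O(n (n - k))\<close>; this is why \<open>Q\<close> is needed.\<close>

definition increment :: "(real \<Rightarrow> 'a::real_vector) \<Rightarrow> real set \<Rightarrow> 'a" where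
  "increment f K = f (Sup K) - f (Inf K)"

text \<open>Divisions play the role of finite families of disjoint intervals, because the gauge
  integral and its bounded variation criterion are formulated with them.\<close>

definition ac_on :: "real \<Rightarrow> real \<Rightarrow> (real \<Rightarrow> 'a::real_normed_vector) \<Rightarrow> bool" where
  "ac_on a b f \<longleftrightarrow> (\<forall>e>0. \<exists>d>0. \<forall>\<D> T. \<D> division_of T \<longrightarrow> T \<subseteq> {a..b} \<longrightarrow> sum (measure lborel) \<D> < d \<longrightarrow>
     (\<Sum>K\<in>\<D>. norm (increment f K)) < e)"

lemma ac_onE:
  assumes "ac_on a b f" "0 < e"
  obtains d where "d > 0" "\<And>\<D> T. \<D> division_of T \<Longrightarrow> T \<subseteq> {a..b} \<Longrightarrow> sum (measure lborel) \<D> < d \<Longrightarrow>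
     (\<Sum>K\<in>\<D>. norm (increment f K)) < e"
proof -
  have "\<exists>d>0. \<forall>\<D> T. \<D> division_of T \<longrightarrow> T \<subseteq> {a..b} \<longrightarrow> sum (measure lborel) \<D> < d \<longrightarrow>
     (\<Sum>K\<in>\<D>. norm (increment f K)) < e"
    using assms unfolding ac_on_def by simp
  then show ?thesis using that by blast
qed

lemma increment_ivl [simp]: "u \<le> v \<Longrightarrow> increment f {u..v} = f v - f u"
  by (simp add: increment_def)

lemma sum_increment_division:
  fixes f :: "real \<Rightarrow> 'a::real_normed_vector"
  assumes "\<D> division_of {a..b}" "a \<le> b"
  shows "sum (increment f) \<D> = f b - f a"
proof -
  \<comment> \<open>Arbitrary tags: telescoping is applied in its form for tagged divisions, and the
    summands do not depend on the tag.\<close>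
  define tag where "tag = (\<lambda>K::real set. SOME x. x \<in> K)"
  have tag: "tag K \<in> K" if "K \<in> \<D>" for K
    using division_ofD(3)[OF assms(1) that] unfolding tag_def by (metis ex_in_conv someI_ex)
  let ?p = "(\<lambda>K. (tag K, K)) ` \<D>"
  have "?p tagged_division_of {a..b}"
  proof (rule tagged_division_ofI)
    fix x1 K1 x2 K2 assume "(x1, K1) \<in> ?p" "(x2, K2) \<in> ?p" "(x1, K1) \<noteq> (x2, K2)"
    then have "K1 \<in> \<D>" "K2 \<in> \<D>" "K1 \<noteq> K2" by auto
    then show "interior K1 \<inter> interior K2 = {}" by (rule division_ofD(5)[OF assms(1)])
  next
    fix x K assume "(x, K) \<in> ?p"
    then have K: "K \<in> \<D>" "x = tag K" by auto
    show "x \<in> K" "K \<subseteq> {a..b}" "\<exists>a b. K = cbox a b"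
      using tag K division_ofD(2,4)[OF assms(1) K(1)] by auto
  next
    have "{K. \<exists>x. (x, K) \<in> ?p} = \<D>" by auto
    then show "\<Union>{K. \<exists>x. (x, K) \<in> ?p} = {a..b}" using division_ofD(6)[OF assms(1)] by simp
  qed (use division_ofD(1)[OF assms(1)] in auto)
  then have "(\<Sum>(x,K)\<in>?p. f (Sup K) - f (Inf K)) = f b - f a"
    using additive_tagged_division_1[OF assms(2)] by blast
  moreover have "(\<Sum>(x,K)\<in>?p. f (Sup K) - f (Inf K)) = sum (increment f) \<D>"
    by (subst sum.reindex) (auto simp: inj_on_def increment_def)
  ultimately show ?thesis by simp
qed

lemma ac_on_subset: "ac_on a b f \<Longrightarrow> {c..d} \<subseteq> {a..b} \<Longrightarrow> ac_on c d f"
  unfolding ac_on_def by (meson order_trans)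

lemma division_of_single_ivl: "u \<le> v \<Longrightarrow> {{u..v}} division_of {u..v::real}"
  using division_of_self[of u v] by (simp add: box_real)

lemma ac_on_continuous:
  assumes "ac_on a b f" shows "continuous_on {a..b} f"
proof (rule continuous_onI)
  fix x e assume x: "x \<in> {a..b}" and e: "(0::real) < e"
  obtain d where d: "d > 0" and D: "\<And>\<D> T. \<D> division_of T \<Longrightarrow> T \<subseteq> {a..b} \<Longrightarrow> sum (measure lborel) \<D> < d \<Longrightarrow>
     (\<Sum>K\<in>\<D>. norm (increment f K)) < e" using assms e unfolding ac_on_def by metis
  have *: "norm (f v - f u) < e" if "u \<le> v" "v - u < d" "u \<in> {a..b}" "v \<in> {a..b}" for u v
    using D[OF division_of_single_ivl[of u v]] that by (auto simp: content_real)
  show "\<exists>d>0. \<forall>x'\<in>{a..b}. dist x' x < d \<longrightarrow> dist (f x') (f x) \<le> e"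
  proof (intro exI[of _ d] conjI ballI impI d)
    fix x' assume "x' \<in> {a..b}" "dist x' x < d"
    then show "dist (f x') (f x) \<le> e"
      using *[of x x'] *[of x' x] x by (cases "x \<le> x'") (auto simp: dist_norm norm_minus_commute)
  qed
qed

text \<open>The Vitali covering theorem yields countably many disjoint intervals that miss only a
  null set of \<open>S\<close>. By continuity of the measure along decreasing sets, finitely many of
  them miss a set of measure below \<open>e\<close>. Disjointness is stronger than the disjoint
  interiors of a division; it keeps apart the pieces into which different intervals are cut
  later.\<close>

lemma Vitali_finite_division:
  fixes S U :: "real set"
  assumes S: "S \<in> lmeasurable" and SU: "S \<subseteq> U"
    and Q: "\<And>t d. t \<in> S \<Longrightarrow> 0 < d \<Longrightarrow> \<exists>u v. u < t \<and> t < v \<and> v - u < d \<and> {u..v} \<subseteq> U \<and> Q u v"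
    and e: "0 < e"
  obtains \<D> where "\<D> division_of \<Union>\<D>" "disjoint \<D>"
    "\<And>K. K \<in> \<D> \<Longrightarrow> \<exists>u v. u < v \<and> K = {u..v} \<and> K \<subseteq> U \<and> Q u v"
    "measure lebesgue (S - \<Union>\<D>) < e"
proof -
  let ?K = "{(u, v). u < v \<and> {u..v} \<subseteq> U \<and> Q u v}"
  let ?a = "\<lambda>(u, v). (u + v) / 2 :: real" and ?r = "\<lambda>(u, v). (v - u) / 2 :: real"
  let ?B = "\<lambda>i. cball (?a i) (?r i)"
  have ball: "cball (?a i) (?r i) = {fst i..snd i}" for i :: "real \<times> real"
    by (cases i) (auto simp: dist_real_def abs_if field_simps split: if_splits)
  obtain C where C: "countable C" "C \<subseteq> ?K" "pairwise (\<lambda>i j. disjnt (?B i) (?B j)) C"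
    "negligible (S - (\<Union>i\<in>C. ?B i))"
  proof (rule Vitali_covering_theorem_cballs[of ?K ?r S ?a])
    fix x d :: real assume "x \<in> S" "0 < d"
    then obtain u v where "u < x" "x < v" "v - u < d" "{u..v} \<subseteq> U" "Q u v" using Q by blast
    then show "\<exists>i. i \<in> ?K \<and> x \<in> ?B i \<and> ?r i < d"
      by (intro exI[of _ "(u, v)"]) (simp only: ball, auto)
  qed (auto simp: case_prod_unfold)
  show ?thesis
  proof (cases "C = {}")
    case True
    then have "measure lebesgue (S - \<Union>{}) < e" using C(4) e by (simp add: negligible_imp_measure0)
    then show ?thesis using that[of "{}"] by auto
  next
    case False
    \<comment> \<open>If \<open>C\<close> is finite, the enumeration repeats members; as
      \<open>\<D>\<close> is the set of its values, this is harmless.\<close>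
    define c where "c = from_nat_into C"
    have c: "range c = C" unfolding c_def by (rule range_from_nat_into[OF False C(1)])
    define A where "A = (\<lambda>n. S - (\<Union>k<n. ?B (c k)))"
    have Am: "A n \<in> lmeasurable" for n
      unfolding A_def by (intro fmeasurable.Diff S) (auto intro!: borel_closed closed_UN)
    have "(\<lambda>n. measure lebesgue (A n)) \<longlonglongrightarrow> measure lebesgue (\<Inter>n. A n)"
    proof (rule Lim_measure_decseq)
      show "range A \<subseteq> sets lebesgue" using Am by auto
      show "decseq A" unfolding A_def decseq_def by force
      show "emeasure lebesgue (A i) \<noteq> \<infinity>" for i using fmeasurableD2[OF Am[of i]] by (metis infinity_ennreal_def)
    qed
    moreover have "(\<Inter>n. A n) \<subseteq> S - (\<Union>i\<in>C. ?B i)" unfolding A_def using c by force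
    then have "measure lebesgue (\<Inter>n. A n) = 0" using C(4) negligible_subset negligible_imp_measure0 by blast
    ultimately have "\<forall>\<^sub>F n in sequentially. measure lebesgue (A n) < e"
      using e by (simp add: order_tendsto_iff)
    then obtain n where n: "measure lebesgue (A n) < e" using eventually_happens by force
    define \<D> where "\<D> = (\<lambda>k. {fst (c k)..snd (c k)}) ` {..<n}"
    have cK: "fst (c k) < snd (c k) \<and> {fst (c k)..snd (c k)} \<subseteq> U \<and> Q (fst (c k)) (snd (c k))" for k
      using C(2) c by (metis (no_types, lifting) case_prod_beta mem_Collect_eq rangeI subsetD)
    have dis: "disjoint \<D>"
    proof (rule disjointI)
      fix K1 K2 assume K: "K1 \<in> \<D>" "K2 \<in> \<D>" and ne: "K1 \<noteq> K2"
      obtain i j where ij: "K1 = {fst (c i)..snd (c i)}" "K2 = {fst (c j)..snd (c j)}"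
        using K unfolding \<D>_def by auto
      with ne have ne': "c i \<noteq> c j" by metis
      have "c i \<in> C" "c j \<in> C" using c by auto
      with ne' have "disjnt (?B (c i)) (?B (c j))" using pairwiseD[OF C(3)] by blast
      then show "K1 \<inter> K2 = {}" unfolding ball ij by (simp add: disjnt_def)
    qed
    have "\<D> division_of \<Union>\<D>"
    proof (rule division_ofI)
      show "finite \<D>" by (simp add: \<D>_def)
      show "K \<subseteq> \<Union>\<D>" if "K \<in> \<D>" for K using that by blast
      show "K \<noteq> {}" if "K \<in> \<D>" for K using that cK by (auto simp: \<D>_def) (metis less_le_not_le linorder_linear)
      show "\<exists>a b. K = cbox a b" if "K \<in> \<D>" for K using that by (auto simp: \<D>_def simp flip: box_real(2))
      show "interior K1 \<inter> interior K2 = {}" if "K1 \<in> \<D>" "K2 \<in> \<D>" "K1 \<noteq> K2" for K1 K2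
        using disjointD[OF dis that] interior_subset[of K1] interior_subset[of K2] by blast
    qed auto
    moreover have "\<exists>u v. u < v \<and> K = {u..v} \<and> K \<subseteq> U \<and> Q u v" if "K \<in> \<D>" for K
      using that cK unfolding \<D>_def by blast
    moreover have "measure lebesgue (S - \<Union>\<D>) < e"
    proof -
      have sub: "S - \<Union>\<D> \<subseteq> A n" unfolding A_def \<D>_def ball by force
      have "\<D> \<subseteq> range (\<lambda>(u,v). {u..v})" unfolding \<D>_def by auto
      then have "\<Union>\<D> \<in> sets lebesgue" unfolding \<D>_def by (intro sets.finite_UN) auto
      then have "S - \<Union>\<D> \<in> lmeasurable" by (intro fmeasurable_Diff S)
      then have "measure lebesgue (S - \<Union>\<D>) \<le> measure lebesgue (A n)"
        by (intro measure_mono_fmeasurable sub fmeasurableD Am)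
      then show ?thesis using n by simp
    qed
    ultimately show ?thesis using that dis by blast
  qed
qed

text \<open>The intervals contain \<open>t\<close> in their interior instead of starting at
  \<open>t\<close>. This makes the set a countable intersection of open sets, hence measurable, and
  makes Vitali coverings applicable. Large slopes of \<open>f\<close> are small slopes of
  \<open>- f\<close>.\<close>

definition small_slope_at :: "real \<Rightarrow> real \<Rightarrow> (real \<Rightarrow> real) \<Rightarrow> real \<Rightarrow> real set" where
  "small_slope_at a b f p = {t. \<forall>d>0. \<exists>u v. a < u \<and> u < t \<and> t < v \<and> v < b \<and> v - u < d \<and> f v - f u < p * (v - u)}"

lemma small_slope_atE:
  assumes "t \<in> small_slope_at a b f p" "0 < d"
  obtains u v where "a < u" "u < t" "t < v" "v < b" "v - u < d" "f v - f u < p * (v - u)"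
  using assms unfolding small_slope_at_def by blast

lemma small_slope_at_subset: "small_slope_at a b f p \<subseteq> {a<..<b}"
  unfolding small_slope_at_def by (auto dest!: spec[of _ 1])

lemma small_slope_at_measurable: "small_slope_at a b f p \<in> lmeasurable"
proof -
  let ?O = "\<lambda>n. \<Union>{{u<..<v} | u v. a < u \<and> v < b \<and> v - u < inverse (real (Suc n)) \<and> f v - f u < p * (v - u)}"
  have "small_slope_at a b f p = (\<Inter>n. ?O n)"
  proof (intro equalityI subsetI)
    fix t assume "t \<in> small_slope_at a b f p"
    then show "t \<in> (\<Inter>n. ?O n)" unfolding small_slope_at_def
      by clarsimp (metis (no_types) greaterThanLessThan_iff inverse_positive_iff_positive of_nat_0_less_iff of_nat_Suc zero_less_Suc)
  next
    fix t assume t: "t \<in> (\<Inter>n. ?O n)"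
    show "t \<in> small_slope_at a b f p"
      unfolding small_slope_at_def
    proof (intro CollectI allI impI)
      fix d :: real assume "0 < d"
      then obtain n where n: "inverse (real (Suc n)) < d" using reals_Archimedean by blast
      from t have "t \<in> ?O n" by blast
      then obtain u v where "t \<in> {u<..<v}" "a < u" "v < b" "v - u < inverse (real (Suc n))" "f v - f u < p * (v - u)"
        by blast
      then show "\<exists>u v. a < u \<and> u < t \<and> t < v \<and> v < b \<and> v - u < d \<and> f v - f u < p * (v - u)"
        using n by (intro exI[of _ u] exI[of _ v]) auto
    qed
  qed
  moreover have "open (?O n)" for n by (rule open_Union) auto
  ultimately have "small_slope_at a b f p \<in> sets borel" by (auto intro!: sets.countable_INT borel_open)
  then have "small_slope_at a b f p \<in> sets lebesgue" by auto
  then show ?thesis using small_slope_at_subset[of a b f p]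
    by (metis bounded_closed_interval bounded_set_imp_lmeasurable bounded_subset
        greaterThanLessThan_subseteq_atLeastAtMost_iff order_refl)
qed

lemma sum_content_division_eq_measure:
  assumes "\<D> division_of (S::real set)"
  shows "sum (measure lborel) \<D> = measure lebesgue S"
proof -
  have "sum (measure lborel) \<D> = sum (measure lebesgue) \<D>"
  proof (intro sum.cong refl)
    fix K assume "K \<in> \<D>"
    then obtain u v where "K = cbox u v" using division_ofD(4)[OF assms] by blast
    then show "measure lborel K = measure lebesgue K" by (simp add: measure_completion)
  qed
  then show ?thesis by (simp only: content_division[OF assms])
qed

text \<open>A fine cover of a set of points with arbitrarily small slopes below \<open>p\<close> by intervals of such slopes is
  refined by intervals of slopes above \<open>q\<close>; by absolute continuity the increments over the two families
  nearly agree, although the sums are at most \<open>p\<close> and at least \<open>q\<close> times the measure of the set.\<close>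

lemma negligible_two_slopes:
  assumes ac: "ac_on a b f" and pq: "p < q"
  shows "negligible (small_slope_at a b f p \<inter> small_slope_at a b (\<lambda>t. - f t) (- q))"
proof -
  define S where "S = small_slope_at a b f p \<inter> small_slope_at a b (\<lambda>t. - f t) (- q)"
  have S: "S \<in> lmeasurable" unfolding S_def by (intro fmeasurable.Int small_slope_at_measurable)
  define \<mu> where "\<mu> = measure lebesgue S"
  have bound: "(q - p) * \<mu> \<le> (2 * \<bar>q\<bar> + \<bar>p\<bar> + 1) * e" if e: "0 < e" for e
  proof -
    obtain d where d: "d > 0" and D: "\<And>\<D> T. \<D> division_of T \<Longrightarrow> T \<subseteq> {a..b} \<Longrightarrow> sum (measure lborel) \<D> < d \<Longrightarrow>
       (\<Sum>K\<in>\<D>. norm (increment f K)) < e" by (rule ac_onE[OF ac, of "e"]) (use e in auto)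
    \<comment> \<open>The second family will miss at most the length \<open>3 * \<eta>\<close> of
      the first, which has to stay below \<open>d\<close>.\<close>
    define \<eta> where "\<eta> = min (d / 4) e"
    have \<eta>: "0 < \<eta>" "\<eta> \<le> e" "3 * \<eta> < d" using d e by (auto simp: \<eta>_def)
    obtain U0 where U0: "open U0" "S \<subseteq> U0" "U0 - S \<in> lmeasurable" "emeasure lebesgue (U0 - S) < ennreal \<eta>"
      using sets_lebesgue_outer_open[OF fmeasurableD[OF S] \<eta>(1)] by blast
    define U where "U = U0 \<inter> {a<..<b}"
    have U: "open U" "S \<subseteq> U" "U \<subseteq> {a<..<b}"
      using U0 small_slope_at_subset[of a b f p] by (auto simp: U_def S_def)
    have Um: "U \<in> lmeasurable" using U
      by (metis bounded_closed_interval lmeasurable_open bounded_subset greaterThanLessThan_subseteq_atLeastAtMost_iff order_refl)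
    have mU: "measure lebesgue U \<le> \<mu> + \<eta>"
    proof -
      have "measure lebesgue U \<le> measure lebesgue (S \<union> (U0 - S))"
        by (rule measure_mono_fmeasurable[OF _ fmeasurableD[OF Um] fmeasurable.Un[OF S U0(3)]]) (auto simp: U_def)
      also have "\<dots> \<le> \<mu> + measure lebesgue (U0 - S)" unfolding \<mu>_def
        by (rule measure_Un_le) (use S U0 in auto)
      also have "measure lebesgue (U0 - S) \<le> \<eta>"
        using U0(3,4) \<eta>(1) by (metis emeasure_eq_measure2 ennreal_less_iff less_eq_real_def measure_nonneg)
      finally show ?thesis by simp
    qed
    obtain \<D>1 where D1: "\<D>1 division_of \<Union>\<D>1" and dis1: "disjoint \<D>1" and D1':
      "\<And>K. K \<in> \<D>1 \<Longrightarrow> \<exists>u v. u < v \<and> K = {u..v} \<and> K \<subseteq> U \<and> f v - f u < p * (v - u)"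
      "measure lebesgue (S - \<Union>\<D>1) < \<eta>"
    proof (rule Vitali_finite_division[OF S U(2) _ \<eta>(1), where Q = "\<lambda>u v. f v - f u < p * (v - u)"])
      fix t d :: real assume t: "t \<in> S" and d: "0 < d"
      obtain r where r: "r > 0" "ball t r \<subseteq> U" using U t by (meson openE subsetD)
      obtain u v where uv: "a < u" "u < t" "t < v" "v < b" "v - u < min d r" "f v - f u < p * (v - u)"
        using t d r by (auto simp: S_def intro: small_slope_atE[of t a b f p "min d r"])
      then have "{u..v} \<subseteq> ball t r" by (auto simp: dist_real_def)
      then show "\<exists>u v. u < t \<and> t < v \<and> v - u < d \<and> {u..v} \<subseteq> U \<and> f v - f u < p * (v - u)"
        using uv r by (intro exI[of _ u] exI[of _ v]) auto
    qed blast
    \<comment> \<open>The second cover is taken inside the interiors, so that each of its intervals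
      lies in a single interval of \<open>\<D>1\<close>. Only boundary points, a null set, are
      lost.\<close>
    define V where "V = (\<Union>K\<in>\<D>1. interior K)"
    define S1 where "S1 = S \<inter> V"
    have "open V" unfolding V_def by blast
    then have "V \<in> sets lebesgue" using borel_open[of V] by auto
    then have S1: "S1 \<in> lmeasurable" unfolding S1_def by (rule fmeasurable_Int_fmeasurable[OF S])
    obtain \<D>2 where D2: "\<D>2 division_of \<Union>\<D>2" and "disjoint \<D>2" and D2':
      "\<And>K. K \<in> \<D>2 \<Longrightarrow> \<exists>u v. u < v \<and> K = {u..v} \<and> K \<subseteq> V \<and> (q * (v - u) < f v - f u \<and> (\<exists>K\<in>\<D>1. {u..v} \<subseteq> K))"
      "measure lebesgue (S1 - \<Union>\<D>2) < \<eta>"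
    proof (rule Vitali_finite_division[OF S1 _ _ \<eta>(1), where Q = "\<lambda>u v. q * (v - u) < f v - f u \<and> (\<exists>K\<in>\<D>1. {u..v} \<subseteq> K)"])
      show "S1 \<subseteq> V" by (simp add: S1_def)
      fix t d :: real assume t: "t \<in> S1" and d: "0 < d"
      then obtain K where K: "K \<in> \<D>1" "t \<in> interior K" by (auto simp: S1_def V_def)
      then obtain r where r: "r > 0" "ball t r \<subseteq> interior K" by (meson open_interior openE)
      obtain u v where uv: "a < u" "u < t" "t < v" "v < b" "v - u < min d r" "- f v - - f u < - q * (v - u)"
        using t d r by (auto simp: S1_def S_def intro: small_slope_atE[of t a b "\<lambda>t. - f t" "- q" "min d r"])
      then have "{u..v} \<subseteq> ball t r" by (auto simp: dist_real_def)
      then have "{u..v} \<subseteq> interior K" using r by blast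
      then show "\<exists>u v. u < t \<and> t < v \<and> v - u < d \<and> {u..v} \<subseteq> V \<and> (q * (v - u) < f v - f u \<and> (\<exists>K\<in>\<D>1. {u..v} \<subseteq> K))"
        using uv K interior_subset[of K] by (intro exI[of _ u] exI[of _ v]) (auto simp: V_def)
    qed blast
    have fin: "finite \<D>1" "finite \<D>2" using D1(1) D2(1) by (simp_all add: division_of_finite)
    \<comment> \<open>\<open>G K\<close> collects the fine intervals inside \<open>K\<close>,
      \<open>E K\<close> extends them to a division of \<open>K\<close>, and \<open>R\<close>
      consists of the added pieces. The increments over \<open>\<D>1\<close> are those over
      \<open>\<D>2\<close> plus those over \<open>R\<close>, and the latter are below
      \<open>e\<close> because \<open>R\<close> is short.\<close>
    define G where "G = (\<lambda>K. {J \<in> \<D>2. J \<subseteq> K})"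
    have "\<exists>E. G K \<subseteq> E \<and> E division_of K" if K: "K \<in> \<D>1" for K
    proof -
      obtain u v where uv: "u < v" "K = cbox u v" using D1'(1)[OF K] by auto
      have "G K division_of \<Union>(G K)" using division_of_subset[OF D2(1)] by (metis (no_types, lifting) G_def mem_Collect_eq subsetI division_of_union_self)
      moreover have "\<Union>(G K) \<subseteq> cbox u v" using uv by (auto simp: G_def)
      ultimately show ?thesis using partial_division_extend_interval[of "G K" u v] uv(2) by metis
    qed
    then obtain E where E: "\<And>K. K \<in> \<D>1 \<Longrightarrow> G K \<subseteq> E K" "\<And>K. K \<in> \<D>1 \<Longrightarrow> E K division_of K" by metis
    have disj1: "K \<inter> K' = {}" if "K \<in> \<D>1" "K' \<in> \<D>1" "K \<noteq> K'" for K K'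
      using disjointD[OF dis1 that] .
    have ne2: "J \<noteq> {}" if "J \<in> \<D>2" for J using division_ofD(3)[OF D2 that] .
    have disjG: "G K \<inter> G K' = {}" if "K \<in> \<D>1" "K' \<in> \<D>1" "K \<noteq> K'" for K K'
      using disj1[OF that] ne2 unfolding G_def by blast
    have D2G: "\<D>2 = (\<Union>K\<in>\<D>1. G K)" using D2' unfolding G_def by blast
    have finG: "finite (G K)" for K using fin(2) by (simp add: G_def)
    define R where "R = (\<Union>K\<in>\<D>1. E K - G K)"
    have finE: "finite (E K)" if "K \<in> \<D>1" for K using E(2)[OF that] by (rule division_of_finite)
    have EK: "J \<subseteq> K" "J \<noteq> {}" if "K \<in> \<D>1" "J \<in> E K" for K J
      using division_ofD(2,3)[OF E(2)[OF that(1)] that(2)] by auto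
    have disjE: "E K \<inter> E K' = {}" if "K \<in> \<D>1" "K' \<in> \<D>1" "K \<noteq> K'" for K K'
      using disj1[OF that] EK that by blast
    have R: "R division_of \<Union>R"
    proof (rule division_ofI)
      show "finite R" unfolding R_def using fin finE by auto
      show "K \<subseteq> \<Union>R" if "K \<in> R" for K using that by blast
      show "J \<noteq> {}" if "J \<in> R" for J using that EK by (auto simp: R_def)
      show "\<exists>a b. J = cbox a b" if J: "J \<in> R" for J
      proof -
        obtain K where "K \<in> \<D>1" "J \<in> E K" using J by (auto simp: R_def)
        then show ?thesis using division_ofD(4)[OF E(2)] by metis
      qed
      show "interior J \<inter> interior J' = {}" if J: "J \<in> R" "J' \<in> R" "J \<noteq> J'" for J J'
      proof -
        obtain K K' where K: "K \<in> \<D>1" "J \<in> E K" "K' \<in> \<D>1" "J' \<in> E K'" using J by (auto simp: R_def)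
        show ?thesis
        proof (cases "K = K'")
          case True then show ?thesis using division_ofD(5)[OF E(2)[OF K(1)] K(2)] K J by blast
        next
          case False
          then show ?thesis using disj1[OF K(1) K(3)] EK K interior_subset by blast
        qed
      qed
    qed auto
    have split: "(\<Sum>K\<in>\<D>1. sum g (E K)) = sum g \<D>2 + sum g R" for g :: "real set \<Rightarrow> real"
    proof -
      have "(\<Sum>K\<in>\<D>1. sum g (E K)) = (\<Sum>K\<in>\<D>1. sum g (G K) + sum g (E K - G K))"
        by (intro sum.cong refl) (metis E(1) add.commute finE sum.subset_diff)
      also have "\<dots> = (\<Sum>K\<in>\<D>1. sum g (G K)) + (\<Sum>K\<in>\<D>1. sum g (E K - G K))" by (rule sum.distrib)
      also have "(\<Sum>K\<in>\<D>1. sum g (G K)) = sum g \<D>2"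
        unfolding D2G by (rule sum.UNION_disjoint[symmetric]) (use fin disjG finG in auto)
      also have "(\<Sum>K\<in>\<D>1. sum g (E K - G K)) = sum g R"
        unfolding R_def by (rule sum.UNION_disjoint[symmetric]) (use fin disjE finE in auto)
      finally show ?thesis .
    qed
    have sub: "\<Union>\<D>1 \<subseteq> U" using D1' by blast
    have R_sub: "\<Union>R \<subseteq> {a..b}"
    proof -
      have "\<Union>R \<subseteq> \<Union>\<D>1" using EK by (auto simp: R_def)
      then show ?thesis using sub U(3) by force
    qed
    have m1: "sum (measure lborel) \<D>1 = measure lebesgue (\<Union>\<D>1)" and m2: "sum (measure lborel) \<D>2 = measure lebesgue (\<Union>\<D>2)"
      using D1 D2 by (simp_all add: sum_content_division_eq_measure)
    have l1: "\<Union>\<D>1 \<in> lmeasurable" and l2: "\<Union>\<D>2 \<in> lmeasurable"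
      using D1 D2 by (simp_all add: lmeasurable_division)
    have d1u: "sum (measure lborel) \<D>1 \<le> \<mu> + \<eta>"
      unfolding m1 using measure_mono_fmeasurable[OF sub fmeasurableD[OF l1] Um] mU by simp
    have lower: "measure lebesgue A \<le> measure lebesgue B + measure lebesgue (A - B)"
      if "A \<in> lmeasurable" "B \<in> lmeasurable" for A B :: "real set"
    proof -
      have "measure lebesgue A \<le> measure lebesgue (B \<union> (A - B))"
        by (rule measure_mono_fmeasurable) (use that in auto)
      also have "\<dots> \<le> measure lebesgue B + measure lebesgue (A - B)"
        by (rule measure_Un_le) (use that in auto)
      finally show ?thesis .
    qed
    have d1l: "\<mu> - \<eta> \<le> sum (measure lborel) \<D>1"
      unfolding m1 using lower[OF S l1] D1'(2) by (simp add: \<mu>_def)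
    have S1l: "\<mu> - \<eta> \<le> measure lebesgue S1"
    proof -
      have neg: "negligible (\<Union>K\<in>\<D>1. frontier K)"
      proof (rule negligible_Union)
        show "finite ((\<lambda>K. frontier K) ` \<D>1)" using fin by simp
        fix F assume "F \<in> (\<lambda>K. frontier K) ` \<D>1"
        then obtain u v where "F = frontier (cbox u v)" using D1'(1) by (metis box_real(2) imageE)
        then show "negligible F" by (simp only: negligible_convex_frontier[OF convex_box(1)])
      qed
      have "S - S1 \<subseteq> (S - \<Union>\<D>1) \<union> (\<Union>K\<in>\<D>1. frontier K)"
        using closure_subset by (fastforce simp: S1_def V_def frontier_def)
      then have "measure lebesgue (S - S1) \<le> measure lebesgue ((S - \<Union>\<D>1) \<union> (\<Union>K\<in>\<D>1. frontier K))"
        by (rule measure_mono_fmeasurable[OF _ fmeasurableD[OF fmeasurable.Diff[OF S S1]]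
              fmeasurable.Un[OF fmeasurable.Diff[OF S l1] negligible_imp_measurable[OF neg]]])
      also have "\<dots> \<le> measure lebesgue (S - \<Union>\<D>1) + measure lebesgue (\<Union>K\<in>\<D>1. frontier K)"
        by (rule measure_Un_le[OF fmeasurableD[OF fmeasurable.Diff[OF S l1]] negligible_imp_sets[OF neg]])
      also have "measure lebesgue (\<Union>K\<in>\<D>1. frontier K) = 0" using neg by (rule negligible_imp_measure0)
      finally show ?thesis using lower[OF S S1] D1'(2) by (simp add: \<mu>_def)
    qed
    have d2l: "\<mu> - 2 * \<eta> \<le> sum (measure lborel) \<D>2"
      unfolding m2 using lower[OF S1 l2] D2'(2) S1l by simp
    have cE: "sum (measure lborel) (E K) = measure lborel K" and iE: "sum (increment f) (E K) = increment f K" if KD: "K \<in> \<D>1" for K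
    proof -
      obtain u v where uv: "u < v" "K = {u..v}" using D1'(1)[OF KD] by blast
      show "sum (measure lborel) (E K) = measure lborel K" using E(2)[OF KD] uv additive_content_division by (metis box_real(2))
      show "sum (increment f) (E K) = increment f K" using E(2)[OF KD] uv sum_increment_division[of "E K" u v f] by simp
    qed
    have c: "sum (measure lborel) \<D>1 = sum (measure lborel) \<D>2 + sum (measure lborel) R" using split[of "measure lborel"] cE by simp
    have i: "sum (increment f) \<D>1 = sum (increment f) \<D>2 + sum (increment f) R" using split[of "increment f"] iE by simp
    have "sum (measure lborel) R < d" using c d1u d2l \<eta> by linarith
    then have "(\<Sum>K\<in>R. norm (increment f K)) < e" using D[OF R R_sub] by blast
    then have aR: "(\<Sum>K\<in>R. \<bar>increment f K\<bar>) < e" by simp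
    have iR: "\<bar>sum (increment f) R\<bar> < e" by (rule le_less_trans[OF sum_abs aR])
    have i1: "sum (increment f) \<D>1 \<le> p * sum (measure lborel) \<D>1"
      unfolding sum_distrib_left
    proof (rule sum_mono)
      fix K assume "K \<in> \<D>1"
      then obtain u v where "u < v" "K = {u..v}" "f v - f u < p * (v - u)" using D1'(1) by blast
      then show "increment f K \<le> p * measure lborel K" by simp
    qed
    have i2: "q * sum (measure lborel) \<D>2 \<le> sum (increment f) \<D>2"
      unfolding sum_distrib_left
    proof (rule sum_mono)
      fix K assume "K \<in> \<D>2"
      then obtain u v where "u < v" "K = {u..v}" "q * (v - u) < f v - f u" using D2'(1) by blast
      then show "q * measure lborel K \<le> increment f K" by simp
    qed
    have d2u: "sum (measure lborel) \<D>2 \<le> \<mu> + \<eta>"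
      using c d1u sum_nonneg[of R "measure lborel"] by simp
    have "p * sum (measure lborel) \<D>1 \<le> p * \<mu> + \<bar>p\<bar> * \<eta>"
    proof -
      have "p * (sum (measure lborel) \<D>1 - \<mu>) \<le> \<bar>p\<bar> * \<bar>sum (measure lborel) \<D>1 - \<mu>\<bar>" by (metis abs_ge_self abs_mult)
      also have "\<dots> \<le> \<bar>p\<bar> * \<eta>" using d1u d1l by (intro mult_left_mono) auto
      finally show ?thesis by (simp add: algebra_simps)
    qed
    moreover have "q * \<mu> - \<bar>q\<bar> * (2 * \<eta>) \<le> q * sum (measure lborel) \<D>2"
    proof -
      have "q * (\<mu> - sum (measure lborel) \<D>2) \<le> \<bar>q\<bar> * \<bar>\<mu> - sum (measure lborel) \<D>2\<bar>" by (metis abs_ge_self abs_mult)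
      also have "\<dots> \<le> \<bar>q\<bar> * (2 * \<eta>)" using d2u d2l \<eta> by (intro mult_left_mono) auto
      finally show ?thesis by (simp add: algebra_simps)
    qed
    ultimately have "(q - p) * \<mu> \<le> \<bar>p\<bar> * \<eta> + \<bar>q\<bar> * (2 * \<eta>) + e"
      using i i1 i2 iR by (simp add: algebra_simps)
    also have "\<dots> \<le> \<bar>p\<bar> * e + \<bar>q\<bar> * (2 * e) + e"
      using \<eta> by (intro add_mono mult_left_mono) auto
    finally show ?thesis by (simp add: algebra_simps)
  qed
  have "\<mu> \<le> 0"
  proof (rule ccontr)
    assume "\<not> \<mu> \<le> 0"
    then have pos: "0 < (q - p) * \<mu>" using pq by simp
    define c where "c = 2 * \<bar>q\<bar> + \<bar>p\<bar> + 1"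
    have c: "c > 0" unfolding c_def by linarith
    then have "c * ((q - p) * \<mu> / (2 * c)) = (q - p) * \<mu> / 2" by simp
    moreover have "0 < (q - p) * \<mu> / (2 * c)" using pos c by (intro divide_pos_pos) auto
    ultimately have "(q - p) * \<mu> \<le> (q - p) * \<mu> / 2" using bound[of "(q - p) * \<mu> / (2 * c)"] unfolding c_def[symmetric] by linarith
    then show False using pos by linarith
  qed
  then have "measure lebesgue S = 0" using measure_nonneg[of lebesgue S] by (simp add: \<mu>_def)
  then show ?thesis using S unfolding S_def[symmetric] by (simp add: negligible_iff_measure)
qed

text \<open>Intervals of slope below \<open>- n\<close> cover the set up to measure
  \<open>1 / n\<close>. As the variation is at most 1, their total length is at most
  \<open>1 / n\<close> too, so the set has measure at most \<open>2 / n\<close>.\<close>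

lemma negligible_unbounded_slopes:
  assumes var: "\<And>\<D> T. \<D> division_of T \<Longrightarrow> T \<subseteq> {a..b} \<Longrightarrow> (\<Sum>K\<in>\<D>. norm (increment f K)) \<le> 1"
  shows "negligible (\<Inter>n::nat. small_slope_at a b f (- real n))"
proof -
  define S where "S = (\<Inter>n::nat. small_slope_at a b f (- real n))"
  have S: "S \<in> lmeasurable"
  proof -
    have "S \<in> sets lebesgue" unfolding S_def by (intro sets.countable_INT) (auto intro: fmeasurableD small_slope_at_measurable)
    then show ?thesis
      by (rule fmeasurableI2[OF small_slope_at_measurable[of a b f "- real 0"], rotated]) (unfold S_def, blast)
  qed
  have bound: "real n * measure lebesgue S \<le> 2" if n: "n > 0" for n :: nat
  proof -
    have e: "0 < 1 / real n" using n by simp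
    obtain \<D> where D: "\<D> division_of \<Union>\<D>"
      "\<And>K. K \<in> \<D> \<Longrightarrow> \<exists>u v. u < v \<and> K = {u..v} \<and> K \<subseteq> {a..b} \<and> f v - f u < - real n * (v - u)"
      "measure lebesgue (S - \<Union>\<D>) < 1 / real n"
    proof (rule Vitali_finite_division[OF S _ _ e, where U = "{a..b}" and Q = "\<lambda>u v. f v - f u < - real n * (v - u)"])
      have "S \<subseteq> small_slope_at a b f (- real 0)" unfolding S_def by blast
      then show "S \<subseteq> {a..b}" using small_slope_at_subset[of a b f "- real 0"] by force
      fix t d :: real assume "t \<in> S" "0 < d"
      then have "t \<in> small_slope_at a b f (- real n)" by (simp add: S_def)
      then obtain u v where "a < u" "u < t" "t < v" "v < b" "v - u < d" "f v - f u < - real n * (v - u)"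
        using \<open>0 < d\<close> unfolding small_slope_at_def by blast
      then show "\<exists>u v. u < t \<and> t < v \<and> v - u < d \<and> {u..v} \<subseteq> {a..b} \<and> f v - f u < - real n * (v - u)"
        by (intro exI[of _ u] exI[of _ v]) auto
    qed blast
    have "real n * sum (measure lborel) \<D> \<le> (\<Sum>K\<in>\<D>. norm (increment f K))"
      unfolding sum_distrib_left
    proof (rule sum_mono)
      fix K assume "K \<in> \<D>"
      then obtain u v where "u < v" "K = {u..v}" "f v - f u < - real n * (v - u)" using D(2) by blast
      then show "real n * measure lborel K \<le> norm (increment f K)" by simp
    qed
    also have "\<dots> \<le> 1" using var[OF D(1)] D(2) by blast
    finally have 1: "real n * measure lebesgue (\<Union>\<D>) \<le> 1" by (simp add: sum_content_division_eq_measure[OF D(1)])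
    have l: "\<Union>\<D> \<in> lmeasurable" using D(1) by (rule lmeasurable_division)
    have "measure lebesgue S \<le> measure lebesgue (\<Union>\<D> \<union> (S - \<Union>\<D>))"
      by (rule measure_mono_fmeasurable) (use l S in auto)
    also have "\<dots> \<le> measure lebesgue (\<Union>\<D>) + measure lebesgue (S - \<Union>\<D>)"
      by (rule measure_Un_le) (use l S in auto)
    finally have "measure lebesgue S \<le> measure lebesgue (\<Union>\<D>) + 1 / real n" using D(3) by simp
    then have "real n * measure lebesgue S \<le> real n * (measure lebesgue (\<Union>\<D>) + 1 / real n)" by (intro mult_left_mono) auto
    then show ?thesis using 1 n by (simp add: distrib_left)
  qed
  have "measure lebesgue S \<le> 0"
  proof (rule ccontr)
    assume "\<not> measure lebesgue S \<le> 0"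
    then have pos: "0 < measure lebesgue S" by simp
    obtain n where "real n > 2 / measure lebesgue S" using reals_Archimedean2 by blast
    moreover from this have "n > 0" using pos by (metis divide_pos_pos gr0I less_asym of_nat_0 zero_less_numeral)
    ultimately show False using bound[of n] pos by (simp add: field_simps)
  qed
  then have "measure lebesgue S = 0" using measure_nonneg[of lebesgue S] by linarith
  then show ?thesis using S unfolding S_def[symmetric] by (simp add: negligible_iff_measure)
qed

text \<open>A difference quotient at \<open>t\<close> gives an interval with \<open>t\<close> as an
  endpoint. Moving both endpoints outwards a little puts \<open>t\<close> into the interior, and by
  continuity the strict bound on the slope survives.\<close>

lemma slope_frequently_imp_small_slope_at:
  assumes cont: "continuous_on {a<..<b} f" and t: "a < t" "t < b"
    and fr: "\<exists>\<^sub>F h in at 0. (f (t + h) - f t) / h < p"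
  shows "t \<in> small_slope_at a b f p"
  unfolding small_slope_at_def
proof (intro CollectI allI impI)
  fix d :: real assume d: "0 < d"
  define r where "r = min (d / 2) (min (t - a) (b - t))"
  have r: "0 < r" using d t by (auto simp: r_def)
  have "\<forall>\<^sub>F h in at (0::real). \<bar>h\<bar> < r \<and> h \<noteq> 0"
    unfolding eventually_at using r by (intro exI[of _ r]) (auto simp: dist_real_def)
  then have "\<forall>\<^sub>F h in at 0. (f (t + h) - f t) / h < p \<longrightarrow> (f (t + h) - f t) / h < p \<and> \<bar>h\<bar> < r \<and> h \<noteq> 0"
    by eventually_elim simp
  then have "\<exists>\<^sub>F h in at 0. (f (t + h) - f t) / h < p \<and> \<bar>h\<bar> < r \<and> h \<noteq> 0"
    by (rule frequently_rev_mp[OF fr])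
  then obtain h where h: "(f (t + h) - f t) / h < p" "\<bar>h\<bar> < r" "h \<noteq> 0" using frequently_ex by blast
  have c0: "isCont f x" if "a < x" "x < b" for x
    using cont that by (simp add: continuous_on_eq_continuous_at)
  define x y where "x = min t (t + h)" and "y = max t (t + h)"
  have xy: "x < y" "a < x" "y < b" "y - x < r" "x \<le> t" "t \<le> y" "f y - f x - p * (y - x) < 0"
    using h by (auto simp: x_def y_def r_def min_def max_def abs_if field_simps split: if_splits)
  let ?g = "\<lambda>s. f (y + s) - f (x - s) - p * ((y + s) - (x - s))"
  have "isCont (\<lambda>s. f (y + s)) 0"
    by (rule isCont_o2[where f = "\<lambda>s. y + s" and g = f]) (use c0[of y] xy in \<open>auto intro!: continuous_intros\<close>)
  moreover have "isCont (\<lambda>s. f (x - s)) 0"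
    by (rule isCont_o2[where f = "\<lambda>s. x - s" and g = f]) (use c0[of x] xy in \<open>auto intro!: continuous_intros\<close>)
  ultimately have "isCont ?g 0" by (auto intro!: continuous_intros)
  then have "(?g \<longlongrightarrow> ?g 0) (at_right 0)"
    using continuous_at filterlim_at_split by blast
  then have "\<forall>\<^sub>F s in at_right 0. ?g s < 0" using xy by (intro order_tendstoD(2)) auto
  moreover have "\<forall>\<^sub>F s in at_right (0::real). s \<in> {0<..<min (d / 4) (min (x - a) (b - y))}"
    using d xy by (intro eventually_at_right_real) auto
  ultimately have "\<forall>\<^sub>F s in at_right 0. ?g s < 0 \<and> s < min (d / 4) (min (x - a) (b - y)) \<and> 0 < s"
    by eventually_elim auto
  then obtain s where s: "?g s < 0" "s < min (d / 4) (min (x - a) (b - y))" "0 < s"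
    using eventually_happens'[OF trivial_limit_at_right_real] by blast
  then show "\<exists>u v. a < u \<and> u < t \<and> t < v \<and> v < b \<and> v - u < d \<and> f v - f u < p * (v - u)"
    using xy by (intro exI[of _ "x - s"] exI[of _ "y + s"]) (auto simp: r_def)
qed

text \<open>Outside \<open>N\<close> no pair of rationals \<open>p < q\<close> separates small from
  large slopes, so the difference quotients converge to the supremum \<open>L\<close> of their
  rational lower bounds. The two infinite intersections in \<open>N\<close> ensure that such bounds
  exist and are bounded above.\<close>

lemma ac_on_differentiable_ae:
  fixes f :: "real \<Rightarrow> real"
  assumes ac: "ac_on a b f"
    and var: "\<And>\<D> T. \<D> division_of T \<Longrightarrow> T \<subseteq> {a..b} \<Longrightarrow> (\<Sum>K\<in>\<D>. norm (increment f K)) \<le> 1"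
  obtains N where "negligible N" "\<And>t. t \<in> {a<..<b} - N \<Longrightarrow> f differentiable (at t)"
proof -
  let ?A = "\<lambda>p. small_slope_at a b f p" and ?B = "\<lambda>q. small_slope_at a b (\<lambda>t. - f t) (- q)"
  define N where "N = (\<Union>p\<in>\<rat>. \<Union>q\<in>\<rat> \<inter> {p<..}. ?A p \<inter> ?B q) \<union> (\<Inter>n::nat. ?A (- real n)) \<union> (\<Inter>n::nat. ?B (real n))"
  have var': "(\<Sum>K\<in>\<D>. norm (increment (\<lambda>t. - f t) K)) \<le> 1" if "\<D> division_of T" "T \<subseteq> {a..b}" for \<D> T
    using var[OF that] by (simp add: increment_def abs_minus_commute)
  have "negligible N"
    unfolding N_def
  proof (intro negligible_Un)
    show "negligible (\<Union>p\<in>\<rat>. \<Union>q\<in>\<rat> \<inter> {p<..}. ?A p \<inter> ?B q)"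
    proof (rule negligible_countable_Union)
      fix T assume "T \<in> (\<lambda>p. \<Union>q\<in>\<rat> \<inter> {p<..}. ?A p \<inter> ?B q) ` \<rat>"
      then obtain p where T: "T = (\<Union>q\<in>\<rat> \<inter> {p<..}. ?A p \<inter> ?B q)" by blast
      show "negligible T" unfolding T
      proof (rule negligible_countable_Union)
        show "countable ((\<lambda>q. ?A p \<inter> ?B q) ` (\<rat> \<inter> {p<..}))" by (intro countable_image countable_Int1 countable_rat)
      qed (use negligible_two_slopes[OF ac] in auto)
    qed (intro countable_image countable_rat)
    show "negligible (\<Inter>n::nat. ?A (- real n))" by (rule negligible_unbounded_slopes[OF var])
    show "negligible (\<Inter>n::nat. ?B (real n))" by (rule negligible_unbounded_slopes[OF var'])
  qed
  moreover have "f differentiable (at t)" if t: "t \<in> {a<..<b} - N" for t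
  proof -
    have cont: "continuous_on {a<..<b} f"
      using ac_on_continuous[OF ac] by (rule continuous_on_subset) auto
    let ?Q = "\<lambda>h. (f (t + h) - f t) / h"
    have lo: "\<forall>\<^sub>F h in at 0. p \<le> ?Q h" if "t \<notin> ?A p" for p
      using slope_frequently_imp_small_slope_at[OF cont, of t p] t that
      by (auto simp: frequently_def not_less)
    have hi: "\<forall>\<^sub>F h in at 0. ?Q h \<le> q" if "t \<notin> ?B q" for q
    proof -
      have "\<forall>\<^sub>F h in at 0. - q \<le> (- f (t + h) - - f t) / h"
        using slope_frequently_imp_small_slope_at[OF continuous_on_minus[OF cont], of t "- q"] t that
        by (auto simp: frequently_def not_less)
      then show ?thesis by eventually_elim (metis minus_diff_minus minus_divide_left neg_le_iff_le)
    qed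
    define X where "X = {p\<in>\<rat>. t \<notin> ?A p}"
    obtain m where m: "t \<notin> ?A (- real m)" using t by (auto simp: N_def)
    obtain n where n: "t \<notin> ?B (real n)" using t by (auto simp: N_def)
    have Xne: "X \<noteq> {}" using m by (auto simp: X_def intro!: exI[of _ "- real m"])
    have Xb: "p \<le> real n" if "p \<in> X" for p
    proof -
      have "t \<notin> ?A p" using that by (simp add: X_def)
      from eventually_conj[OF lo[OF this] hi[OF n]] have "\<forall>\<^sub>F h in at (0::real). p \<le> real n"
        by (rule eventually_mono) linarith
      then show ?thesis by simp
    qed
    define L where "L = Sup X"
    have bdd: "bdd_above X" using Xb by (auto simp: bdd_above_def)
    have "(?Q \<longlongrightarrow> L) (at 0)"
    proof (rule order_tendstoI)
      fix c assume "c < L"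
      then obtain p where p: "p \<in> X" "c < p" using less_cSupE[of c X] Xne by (auto simp: L_def)
      then show "\<forall>\<^sub>F h in at 0. c < ?Q h" using lo[of p] by (auto simp: X_def elim: eventually_mono)
    next
      fix c assume "L < c"
      then obtain p where p: "p \<in> \<rat>" "L < p" "p < c" using Rats_dense_in_real by blast
      then obtain q where q: "q \<in> \<rat>" "p < q" "q < c" using Rats_dense_in_real by blast
      have "p \<notin> X" using cSup_upper[OF _ bdd] p(2) by (force simp: L_def)
      then have "t \<in> ?A p" using p by (auto simp: X_def)
      then have "t \<notin> ?B q" using t p q by (auto simp: N_def)
      from hi[OF this] show "\<forall>\<^sub>F h in at 0. ?Q h < c" using q by (auto elim: eventually_mono)
    qed
    then have "(f has_field_derivative L) (at t)" by (simp add: DERIV_def)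
    then show ?thesis using real_differentiable_def by blast
  qed
  ultimately show ?thesis using that by blast
qed

text \<open>The gauge distinguishes two kinds of tags. Outside \<open>N\<close>, differentiability
  makes the summands match the increments up to \<open>e1\<close> times the length. Intervals tagged
  in \<open>N\<close>, where the integrand is set to 0, are forced into an open set of measure below
  \<open>d\<close>, and absolute continuity bounds their increments.\<close>

lemma ac_on_fundamental_theorem:
  fixes f :: "real \<Rightarrow> 'a::euclidean_space"
  assumes ac: "ac_on a b f" and ab: "a \<le> b" and N: "negligible N"
    and der: "\<And>t. t \<in> {a..b} - N \<Longrightarrow> (f has_vector_derivative g t) (at t)"
  shows "(g has_integral f b - f a) {a..b}"
proof -
  let ?g = "\<lambda>t. if t \<in> N then 0 else g t"
  have "(?g has_integral f b - f a) (cbox a b)"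
    unfolding has_integral
  proof (intro allI impI)
    fix e :: real assume e: "0 < e"
    define e1 where "e1 = e / (2 * (b - a + 1))"
    have e1: "0 < e1" "e1 * (b - a) < e / 2" using e ab by (auto simp: e1_def field_simps)
    obtain d where d: "d > 0" and D: "\<And>\<D> T. \<D> division_of T \<Longrightarrow> T \<subseteq> {a..b} \<Longrightarrow> sum (measure lborel) \<D> < d \<Longrightarrow>
       (\<Sum>K\<in>\<D>. norm (increment f K)) < e / 2" by (rule ac_onE[OF ac, of "e / 2"]) (use e in auto)
    obtain U where U: "open U" "N \<subseteq> U" "U - N \<in> lmeasurable" "emeasure lebesgue (U - N) < ennreal d"
      using sets_lebesgue_outer_open[OF negligible_imp_sets[OF N] d] by blast
    have Um: "U \<in> lmeasurable" "measure lebesgue U < d"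
    proof -
      have eq: "U = (U - N) \<union> N" using U by blast
      show "U \<in> lmeasurable" by (subst eq) (intro fmeasurable.Un U negligible_imp_measurable N)
      have "measure lebesgue U \<le> measure lebesgue (U - N) + measure lebesgue N"
        by (subst eq) (rule measure_Un_le, use U N in \<open>auto intro: negligible_imp_sets\<close>)
      also have "measure lebesgue (U - N) < d"
        using U(3,4) d by (metis emeasure_eq_measure2 ennreal_less_iff measure_nonneg)
      finally show "measure lebesgue U < d" using N by (simp add: negligible_imp_measure0)
    qed
    have "\<exists>r>0. \<forall>u v. u \<le> t \<and> t \<le> v \<and> {u..v} \<subseteq> ball t r \<longrightarrow> norm (f v - f u - (v - u) *\<^sub>R g t) \<le> e1 * (v - u)"
      if "t \<in> {a..b} - N" for t
    proof -
      have "(f has_derivative (\<lambda>h. h *\<^sub>R g t)) (at t)" using der[OF that] by (simp add: has_vector_derivative_def)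
      then obtain r where r: "r > 0" "\<And>y. norm (y - t) < r \<Longrightarrow> norm (f y - f t - (y - t) *\<^sub>R g t) \<le> e1 * norm (y - t)"
        unfolding has_derivative_at_alt using e1(1) by blast
      show ?thesis
      proof (intro exI[of _ r] conjI allI impI r(1))
        fix u v assume uv: "u \<le> t \<and> t \<le> v \<and> {u..v} \<subseteq> ball t r"
        have "u \<in> {u..v}" "v \<in> {u..v}" using uv by auto
        then have "u \<in> ball t r" "v \<in> ball t r" using uv by blast+
        then have "norm (u - t) < r" "norm (v - t) < r" by (auto simp: dist_norm norm_minus_commute)
        then have b: "norm (f v - f t - (v - t) *\<^sub>R g t) \<le> e1 * (v - t)" "norm (f u - f t - (u - t) *\<^sub>R g t) \<le> e1 * (t - u)"
          using r(2)[of u] r(2)[of v] uv by auto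
        have eq: "f v - f u - (v - u) *\<^sub>R g t = (f v - f t - (v - t) *\<^sub>R g t) - (f u - f t - (u - t) *\<^sub>R g t)"
          by (simp add: algebra_simps)
        have "norm (f v - f u - (v - u) *\<^sub>R g t) \<le> e1 * (v - t) + e1 * (t - u)"
          unfolding eq using add_mono[OF b(1) b(2)] norm_triangle_ineq4 order_trans by blast
        then show "norm (f v - f u - (v - u) *\<^sub>R g t) \<le> e1 * (v - u)" by (simp add: algebra_simps)
      qed
    qed
    then obtain r where r: "\<And>t. t \<in> {a..b} - N \<Longrightarrow> r t > 0"
      "\<And>t u v. t \<in> {a..b} - N \<Longrightarrow> u \<le> t \<Longrightarrow> t \<le> v \<Longrightarrow> {u..v} \<subseteq> ball t (r t) \<Longrightarrow>
         norm (f v - f u - (v - u) *\<^sub>R g t) \<le> e1 * (v - u)" by metis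
    define \<gamma> where "\<gamma> = (\<lambda>t. if t \<in> N then U else if t \<in> {a..b} then ball t (r t) else ball t 1)"
    have "gauge \<gamma>" using U r by (auto simp: gauge_def \<gamma>_def)
    moreover have "norm ((\<Sum>(x, K)\<in>p. measure lborel K *\<^sub>R ?g x) - (f b - f a)) < e"
      if p: "p tagged_division_of cbox a b" "\<gamma> fine p" for p
    proof -
      have fin: "finite p" using p(1) by (rule tagged_division_ofD)
      have p': "x \<in> K" "K \<subseteq> {a..b}" "K \<subseteq> \<gamma> x" "\<exists>u v. u \<le> v \<and> K = {u..v}" if xK: "(x, K) \<in> p" for x K
      proof -
        show "x \<in> K" "K \<subseteq> {a..b}" "K \<subseteq> \<gamma> x" using tagged_division_ofD(2,3)[OF p(1) xK] p(2) xK by (auto simp: fine_def)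
        obtain u v where "K = {u..v}" using tagged_division_ofD(4)[OF p(1) xK] by auto
        then show "\<exists>u v. u \<le> v \<and> K = {u..v}" using \<open>x \<in> K\<close> by auto
      qed
      define P where "P = {(x, K) \<in> p. x \<in> N}"
      let ?h = "\<lambda>(x, K). measure lborel K *\<^sub>R ?g x - increment f K"
      have "(\<Sum>(x, K)\<in>p. increment f K) = f b - f a"
        using additive_tagged_division_1[OF ab, of p f] p(1) by (simp add: increment_def)
      then have "(\<Sum>(x, K)\<in>p. measure lborel K *\<^sub>R ?g x) - (f b - f a) = sum ?h p"
        by (simp add: case_prod_unfold sum_subtractf)
      also have "\<dots> = sum ?h P + sum ?h (p - P)"
        by (metis (no_types, lifting) P_def add.commute fin mem_Collect_eq subsetI sum.subset_diff case_prodE case_prodD)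
      finally have eq: "(\<Sum>(x, K)\<in>p. measure lborel K *\<^sub>R ?g x) - (f b - f a) = sum ?h P + sum ?h (p - P)" .
      have PP: "P \<subseteq> p" by (auto simp: P_def)
      have "norm (sum ?h P) < e / 2"
      proof -
        have tp: "P tagged_partial_division_of cbox a b"
          using tagged_partial_division_subset[OF _ PP] p(1) by (simp add: tagged_division_of_def)
        then have div: "snd ` P division_of \<Union>(snd ` P)" by (rule partial_division_of_tagged_division)
        have sub: "\<Union>(snd ` P) \<subseteq> U" using p'(3) by (force simp: P_def \<gamma>_def)
        have "sum (measure lborel) (snd ` P) = measure lebesgue (\<Union>(snd ` P))"
          by (rule sum_content_division_eq_measure[OF div])
        also have "\<dots> \<le> measure lebesgue U"
          by (rule measure_mono_fmeasurable[OF sub _ Um(1)]) (intro fmeasurableD lmeasurable_division[OF div])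
        finally have "sum (measure lborel) (snd ` P) < d" using Um by simp
        moreover have "\<Union>(snd ` P) \<subseteq> {a..b}" using p'(2) PP by fastforce
        ultimately have s: "(\<Sum>K\<in>snd ` P. norm (increment f K)) < e / 2" using D[OF div] by blast
        have "norm (sum ?h P) \<le> (\<Sum>(x, K)\<in>P. norm (increment f K))"
          by (rule order_trans[OF norm_sum]) (auto intro!: sum_mono simp: P_def)
        \<comment> \<open>The passage from tagged intervals to intervals asks for summands that
          vanish at every degenerate interval, including the empty one, where
          \<open>increment\<close> would evaluate \<open>f\<close> at \<open>Sup {}\<close> and
          \<open>Inf {}\<close>.\<close>
        also have "\<dots> = (\<Sum>(x, K)\<in>P. if K = {} then 0 else norm (increment f K))"
          using p'(1) PP by (intro sum.cong refl) (auto, blast)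
        also have "\<dots> = (\<Sum>K\<in>snd ` P. if K = {} then 0 else norm (increment f K))"
        proof (rule sum.over_tagged_division_lemma[of P "\<Union>(snd ` P)"])
          show "P tagged_division_of \<Union>(snd ` P)" using tp by (simp add: tagged_partial_division_of_Union_self)
          show "(if cbox u v = {} then 0 else norm (increment f (cbox u v))) = 0" if "box u v = {}" for u v :: real
            using that by (auto simp: increment_def)
        qed
        also have "\<dots> = (\<Sum>K\<in>snd ` P. norm (increment f K))"
          using p'(1) PP by (intro sum.cong refl) (auto, blast)
        finally show ?thesis using s by simp
      qed
      moreover have "norm (sum ?h (p - P)) \<le> e1 * (b - a)"
      proof -
        have "norm (sum ?h (p - P)) \<le> (\<Sum>(x, K)\<in>p - P. e1 * measure lborel K)"
        proof (rule sum_norm_le, clarify)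
          fix x K assume xK: "(x, K) \<in> p" "(x, K) \<notin> P"
          obtain u v where uv: "u \<le> v" "K = {u..v}" using p'(4)[OF xK(1)] by blast
          have x: "x \<in> {a..b} - N" "{u..v} \<subseteq> ball x (r x)"
            using xK p'(1,2,3)[OF xK(1)] uv by (auto simp: P_def \<gamma>_def)
          have "norm (f v - f u - (v - u) *\<^sub>R g x) \<le> e1 * (v - u)"
            using r(2)[OF x(1) _ _ x(2)] p'(1)[OF xK(1)] uv by auto
          then show "norm (measure lborel K *\<^sub>R ?g x - increment f K) \<le> e1 * measure lborel K"
            using uv x by (simp add: norm_minus_commute)
        qed
        also have "\<dots> \<le> (\<Sum>(x, K)\<in>p. e1 * measure lborel K)"
          by (rule sum_mono2[OF fin]) (use e1 in auto)
        also have "\<dots> = e1 * (b - a)"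
          using additive_content_tagged_division[OF p(1)] ab by (simp add: case_prod_unfold flip: sum_distrib_left)
        finally show ?thesis .
      qed
      ultimately show ?thesis unfolding eq using norm_triangle_ineq[of "sum ?h P" "sum ?h (p - P)"] e1(2) by linarith
    qed
    ultimately show "\<exists>\<gamma>. gauge \<gamma> \<and> (\<forall>p. p tagged_division_of cbox a b \<and> \<gamma> fine p \<longrightarrow>
        norm ((\<Sum>(x, K)\<in>p. measure lborel K *\<^sub>R ?g x) - (f b - f a)) < e)"
      by (intro exI[of _ \<gamma>] conjI allI impI) (auto simp only:)
  qed
  then show ?thesis using has_integral_spike[OF N, of "{a..b}" g ?g] by simp
qed

text \<open>On pieces of length \<open>s < d\<close> the variation is at most 1. This provides
  differentiability almost everywhere, coordinate by coordinate, and absolute integrability of the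
  derivative. The finitely many cut points, with \<open>a\<close> and \<open>b\<close> among them,
  are put into the exceptional set.\<close>

lemma ac_on_absolutely_integrable_derivative:
  fixes f :: "real \<Rightarrow> 'a::euclidean_space"
  assumes ac: "ac_on a b f" and ab: "a < b"
  obtains N g where "negligible N" "\<And>t. t \<in> {a..b} - N \<Longrightarrow> (f has_vector_derivative g t) (at t)"
    "g absolutely_integrable_on {a..b}" "integral {a..b} g = f b - f a"
proof -
  obtain d where d: "d > 0" and D: "\<And>\<D> T. \<D> division_of T \<Longrightarrow> T \<subseteq> {a..b} \<Longrightarrow> sum (measure lborel) \<D> < d \<Longrightarrow>
     (\<Sum>K\<in>\<D>. norm (increment f K)) < 1" by (rule ac_onE[OF ac, of 1]) auto
  obtain m :: nat where m: "real m > (b - a) / d" using reals_Archimedean2 by blast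
  have m0: "real m > 0" using m ab d by (metis divide_pos_pos diff_gt_0_iff_gt order.strict_trans)
  define s where "s = (b - a) / real m"
  have s: "0 < s" "s < d" using m m0 d ab by (auto simp: s_def field_simps)
  define c where "c = (\<lambda>k::nat. a + real k * s)"
  have c: "c 0 = a" "c m = b" "\<And>k. c (Suc k) = c k + s" using m0 by (auto simp: c_def s_def field_simps)
  have cle: "a \<le> c k" for k using s by (simp add: c_def)
  have cb: "c k \<le> b" if "k \<le> m" for k
  proof -
    have "real k * s \<le> real m * s" using that s by (intro mult_right_mono) auto
    then show ?thesis using c(2) by (simp add: c_def)
  qed
  have var: "(\<Sum>K\<in>\<D>. norm (increment f K)) < 1" if "\<D> division_of T" "T \<subseteq> {c k..c (Suc k)}" "k < m" for \<D> T k
  proof (rule D[OF that(1)])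
    show "T \<subseteq> {a..b}" using that(2,3) cle[of k] cb[of "Suc k"] by fastforce
    have "sum (measure lborel) \<D> = measure lebesgue T" by (rule sum_content_division_eq_measure[OF that(1)])
    also have "\<dots> \<le> measure lebesgue {c k..c (Suc k)}"
      by (rule measure_mono_fmeasurable[OF that(2)]) (auto intro: fmeasurableD lmeasurable_division[OF that(1)])
    also have "\<dots> = s" using s by (simp add: c)
    finally show "sum (measure lborel) \<D> < d" using s by simp
  qed
  have "\<exists>N. negligible N \<and> (\<forall>t\<in>{c k<..<c (Suc k)} - N. f differentiable (at t))" if k: "k < m" for k
  proof -
    have "\<exists>N. negligible N \<and> (\<forall>t\<in>{c k<..<c (Suc k)} - N. (\<lambda>t. inner (f t) i) differentiable (at t))" if i: "i \<in> Basis" for i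
    proof -
      have ni: "norm (increment (\<lambda>t. inner (f t) i) K) \<le> norm (increment f K)" for K
        using Basis_le_norm[OF i, of "increment f K"] by (simp add: increment_def inner_diff_left)
      have sni: "(\<Sum>K\<in>\<D>. norm (increment (\<lambda>t. inner (f t) i) K)) \<le> (\<Sum>K\<in>\<D>. norm (increment f K))" for \<D>
        by (intro sum_mono ni)
      have A: "ac_on (c k) (c (Suc k)) (\<lambda>t. inner (f t) i)"
        unfolding ac_on_def
      proof (intro allI impI)
        fix e :: real assume "0 < e"
        obtain d where d: "d > 0" and D: "\<And>\<D> T. \<D> division_of T \<Longrightarrow> T \<subseteq> {a..b} \<Longrightarrow> sum (measure lborel) \<D> < d \<Longrightarrow>
          (\<Sum>K\<in>\<D>. norm (increment f K)) < e" by (rule ac_onE[OF ac \<open>0 < e\<close>]) blast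
        show "\<exists>d>0. \<forall>\<D> T. \<D> division_of T \<longrightarrow> T \<subseteq> {c k..c (Suc k)} \<longrightarrow> sum (measure lborel) \<D> < d \<longrightarrow>
          (\<Sum>K\<in>\<D>. norm (increment (\<lambda>t. inner (f t) i) K)) < e"
        proof (intro exI[of _ d] conjI allI impI d)
          fix \<D> T assume h: "\<D> division_of T" "T \<subseteq> {c k..c (Suc k)}" "sum (measure lborel) \<D> < d"
          have "T \<subseteq> {a..b}" using h(2) k cle[of k] cb[of "Suc k"] by fastforce
          then show "(\<Sum>K\<in>\<D>. norm (increment (\<lambda>t. inner (f t) i) K)) < e"
            using D[OF h(1) _ h(3)] sni[of \<D>] by linarith
        qed
      qed
      have V: "(\<Sum>K\<in>\<D>. norm (increment (\<lambda>t. inner (f t) i) K)) \<le> 1"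
        if "\<D> division_of T" "T \<subseteq> {c k..c (Suc k)}" for \<D> T
        using var[OF that k] sni[of \<D>] by linarith
      show ?thesis
      proof (rule ac_on_differentiable_ae[OF A])
        show "(\<Sum>K\<in>\<D>. norm (increment (\<lambda>t. inner (f t) i) K)) \<le> 1"
          if "\<D> division_of T" "T \<subseteq> {c k..c (Suc k)}" for \<D> T by (rule V[OF that])
      qed blast
    qed
    then obtain N where N: "\<And>i. i \<in> Basis \<Longrightarrow> negligible (N i)"
      "\<And>i t. i \<in> Basis \<Longrightarrow> t \<in> {c k<..<c (Suc k)} - N i \<Longrightarrow> (\<lambda>t. inner (f t) i) differentiable (at t)" by metis
    show ?thesis
    proof (intro exI[of _ "\<Union>i\<in>Basis. N i"] conjI ballI)
      show "negligible (\<Union>i\<in>Basis. N i)" by (intro negligible_Union) (auto intro: N)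
      fix t assume "t \<in> {c k<..<c (Suc k)} - (\<Union>i\<in>Basis. N i)"
      then have "(\<lambda>t. inner (f t) i) differentiable (at t)" if "i \<in> Basis" for i using N(2)[OF that] that by blast
      then show "f differentiable (at t)" using differentiable_componentwise_within[of f t UNIV] by blast
    qed
  qed
  then obtain N where N: "\<And>k. k < m \<Longrightarrow> negligible (N k)"
    "\<And>k t. k < m \<Longrightarrow> t \<in> {c k<..<c (Suc k)} - N k \<Longrightarrow> f differentiable (at t)" by metis
  define N' where "N' = (\<Union>k<m. N k) \<union> c ` {..m}"
  have N': "negligible N'" unfolding N'_def
  proof (rule negligible_Un)
    show "negligible (\<Union>k<m. N k)" by (rule negligible_Union) (auto intro: N)
    show "negligible (c ` {..m})" by (rule negligible_finite) simp
  qed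
  define g where "g = (\<lambda>t. vector_derivative f (at t))"
  have der: "(f has_vector_derivative g t) (at t)" if t: "t \<in> {a..b} - N'" for t
  proof -
    have "\<exists>k<m. t \<in> {c k..c (Suc k)}"
    proof -
      define k where "k = (LEAST k. t \<le> c k)"
      have "t \<le> c m" using t c by simp
      then have k: "t \<le> c k" "k \<le> m" unfolding k_def by (rule LeastI, rule Least_le)
      show ?thesis
      proof (cases k)
        case 0
        then have "t = c 0" using k t c by simp
        then show ?thesis using t by (auto simp: N'_def)
      next
        case (Suc j)
        then have "\<not> t \<le> c j" using not_less_Least[of j "\<lambda>k. t \<le> c k"] by (simp add: k_def)
        then show ?thesis using k Suc by (intro exI[of _ j]) auto
      qed
    qed
    then obtain k where k: "k < m" "t \<in> {c k..c (Suc k)}" by blast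
    have "t \<noteq> c k" "t \<noteq> c (Suc k)" "t \<notin> N k" using t k by (auto simp: N'_def)
    then have "f differentiable (at t)" using N(2)[OF k(1), of t] k(2) by auto
    then show ?thesis unfolding g_def using vector_derivative_works by blast
  qed
  have int: "(g has_integral f v - f u) {u..v}" if "{u..v} \<subseteq> {a..b}" "u \<le> v" for u v
    by (rule ac_on_fundamental_theorem[OF ac_on_subset[OF ac that(1)] that(2) N']) (use der that in blast)
  have ai: "g absolutely_integrable_on {c k..c (Suc k)}" if k: "k < m" for k
  proof -
    have sub: "{c k..c (Suc k)} \<subseteq> {a..b}" using k cle[of k] cb[of "Suc k"] by auto
    have "g absolutely_integrable_on cbox (c k) (c (Suc k))"
    proof (rule bounded_variation_absolutely_integrable_interval[where B=1])
      show "g integrable_on cbox (c k) (c (Suc k))" using int[OF sub] c s by (auto simp: integrable_on_def)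
      fix \<D> assume div: "\<D> division_of cbox (c k) (c (Suc k))"
      have "(\<Sum>K\<in>\<D>. norm (integral K g)) = (\<Sum>K\<in>\<D>. norm (increment f K))"
      proof (intro sum.cong refl arg_cong[where f=norm])
        fix K assume K: "K \<in> \<D>"
        then obtain u v where uv: "K = {u..v}" using division_ofD(4)[OF div] by force
        have "u \<le> v" using division_ofD(3)[OF div K] uv by simp
        moreover have "{u..v} \<subseteq> {a..b}" using division_ofD(2)[OF div K] sub uv by auto
        ultimately show "integral K g = increment f K" using int uv by (simp add: integral_unique)
      qed
      also have "\<dots> \<le> 1" using var[OF div _ k] by auto
      finally show "(\<Sum>K\<in>\<D>. norm (integral K g)) \<le> 1" .
    qed
    then show ?thesis by simp
  qed
  have "g absolutely_integrable_on {a..c k}" if "k \<le> m" for k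
    using that
  proof (induction k)
    case 0
    then show ?case using absolutely_integrable_on_null[of a a g] by (simp add: c)
  next
    case (Suc k)
    have "{a..c (Suc k)} = {a..c k} \<union> {c k..c (Suc k)}" using cle[of k] c s by auto
    then show ?case using Suc ai[of k] by (metis Suc_leD Suc_le_lessD absolutely_integrable_Un)
  qed
  then have "g absolutely_integrable_on {a..b}" using c by (metis order_refl)
  moreover have "integral {a..b} g = f b - f a" using int[of a b] ab by (simp add: integral_unique)
  ultimately show ?thesis using that[OF N' der] by blast
qed

section \<open>Volumes in finite-dimensional normed spaces\<close>

lemma emeasure_lborel_affine_vimage:
  fixes r c :: real
  assumes "0 < r" and A: "A \<in> sets borel"
  shows "emeasure lborel {x. (x - c) / r \<in> A} = ennreal r * emeasure lborel A"
proof -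
  have m: "(\<lambda>x. - c / r + 1 / r * x) \<in> lborel \<rightarrow>\<^sub>M borel" by simp
  have "emeasure lborel A = emeasure (density (distr lborel borel (\<lambda>x. - c / r + 1 / r * x)) (\<lambda>_. ennreal \<bar>1 / r\<bar>)) A"
    using lborel_real_affine[of "1 / r" "- c / r"] assms by simp
  also have "\<dots> = ennreal (1 / r) * emeasure lborel ((\<lambda>x. - c / r + 1 / r * x) -` A)"
    using assms m by (simp add: emeasure_density_const emeasure_distr)
  also have "(\<lambda>x. - c / r + 1 / r * x) -` A = {x. (x - c) / r \<in> A}"
    by (auto simp: diff_divide_distrib)
  finally have "ennreal r * emeasure lborel A = ennreal r * ennreal (1 / r) * emeasure lborel {x. (x - c) / r \<in> A}"
    by (simp add: mult.assoc)
  also have "ennreal r * ennreal (1 / r) = 1" using assms by (simp flip: ennreal_mult)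
  finally show ?thesis by simp
qed

text \<open>The norm is arbitrary, so volumes are taken in the space of coordinates.
  \<open>coord_bound\<close> is a quantitative form of linear independence: it makes the unit ball
  bounded in coordinates. The packing and covering bounds do not involve \<open>R0\<close>, so its
  size is free.\<close>

locale coordinate_system =
  fixes b :: "nat \<Rightarrow> 'a::real_normed_vector" and d :: nat and R0 :: real
  assumes coord_bound: "\<And>f i. i < d \<Longrightarrow> \<bar>f i\<bar> \<le> R0 * norm (\<Sum>i<d. f i *\<^sub>R b i)"
begin

definition comb :: "(nat \<Rightarrow> real) \<Rightarrow> 'a" where
  "comb f = (\<Sum>i<d. f i *\<^sub>R b i)"

definition vol :: "(nat \<Rightarrow> real) measure" where
  "vol = (\<Pi>\<^sub>M i\<in>{..<d}. lborel)"

definition cell :: "(nat \<Rightarrow> real) \<Rightarrow> real \<Rightarrow> (nat \<Rightarrow> real) set" where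
  "cell c r = {f \<in> space vol. norm (comb f - comb c) < r}"

lemma comb_diff: "comb f - comb g = comb (\<lambda>i. f i - g i)"
  by (simp add: comb_def scaleR_diff_left sum_subtractf)

lemma comb_scale: "comb (\<lambda>i. r * f i) = r *\<^sub>R comb f"
  by (simp add: comb_def scaleR_sum_right)

lemma comb_cong: "(\<And>i. i < d \<Longrightarrow> f i = g i) \<Longrightarrow> comb f = comb g"
  by (simp add: comb_def)

lemma space_vol: "space vol = {..<d} \<rightarrow>\<^sub>E UNIV"
  by (simp add: vol_def space_PiM)

text \<open>The product measure lives on functions on \<open>{..<d}\<close>. Extension by zero maps
  them measurably to functions on all naturals, where continuity in the product topology gives Borel
  measurability.\<close>

lemma norm_comb_measurable: "(\<lambda>f. norm (comb f - x)) \<in> borel_measurable vol"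
proof -
  let ?g = "\<lambda>f :: nat \<Rightarrow> real. norm (comb f - x)"
  let ?h = "\<lambda>(f :: nat \<Rightarrow> real) i. if i < d then f i else 0"
  have "continuous_on UNIV ?g"
    unfolding comb_def by (intro continuous_intros continuous_on_product_coordinates)
  then have "?g \<in> borel_measurable borel" by (rule borel_measurable_continuous_onI)
  then have g: "?g \<in> borel_measurable (\<Pi>\<^sub>M i\<in>UNIV. borel)"
    by (simp add: measurable_def sets_PiM_equal_borel space_PiM)
  have "?h \<in> vol \<rightarrow>\<^sub>M (\<Pi>\<^sub>M i\<in>UNIV. borel)"
    unfolding vol_def
  proof (rule measurable_PiM_single')
    fix i :: nat
    show "(\<lambda>f. ?h f i) \<in> borel_measurable (\<Pi>\<^sub>M i\<in>{..<d}. lborel)"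
    proof (cases "i < d")
      case True
      then have "(\<lambda>f. f i) \<in> (\<Pi>\<^sub>M i\<in>{..<d}. lborel) \<rightarrow>\<^sub>M lborel" by (intro measurable_component_singleton) auto
      then show ?thesis using True by simp
    qed simp
  qed (auto simp: space_PiM)
  from measurable_comp[OF this g] have "?g \<circ> ?h \<in> borel_measurable vol" .
  moreover have "?g \<circ> ?h = ?g" by (auto simp: fun_eq_iff intro!: arg_cong[where f=norm] comb_cong)
  ultimately show ?thesis by metis
qed

lemma cell_sets [measurable]: "cell c r \<in> sets vol"
  unfolding cell_def by (rule borel_measurable_less[OF norm_comb_measurable borel_measurable_const])

text \<open>The ball of radius \<open>r\<close> is the preimage of the unit ball under the affine
  map \<open>?T\<close>, and a comparison on boxes shows that preimages under \<open>?T\<close> have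
  \<open>r ^ d\<close> times the measure.\<close>

lemma emeasure_cell:
  assumes r: "0 < r"
  shows "emeasure vol (cell c r) = ennreal (r ^ d) * emeasure vol (cell (\<lambda>_. 0) 1)"
proof -
  interpret product_sigma_finite "\<lambda>_::nat. lborel :: real measure" ..
  let ?T = "\<lambda>f. \<lambda>i\<in>{..<d}. (f i - c i) / r"
  have T: "?T \<in> vol \<rightarrow>\<^sub>M vol"
    unfolding vol_def
  proof (rule measurable_restrict)
    fix i assume "i \<in> {..<d}"
    then have "(\<lambda>f. f i) \<in> (\<Pi>\<^sub>M i\<in>{..<d}. lborel) \<rightarrow>\<^sub>M lborel" by (intro measurable_component_singleton) auto
    then have "(\<lambda>f. (f i - c i) / r) \<in> borel_measurable (\<Pi>\<^sub>M i\<in>{..<d}. lborel)"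
      by (intro borel_measurable_divide borel_measurable_diff borel_measurable_const) simp
    then show "(\<lambda>f. (f i - c i) / r) \<in> (\<Pi>\<^sub>M i\<in>{..<d}. lborel) \<rightarrow>\<^sub>M lborel" by simp
  qed
  have eq: "scale_measure (ennreal (1 / r ^ d)) (distr vol vol ?T) = vol"
    unfolding vol_def
  proof (rule PiM_eqI)
    show "finite {..<d}" by simp
    show "sets (scale_measure (ennreal (1 / r ^ d)) (distr (Pi\<^sub>M {..<d} (\<lambda>_. lborel)) (Pi\<^sub>M {..<d} (\<lambda>_. lborel)) ?T))
        = sets (Pi\<^sub>M {..<d} (\<lambda>_. lborel))" by simp
    fix A :: "nat \<Rightarrow> real set" assume A: "\<And>i. i \<in> {..<d} \<Longrightarrow> A i \<in> sets lborel"
    have pre: "?T -` Pi\<^sub>E {..<d} A \<inter> space (Pi\<^sub>M {..<d} (\<lambda>_. lborel)) = Pi\<^sub>E {..<d} (\<lambda>i. {x. (x - c i) / r \<in> A i})"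
      by (auto simp: space_PiM PiE_def Pi_def restrict_def extensional_def)
    have ms: "{x. (x - c i) / r \<in> A i} \<in> sets lborel" if "i \<in> {..<d}" for i
    proof -
      have "(\<lambda>x. (x - c i) / r) \<in> borel_measurable borel" by simp
      from measurable_sets[OF this, of "A i"] A[OF that] show ?thesis by (simp add: vimage_def)
    qed
    have "emeasure (distr (Pi\<^sub>M {..<d} (\<lambda>_. lborel)) (Pi\<^sub>M {..<d} (\<lambda>_. lborel)) ?T) (Pi\<^sub>E {..<d} A)
      = emeasure (Pi\<^sub>M {..<d} (\<lambda>_. lborel)) (Pi\<^sub>E {..<d} (\<lambda>i. {x. (x - c i) / r \<in> A i}))"
      using T A unfolding vol_def by (subst emeasure_distr) (auto simp: pre sets_PiM_I_finite)
    also have "\<dots> = (\<Prod>i<d. emeasure lborel {x. (x - c i) / r \<in> A i})"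
      by (rule emeasure_PiM) (use ms in auto)
    also have "\<dots> = (\<Prod>i<d. ennreal r * emeasure lborel (A i))"
      using A r by (intro prod.cong refl emeasure_lborel_affine_vimage) auto
    also have "\<dots> = ennreal (r ^ d) * (\<Prod>i<d. emeasure lborel (A i))"
      using r by (simp add: prod.distrib ennreal_power)
    finally have "emeasure (scale_measure (ennreal (1 / r ^ d)) (distr (Pi\<^sub>M {..<d} (\<lambda>_. lborel)) (Pi\<^sub>M {..<d} (\<lambda>_. lborel)) ?T)) (Pi\<^sub>E {..<d} A)
      = ennreal (1 / r ^ d) * ennreal (r ^ d) * (\<Prod>i<d. emeasure lborel (A i))"
      by (simp add: mult.assoc)
    also have "ennreal (1 / r ^ d) * ennreal (r ^ d) = 1" using r by (simp flip: ennreal_mult)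
    finally show "emeasure (scale_measure (ennreal (1 / r ^ d)) (distr (Pi\<^sub>M {..<d} (\<lambda>_. lborel)) (Pi\<^sub>M {..<d} (\<lambda>_. lborel)) ?T)) (Pi\<^sub>E {..<d} A)
      = (\<Prod>i\<in>{..<d}. emeasure lborel (A i))" by (simp only: mult_1_left)
  qed
  have pre: "?T -` cell (\<lambda>_. 0) 1 \<inter> space vol = cell c r"
  proof -
    have "norm (comb (?T f)) = norm (comb f - comb c) / r" for f
    proof -
      have "comb (?T f) = comb (\<lambda>i. (1 / r) * (f i - c i))" by (rule comb_cong) simp
      also have "\<dots> = (1 / r) *\<^sub>R comb (\<lambda>i. f i - c i)" by (rule comb_scale)
      also have "comb (\<lambda>i. f i - c i) = comb f - comb c" by (simp only: comb_diff)
      finally have "norm (comb (?T f)) = \<bar>1 / r\<bar> * norm (comb f - comb c)" by (simp only: norm_scaleR)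
      then show ?thesis using r by simp
    qed
    moreover have "comb (\<lambda>_. 0) = 0" by (simp add: comb_def)
    ultimately show ?thesis using r by (auto simp: cell_def space_vol divide_less_eq)
  qed
  have "emeasure vol (cell (\<lambda>_. 0) 1) = ennreal (1 / r ^ d) * emeasure (distr vol vol ?T) (cell (\<lambda>_. 0) 1)"
    by (subst eq[symmetric]) simp
  also have "emeasure (distr vol vol ?T) (cell (\<lambda>_. 0) 1) = emeasure vol (cell c r)"
    by (subst emeasure_distr[OF T]) (auto simp: pre)
  finally have "ennreal (r ^ d) * emeasure vol (cell (\<lambda>_. 0) 1)
    = ennreal (r ^ d) * ennreal (1 / r ^ d) * emeasure vol (cell c r)" by (simp add: mult.assoc)
  also have "ennreal (r ^ d) * ennreal (1 / r ^ d) = 1" using r by (simp flip: ennreal_mult)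
  finally show ?thesis by simp
qed

definition unit_vol :: real where
  "unit_vol = measure vol (cell (\<lambda>_. 0) 1)"

text \<open>The unit ball contains a small box and, by \<open>coord_bound\<close>, lies in a large
  one.\<close>

lemma emeasure_unit_cell: "emeasure vol (cell (\<lambda>_. 0) 1) = ennreal unit_vol" and unit_vol_pos: "0 < unit_vol"
proof -
  interpret product_sigma_finite "\<lambda>_::nat. lborel :: real measure" ..
  have c0: "comb (\<lambda>_. 0) = 0" by (simp add: comb_def)
  let ?R = "\<bar>R0\<bar>"
  have "cell (\<lambda>_. 0) 1 \<subseteq> Pi\<^sub>E {..<d} (\<lambda>_. {- ?R..?R})"
  proof
    fix f assume "f \<in> cell (\<lambda>_. 0) 1"
    then have f: "f \<in> {..<d} \<rightarrow>\<^sub>E UNIV" "norm (comb f) < 1" by (auto simp: cell_def space_vol c0)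
    have "\<bar>f i\<bar> \<le> ?R" if "i < d" for i
    proof -
      have "\<bar>f i\<bar> \<le> R0 * norm (comb f)" using coord_bound[OF that] by (simp add: comb_def)
      also have "\<dots> \<le> ?R * 1" by (rule mult_mono) (use f in auto)
      finally show ?thesis by simp
    qed
    then show "f \<in> Pi\<^sub>E {..<d} (\<lambda>_. {- ?R..?R})" using f(1) by (auto simp: PiE_iff abs_le_iff) (meson minus_le_iff)
  qed
  then have "emeasure vol (cell (\<lambda>_. 0) 1) \<le> emeasure vol (Pi\<^sub>E {..<d} (\<lambda>_. {- ?R..?R}))"
    by (rule emeasure_mono) (auto simp: vol_def intro!: sets_PiM_I_finite)
  also have "\<dots> = (\<Prod>i<d. emeasure lborel {- ?R..?R})"
    unfolding vol_def by (rule emeasure_PiM) auto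
  also have "\<dots> = ennreal ((2 * ?R) ^ d)" by (simp add: ennreal_power)
  also have "\<dots> < \<infinity>" by (simp add: ennreal_less_top)
  finally show eq: "emeasure vol (cell (\<lambda>_. 0) 1) = ennreal unit_vol"
    unfolding unit_vol_def by (simp add: emeasure_eq_ennreal_measure)
  define s where "s = 1 / (1 + (\<Sum>i<d. norm (b i)))"
  have den: "0 < 1 + (\<Sum>i<d. norm (b i))" by (rule add_pos_nonneg) (auto intro: sum_nonneg)
  then have s: "0 < s" by (simp add: s_def)
  have "Pi\<^sub>E {..<d} (\<lambda>_. {- s..s}) \<subseteq> cell (\<lambda>_. 0) 1"
  proof
    fix f assume f: "f \<in> Pi\<^sub>E {..<d} (\<lambda>_. {- s..s})"
    have "norm (comb f) \<le> (\<Sum>i<d. \<bar>f i\<bar> * norm (b i))"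
      unfolding comb_def by (rule order_trans[OF norm_sum]) simp
    also have "\<dots> \<le> (\<Sum>i<d. s * norm (b i))"
    proof (intro sum_mono mult_right_mono)
      fix i assume "i \<in> {..<d}"
      then have "- s \<le> f i \<and> f i \<le> s" using f by (auto simp: PiE_iff)
      then show "\<bar>f i\<bar> \<le> s" by linarith
    qed simp
    also have "\<dots> = s * (\<Sum>i<d. norm (b i))" by (simp add: sum_distrib_left)
    also have "\<dots> < 1" using den by (simp add: s_def)
    finally show "f \<in> cell (\<lambda>_. 0) 1" using f by (auto simp: cell_def space_vol c0 PiE_iff)
  qed
  then have "emeasure vol (Pi\<^sub>E {..<d} (\<lambda>_. {- s..s})) \<le> emeasure vol (cell (\<lambda>_. 0) 1)"
    by (rule emeasure_mono) auto
  moreover have "emeasure vol (Pi\<^sub>E {..<d} (\<lambda>_. {- s..s})) = (\<Prod>i<d. emeasure lborel {- s..s})"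
    unfolding vol_def by (rule emeasure_PiM) auto
  moreover have "(\<Prod>i<d. emeasure lborel {- s..s}) = ennreal ((2 * s) ^ d)"
    using s by (simp add: ennreal_power)
  ultimately have "ennreal ((2 * s) ^ d) \<le> ennreal unit_vol" using eq by simp
  then have "(2 * s) ^ d \<le> unit_vol" unfolding unit_vol_def by (simp add: ennreal_le_iff)
  then show "0 < unit_vol" using s by (meson less_le_trans mult_pos_pos zero_less_numeral zero_less_power)
qed

lemma emeasure_cell_eq: "0 < r \<Longrightarrow> emeasure vol (cell c r) = ennreal (r ^ d * unit_vol)"
  using emeasure_cell[of r c] unit_vol_pos by (simp add: emeasure_unit_cell ennreal_mult)

lemma exists_coords:
  assumes "x \<in> comb ` UNIV" obtains c where "c \<in> space vol" "comb c = x"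
proof -
  obtain f where f: "x = comb f" using assms by blast
  have "comb (restrict f {..<d}) = comb f" by (rule comb_cong) simp
  then show ?thesis using that[of "restrict f {..<d}"] f by (simp add: space_vol)
qed

text \<open>The balls of radius \<open>e / 2\<close> about the points are disjoint and lie in the
  ball of radius \<open>R + e / 2\<close>; the bound is the quotient of the volumes.\<close>

lemma packing_bound:
  assumes S: "finite S" "S \<subseteq> comb ` UNIV" and n: "\<And>x. x \<in> S \<Longrightarrow> norm x \<le> R" and R: "0 \<le> R"
    and sep: "\<And>x y. x \<in> S \<Longrightarrow> y \<in> S \<Longrightarrow> x \<noteq> y \<Longrightarrow> e \<le> norm (x - y)" and e: "0 < e"
  shows "real (card S) \<le> (1 + 2 * R / e) ^ d"
proof -
  have "\<exists>c. c \<in> space vol \<and> comb c = x" if "x \<in> S" for x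
    using exists_coords[OF subsetD[OF S(2) that]] by blast
  then have "\<forall>x\<in>S. \<exists>c. c \<in> space vol \<and> comb c = x" by blast
  from bchoice[OF this] obtain c where c': "\<forall>x\<in>S. c x \<in> space vol \<and> comb (c x) = x" ..
  then have c: "c x \<in> space vol" "comb (c x) = x" if "x \<in> S" for x using that by auto
  let ?U = "\<Union>x\<in>S. cell (c x) (e / 2)"
  have "emeasure vol ?U = (\<Sum>x\<in>S. emeasure vol (cell (c x) (e / 2)))"
  proof (rule sum_emeasure[symmetric])
    show "disjoint_family_on (\<lambda>x. cell (c x) (e / 2)) S"
      unfolding disjoint_family_on_def
    proof (intro ballI impI)
      fix x y assume xy: "x \<in> S" "y \<in> S" "x \<noteq> y"
      show "cell (c x) (e / 2) \<inter> cell (c y) (e / 2) = {}"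
      proof (rule ccontr)
        assume "cell (c x) (e / 2) \<inter> cell (c y) (e / 2) \<noteq> {}"
        then obtain f where "norm (comb f - x) < e / 2" "norm (comb f - y) < e / 2"
          using c xy by (auto simp: cell_def)
        moreover have "norm (x - y) \<le> norm (comb f - y) + norm (comb f - x)"
          using norm_triangle_ineq4[of "comb f - y" "comb f - x"] by simp
        ultimately show False using sep[OF xy] by linarith
      qed
    qed
  qed (use S in auto)
  also have "\<dots> = ennreal (real (card S) * ((e / 2) ^ d * unit_vol))"
    using e unit_vol_pos by (simp add: emeasure_cell_eq ennreal_of_nat_eq_real_of_nat ennreal_mult)
  finally have "ennreal (real (card S) * ((e / 2) ^ d * unit_vol)) = emeasure vol ?U" by simp
  also have "\<dots> \<le> emeasure vol (cell (\<lambda>_. 0) (R + e / 2))"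
  proof (rule emeasure_mono)
    show "?U \<subseteq> cell (\<lambda>_. 0) (R + e / 2)"
    proof safe
      fix x f assume x: "x \<in> S" "f \<in> cell (c x) (e / 2)"
      then have "norm (comb f - x) < e / 2" "f \<in> space vol" using c by (auto simp: cell_def)
      moreover have "norm (comb f) \<le> norm (comb f - x) + norm x" by (metis diff_add_cancel norm_triangle_ineq)
      ultimately show "f \<in> cell (\<lambda>_. 0) (R + e / 2)" using n[OF x(1)] by (simp add: cell_def comb_def)
    qed
  qed auto
  also have "\<dots> = ennreal ((R + e / 2) ^ d * unit_vol)" using R e by (intro emeasure_cell_eq) auto
  finally have "real (card S) * ((e / 2) ^ d * unit_vol) \<le> (R + e / 2) ^ d * unit_vol"
    using R e unit_vol_pos ennreal_le_iff[of "(R + e / 2) ^ d * unit_vol"] by simp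
  then have "real (card S) * (e / 2) ^ d \<le> (R + e / 2) ^ d" using unit_vol_pos by simp
  then have "real (card S) \<le> (R + e / 2) ^ d / (e / 2) ^ d" using e by (simp add: field_simps)
  also have "\<dots> = ((R + e / 2) / (e / 2)) ^ d" by (simp only: power_divide)
  also have "(R + e / 2) / (e / 2) = 1 + 2 * R / e" using e by (simp add: field_simps)
  finally show ?thesis .
qed

text \<open>Comparison of volumes. The centres \<open>p s\<close> are indexed by \<open>S\<close>,
  because in the application \<open>S\<close> consists of matrices outside the space that is
  covered.\<close>

lemma covering_bound:
  assumes S: "finite S" "\<And>s. s \<in> S \<Longrightarrow> p s \<in> comb ` UNIV"
    and cov: "\<And>x. x \<in> comb ` UNIV \<Longrightarrow> norm x < R \<Longrightarrow> \<exists>s\<in>S. norm (x - p s) < r" and R: "0 < R" and r: "0 < r"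
  shows "(R / r) ^ d \<le> real (card S)"
proof -
  have "\<exists>c. c \<in> space vol \<and> comb c = p s" if "s \<in> S" for s
    using exists_coords[OF S(2)[OF that]] by blast
  then have "\<forall>s\<in>S. \<exists>c. c \<in> space vol \<and> comb c = p s" by blast
  from bchoice[OF this] obtain c where c': "\<forall>s\<in>S. c s \<in> space vol \<and> comb (c s) = p s" ..
  then have c: "c s \<in> space vol" "comb (c s) = p s" if "s \<in> S" for s using that by auto
  have "ennreal (R ^ d * unit_vol) = emeasure vol (cell (\<lambda>_. 0) R)" using R by (simp add: emeasure_cell_eq)
  also have "\<dots> \<le> emeasure vol (\<Union>s\<in>S. cell (c s) r)"
  proof (rule emeasure_mono)
    show "cell (\<lambda>_. 0) R \<subseteq> (\<Union>s\<in>S. cell (c s) r)"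
    proof
      fix f assume f: "f \<in> cell (\<lambda>_. 0) R"
      then have "norm (comb f) < R" by (simp add: cell_def comb_def)
      then obtain s where "s \<in> S" "norm (comb f - p s) < r" using cov by blast
      then show "f \<in> (\<Union>s\<in>S. cell (c s) r)" using f c by (auto simp: cell_def)
    qed
  qed (use S in auto)
  also have "\<dots> \<le> (\<Sum>s\<in>S. emeasure vol (cell (c s) r))" by (rule emeasure_subadditive_finite) (use S in auto)
  also have "\<dots> = ennreal (real (card S) * (r ^ d * unit_vol))"
    using r unit_vol_pos by (simp add: emeasure_cell_eq ennreal_of_nat_eq_real_of_nat ennreal_mult)
  finally have "R ^ d * unit_vol \<le> real (card S) * (r ^ d * unit_vol)"
    using r unit_vol_pos ennreal_le_iff[of "real (card S) * (r ^ d * unit_vol)"] by simp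
  then have "R ^ d \<le> real (card S) * r ^ d" using unit_vol_pos by simp
  then show ?thesis using r by (simp add: power_divide field_simps)
qed

end

section \<open>Exponentials and binomial series in Banach algebras\<close>

lemma norm_power_diff_le:
  fixes x y :: "'a::real_normed_algebra_1"
  assumes "norm x \<le> r" "norm y \<le> r"
  shows "norm (x ^ n - y ^ n) \<le> real n * r ^ (n - 1) * norm (x - y)"
proof (induction n)
  case 0
  then show ?case by simp
next
  case (Suc n)
  have r: "0 \<le> r" using assms(1) norm_ge_zero order_trans by blast
  have eq: "x ^ Suc n - y ^ Suc n = x * (x ^ n - y ^ n) + (x - y) * y ^ n"
    by (simp add: algebra_simps)
  have "norm (x * (x ^ n - y ^ n)) \<le> r * (real n * r ^ (n - 1) * norm (x - y))"
    by (intro order_trans[OF norm_mult_ineq] mult_mono assms Suc r) auto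
  moreover have "norm ((x - y) * y ^ n) \<le> norm (x - y) * r ^ n"
    by (intro order_trans[OF norm_mult_ineq] mult_mono order_trans[OF norm_power_ineq] power_mono assms)
      (auto simp: r)
  moreover have "r * (real n * r ^ (n - 1) * norm (x - y)) = real n * r ^ n * norm (x - y)"
    by (cases n) auto
  ultimately have "norm (x ^ Suc n - y ^ Suc n) \<le> real n * r ^ n * norm (x - y) + norm (x - y) * r ^ n"
    unfolding eq using norm_triangle_ineq[of "x * (x ^ n - y ^ n)" "(x - y) * y ^ n"] by linarith
  then show ?case by (simp add: algebra_simps)
qed

text \<open>Subtracting \<open>x\<close> removes the linear term of the series; the bounds for the
  remaining differences of powers add up to the constant \<open>exp r - 1\<close>, which is small
  for small \<open>r\<close>. The contractions below rest on this.\<close>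

lemma exp_minus_id_lipschitz:
  fixes x y :: "'a::{real_normed_algebra_1,banach}"
  assumes x: "norm x \<le> r" and y: "norm y \<le> r"
  shows "norm ((exp x - x) - (exp y - y)) \<le> (exp r - 1) * norm (x - y)"
proof -
  let ?e = "\<lambda>x::'a. \<lambda>n. x ^ n /\<^sub>R fact n"
  let ?g = "\<lambda>n. (r ^ n /\<^sub>R fact n) * norm (x - y)"
  have eq: "(exp z - z) = (\<Sum>n. ?e z (n + 2)) + 1" for z :: 'a
    using suminf_split_initial_segment[OF summable_exp_generic[of z], of 2]
    by (simp add: exp_def numeral_2_eq_2)
  have s: "summable (\<lambda>n. ?e z (n + 2))" for z :: 'a
    using summable_exp_generic[of z] summable_iff_shift[of "?e z" 2] by blast
  have gs: "summable (\<lambda>n. ?g (n + 1))"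
    using summable_exp_generic[of r] summable_iff_shift[of "\<lambda>n. r ^ n /\<^sub>R fact n" 1]
    by (intro summable_mult2) auto
  have b: "norm (?e x (n + 2) - ?e y (n + 2)) \<le> ?g (n + 1)" for n
  proof -
    have "norm (?e x (n + 2) - ?e y (n + 2)) = norm (x ^ (n+2) - y ^ (n+2)) / fact (n + 2)"
      by (simp flip: scaleR_diff_right add: divide_inverse mult.commute)
    also have "\<dots> \<le> (real (n+2) * r ^ (n + 1) * norm (x - y)) / fact (n + 2)"
      using norm_power_diff_le[OF x y, of "n+2"] by (intro divide_right_mono) auto
    also have "\<dots> = ?g (n + 1)"
      by (simp add: divide_simps)
    finally show ?thesis .
  qed
  have "(exp x - x) - (exp y - y) = (\<Sum>n. ?e x (n + 2) - ?e y (n + 2))"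
    unfolding eq using suminf_diff[OF s[of x] s[of y]] by simp
  also have "norm \<dots> \<le> (\<Sum>n. ?g (n + 1))"
    by (rule norm_suminf_le) (use b gs in auto)
  also have "\<dots> = (\<Sum>n. r ^ (n + 1) /\<^sub>R fact (n + 1)) * norm (x - y)"
    using summable_exp_generic[of r] summable_iff_shift[of "\<lambda>n. r ^ n /\<^sub>R fact n" 1]
    by (intro suminf_mult2[symmetric]) auto
  also have "(\<Sum>n. r ^ (n + 1) /\<^sub>R fact (n + 1)) = exp r - 1"
    using suminf_split_initial_segment[OF summable_exp_generic[of r], of 1]
    by (simp add: exp_def)
  finally show ?thesis .
qed

lemma exp_le_quadratic_bound:
  fixes r :: real
  assumes "0 \<le> r" "r \<le> 1"
  shows "exp r \<le> 1 + 2 * r"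
proof -
  have "exp r \<le> 1 + r + r\<^sup>2" using assms exp_bound by blast
  also have "r\<^sup>2 \<le> r" using assms by (simp add: power2_eq_square mult_left_le)
  finally show ?thesis by simp
qed

lemma exp_lipschitz:
  fixes x y :: "'a::{real_normed_algebra_1,banach}"
  assumes x: "norm x \<le> r" and y: "norm y \<le> r"
  shows "norm (exp x - exp y) \<le> exp r * norm (x - y)"
proof -
  have "exp x - exp y = ((exp x - x) - (exp y - y)) + (x - y)" by simp
  also have "norm \<dots> \<le> (exp r - 1) * norm (x - y) + norm (x - y)"
    by (intro order_trans[OF norm_triangle_ineq] add_mono exp_minus_id_lipschitz assms) auto
  finally show ?thesis by (simp add: algebra_simps)
qed

lemma norm_exp_minus_one_le:
  fixes x :: "'a::{real_normed_algebra_1,banach}"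
  assumes x: "norm x \<le> r" "r \<le> 1/2"
  shows "norm (exp x - 1) \<le> 2 * norm x"
proof -
  have r: "0 \<le> r" using assms(1) norm_ge_zero order_trans by blast
  have "norm (exp x - exp 0) \<le> exp r * norm (x - 0)" by (rule exp_lipschitz) (use assms r in auto)
  also have "\<dots> \<le> 2 * norm x"
    using exp_le_quadratic_bound[of r] assms r by (intro mult_mono) auto
  finally show ?thesis by simp
qed

text \<open>To first order \<open>exp x * exp z\<close> is \<open>1 + x + z\<close>; the remainder
  has the Lipschitz constant \<open>exp (2 * r) - 1 \<le> 4 * r\<close>.\<close>

lemma exp_mult_exp_lipschitz:
  fixes x y z w :: "'a::{real_normed_algebra_1,banach}"
  assumes "norm x \<le> r" "norm y \<le> r" "norm z \<le> r" "norm w \<le> r" and r: "r \<le> 1/2"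
  shows "norm ((exp x * exp z - x - z) - (exp y * exp w - y - w)) \<le> 4 * r * (norm (x - y) + norm (z - w))"
proof -
  have r0: "0 \<le> r" using assms(1) norm_ge_zero order_trans by blast
  let ?E = "exp r"
  have E: "?E \<ge> 1" using r0 by simp
  have e1: "norm ((exp x - x) - (exp y - y)) \<le> (?E - 1) * norm (x - y)"
    and e2: "norm ((exp z - z) - (exp w - w)) \<le> (?E - 1) * norm (z - w)"
    and e3: "norm (exp x - exp y) \<le> ?E * norm (x - y)"
    and e4: "norm (exp z - exp w) \<le> ?E * norm (z - w)"
    by (intro exp_minus_id_lipschitz exp_lipschitz assms)+
  have e5: "norm (exp z - 1) \<le> ?E - 1" "norm (exp y - 1) \<le> ?E - 1"
    using exp_lipschitz[of z "norm z" 0] exp_lipschitz[of y "norm y" 0] exp_minus_id_lipschitz[of z r 0]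
  proof -
    have *: "norm (exp u - 1) \<le> ?E - 1" if u: "norm u \<le> r" for u :: 'a
    proof -
      have eq: "exp u - 1 = (\<Sum>n. u ^ (n + 1) /\<^sub>R fact (n + 1))"
        using suminf_split_initial_segment[OF summable_exp_generic[of u], of 1]
        by (simp add: exp_def)
      have "norm (exp u - 1) \<le> (\<Sum>n. r ^ (n + 1) /\<^sub>R fact (n + 1))"
        unfolding eq
      proof (rule norm_suminf_le)
        show "summable (\<lambda>n. r ^ (n + 1) /\<^sub>R fact (n + 1))"
          using summable_exp_generic[of r] summable_iff_shift[of "\<lambda>n. r ^ n /\<^sub>R fact n" 1] by simp
        show "norm (u ^ (n + 1) /\<^sub>R fact (n + 1)) \<le> r ^ (n + 1) /\<^sub>R fact (n + 1)" for n
          using order_trans[OF norm_power_ineq power_mono[OF u norm_ge_zero, of "n+1"]]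
          by (simp add: mult_left_mono)
      qed
      also have "\<dots> = ?E - 1"
        using suminf_split_initial_segment[OF summable_exp_generic[of r], of 1]
        by (simp add: exp_def)
      finally show ?thesis .
    qed
    show "norm (exp z - 1) \<le> ?E - 1" "norm (exp y - 1) \<le> ?E - 1"
      by (intro * assms)+
  qed
  have "(exp x * exp z - x - z) - (exp y * exp w - y - w) =
    ((exp x - x) - (exp y - y)) + (exp x - exp y) * (exp z - 1) + ((exp z - z) - (exp w - w))
     + (exp y - 1) * (exp z - exp w)"
    by (simp add: algebra_simps)
  also have "norm \<dots> \<le> (?E - 1) * norm (x - y) + ?E * norm (x - y) * (?E - 1) + (?E - 1) * norm (z - w)
     + (?E - 1) * (?E * norm (z - w))"
    by (intro order_trans[OF norm_triangle_ineq] order_trans[OF norm_mult_ineq] add_mono mult_mono e1 e2 e3 e4 e5)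
      (use E in auto)
  also have "\<dots> = (?E\<^sup>2 - 1) * (norm (x - y) + norm (z - w))"
    by (simp add: algebra_simps power2_eq_square)
  also have "?E\<^sup>2 = exp (2 * r)" by (simp add: exp_double)
  also have "(exp (2 * r) - 1) * (norm (x - y) + norm (z - w)) \<le> 4 * r * (norm (x - y) + norm (z - w))"
    using exp_le_quadratic_bound[of "2 * r"] r r0 by (intro mult_right_mono) auto
  finally show ?thesis .
qed

text \<open>A solution is a fixed point of \<open>x \<mapsto> y - (exp x - x - 1)\<close>. For
  \<open>norm y \<le> 1/6\<close> this map has the Lipschitz constant
  \<open>exp (1/3) - 1 \<le> 1/2\<close> on the ball of radius \<open>2 * norm y\<close>.\<close>

lemma exp_eq_near_one:
  fixes y :: "'a::{real_normed_algebra_1,banach}"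
  assumes "norm y \<le> 1/6"
  obtains x where "exp x = 1 + y" "norm x \<le> 2 * norm y"
proof -
  let ?r = "2 * norm y"
  let ?T = "\<lambda>x. y - (exp x - x - 1)"
  have le: "exp ?r - 1 \<le> 1/2"
  proof -
    have "exp ?r \<le> exp (1/3)" using assms by simp
    also have "exp (1/3::real) \<le> 1 + 1/3 + (1/3)\<^sup>2" by (rule exp_bound) auto
    also have "\<dots> \<le> 3/2" by (simp add: power2_eq_square)
    finally show ?thesis by simp
  qed
  have lip: "norm (?T x - ?T x') \<le> 1/2 * norm (x - x')" if "norm x \<le> ?r" "norm x' \<le> ?r" for x x'
  proof -
    have "?T x - ?T x' = - ((exp x - x) - (exp x' - x'))" by simp
    hence "norm (?T x - ?T x') = norm ((exp x - x) - (exp x' - x'))" by (metis norm_minus_cancel)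
    also have "\<dots> \<le> (exp ?r - 1) * norm (x - x')" by (rule exp_minus_id_lipschitz[OF that])
    also have "\<dots> \<le> 1/2 * norm (x - x')" by (intro mult_right_mono le) auto
    finally show ?thesis .
  qed
  have "\<exists>!x\<in>cball 0 ?r. ?T x = x"
  proof (rule Banach_fix[where c="1/2"])
    show "?T ` cball 0 ?r \<subseteq> cball 0 ?r"
    proof safe
      fix x :: 'a assume "x \<in> cball 0 ?r"
      hence x: "norm x \<le> ?r" by simp
      have "norm (?T x) \<le> norm (?T x - ?T 0) + norm (?T 0)"
        by (metis diff_add_cancel norm_triangle_ineq)
      also have "\<dots> \<le> 1/2 * norm (x - 0) + norm y" by (intro add_mono lip x) auto
      also have "\<dots> \<le> ?r" using x by simp
      finally show "?T x \<in> cball 0 ?r" by simp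
    qed
  qed (use lip in \<open>auto simp: dist_norm complete_eq_closed\<close>)
  then obtain x where "norm x \<le> ?r" "?T x = x" by auto
  hence "exp x = 1 + y" by (simp add: algebra_simps)
  then show ?thesis using that \<open>norm x \<le> ?r\<close> by blast
qed

text \<open>On the ball of radius 2/5 the map \<open>exp x - x\<close> has the Lipschitz constant
  \<open>exp (2/5) - 1 < 1\<close>. The radius exceeds 1/3, the largest norm of a logarithm from
  \<open>exp_eq_near_one\<close>.\<close>

lemma exp_inj_near_zero:
  fixes x y :: "'a::{real_normed_algebra_1,banach}"
  assumes x: "norm x \<le> 2/5" and y: "norm y \<le> 2/5" and eq: "exp x = exp y"
  shows "x = y"
proof -
  have "exp (2/5::real) < 2"
  proof -
    have "exp (2/5::real) \<le> 1 + 2/5 + (2/5)\<^sup>2" by (rule exp_bound) auto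
    also have "\<dots> < 2" by (simp add: power2_eq_square)
    finally show ?thesis .
  qed
  have "norm (x - y) = norm ((exp x - x) - (exp y - y))" using eq by (simp add: norm_minus_commute)
  also have "\<dots> \<le> (exp (2/5) - 1) * norm (x - y)" by (rule exp_minus_id_lipschitz[OF x y])
  finally have "(2 - exp (2/5)) * norm (x - y) \<le> 0" by (simp add: algebra_simps)
  with \<open>exp (2/5::real) < 2\<close> show ?thesis by (simp add: mult_le_0_iff)
qed

section \<open>Binomial series: the powers \<open>(1 + y) ^ a\<close> in a Banach algebra\<close>

definition binser :: "real \<Rightarrow> 'a::{real_normed_algebra_1,banach} \<Rightarrow> 'a" where
  "binser a y = (\<Sum>k. (a gchoose k) *\<^sub>R y ^ k)"

text \<open>Each coefficient is the previous one times \<open>(a - k) / (k + 1)\<close>, which has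
  modulus at most 1. The series is thus dominated by the geometric series.\<close>

lemma abs_gbinomial_le_1:
  fixes a :: real
  assumes "\<bar>a\<bar> \<le> 1"
  shows "\<bar>a gchoose k\<bar> \<le> 1"
proof (induction k)
  case (Suc k)
  have "a gchoose Suc k = (a gchoose k) * ((a - real k) / real (Suc k))"
    using gbinomial_absorb_comp[of a k] gbinomial_mult_1[of a k]
    by (simp add: field_simps)
  moreover have "\<bar>(a - real k) / real (Suc k)\<bar> \<le> 1" using assms by (simp add: abs_le_iff field_simps)
  ultimately show ?case using Suc mult_le_one[of "\<bar>a gchoose k\<bar>" "\<bar>(a - real k) / real (Suc k)\<bar>"]
    by (metis abs_ge_zero abs_mult)
qed simp

lemma norm_binser_term_le:
  fixes y :: "'a::{real_normed_algebra_1,banach}"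
  assumes "\<bar>a\<bar> \<le> 1"
  shows "norm ((a gchoose k) *\<^sub>R y ^ k) \<le> norm y ^ k"
  using mult_mono[OF abs_gbinomial_le_1[OF assms] norm_power_ineq[of y k]] by simp

lemma summable_binser:
  fixes y :: "'a::{real_normed_algebra_1,banach}"
  assumes "\<bar>a\<bar> \<le> 1" "norm y < 1"
  shows "summable (\<lambda>k. norm ((a gchoose k) *\<^sub>R y ^ k))"
  by (rule summable_comparison_test'[OF summable_geometric[of "norm y"], of 0])
    (use assms norm_binser_term_le[OF assms(1)] in auto)

text \<open>The Cauchy product of the two series, summed by Vandermonde's identity.\<close>

lemma binser_mult:
  fixes y :: "'a::{real_normed_algebra_1,banach}"
  assumes "\<bar>a\<bar> \<le> 1" "\<bar>b\<bar> \<le> 1" "norm y < 1"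
  shows "binser a y * binser b y = binser (a + b) y"
proof -
  have "binser a y * binser b y =
      (\<Sum>k. \<Sum>i\<le>k. ((a gchoose i) *\<^sub>R y ^ i) * ((b gchoose (k - i)) *\<^sub>R y ^ (k - i)))"
    unfolding binser_def by (intro Cauchy_product summable_binser assms)
  also have "(\<lambda>k. \<Sum>i\<le>k. ((a gchoose i) *\<^sub>R y ^ i) * ((b gchoose (k - i)) *\<^sub>R y ^ (k - i)))
    = (\<lambda>k. ((a + b) gchoose k) *\<^sub>R y ^ k)"
  proof
    fix k
    have "(\<Sum>i\<le>k. ((a gchoose i) *\<^sub>R y ^ i) * ((b gchoose (k - i)) *\<^sub>R y ^ (k - i)))
      = (\<Sum>i\<le>k. ((a gchoose i) * (b gchoose (k - i))) *\<^sub>R y ^ k)"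
      by (intro sum.cong refl) (simp flip: power_add)
    also have "\<dots> = ((a + b) gchoose k) *\<^sub>R y ^ k"
      using gbinomial_Vandermonde[of a b k]
      by (simp flip: scaleR_sum_left add: atMost_atLeast0)
    finally show "(\<Sum>i\<le>k. ((a gchoose i) *\<^sub>R y ^ i) * ((b gchoose (k - i)) *\<^sub>R y ^ (k - i)))
      = ((a + b) gchoose k) *\<^sub>R y ^ k" .
  qed
  finally show ?thesis by (simp add: binser_def)
qed

lemma binser_of_nat:
  "binser (real m) y = (\<Sum>k\<le>m. real (m choose k) *\<^sub>R y ^ k)"
proof -
  have "(\<lambda>k. (real m gchoose k) *\<^sub>R y ^ k) sums (\<Sum>k\<le>m. (real m gchoose k) *\<^sub>R y ^ k)"
    by (rule sums_finite) (auto simp flip: binomial_gbinomial)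
  then show ?thesis unfolding binser_def by (simp add: sums_iff binomial_gbinomial)
qed

lemma binser_0 [simp]: "binser 0 y = 1"
  using binser_of_nat[of 0 y] by simp

lemma binser_1 [simp]: "binser 1 y = 1 + y"
  using binser_of_nat[of 1 y] by simp

lemma norm_binser_minus_one_le:
  fixes y :: "'a::{real_normed_algebra_1,banach}"
  assumes "\<bar>a\<bar> \<le> 1" "norm y < 1"
  shows "norm (binser a y - 1) \<le> norm y / (1 - norm y)"
proof -
  have "binser a y - 1 = (\<Sum>k. (a gchoose (k+1)) *\<^sub>R y ^ (k+1))"
    using suminf_split_initial_segment[OF summable_norm_cancel[OF summable_binser[OF assms]], of 1]
    by (simp add: binser_def)
  also have "norm \<dots> \<le> (\<Sum>k. norm y ^ (k+1))"
  proof (rule norm_suminf_le)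
    show "summable (\<lambda>k. norm y ^ (k+1))" using assms by (simp add: summable_mult)
    show "norm ((a gchoose (k+1)) *\<^sub>R y ^ (k+1)) \<le> norm y ^ (k+1)" for k
      by (rule norm_binser_term_le[OF assms(1)])
  qed
  also have "\<dots> = norm y / (1 - norm y)"
    using suminf_mult[OF summable_geometric[of "norm y"], of "norm y"] suminf_geometric[of "norm y"] assms
    by (simp add: field_simps)
  finally show ?thesis .
qed

lemma binser_bounded_linear:
  fixes f :: "'a::{real_normed_algebra_1,banach} \<Rightarrow> 'b::real_normed_vector"
  assumes f: "bounded_linear f" and "\<bar>a\<bar> \<le> 1" "norm y < 1"
  shows "(\<lambda>k. (a gchoose k) *\<^sub>R f (y ^ k)) sums f (binser a y)"
proof -
  interpret bounded_linear f by (rule f)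
  have "(\<lambda>k. f ((a gchoose k) *\<^sub>R y ^ k)) sums f (\<Sum>k. (a gchoose k) *\<^sub>R y ^ k)"
    by (intro sums summable_sums summable_norm_cancel[OF summable_binser[OF assms(2,3)]])
  then show ?thesis by (simp add: scaleR binser_def)
qed

lemma binser_commute:
  fixes y :: "'a::{real_normed_algebra_1,banach}"
  assumes "\<bar>a\<bar> \<le> 1" "norm y < 1" and c: "c * y = y * c"
  shows "c * binser a y = binser a y * c"
proof -
  have p: "c * y ^ k = y ^ k * c" for k
    by (induction k) (auto simp: mult.assoc c, metis c mult.assoc)
  have "(\<lambda>k. (a gchoose k) *\<^sub>R (c * y ^ k)) sums (c * binser a y)"
    by (rule binser_bounded_linear[OF bounded_linear_mult_right assms(1,2)])
  moreover have "(\<lambda>k. (a gchoose k) *\<^sub>R (y ^ k * c)) sums (binser a y * c)"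
    by (rule binser_bounded_linear[OF bounded_linear_mult_left assms(1,2)])
  ultimately show ?thesis by (simp add: p sums_unique2)
qed

section \<open>Exponentials under linear maps and the Trotter product formula\<close>

lemma exp_bounded_linear_sums:
  fixes f :: "'a::{real_normed_algebra_1,banach} \<Rightarrow> 'b::real_normed_vector"
  assumes f: "bounded_linear f"
  shows "(\<lambda>k. f (x ^ k) /\<^sub>R fact k) sums f (exp x)"
proof -
  interpret bounded_linear f by (rule f)
  show ?thesis using sums[OF exp_converges[of x]] by (simp add: scaleR)
qed

lemma exp_power:
  fixes x :: "'a::{real_normed_algebra_1,banach}"
  shows "exp x ^ n = exp (real n *\<^sub>R x)"
proof (induction n)
  case (Suc n)
  have "exp (real (Suc n) *\<^sub>R x) = exp (x + real n *\<^sub>R x)" by (simp add: scaleR_add_left)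
  also have "\<dots> = exp x * exp (real n *\<^sub>R x)" by (rule exp_add_commuting) simp
  finally show ?case using Suc by simp
qed simp

text \<open>One factor differs from \<open>exp ((1 / m) *\<^sub>R (x + y))\<close> by
  \<open>O(1 / m\<^sup>2)\<close>. As the norms are at most 1, passing to \<open>m\<close>-th powers
  multiplies the error by at most \<open>m\<close>.\<close>

lemma trotter_product:
  fixes x y :: "'a::{real_normed_algebra_1,banach}"
  assumes bx: "\<And>t. norm (exp (t *\<^sub>R x)) \<le> 1" and by': "\<And>t. norm (exp (t *\<^sub>R y)) \<le> 1"
    and bxy: "\<And>t. norm (exp (t *\<^sub>R (x + y))) \<le> 1"
  shows "(\<lambda>m. (exp ((1 / real (Suc m)) *\<^sub>R x) * exp ((1 / real (Suc m)) *\<^sub>R y)) ^ Suc m) \<longlonglongrightarrow> exp (x + y)"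
proof -
  define B where "B = norm x + norm y"
  have B: "0 \<le> B" "norm x \<le> B" "norm y \<le> B" "norm (x + y) \<le> B"
    using norm_triangle_ineq[of x y] by (auto simp: B_def)
  have main: "norm ((exp ((1 / m) *\<^sub>R x) * exp ((1 / m) *\<^sub>R y)) ^ n - exp (x + y)) \<le> 8 * B\<^sup>2 / m"
    if m: "m = real n" and big: "2 * B \<le> m" "0 < m" for m n
  proof -
    let ?r = "B / m"
    have r: "?r \<le> 1/2" "0 \<le> ?r" using big B by (auto simp: field_simps)
    let ?a = "exp ((1 / m) *\<^sub>R x) * exp ((1 / m) *\<^sub>R y)" and ?b = "exp ((1 / m) *\<^sub>R (x + y))"
    have n: "norm ((1 / m) *\<^sub>R x) \<le> ?r" "norm ((1 / m) *\<^sub>R y) \<le> ?r" "norm ((1 / m) *\<^sub>R (x + y)) \<le> ?r"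
      using B big by (auto simp only: norm_scaleR abs_of_pos zero_less_divide_1_iff mult_1 times_divide_eq_left divide_right_mono less_imp_le)
    let ?X = "(1 / m) *\<^sub>R x" and ?Y = "(1 / m) *\<^sub>R y"
    \<comment> \<open>The comparison exponential is written as \<open>exp (?X + ?Y) * exp 0\<close>,
      so that both products fall under \<open>exp_mult_exp_lipschitz\<close>.\<close>
    have "norm ((exp ?X * exp ?Y - ?X - ?Y) - (exp (?X + ?Y) * exp 0 - (?X + ?Y) - 0))
        \<le> 4 * ?r * (norm (?X - (?X + ?Y)) + norm (?Y - 0))"
      by (rule exp_mult_exp_lipschitz) (use n r in \<open>auto simp: scaleR_add_right\<close>)
    also have "\<dots> \<le> 4 * ?r * (2 * ?r)" using n r by (intro mult_left_mono) auto
    also have "(exp ?X * exp ?Y - ?X - ?Y) - (exp (?X + ?Y) * exp 0 - (?X + ?Y) - 0) = ?a - ?b"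
      by (simp add: scaleR_add_right)
    finally have d: "norm (?a - ?b) \<le> 8 * ?r\<^sup>2" by (simp add: power2_eq_square)
    have "norm ?a \<le> 1 * 1"
      by (intro order_trans[OF norm_mult_ineq] mult_mono bx by') auto
    hence "norm (?a ^ n - ?b ^ n) \<le> real n * 1 ^ (n - 1) * norm (?a - ?b)"
      by (intro norm_power_diff_le bxy) auto
    also have "\<dots> \<le> m * (8 * ?r\<^sup>2)" using d big m by (auto intro!: mult_left_mono)
    also have "\<dots> = 8 * B\<^sup>2 / m" using big by (simp add: power2_eq_square field_simps)
    also have "?b ^ n = exp (x + y)"
    proof -
      have "?b ^ n = exp (real n *\<^sub>R ((1/m) *\<^sub>R (x + y)))"
        by (rule exp_power)
      then show ?thesis using m big by simp
    qed
    finally show ?thesis .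
  qed
  have lim: "(\<lambda>m. 8 * B\<^sup>2 / real (Suc m)) \<longlonglongrightarrow> 0"
    by (rule tendsto_divide_0[OF tendsto_const])
      (metis filterlim_Suc filterlim_at_top_imp_at_infinity filterlim_compose filterlim_real_sequentially)
  have ev: "\<forall>\<^sub>F m in sequentially. 2 * B \<le> real (Suc m)"
    using filterlim_compose[OF filterlim_real_sequentially filterlim_Suc]
    by (simp add: filterlim_at_top)
  show ?thesis
    by (rule LIM_zero_cancel, rule Lim_null_comparison[OF _ lim])
      (use ev in eventually_elim, rule main, auto simp del: of_nat_Suc)
qed

section \<open>The Banach algebra of square matrices with the operator norm\<close>

text \<open>Real and complex scalars at once, so that one argument serves both groups. The real
  inner product is the real part of \<open>x * conjugate y\<close>, and \<open>card Basis\<close> is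
  the real dimension of the scalars.\<close>

class rc_field = real_normed_field + euclidean_space + conjugatable_ordered_field +
  assumes mult_conjugate_scaleR: "x * conjugate x = scaleR (norm x * norm x) 1"
    and conjugate_scaleR_one: "conjugate (scaleR r 1) = scaleR r 1"
    and inner_eq_mult_conjugate: "inner x y = inner (x * conjugate y) 1"
    and card_Basis_le_2: "card Basis \<le> 2"

instance real :: rc_field
  by standard (auto simp: power2_eq_square Basis_real_def)

instance complex :: rc_field
proof
  fix x y :: complex and r :: real
  show "x * conjugate x = scaleR (norm x * norm x) 1"
    using complex_norm_square[of x] by (simp add: power2_eq_square scaleR_conv_of_real)
  show "conjugate (scaleR r (1::complex)) = scaleR r 1" by (simp add: complex_eq_iff)
  show "inner x y = inner (x * conjugate y) 1" by (simp add: inner_complex_def)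
  show "card (Basis :: complex set) \<le> 2" by (simp add: Basis_complex_def card_insert_if)
qed

section \<open>Identities for real and complex scalars\<close>

lemma mult_conjugate: "x * conjugate x = of_real ((norm (x::'a::rc_field))\<^sup>2)"
  by (simp add: mult_conjugate_scaleR of_real_def power2_eq_square)

lemma conjugate_of_real [simp]: "conjugate (of_real r) = (of_real r :: 'a::rc_field)"
  by (simp add: of_real_def conjugate_scaleR_one)

lemma inner_mult_left_conjugate: "inner (a * b) c = inner b (conjugate a * (c::'a::rc_field))"
  by (subst (1 2) inner_eq_mult_conjugate) (simp add: conjugate_dist_mul mult.commute mult.left_commute)

lemma conjugate_scaleR [simp]: "conjugate (r *\<^sub>R x) = r *\<^sub>R conjugate (x::'a::rc_field)"
  by (simp add: scaleR_conv_of_real conjugate_dist_mul)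

lemma conjugate_one [simp]: "conjugate 1 = (1::'a::rc_field)"
  using conjugate_of_real[of 1, where ?'a='a] by simp

lemma norm_conjugate [simp]: "norm (conjugate x) = norm (x::'a::rc_field)"
proof -
  have "of_real ((norm (conjugate x))\<^sup>2) = (of_real ((norm x)\<^sup>2) :: 'a)"
    using mult_conjugate[of x] mult_conjugate[of "conjugate x"] by (simp add: mult.commute)
  then show ?thesis by (metis norm_ge_zero of_real_eq_iff power2_eq_imp_eq)
qed

text \<open>A copy of the type of square matrices: \<open>'a^'n^'n\<close> carries the Euclidean
  norm, whereas a Banach algebra under the operator norm is wanted. The Euclidean structure stays
  accessible through \<open>entries\<close> and provides dimensions and the Hilbert-Schmidt inner
  product.\<close>

typedef (overloaded) ('a, 'n) cmat = "UNIV :: ('a::rc_field^'n::finite^'n) set"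
  morphisms entries of_entries by auto

setup_lifting type_definition_cmat

lemma bounded_linear_mv: "bounded_linear ((*v) (A :: 'a::rc_field^'n^'m))"
  by (rule matrix_vector_mul_bounded_linear)

lemma scaleR_mv: "(r *\<^sub>R A) *v x = r *\<^sub>R (A *v x)" for A :: "'a::rc_field^'n^'m"
  by (simp add: matrix_vector_mult_def Finite_Cartesian_Product.vec_eq_iff scaleR_sum_right)

instantiation cmat :: (rc_field, finite) real_normed_algebra_1
begin

lift_definition norm_cmat :: "('a, 'b) cmat \<Rightarrow> real" is "\<lambda>A. onorm ((*v) A)" .
lift_definition minus_cmat :: "('a, 'b) cmat \<Rightarrow> ('a, 'b) cmat \<Rightarrow> ('a, 'b) cmat" is "\<lambda>A B. A - B" .
lift_definition plus_cmat :: "('a, 'b) cmat \<Rightarrow> ('a, 'b) cmat \<Rightarrow> ('a, 'b) cmat" is "\<lambda>A B. A + B" .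
lift_definition times_cmat :: "('a, 'b) cmat \<Rightarrow> ('a, 'b) cmat \<Rightarrow> ('a, 'b) cmat" is "\<lambda>A B. A ** B" .
lift_definition uminus_cmat :: "('a, 'b) cmat \<Rightarrow> ('a, 'b) cmat" is "\<lambda>A. - A" .
lift_definition zero_cmat :: "('a, 'b) cmat" is "0" .
lift_definition one_cmat :: "('a, 'b) cmat" is "Finite_Cartesian_Product.mat 1" .
lift_definition scaleR_cmat :: "real \<Rightarrow> ('a, 'b) cmat \<Rightarrow> ('a, 'b) cmat" is "\<lambda>r A. r *\<^sub>R A" .

definition dist_cmat :: "('a, 'b) cmat \<Rightarrow> ('a, 'b) cmat \<Rightarrow> real"
  where "dist_cmat a b = norm (a - b)"
definition uniformity_cmat :: "(('a, 'b) cmat \<times> ('a, 'b) cmat) filter"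
  where "uniformity_cmat = (INF e\<in>{0 <..}. principal {(x, y). dist x y < e})"
definition open_cmat :: "('a, 'b) cmat set \<Rightarrow> bool"
  where "open_cmat S = (\<forall>x\<in>S. \<forall>\<^sub>F (x', y) in uniformity. x' = x \<longrightarrow> y \<in> S)"
definition sgn_cmat :: "('a, 'b) cmat \<Rightarrow> ('a, 'b) cmat"
  where "sgn_cmat x = scaleR (inverse (norm x)) x"

lemma matrix_mult_scaleR_left: "(r *\<^sub>R A) ** B = r *\<^sub>R (A ** B)" for A :: "'a::rc_field^'b^'b"
  by (simp add: matrix_matrix_mult_def Finite_Cartesian_Product.vec_eq_iff scaleR_sum_right)

lemma matrix_mult_scaleR_right: "A ** (r *\<^sub>R B) = r *\<^sub>R (A ** B)" for A :: "'a::rc_field^'b^'b"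
  by (simp add: matrix_matrix_mult_def Finite_Cartesian_Product.vec_eq_iff scaleR_sum_right)

lemma matrix_mult_distrib_left: "(A + B) ** C = A ** C + B ** C" for A :: "'a::rc_field^'b^'b"
  by (simp add: matrix_matrix_mult_def Finite_Cartesian_Product.vec_eq_iff distrib_right sum.distrib)

lemma matrix_mult_distrib_right: "C ** (A + B) = C ** A + C ** B" for A :: "'a::rc_field^'b^'b"
  by (simp add: matrix_matrix_mult_def Finite_Cartesian_Product.vec_eq_iff distrib_left sum.distrib)

lemma mv_zero_iff: "(\<forall>x. A *v x = 0) \<longleftrightarrow> A = 0" for A :: "'a::rc_field^'b^'b"
  by (metis matrix_eq matrix_vector_mult_0)

instance
proof
  fix a b c :: "('a, 'b) cmat" and r s :: real
  show "a + b + c = a + (b + c)" "a + b = b + a" "0 + a = a" "- a + a = 0" "a - b = a + - b"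
    "r *\<^sub>R (a + b) = r *\<^sub>R a + r *\<^sub>R b" "(r + s) *\<^sub>R a = r *\<^sub>R a + s *\<^sub>R a" "r *\<^sub>R s *\<^sub>R a = (r * s) *\<^sub>R a"
    "1 *\<^sub>R a = a"
    by (transfer, simp add: algebra_simps)+
  show "a * b * c = a * (b * c)" by transfer (simp add: matrix_mul_assoc)
  show "(a + b) * c = a * c + b * c" by transfer (rule matrix_mult_distrib_left)
  show "a * (b + c) = a * b + a * c" by transfer (rule matrix_mult_distrib_right)
  show "1 * a = a" "a * 1 = a" by (transfer, simp)+
  show "r *\<^sub>R a * b = r *\<^sub>R (a * b)" by transfer (rule matrix_mult_scaleR_left)
  show "a * r *\<^sub>R b = r *\<^sub>R (a * b)" by transfer (rule matrix_mult_scaleR_right)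
  show "(0::('a, 'b) cmat) \<noteq> 1"
    by transfer (auto simp: Finite_Cartesian_Product.vec_eq_iff Finite_Cartesian_Product.mat_def)
  show "dist a b = norm (a - b)" by (rule dist_cmat_def)
  show "(uniformity :: (('a, 'b) cmat \<times> ('a, 'b) cmat) filter) = (INF e\<in>{0 <..}. principal {(x, y). dist x y < e})"
    by (rule uniformity_cmat_def)
  show "open S = (\<forall>x\<in>S. \<forall>\<^sub>F (x', y) in uniformity. x' = x \<longrightarrow> y \<in> S)" for S :: "('a, 'b) cmat set"
    by (rule open_cmat_def)
  show "sgn a = inverse (norm a) *\<^sub>R a" by (rule sgn_cmat_def)
  show "(norm a = 0) = (a = 0)"
    by transfer (simp add: onorm_eq_0[OF bounded_linear_mv] mv_zero_iff)
  show "norm (a + b) \<le> norm a + norm b"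
  proof transfer
    fix A B :: "'a^'b^'b"
    have "(*v) (A + B) = (\<lambda>x. A *v x + B *v x)" by (auto simp: matrix_vector_mult_add_rdistrib)
    then show "onorm ((*v) (A + B)) \<le> onorm ((*v) A) + onorm ((*v) B)"
      using onorm_triangle[OF bounded_linear_mv bounded_linear_mv] by metis
  qed
  show "norm (r *\<^sub>R a) = \<bar>r\<bar> * norm a"
  proof transfer
    fix A :: "'a^'b^'b" and r :: real
    have "(*v) (r *\<^sub>R A) = (\<lambda>x. r *\<^sub>R (A *v x))" by (auto simp: scaleR_mv)
    then show "onorm ((*v) (r *\<^sub>R A)) = \<bar>r\<bar> * onorm ((*v) A)"
      using onorm_scaleR[OF bounded_linear_mv] by metis
  qed
  show "norm (a * b) \<le> norm a * norm b"
  proof transfer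
    fix A B :: "'a^'b^'b"
    have "(*v) (A ** B) = (*v) A \<circ> (*v) B" by (auto simp: matrix_vector_mul_assoc)
    then show "onorm ((*v) (A ** B)) \<le> onorm ((*v) A) * onorm ((*v) B)"
      using onorm_compose[OF bounded_linear_mv bounded_linear_mv] by metis
  qed
  show "norm (1::('a, 'b) cmat) = 1"
  proof transfer
    have "(*v) (Finite_Cartesian_Product.mat 1) = (\<lambda>x :: 'a^'b. x)" by auto
    then show "onorm ((*v) (Finite_Cartesian_Product.mat 1 :: 'a^'b^'b)) = 1" by (simp add: onorm_id)
  qed
qed

end

section \<open>Action on vectors and the adjoint\<close>

lift_definition mapp :: "('a::rc_field, 'n::finite) cmat \<Rightarrow> 'a^'n \<Rightarrow> 'a^'n" is "(*v)" .

lift_definition star :: "('a::rc_field, 'n::finite) cmat \<Rightarrow> ('a, 'n) cmat"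
  is "\<lambda>A. vec_lambda (\<lambda>i. vec_lambda (\<lambda>j. conjugate (vec_nth (vec_nth A j) i)))" .

lemma mapp_add [simp]: "mapp (A + B) x = mapp A x + mapp B x"
  by transfer (simp add: matrix_vector_mult_add_rdistrib)
lemma mapp_diff [simp]: "mapp (A - B) x = mapp A x - mapp B x"
  by transfer (simp add: matrix_vector_mult_diff_rdistrib)
lemma mapp_uminus [simp]: "mapp (- A) x = - mapp A x"
  using mapp_diff[of 0 A x] by (metis add.left_neutral add_cancel_right_left diff_0 mapp_add)
lemma mapp_mult [simp]: "mapp (A * B) x = mapp A (mapp B x)"
  by transfer (simp add: matrix_vector_mul_assoc)
lemma mapp_one [simp]: "mapp 1 x = x" by transfer simp
lemma mapp_zero [simp]: "mapp 0 x = 0" by transfer simp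
lemma mapp_scaleR [simp]: "mapp (r *\<^sub>R A) x = r *\<^sub>R mapp A x" by transfer (rule scaleR_mv)
lemma bounded_linear_mapp: "bounded_linear (mapp A)" by transfer (rule bounded_linear_mv)
lemma norm_mapp_le: "norm (mapp A x) \<le> norm A * norm x" by transfer (rule onorm[OF bounded_linear_mv])
lemma norm_cmat_leI: "(\<And>x. norm (mapp A x) \<le> b * norm x) \<Longrightarrow> norm A \<le> b"
  by transfer (rule onorm_le)
lemma cmat_eqI: "(\<And>x. mapp A x = mapp B x) \<Longrightarrow> A = B"
  by transfer (simp add: matrix_eq)

lemmas mapp_vec_simps [simp] =
  linear_add[OF bounded_linear.linear[OF bounded_linear_mapp]]
  linear_diff[OF bounded_linear.linear[OF bounded_linear_mapp]]
  linear_neg[OF bounded_linear.linear[OF bounded_linear_mapp]]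
  linear_0[OF bounded_linear.linear[OF bounded_linear_mapp]]
  linear_scale[OF bounded_linear.linear[OF bounded_linear_mapp]]

lemma star_add [simp]: "star (A + B) = star A + star B"
  by transfer (simp add: Finite_Cartesian_Product.vec_eq_iff conjugate_dist_add)
lemma star_uminus [simp]: "star (- A) = - star A"
  by transfer (simp add: Finite_Cartesian_Product.vec_eq_iff conjugate_neg)
lemma star_diff [simp]: "star (A - B) = star A - star B"
  using star_add[of A "- B"] by simp
lemma star_scaleR [simp]: "star (r *\<^sub>R A) = r *\<^sub>R star A"
  by transfer (simp add: Finite_Cartesian_Product.vec_eq_iff)
lemma star_zero [simp]: "star 0 = 0"
  by transfer (simp add: Finite_Cartesian_Product.vec_eq_iff)
lemma star_one [simp]: "star 1 = 1"
  by transfer (simp add: Finite_Cartesian_Product.vec_eq_iff Finite_Cartesian_Product.mat_def)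
lemma star_mult [simp]: "star (A * B) = star B * star A"
  by transfer (simp add: Finite_Cartesian_Product.vec_eq_iff matrix_matrix_mult_def sum_conjugate conjugate_dist_mul mult.commute)
lemma star_star [simp]: "star (star A) = A"
  by transfer (simp add: Finite_Cartesian_Product.vec_eq_iff)
lemma star_power [simp]: "star (A ^ n) = star A ^ n"
  by (induction n) (auto simp: power_commutes)

text \<open>\<open>inner\<close> is the real part of the Hermitian form, and the conjugate transpose
  is the adjoint for both.\<close>

lemma inner_mapp_left: "inner (mapp A x) y = inner x (mapp (star A) y)"
proof transfer
  fix A :: "'a^'b^'b" and x y
  have "inner (A *v x) y = (\<Sum>i\<in>UNIV. \<Sum>j\<in>UNIV. inner (vec_nth (vec_nth A i) j * vec_nth x j) (vec_nth y i))"
    by (simp add: inner_vec_def matrix_vector_mult_def inner_sum_left)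
  also have "\<dots> = (\<Sum>j\<in>UNIV. \<Sum>i\<in>UNIV. inner (vec_nth x j) (conjugate (vec_nth (vec_nth A i) j) * vec_nth y i))"
    by (subst sum.swap) (simp add: inner_mult_left_conjugate)
  also have "\<dots> = inner x ((vec_lambda (\<lambda>i. vec_lambda (\<lambda>j. conjugate (vec_nth (vec_nth A j) i)))) *v y)"
    by (simp add: inner_vec_def matrix_vector_mult_def inner_sum_right)
  finally show "inner (A *v x) y = inner x ((vec_lambda (\<lambda>i. vec_lambda (\<lambda>j. conjugate (vec_nth (vec_nth A j) i)))) *v y)" .
qed

lemma norm_star_le: "norm (star A) \<le> norm A"
proof (rule norm_cmat_leI)
  fix x
  have "(norm (mapp (star A) x))\<^sup>2 = inner (mapp A (mapp (star A) x)) x"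
    by (simp add: inner_mapp_left power2_norm_eq_inner)
  also have "\<dots> \<le> norm A * norm (mapp (star A) x) * norm x"
    by (rule order_trans[OF norm_cauchy_schwarz]) (intro mult_right_mono norm_mapp_le norm_ge_zero)
  finally show "norm (mapp (star A) x) \<le> norm A * norm x"
    by (cases "norm (mapp (star A) x) = 0") (auto simp: power2_eq_square)
qed

lemma norm_star [simp]: "norm (star A) = norm A"
  using norm_star_le[of A] norm_star_le[of "star A"] by simp

lemma bounded_linear_star: "bounded_linear star"
  by (rule bounded_linear_intro[where K=1]) auto

lemma bounded_linear_of_entries: "bounded_linear (of_entries :: 'a::rc_field^'n::finite^'n \<Rightarrow> _)"
proof -
  have "linear (of_entries :: 'a^'n^'n \<Rightarrow> _)"
    by (rule linearI) (auto simp: plus_cmat.abs_eq scaleR_cmat.abs_eq)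
  then show ?thesis by (simp add: linear_conv_bounded_linear)
qed

lemma norm_entry_le: "norm (vec_nth (vec_nth (entries A) i) j) \<le> norm A"
proof -
  have "norm (vec_nth (vec_nth (entries A) i) j) = norm (vec_nth (mapp A (axis j 1)) i)"
    by transfer (simp add: matrix_vector_mult_def axis_def if_distrib[of "\<lambda>x. _ * x"] cong: if_cong)
  also have "\<dots> \<le> norm (mapp A (axis j 1))" by (rule Finite_Cartesian_Product.norm_nth_le)
  also have "\<dots> \<le> norm A * norm (axis j (1::'a) :: 'a^'b)" by (rule norm_mapp_le)
  also have "norm (axis j (1::'a) :: 'a^'b) = 1"
  proof -
    have "inner (1::'a) 1 = 1" by (metis norm_eq_1 norm_one)
    then show ?thesis by (simp add: norm_eq_1 inner_axis_axis)
  qed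
  finally show ?thesis by simp
qed

lemma bounded_linear_entries: "bounded_linear (entries :: _ \<Rightarrow> 'a::rc_field^'n::finite^'n)"
proof (rule bounded_linear_intro[where K="real CARD('n) * real CARD('n)"])
  show "entries (x + y) = entries x + entries y" for x y :: "('a, 'n) cmat" by transfer simp
  show "entries (r *\<^sub>R x) = r *\<^sub>R entries x" for r and x :: "('a, 'n) cmat" by transfer simp
  fix A :: "('a, 'n) cmat"
  have "norm (entries A) \<le> (\<Sum>i\<in>UNIV. norm (vec_nth (entries A) i))"
    unfolding norm_vec_def by (rule L2_set_le_sum) auto
  also have "\<dots> \<le> (\<Sum>i\<in>(UNIV::'n set). \<Sum>j\<in>(UNIV::'n set). norm A)"
  proof (intro sum_mono)
    fix i
    have "norm (vec_nth (entries A) i) \<le> (\<Sum>j\<in>UNIV. norm (vec_nth (vec_nth (entries A) i) j))"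
      unfolding norm_vec_def by (rule L2_set_le_sum) auto
    also have "\<dots> \<le> (\<Sum>j\<in>(UNIV::'n set). norm A)" by (intro sum_mono norm_entry_le)
    finally show "norm (vec_nth (entries A) i) \<le> (\<Sum>j\<in>(UNIV::'n set). norm A)" .
  qed
  finally show "norm (entries A) \<le> norm A * (real CARD('n) * real CARD('n))" by (simp add: mult_ac)
qed

lemma tendsto_cmat_iff: "(f \<longlongrightarrow> a) F \<longleftrightarrow> ((\<lambda>x. entries (f x)) \<longlongrightarrow> entries a) F"
proof
  assume "((\<lambda>x. entries (f x)) \<longlongrightarrow> entries a) F"
  from bounded_linear.tendsto[OF bounded_linear_of_entries this] show "(f \<longlongrightarrow> a) F"
    by (simp add: entries_inverse)
qed (rule bounded_linear.tendsto[OF bounded_linear_entries])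

instance cmat :: (rc_field, finite) banach
proof
  fix X :: "nat \<Rightarrow> ('a, 'b) cmat"
  assume "Cauchy X"
  then have "Cauchy (\<lambda>n. entries (X n))" by (rule bounded_linear.Cauchy[OF bounded_linear_entries])
  then obtain L where "(\<lambda>n. entries (X n)) \<longlonglongrightarrow> L" using Cauchy_convergent_iff convergent_def by blast
  then have "X \<longlonglongrightarrow> of_entries L" by (simp add: tendsto_cmat_iff of_entries_inverse)
  then show "convergent X" by (auto simp: convergent_def)
qed

instance cmat :: (rc_field, finite) heine_borel
proof
  fix f :: "nat \<Rightarrow> ('a, 'b) cmat"
  assume "bounded (range f)"
  then have "bounded (range (\<lambda>n. entries (f n)))"
    using bounded_linear_image[OF _ bounded_linear_entries] by (metis (no_types) image_image)
  then obtain L r where "strict_mono (r::nat\<Rightarrow>nat)" "((\<lambda>n. entries (f n)) \<circ> r) \<longlonglongrightarrow> L"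
    using bounded_imp_convergent_subsequence by blast
  then have "(f \<circ> r) \<longlonglongrightarrow> of_entries L" by (simp add: tendsto_cmat_iff of_entries_inverse o_def)
  with \<open>strict_mono r\<close> show "\<exists>l r. strict_mono (r::nat\<Rightarrow>nat) \<and> (f \<circ> r) \<longlonglongrightarrow> l" by blast
qed

lemma star_exp: "star (exp A) = exp (star A)"
  using exp_bounded_linear_sums[OF bounded_linear_star, of A] exp_converges[of "star A"]
  by (simp add: sums_unique2)

lemma star_binser:
  assumes "\<bar>a\<bar> \<le> 1" "norm y < 1"
  shows "star (binser a y) = binser a (star y)"
  using binser_bounded_linear[OF bounded_linear_star assms]
    summable_sums[OF summable_norm_cancel[OF summable_binser[OF assms(1), of "star y"]]] assms(2)
  by (simp add: sums_unique2 binser_def)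

section \<open>Unitary and skew matrices\<close>

definition unitary :: "('a::rc_field, 'n::finite) cmat \<Rightarrow> bool" where
  "unitary u \<longleftrightarrow> star u * u = 1"

definition skewadj :: "('a::rc_field, 'n::finite) cmat \<Rightarrow> bool" where
  "skewadj x \<longleftrightarrow> star x = - x"

lemma cmat_left_right_inverse: "A * B = 1 \<Longrightarrow> B * A = (1 :: ('a::rc_field, 'n::finite) cmat)"
  by transfer (simp add: matrix_left_right_inverse)

lemma unitaryD: "unitary u \<Longrightarrow> star u * u = 1" "unitary u \<Longrightarrow> u * star u = 1"
  by (auto simp: unitary_def cmat_left_right_inverse)

lemma unitary_one [simp]: "unitary 1"
  by (simp add: unitary_def)

lemma unitary_star [simp]: "unitary (star u) \<longleftrightarrow> unitary u"
  by (auto simp: unitary_def dest: cmat_left_right_inverse)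

lemma unitary_mult: "unitary u \<Longrightarrow> unitary v \<Longrightarrow> unitary (u * v)"
  by (simp add: unitary_def mult.assoc) (metis mult.assoc mult.left_neutral)

lemma norm_mapp_unitary:
  assumes "unitary u" shows "norm (mapp u x) = norm x"
proof -
  have "inner (mapp u x) (mapp u x) = inner x (mapp (star u * u) x)"
    by (simp add: inner_mapp_left)
  then show ?thesis using assms by (simp only: unitary_def norm_eq_sqrt_inner mapp_one)
qed

lemma norm_unitary_mult:
  assumes "unitary u" shows "norm (u * A) = norm A"
proof (rule antisym)
  show "norm (u * A) \<le> norm A"
    by (rule norm_cmat_leI) (simp add: norm_mapp_unitary assms norm_mapp_le)
  show "norm A \<le> norm (u * A)"
  proof (rule norm_cmat_leI)
    fix x show "norm (mapp A x) \<le> norm (u * A) * norm x"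
      using norm_mapp_le[of "u * A" x] by (simp add: norm_mapp_unitary assms)
  qed
qed

lemma norm_mult_unitary:
  assumes "unitary u" shows "norm (A * u) = norm A"
  using norm_unitary_mult[of "star u" "star A"] assms norm_star[of "A * u"] by simp

lemma norm_unitary [simp]: "unitary u \<Longrightarrow> norm u = 1"
  using norm_unitary_mult[of u 1] by simp

lemma skewadj_scaleR [intro]: "skewadj x \<Longrightarrow> skewadj (r *\<^sub>R x)"
  by (simp add: skewadj_def)

lemma skewadj_add [intro]: "skewadj x \<Longrightarrow> skewadj y \<Longrightarrow> skewadj (x + y)"
  by (simp add: skewadj_def)

lemma skewadj_diff [intro]: "skewadj x \<Longrightarrow> skewadj y \<Longrightarrow> skewadj (x - y)"
  by (simp add: skewadj_def)

lemma skewadj_uminus [simp]: "skewadj (- x) \<longleftrightarrow> skewadj x"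
  by (simp add: skewadj_def) (metis minus_equation_iff)

lemma skewadj_zero [simp]: "skewadj 0"
  by (simp add: skewadj_def)

lemma exp_minus_mult: "exp (- x) * exp x = (1::'a::{real_normed_algebra_1,banach})"
  using exp_add_commuting[of "- x" x] by simp

lemma unitary_exp: "skewadj x \<Longrightarrow> unitary (exp x)"
  by (simp add: unitary_def skewadj_def star_exp exp_minus_mult)

lemma star_exp_skewadj: "skewadj x \<Longrightarrow> star (exp x) = exp (- x)"
  by (simp add: skewadj_def star_exp)

text \<open>The logarithm \<open>x\<close> from \<open>exp_eq_near_one\<close> is skew because
  \<open>exp (star x) = star u\<close> is the inverse \<open>exp (- x)\<close> of \<open>u\<close>,
  and \<open>exp\<close> is injective on the ball that contains \<open>star x\<close> and
  \<open>- x\<close>.\<close>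

lemma unitary_near_one_exp:
  assumes u: "unitary u" and n: "norm (u - 1) \<le> 1/6"
  obtains x where "skewadj x" "exp x = u" "norm x \<le> 2 * norm (u - 1)"
proof -
  obtain x where x: "exp x = 1 + (u - 1)" "norm x \<le> 2 * norm (u - 1)"
    using exp_eq_near_one[OF n] by blast
  have "exp (star x) = exp (- x)"
  proof -
    have "exp (star x) = star u" using x(1) star_exp[of x] by simp
    moreover have "exp (- x) * u = 1" using exp_minus_mult[of x] x(1) by simp
    then have "exp (- x) = star u"
      using cmat_left_right_inverse[of "exp (- x)" u] unitaryD[OF u]
        mult.assoc[of "exp (- x)" u "star u"] by simp
    ultimately show ?thesis by simp
  qed
  then have "star x = - x"
    by (rule exp_inj_near_zero[rotated 2]) (use x n in auto)
  then show ?thesis using that[of x] x by (simp add: skewadj_def)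
qed

section \<open>Exponentials of skew matrices at a norm-attaining vector\<close>

lemma norm_cmat_attained:
  fixes A :: "('a::rc_field, 'n::finite) cmat"
  obtains v where "norm v = 1" "norm (mapp A v) = norm A"
proof -
  have "continuous_on (sphere (0::'a^'n) 1) (\<lambda>x. norm (mapp A x))"
    by (intro continuous_intros linear_continuous_on bounded_linear_mapp)
  moreover obtain w :: "'a^'n" where "norm w = 1" using vector_choose_size[of 1] by auto
  then have "sphere (0::'a^'n) 1 \<noteq> {}" by auto
  ultimately obtain v where v: "v \<in> sphere 0 1" "\<forall>y\<in>sphere 0 1. norm (mapp A y) \<le> norm (mapp A v)"
    using continuous_attains_sup[OF compact_sphere] by blast
  have "norm A \<le> norm (mapp A v)"
  proof (rule norm_cmat_leI)
    fix x
    show "norm (mapp A x) \<le> norm (mapp A v) * norm x"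
    proof (cases "x = 0")
      case False
      then have "norm (mapp A (inverse (norm x) *\<^sub>R x)) \<le> norm (mapp A v)"
        by (intro v(2)[rule_format]) simp
      then show ?thesis using False by (simp add: field_simps)
    qed simp
  qed
  moreover have "norm (mapp A v) \<le> norm A" using norm_mapp_le[of A v] v by simp
  ultimately show ?thesis using that[of v] v by simp
qed

lemma bounded_bilinear_mapp: "bounded_bilinear mapp"
  by (rule bounded_bilinear.intro) (auto intro!: exI[of _ 1] norm_mapp_le)

lemma inner_skewadj_self: "skewadj z \<Longrightarrow> inner (mapp z x) x = 0"
  using inner_mapp_left[of z x x] by (simp add: skewadj_def inner_commute)

text \<open>A substitute for the spectral theorem. Equality in the Cauchy-Schwarz inequality forces
  \<open>mapp z (mapp z v) = - (l\<^sup>2 *\<^sub>R v)\<close> at a vector where the norm is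
  attained, so \<open>exp (t *\<^sub>R z)\<close> rotates the plane of \<open>v\<close> and
  \<open>mapp z v\<close> by the angle \<open>l * t\<close>.\<close>

lemma exp_skewadj_top_vector:
  assumes z: "skewadj z" and v: "norm v = 1" "norm (mapp z v) = norm z" and z0: "z \<noteq> 0"
  defines "l \<equiv> norm z"
  shows "mapp (exp z) v = cos l *\<^sub>R v + (sin l / l) *\<^sub>R mapp z v"
proof -
  have l: "l \<noteq> 0" using z0 by (simp add: l_def)
  have z2: "mapp z (mapp z v) = - (l\<^sup>2 *\<^sub>R v)"
  proof -
    let ?w = "- mapp z (mapp z v)"
    have "inner ?w v = inner (mapp z v) (mapp z v)"
      using inner_mapp_left[of z "mapp z v" v] z by (simp add: skewadj_def inner_minus_right inner_minus_left)
    then have "inner ?w v = l\<^sup>2" unfolding l_def v(2)[symmetric] by (simp only: power2_norm_eq_inner)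
    moreover have "norm ?w \<le> l\<^sup>2"
      using norm_mapp_le[of z "mapp z v"] v by (simp add: l_def power2_eq_square)
    then have "inner ?w ?w \<le> (l\<^sup>2)\<^sup>2"
      by (metis norm_ge_zero power2_norm_eq_inner power_mono)
    moreover have "inner (w - c *\<^sub>R v) (w - c *\<^sub>R v) = inner w w - 2 * c * inner w v + c\<^sup>2 * inner v v" for w c
      by (simp only: inner_diff_left inner_diff_right inner_scaleR_left inner_scaleR_right inner_commute[of v w])
        (simp add: power2_eq_square algebra_simps)
    moreover have "inner v v = 1" using v(1) by (simp flip: power2_norm_eq_inner)
    ultimately have "inner (?w - l\<^sup>2 *\<^sub>R v) (?w - l\<^sup>2 *\<^sub>R v) \<le> 0"
      by (simp add: power2_eq_square)
    then have "?w = l\<^sup>2 *\<^sub>R v" using inner_ge_zero[of "?w - l\<^sup>2 *\<^sub>R v"] by (metis antisym eq_iff_diff_eq_0 inner_eq_zero_iff)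
    then show ?thesis by (metis minus_minus)
  qed
  let ?c = "\<lambda>t. cos (l * t) *\<^sub>R v + (sin (l * t) / l) *\<^sub>R mapp z v"
  let ?c' = "\<lambda>t. (- l * sin (l * t)) *\<^sub>R v + cos (l * t) *\<^sub>R mapp z v"
  \<comment> \<open>Undoing the exponential along the presumed curve gives a function with
    derivative 0, which is therefore constant.\<close>
  let ?f = "\<lambda>t. mapp (exp (t *\<^sub>R (- z))) (?c t)"
  have dc: "(?c has_vector_derivative ?c' t) (at t)" for t
    using l by (auto intro!: derivative_eq_intros simp: has_vector_derivative_def algebra_simps)
  have "(?f has_vector_derivative 0) (at t within UNIV)" for t
  proof -
    have "(?f has_vector_derivative mapp (exp (t *\<^sub>R (- z))) (?c' t) + mapp (exp (t *\<^sub>R (- z)) * (- z)) (?c t)) (at t)"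
      by (intro bounded_bilinear.has_vector_derivative[OF bounded_bilinear_mapp] dc
        exp_scaleR_has_vector_derivative_right)
    moreover have "mapp (exp (t *\<^sub>R (- z))) (?c' t) + mapp (exp (t *\<^sub>R (- z)) * (- z)) (?c t) = 0"
    proof -
      have "mapp E x + mapp (E * (- z)) y = mapp E (x - mapp z y)" for E x y by simp
      moreover have "?c' t - mapp z (?c t) = 0"
        using l by (simp add: z2 power2_eq_square)
      ultimately show ?thesis by (simp only: mapp_vec_simps(4))
    qed
    ultimately show ?thesis by (simp only:)
  qed
  then obtain c where c: "?f t = c" for t
    using has_vector_derivative_zero_constant[of UNIV ?f] by auto
  have "mapp (exp (- z)) (?c 1) = v" using c[of 1] c[of 0] by simp
  then have "mapp (exp z) (mapp (exp (- z)) (?c 1)) = mapp (exp z) v" by simp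
  moreover have "exp z * exp (- z) = 1" using exp_minus_mult[of "- z"] by simp
  ultimately show ?thesis by (metis mapp_mult mapp_one mult.right_neutral)
qed

lemma half_le_sin:
  fixes y :: real
  assumes "0 \<le> y" "y \<le> pi / 2"
  shows "y / 2 \<le> sin y"
proof -
  have "y \<le> 2" using assms pi_less_4 by simp
  show ?thesis
  proof (cases "y \<le> pi / 3")
    case True
    show ?thesis
    proof (cases "y = 0")
      case y: False
      then obtain z where z: "0 < z" "z < y" "sin y - sin 0 = (y - 0) * cos z"
        using MVT2[of 0 y sin cos] assms(1) by auto
      then have "1/2 \<le> cos z"
        using cos_monotone_0_pi_le[of z "pi/3"] True by (simp add: cos_60)
      then have "y * (1/2) \<le> y * cos z" using assms(1) by (intro mult_left_mono) auto
      then show ?thesis using z(3) by simp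
    qed simp
  next
    case False
    have "sin (pi/3) \<le> sin y" using sin_monotone_2pi_le[of "pi/3" y] False assms by simp
    moreover have "sin (pi/3) = sqrt 3 / 2" by (simp add: sin_60)
    moreover have "sqrt 3 \<ge> 1.7" by (rule real_le_rsqrt) (simp add: power2_eq_square)
    moreover have "y \<le> 1.6" using assms pi_approx by simp
    ultimately show ?thesis by simp
  qed
qed

text \<open>At a norm-attaining vector the displacement has norm
  \<open>2 * sin (norm z / 2)\<close>, and \<open>norm z / 2\<close> lies in the range where
  \<open>half_le_sin\<close> applies. Here the bound \<open>pi\<close> in the definition of woven
  subgroups matters: it turns closeness of \<open>exp z\<close> to 1 into smallness of
  \<open>z\<close>.\<close>

lemma norm_le_norm_exp_minus_one:
  assumes z: "skewadj z" and "norm z < pi"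
  shows "norm z \<le> 2 * norm (exp z - 1)"
proof (cases "z = 0")
  case False
  let ?l = "norm z"
  obtain v where v: "norm v = 1" "norm (mapp z v) = norm z" using norm_cmat_attained by blast
  let ?a = "cos ?l - 1" and ?b = "sin ?l / ?l"
  have "mapp (exp z - 1) v = ?a *\<^sub>R v + ?b *\<^sub>R mapp z v"
    using exp_skewadj_top_vector[OF z v False] by (simp add: scaleR_diff_left)
  moreover have "(norm (?a *\<^sub>R v + ?b *\<^sub>R mapp z v))\<^sup>2 = ?a\<^sup>2 * (norm v)\<^sup>2 + ?b\<^sup>2 * (norm (mapp z v))\<^sup>2"
    using inner_skewadj_self[OF z, of v]
    by (simp only: power2_norm_eq_inner inner_add_left inner_add_right inner_scaleR_left inner_scaleR_right
        inner_commute[of v "mapp z v"]) (simp add: power2_eq_square)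
  ultimately have "(norm (mapp (exp z - 1) v))\<^sup>2 = ?a\<^sup>2 + (sin ?l)\<^sup>2"
    using v False by (simp add: power_divide)
  also have "\<dots> = 2 - 2 * cos ?l"
    using sin_cos_squared_add[of ?l] by (simp add: power2_eq_square algebra_simps)
  also have "\<dots> = (2 * sin (?l / 2))\<^sup>2"
    using cos_double_sin[of "?l / 2"] by (simp add: power2_eq_square)
  finally have "norm (mapp (exp z - 1) v) = \<bar>2 * sin (?l / 2)\<bar>"
    by (metis abs_ge_zero norm_ge_zero power2_abs power2_eq_iff_nonneg)
  moreover have "?l / 2 / 2 \<le> sin (?l / 2)" by (rule half_le_sin) (use assms in auto)
  moreover have "norm (mapp (exp z - 1) v) \<le> norm (exp z - 1)" using norm_mapp_le[of "exp z - 1" v] v by simp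
  ultimately show ?thesis by linarith
qed simp

section \<open>Polar decomposition and square roots of unitary matrices\<close>

lemma polar_decomposition:
  fixes A :: "('a::rc_field, 'n::finite) cmat"
  assumes "norm (star A * A - 1) < 1"
  defines "y \<equiv> star A * A - 1"
  defines "B \<equiv> binser (-1/2) y"
  shows "unitary (A * B)" "star B = B" "B * B * (1 + y) = 1" "B * (1 + y) = binser (1/2) y"
    "norm (A * B - A) \<le> norm A * (norm y / (1 - norm y))"
    "\<And>c. c * (star A * A) = star A * A * c \<Longrightarrow> c * B = B * c"
proof -
  \<comment> \<open>As \<open>star A * A = 1 + y\<close>, the series \<open>B\<close> is the inverse
    square root of \<open>star A * A\<close>, and \<open>A * B\<close> is the unitary polar factor
    of \<open>A\<close>.\<close>
  have y: "norm y < 1" "star y = y" using assms(1) by (auto simp: y_def)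
  show sB: "star B = B" using star_binser[OF _ y(1), of "-1/2"] y(2) by (simp add: B_def)
  show B1: "B * (1 + y) = binser (1/2) y"
    using binser_mult[of "-1/2" 1 y] y by (simp add: B_def)
  have comm: "(1 + y) * B = B * (1 + y)"
    unfolding B_def by (rule binser_commute) (use y in \<open>auto simp: algebra_simps\<close>)
  show BB: "B * B * (1 + y) = 1"
    using binser_mult[of "-1/2" "1/2" y] y B1 by (simp add: mult.assoc B_def)
  have "star (A * B) * (A * B) = B * ((1 + y) * B)" by (simp add: sB y_def mult.assoc)
  then show "unitary (A * B)" using BB by (simp add: unitary_def comm mult.assoc)
  have "A * B - A = A * (B - 1)" by (simp add: algebra_simps)
  then show "norm (A * B - A) \<le> norm A * (norm y / (1 - norm y))"
    using norm_binser_minus_one_le[of "-1/2" y] y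
    norm_mult_ineq[of A "B - 1"] mult_left_mono[of "norm (B - 1)" "norm y / (1 - norm y)" "norm A"]
    by (simp add: B_def)
  show "c * B = B * c" if "c * (star A * A) = star A * A * c" for c
    unfolding B_def by (rule binser_commute) (use y that in \<open>auto simp: y_def algebra_simps\<close>)
qed

text \<open>The root is the unitary polar factor of \<open>A = (1/2) *\<^sub>R (1 + u)\<close>,
  which exists because \<open>star A * A\<close> differs from 1 by a quarter of
  \<open>star (u - 1) * (u - 1)\<close>. Its self-adjoint part is
  \<open>S = (1 + y) ^ (1/2)\<close>, and the bound of \<open>1 - S\<close> by \<open>norm y\<close>
  halves the squared distance to 1.\<close>

lemma unitary_sqrt:
  assumes u: "unitary u" and n: "norm (u - 1) < 2"
  obtains v where "unitary v" "v * v = u" "(norm (v - 1))\<^sup>2 \<le> (norm (u - 1))\<^sup>2 / 2"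
proof -
  define A where "A = (1/2) *\<^sub>R (1 + u)"
  define y where "y = star A * A - 1"
  have uu: "star u * u = 1" "u * star u = 1" using unitaryD[OF u] by auto
  have half: "(1/2) *\<^sub>R x + (1/2) *\<^sub>R x = x" "(1/4) *\<^sub>R x + (1/4) *\<^sub>R x = (1/2) *\<^sub>R x"
    for x :: "('a, 'b) cmat" by (simp_all flip: scaleR_add_left)
  have "star A * A = (1/4) *\<^sub>R (1 + u + star u + star u * u)"
    by (simp add: A_def algebra_simps)
  also have "\<dots> = ((1/4) *\<^sub>R 1 + (1/4) *\<^sub>R 1) + (1/4) *\<^sub>R (u + star u)"
    by (simp only: uu scaleR_add_right add_ac)
  finally have AA: "star A * A = (1/2) *\<^sub>R 1 + (1/4) *\<^sub>R (u + star u)"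
    by (simp only: half)
  have uw: "u * (1 + y) = (1/4) *\<^sub>R (1 + u + u + u * u)"
  proof -
    have "u * (1 + y) = (1/2) *\<^sub>R u + (1/4) *\<^sub>R (u * u + 1)"
      by (simp add: y_def AA distrib_left uu)
    also have "(1/2) *\<^sub>R u = (1/4) *\<^sub>R u + (1/4) *\<^sub>R u" by (simp only: half)
    finally show ?thesis by (simp only: scaleR_add_right add_ac)
  qed
  have y_eq: "y = - ((1/4) *\<^sub>R (star (u - 1) * (u - 1)))"
  proof -
    have "star (u - 1) * (u - 1) = 1 + 1 - (u + star u)" by (simp add: algebra_simps uu del: one_add_one)
    then have "- ((1/4) *\<^sub>R (star (u - 1) * (u - 1))) = (1/4) *\<^sub>R (u + star u) - ((1/4) *\<^sub>R 1 + (1/4) *\<^sub>R 1)"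
      by (simp only: scaleR_diff_right scaleR_add_right minus_diff_eq)
    also have "\<dots> = (1/4) *\<^sub>R (u + star u) + (1/2) *\<^sub>R 1 - ((1/2) *\<^sub>R 1 + (1/2) *\<^sub>R 1)"
    proof -
      have "X - h = X + h - (h + h)" for X h :: "('a, 'b) cmat" by simp
      then show ?thesis unfolding half(2) .
    qed
    finally show ?thesis unfolding y_def AA by (simp only: half) (simp add: add.commute)
  qed
  have ny: "norm y \<le> (norm (u - 1))\<^sup>2 / 4"
    unfolding y_eq using norm_mult_ineq[of "star (u - 1)" "u - 1"] norm_star[of "u - 1"]
    by (simp add: power2_eq_square)
  have "(norm (u - 1))\<^sup>2 < 2\<^sup>2" by (rule power_strict_mono) (use n in auto)
  then have y1: "norm y < 1" using ny by simp
  define B where "B = binser (-1/2) y"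
  note P = polar_decomposition[of A, folded y_def, OF y1, folded B_def]
  define v where "v = A * B"
  define S where "S = binser (1/2) y"
  \<comment> \<open>The fourth root of \<open>1 + y\<close> exhibits \<open>S = s * s\<close> as
    positive.\<close>
  define s where "s = binser (1/4) y"
  have sy: "star y = y" by (simp add: y_def)
  have uA: "u * (star A * A) = star A * A * u" by (simp add: AA distrib_left distrib_right uu)
  have uB: "u * B = B * u" using P(6)[OF uA] .
  have usB: "star u * B = B * star u"
    using P(6)[of "star u"] by (simp add: AA distrib_left distrib_right uu)
  have AB: "A * B = B * A" "star A * B = B * star A" by (simp_all add: A_def distrib_left distrib_right uB usB)
  have A2: "A * A = u * (1 + y)"
    unfolding uw by (simp add: A_def distrib_left distrib_right add_ac scaleR_add_right)
  have "v * v = A * A * (B * B)" unfolding v_def using AB by (metis mult.assoc)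
  also have "\<dots> = u * ((1 + y) * (B * B))" by (simp add: A2 mult.assoc)
  also have "(1 + y) * (B * B) = 1"
    using P(3) cmat_left_right_inverse by blast
  finally have vv: "v * v = u" by simp
  have "v + star v = (A + star A) * B" by (simp add: v_def P(2) AB distrib_left distrib_right)
  also have "A + star A = 2 *\<^sub>R (1 + y)"
  proof -
    have "A + star A = ((1/2) *\<^sub>R 1 + (1/2) *\<^sub>R 1) + (1/2) *\<^sub>R (u + star u)"
      by (simp only: A_def star_scaleR star_add star_one scaleR_add_right add_ac)
    then have "A + star A = 1 + (1/2) *\<^sub>R (u + star u)" by (simp only: half)
    moreover have "2 *\<^sub>R (1 + y) = 1 + (1/2) *\<^sub>R (u + star u)"
      unfolding y_def AA by (simp add: scaleR_add_right)
    ultimately show ?thesis by simp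
  qed
  also have "2 *\<^sub>R (1 + y) * B = 2 *\<^sub>R S"
  proof -
    have "y * B = B * y" unfolding B_def by (rule binser_commute) (use y1 in auto)
    then have "2 *\<^sub>R (1 + y) * B = 2 *\<^sub>R (B * (1 + y))" by (simp add: distrib_left distrib_right)
    then show ?thesis using P(4) by (simp only: S_def)
  qed
  finally have vS: "v + star v = 2 *\<^sub>R S" .
  have SS: "S * S = 1 + y" using binser_mult[of "1/2" "1/2" y] y1 by (simp add: S_def)
  have ss: "s * s = S" using binser_mult[of "1/4" "1/4" y] y1 by (simp add: S_def s_def)
  have sS: "star s = s" using star_binser[of "1/4" y] y1 sy by (simp add: s_def)
  have Spos: "inner (mapp S x) x \<ge> 0" for x
    using inner_mapp_left[of s "mapp s x" x] by (simp add: sS flip: ss)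
  \<comment> \<open>Positivity of \<open>S\<close> makes \<open>1 + S\<close> expanding, so
    \<open>(1 + S) * (1 - S) = - y\<close> bounds \<open>1 - S\<close> by \<open>y\<close>.\<close>
  have S1: "norm w \<le> norm (mapp (1 + S) w)" for w
  proof -
    have "inner (w + mapp S w) (w + mapp S w) = inner w w + 2 * inner (mapp S w) w + inner (mapp S w) (mapp S w)"
      by (simp add: inner_add_left inner_add_right inner_commute)
    then have "inner w w \<le> inner (w + mapp S w) (w + mapp S w)" using Spos[of w] inner_ge_zero[of "mapp S w"] by linarith
    then show ?thesis by (simp only: norm_le mapp_add mapp_one)
  qed
  have n1: "norm (v - 1) \<le> sqrt (2 * norm y)"
  proof (rule norm_cmat_leI)
    fix x
    have "norm (mapp (1 - S) x) \<le> norm (mapp (1 + S) (mapp (1 - S) x))" by (rule S1)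
    also have "mapp (1 + S) (mapp (1 - S) x) = mapp (- y) x"
    proof -
      have "(1 + S) * (1 - S) = - y" using SS by (simp add: algebra_simps)
      then show ?thesis by (metis mapp_mult)
    qed
    also have "norm \<dots> \<le> norm y * norm x" using norm_mapp_le[of "- y" x] by simp
    finally have a: "norm (mapp (1 - S) x) \<le> norm y * norm x" .
    have "inner (mapp v x) (mapp v x) = inner x x" using norm_mapp_unitary[OF P(1), folded v_def, of x]
      by (simp only: norm_eq)
    moreover have "inner (mapp v x) x = inner (mapp S x) x"
    proof -
      have "inner (mapp (v + star v) x) x = 2 * inner (mapp v x) x"
        using inner_mapp_left[of v x x] inner_commute[of x "mapp (star v) x"] by (simp add: inner_add_left)
      then show ?thesis by (simp add: vS)
    qed
    ultimately have "(norm (mapp (v - 1) x))\<^sup>2 = 2 * inner (mapp (1 - S) x) x"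
      by (simp add: power2_norm_eq_inner inner_diff_left inner_diff_right inner_commute)
    also have "\<dots> \<le> 2 * (norm y * norm x * norm x)"
      using norm_cauchy_schwarz[of "mapp (1 - S) x" x] mult_right_mono[OF a norm_ge_zero[of x]] by linarith
    also have "\<dots> = (sqrt (2 * norm y) * norm x)\<^sup>2" by (simp add: power_mult_distrib power2_eq_square)
    finally show "norm (mapp (v - 1) x) \<le> sqrt (2 * norm y) * norm x"
      by (rule power2_le_imp_le) simp
  qed
  have "(norm (v - 1))\<^sup>2 \<le> (sqrt (2 * norm y))\<^sup>2" by (rule power_mono[OF n1]) simp
  then have "(norm (v - 1))\<^sup>2 \<le> (norm (u - 1))\<^sup>2 / 2" using ny by simp
  then show ?thesis using that[of v] P(1) vv by (simp add: v_def)
qed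

lemma unitary_iterated_sqrt:
  assumes u: "unitary u" and n: "norm (u - 1) < 2"
  shows "\<exists>v. unitary v \<and> v ^ (2 ^ k) = u \<and> (norm (v - 1))\<^sup>2 \<le> (norm (u - 1))\<^sup>2 / 2 ^ k"
proof (induction k)
  case 0
  show ?case using u by auto
next
  case (Suc k)
  then obtain v where v: "unitary v" "v ^ (2 ^ k) = u" "(norm (v - 1))\<^sup>2 \<le> (norm (u - 1))\<^sup>2 / 2 ^ k" by blast
  have "(norm (v - 1))\<^sup>2 \<le> (norm (u - 1))\<^sup>2"
    using v(3) by (rule order_trans) (simp add: divide_le_eq mult_le_cancel_left1)
  then have "norm (v - 1) < 2" using n by (metis norm_ge_zero order.strict_trans1 power2_le_imp_le)
  from unitary_sqrt[OF v(1) this] obtain w where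
    w: "unitary w" "w * w = v" "(norm (w - 1))\<^sup>2 \<le> (norm (v - 1))\<^sup>2 / 2" by blast
  have "w ^ (2 ^ Suc k) = (w * w) ^ (2 ^ k)" by (simp add: power_mult power2_eq_square[symmetric])
  then have "w ^ (2 ^ Suc k) = u" using w(2) v(2) by simp
  moreover have "(norm (w - 1))\<^sup>2 \<le> (norm (u - 1))\<^sup>2 / 2 ^ Suc k"
    using w(3) v(3) by simp
  ultimately show ?case using w(1) by blast
qed

text \<open>Eight square roots reduce the distance to 1 from at most 2 to at most 1/8, below the 1/6
  required for a logarithm. That logarithm has norm at most 1/4, and the power 256 restores
  \<open>u\<close>. The sharp bound would be \<open>pi\<close>; any absolute constant
  serves.\<close>

lemma unitary_exp_bounded:
  assumes u: "unitary u" and n: "norm (u - 1) < 2"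
  obtains x where "skewadj x" "exp x = u" "norm x \<le> 64"
proof -
  obtain v where v: "unitary v" "v ^ (2 ^ 8) = u" "(norm (v - 1))\<^sup>2 \<le> (norm (u - 1))\<^sup>2 / 2 ^ 8"
    using unitary_iterated_sqrt[OF assms] by blast
  have "(norm (u - 1))\<^sup>2 \<le> 2\<^sup>2" by (rule power_mono) (use n in auto)
  then have "(norm (v - 1))\<^sup>2 \<le> (1/8)\<^sup>2" using v(3) by (simp add: power2_eq_square)
  then have v8: "norm (v - 1) \<le> 1/8" by (rule power2_le_imp_le) simp
  then have "norm (v - 1) \<le> 1/6" by simp
  then obtain x where x: "skewadj x" "exp x = v" "norm x \<le> 2 * norm (v - 1)"
    using unitary_near_one_exp[OF v(1)] by blast
  have "exp (real (2 ^ 8) *\<^sub>R x) = u" using exp_power[of x "2^8"] x(2) v(2) by metis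
  moreover have "norm (real (2 ^ 8) *\<^sub>R x) \<le> 64" using x(3) v8 by simp
  ultimately show ?thesis using that x(1) by blast
qed

text \<open>Parallelogram identity at a vector \<open>v\<close> attaining the norm of
  \<open>u - 1\<close>: the squared norms of \<open>u v - v\<close> and \<open>u v + v\<close> add
  up to 4, and the second is positive.\<close>

lemma unitary_no_eigenvalue_minus_one:
  assumes u: "unitary u" and e: "\<And>x. mapp u x = - x \<Longrightarrow> x = 0"
  shows "norm (u - 1) < 2"
proof -
  obtain v where v: "norm v = 1" "norm (mapp (u - 1) v) = norm (u - 1)" using norm_cmat_attained by blast
  have "mapp u v + v \<noteq> 0" using e[of v] v(1) by (metis add.inverse_unique add.commute norm_zero zero_neq_one minus_minus)
  then have "0 < inner (mapp u v + v) (mapp u v + v)" using inner_gt_zero_iff by blast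
  moreover have "inner (mapp u v) (mapp u v) = 1" "inner v v = 1"
    using norm_mapp_unitary[OF u, of v] v(1) by (simp_all flip: power2_norm_eq_inner)
  ultimately have "inner (mapp (u - 1) v) (mapp (u - 1) v) < 4"
    by (simp add: inner_add_left inner_add_right inner_diff_left inner_diff_right inner_commute)
  then have "(norm (u - 1))\<^sup>2 < 2\<^sup>2" by (simp add: power2_norm_eq_inner flip: v(2))
  then show ?thesis by (rule power2_less_imp_less) simp
qed

text \<open>Near the identity a unitary \<open>u = s + \<sigma>\<close> is determined by its skew part \<open>\<sigma>\<close>, because
  \<open>s\<^sup>2 = 1 + \<sigma>\<^sup>2\<close>.\<close>

lemma unitary_eqI_skew_part:
  assumes u: "unitary u" "norm (u - 1) < 1" and v: "unitary v" "norm (v - 1) < 1"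
    and eq: "u - star u = v - star v"
  shows "u = v"
proof -
  define t where "t = (\<lambda>u :: ('a, 'b) cmat. (1/2) *\<^sub>R ((u - 1) + star (u - 1)))"
  have nt: "norm (t w) \<le> norm (w - 1)" for w
  proof -
    have "norm ((w - 1) + star (w - 1)) \<le> norm (w - 1) + norm (star (w - 1))" by (rule norm_triangle_ineq)
    then show ?thesis unfolding t_def using norm_star[of "w - 1"] by (simp del: star_diff)
  qed
  \<comment> \<open>\<open>t w\<close> is the self-adjoint part of \<open>w - 1\<close>, so
    \<open>1 + t w\<close> is that of \<open>w\<close>; its square is determined by the skew
    part.\<close>
  have sq: "(1 + t w) * (1 + t w) = 1 + (1/4) *\<^sub>R ((w - star w) * (w - star w))" if "unitary w" for w
  proof -
    have half: "(1/2) *\<^sub>R x + (1/2) *\<^sub>R x = x" for x :: "('a, 'b) cmat" by (simp flip: scaleR_add_left)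
    have "t w = (1/2) *\<^sub>R (w + star w) - ((1/2) *\<^sub>R 1 + (1/2) *\<^sub>R 1)"
      unfolding t_def by (simp only: star_diff star_one scaleR_add_right scaleR_diff_right) (simp add: algebra_simps)
    then have "1 + t w = (1/2) *\<^sub>R (w + star w)" by (simp only: half) simp
    then have "(1 + t w) * (1 + t w) = (1/4) *\<^sub>R ((w + star w) * (w + star w))" by simp
    also have "(w + star w) * (w + star w) = (w - star w) * (w - star w) + 4 *\<^sub>R 1"
    proof -
      have "(w + star w) * (w + star w) = (w - star w) * (w - star w) + (1 + 1 + (1 + 1))"
        using unitaryD[OF that] by (simp add: algebra_simps del: one_add_one)
      moreover have "4 *\<^sub>R (1::('a, 'b) cmat) = (1 + 1 + (1 + 1))" by (simp add: scaleR_conv_of_real)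
      ultimately show ?thesis by metis
    qed
    finally show ?thesis by (simp add: scaleR_add_right)
  qed
  have "(1 + t u) * (1 + t u) = (1 + t v) * (1 + t v)" using sq[OF u(1)] sq[OF v(1)] eq by simp
  \<comment> \<open>Equality of the two squares is rearranged so that \<open>t u - t v\<close>
    occurs in every term; because \<open>norm (t u) + norm (t v) < 2\<close>, it must
    vanish.\<close>
  then have "2 *\<^sub>R (t u - t v) = - (t u * (t u - t v) + (t u - t v) * t v)"
    by (simp add: algebra_simps scaleR_2)
  then have "2 * norm (t u - t v) = norm (t u * (t u - t v) + (t u - t v) * t v)"
    by (metis norm_minus_cancel norm_scaleR abs_numeral)
  also have "\<dots> \<le> norm (t u) * norm (t u - t v) + norm (t u - t v) * norm (t v)"
    by (intro order_trans[OF norm_triangle_ineq] add_mono norm_mult_ineq)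
  finally have "(2 - (norm (t u) + norm (t v))) * norm (t u - t v) \<le> 0" by (simp add: algebra_simps)
  moreover have "2 - (norm (t u) + norm (t v)) > 0" using nt[of u] nt[of v] u v by linarith
  ultimately have "t u = t v" by (simp add: mult_le_0_iff)
  then have "u + star u = v + star v" by (simp add: t_def)
  then have "(u - star u) + (u + star u) = (v - star v) + (v + star v)" using eq by metis
  then have "2 *\<^sub>R u = 2 *\<^sub>R v" by (simp add: scaleR_2 algebra_simps)
  then show ?thesis by simp
qed

section \<open>Covering numbers of homogeneous spaces of a unitary group\<close>

lemma exp_tendsto:
  fixes f :: "nat \<Rightarrow> 'a::{real_normed_algebra_1,banach}"
  assumes "f \<longlonglongrightarrow> l"
  shows "(\<lambda>n. exp (f n)) \<longlonglongrightarrow> exp l"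
proof -
  obtain B where B: "\<And>n. norm (f n) \<le> B"
    using convergent_imp_Bseq[OF convergentI[OF assms]] by (auto simp: Bseq_def)
  have "norm (exp (f n) - exp l) \<le> exp (max B (norm l)) * norm (f n - l)" for n
    by (rule exp_lipschitz) (use B[of n] in auto)
  moreover have "(\<lambda>n. exp (max B (norm l)) * norm (f n - l)) \<longlonglongrightarrow> exp (max B (norm l)) * norm (l - l)"
    by (intro tendsto_intros assms)
  then have "(\<lambda>n. exp (max B (norm l)) * norm (f n - l)) \<longlonglongrightarrow> 0" by simp
  ultimately have "(\<lambda>n. exp (f n) - exp l) \<longlonglongrightarrow> 0"
    using Lim_null_comparison[of "\<lambda>n. exp (f n) - exp l" "\<lambda>n. exp (max B (norm l)) * norm (f n - l)" sequentially] by simp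
  then show ?thesis by (rule LIM_zero_cancel)
qed

text \<open>Common properties of U(n) and SO(n). By \<open>G_near\<close> the unitaries outside
  \<open>G\<close> keep distance at least 1 from it. By \<open>G_dense\<close> the eigenvalue -1,
  the obstruction to a logarithm, can be removed by a small perturbation within
  \<open>G\<close>.\<close>

locale unitary_group =
  fixes G :: "('a::rc_field, 'n::finite) cmat set"
  assumes G_unitary: "u \<in> G \<Longrightarrow> unitary u"
    and G_one: "1 \<in> G"
    and G_mult: "u \<in> G \<Longrightarrow> v \<in> G \<Longrightarrow> u * v \<in> G"
    and G_star: "u \<in> G \<Longrightarrow> star u \<in> G"
    and G_near: "u \<in> G \<Longrightarrow> unitary v \<Longrightarrow> norm (u - v) < 1 \<Longrightarrow> v \<in> G"
    and G_exp: "skewadj x \<Longrightarrow> exp x \<in> G"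
    and G_dense: "u \<in> G \<Longrightarrow> 0 < e \<Longrightarrow> \<exists>v\<in>G. norm (u - v) < e \<and> (\<forall>x. mapp v x = - x \<longrightarrow> x = 0)"
begin

lemma G_norm_star_mult: "u \<in> G \<Longrightarrow> norm (star u * v - 1) = norm (v - u)"
  using norm_unitary_mult[of "star u" "v - u"] G_unitary[of u] unitaryD[of u]
  by (simp add: right_diff_distrib)

text \<open>\<open>u\<close> may have the eigenvalue -1, so a logarithm is taken at a nearby
  \<open>v\<close>, and the quotient \<open>star v * u\<close> is near 1. The norms add up to at
  most \<open>64 + 2 * (1/6) \<le> 65\<close>.\<close>

lemma G_exp_exp:
  assumes u: "u \<in> G"
  obtains x y where "skewadj x" "skewadj y" "u = exp x * exp y" "norm x + norm y \<le> 65"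
proof -
  obtain v where v: "v \<in> G" "norm (u - v) < 1/6" "\<forall>x. mapp v x = - x \<longrightarrow> x = 0"
    using G_dense[OF u, of "1/6"] by auto
  have "norm (v - 1) < 2" using unitary_no_eigenvalue_minus_one[OF G_unitary[OF v(1)]] v(3) by blast
  then obtain x where x: "skewadj x" "exp x = v" "norm x \<le> 64"
    using unitary_exp_bounded[OF G_unitary[OF v(1)]] by blast
  have w: "star v * u \<in> G" "norm (star v * u - 1) \<le> 1/6"
    using v u G_norm_star_mult[of v u] by (auto intro: G_mult G_star)
  then obtain y where y: "skewadj y" "exp y = star v * u" "norm y \<le> 2 * norm (star v * u - 1)"
    using unitary_near_one_exp[OF G_unitary[OF w(1)]] by blast
  have "v * star v = 1" using unitaryD(2)[OF G_unitary[OF v(1)]] .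
  then have "u = exp x * exp y" unfolding x(2) y(2) by (simp flip: mult.assoc)
  then show ?thesis using that[OF x(1) y(1)] x(3) y(3) w(2) by simp
qed

end

text \<open>The two inequalities through which the intrinsic metric enters. The second is about
  products of two exponentials, the form in which \<open>G_exp_exp\<close> presents every
  element.\<close>

locale metric_unitary_group = unitary_group G for G :: "('a::rc_field, 'n::finite) cmat set" +
  fixes rho :: "('a, 'n) cmat \<Rightarrow> ('a, 'n) cmat \<Rightarrow> real"
  assumes rho_lower: "u \<in> G \<Longrightarrow> v \<in> G \<Longrightarrow> norm (u - v) \<le> rho u v"
    and rho_upper: "v \<in> G \<Longrightarrow> skewadj x \<Longrightarrow> skewadj y \<Longrightarrow> rho (v * (exp x * exp y)) v \<le> norm x + norm y"
begin

lemma rho_le_65: "u \<in> G \<Longrightarrow> v \<in> G \<Longrightarrow> rho u v \<le> 65"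
proof -
  assume uv: "u \<in> G" "v \<in> G"
  then obtain x y where xy: "skewadj x" "skewadj y" "star v * u = exp x * exp y" "norm x + norm y \<le> 65"
    using G_exp_exp[OF G_mult[OF G_star]] by metis
  have "v * star v = 1" using unitaryD(2)[OF G_unitary[OF uv(2)]] .
  then have "v * (exp x * exp y) = u" by (simp flip: xy(3) mult.assoc)
  then show ?thesis using rho_upper[OF uv(2) xy(1,2)] xy(4) by simp
qed

lemma rho_near:
  assumes uv: "u \<in> G" "v \<in> G" and n: "norm (u - v) \<le> 1/6"
  shows "rho u v \<le> 2 * norm (u - v)"
proof -
  have w: "star v * u \<in> G" using uv by (intro G_mult G_star)
  obtain x where x: "skewadj x" "exp x = star v * u" "norm x \<le> 2 * norm (star v * u - 1)"
    using unitary_near_one_exp[OF G_unitary[OF w]] n G_norm_star_mult[OF uv(2)] by metis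
  have "v * star v = 1" using unitaryD(2)[OF G_unitary[OF uv(2)]] .
  then have "v * (exp x * exp 0) = u" by (simp add: x(2) flip: mult.assoc)
  then show ?thesis using rho_upper[OF uv(2) x(1), of 0] x(3) G_norm_star_mult[OF uv(2)] by simp
qed

end

section \<open>The Lie algebra of a subgroup and the chart transversal to it\<close>

definition lie_set :: "('a::rc_field, 'n::finite) cmat set \<Rightarrow> ('a, 'n) cmat set" where
  "lie_set H = {x. skewadj x \<and> (\<forall>t. exp (t *\<^sub>R x) \<in> H)}"

definition skew_part :: "('a::rc_field, 'n::finite) cmat \<Rightarrow> ('a, 'n) cmat" where
  "skew_part A = (1/2) *\<^sub>R (A - star A)"

lemma skew_part_skewadj: "skewadj (skew_part A)"
  by (simp add: skew_part_def skewadj_def flip: scaleR_minus_right)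

lemma skew_part_diff: "skew_part (A - B) = skew_part A - skew_part B"
  by (simp add: skew_part_def scaleR_diff_right)

lemma skew_part_eq: "skewadj A \<Longrightarrow> skew_part A = A"
  by (simp add: skew_part_def skewadj_def)

lemma skew_part_one [simp]: "skew_part 1 = 0"
  by (simp add: skew_part_def)

lemma norm_skew_part_le: "norm (skew_part A) \<le> norm A"
proof -
  have "norm (A - star A) \<le> norm A + norm (star A)" by (rule norm_triangle_ineq4)
  then show ?thesis by (simp add: skew_part_def)
qed

text \<open>\<open>P\<close> projects the skew matrices onto \<open>X\<close> along the Lie algebra
  of \<open>H\<close>; \<open>P_norm\<close> is the bound \<open>1 / \<alpha>\<close> on its
  operator norm, that is, the hypothesis on \<kappa>.\<close>

locale unitary_subgroup = metric_unitary_group G rho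
  for G :: "('a::rc_field, 'n::finite) cmat set" and rho +
  fixes H :: "('a, 'n) cmat set" and X :: "('a, 'n) cmat set"
    and P :: "('a, 'n) cmat \<Rightarrow> ('a, 'n) cmat" and \<alpha> :: real
  assumes H_sub: "H \<subseteq> G" and H_one: "1 \<in> H"
    and H_mult: "u \<in> H \<Longrightarrow> v \<in> H \<Longrightarrow> u * v \<in> H" and H_star: "u \<in> H \<Longrightarrow> star u \<in> H"
    and X_skew: "x \<in> X \<Longrightarrow> skewadj x"
    and X_scale: "x \<in> X \<Longrightarrow> r *\<^sub>R x \<in> X"
    and P_in: "skewadj x \<Longrightarrow> P x \<in> X"
    and P_compl: "skewadj x \<Longrightarrow> x - P x \<in> lie_set H"
    and P_diff: "skewadj x \<Longrightarrow> skewadj y \<Longrightarrow> P (x - y) = P x - P y"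
    and P_X: "x \<in> X \<Longrightarrow> P x = x"
    and P_lie: "x \<in> lie_set H \<Longrightarrow> P x = 0"
    and P_norm: "skewadj x \<Longrightarrow> \<alpha> * norm (P x) \<le> norm x"
    and alpha: "0 < \<alpha>" "\<alpha> \<le> 1/2"
begin

lemma lie_skew: "x \<in> lie_set H \<Longrightarrow> skewadj x"
  by (simp add: lie_set_def)

lemma exp_lie: "x \<in> lie_set H \<Longrightarrow> exp x \<in> H"
  unfolding lie_set_def by (metis (mono_tags, lifting) mem_Collect_eq scaleR_one)

lemma exp_uminus_lie: "x \<in> lie_set H \<Longrightarrow> exp (- x) \<in> H"
  using exp_lie H_star star_exp_skewadj lie_skew by metis

lemma P_norm': "skewadj x \<Longrightarrow> norm (P x) \<le> norm x / \<alpha>"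
  using P_norm alpha by (simp add: field_simps)

lemma norm_compl_le: "skewadj x \<Longrightarrow> norm (x - P x) \<le> norm x + norm x / \<alpha>"
  using norm_triangle_ineq4[of x "P x"] P_norm'[of x] by linarith

text \<open>\<open>P\<close> recovers \<open>x - x'\<close> from the difference \<open>?w\<close> of
  the sums, so \<open>x - x'\<close> and \<open>z - z'\<close> are bounded by
  \<open>norm ?w / \<alpha>\<close> and \<open>norm ?w + norm ?w / \<alpha>\<close>. On the radius
  \<open>\<alpha> / 20\<close> the constant of \<open>exp_mult_exp_lipschitz\<close> is
  \<open>\<alpha> / 5\<close>, and the total is
  \<open>\<alpha> / 5 + 2 / 5 \<le> 1 / 2\<close>.\<close>

lemma exp_product_expansion:
  assumes x: "x \<in> X" "x' \<in> X" and z: "z \<in> lie_set H" "z' \<in> lie_set H"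
    and n: "norm x \<le> \<alpha> / 20" "norm x' \<le> \<alpha> / 20" "norm z \<le> \<alpha> / 20" "norm z' \<le> \<alpha> / 20"
  shows "norm ((exp x * exp z - x - z) - (exp x' * exp z' - x' - z')) \<le> norm ((x + z) - (x' + z')) / 2"
proof -
  let ?w = "(x + z) - (x' + z')"
  have sk: "skewadj (x - x')" "skewadj (z - z')" "skewadj ?w"
    using x z X_skew lie_skew by (auto intro!: skewadj_diff skewadj_add)
  have "P ?w = (P (x - x')) - P (z' - z)"
  proof -
    have "?w = (x - x') - (z' - z)" by simp
    moreover have "skewadj (z' - z)" using z lie_skew by (auto intro!: skewadj_diff)
    ultimately show ?thesis using P_diff sk by metis
  qed
  also have "\<dots> = x - x'" using x z P_diff X_skew lie_skew P_X P_lie by simp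
  finally have Pw: "P ?w = x - x'" .
  then have zw: "z - z' = ?w - P ?w" by simp
  have r: "\<alpha> / 20 \<le> 1/2" using alpha by simp
  have "norm ((exp x * exp z - x - z) - (exp x' * exp z' - x' - z'))
      \<le> 4 * (\<alpha> / 20) * (norm (x - x') + norm (z - z'))"
    by (rule exp_mult_exp_lipschitz) (use n r in auto)
  also have "\<dots> \<le> 4 * (\<alpha> / 20) * (norm ?w / \<alpha> + (norm ?w + norm ?w / \<alpha>))"
  proof (intro mult_left_mono add_mono)
    show "norm (x - x') \<le> norm ?w / \<alpha>" using P_norm'[OF sk(3)] by (simp only: Pw)
    show "norm (z - z') \<le> norm ?w + norm ?w / \<alpha>" using norm_compl_le[OF sk(3)] by (simp only: zw)
  qed (use alpha in auto)
  also have "\<dots> = (\<alpha> / 5 + 2 / 5) * norm ?w" using alpha by (simp add: field_simps)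
  also have "\<dots> \<le> 1/2 * norm ?w" using alpha by (intro mult_right_mono) auto
  finally show ?thesis by simp
qed

text \<open>The factors are found as \<open>P a\<close> and \<open>a - P a\<close> for a single skew
  \<open>a\<close> of norm at most \<open>s = 2 * norm (g - 1)\<close>. The hypothesis gives
  \<open>s / \<alpha> \<le> \<alpha> / 30\<close>, so that both factors stay within the radius
  \<open>\<alpha> / 20\<close> of \<open>exp_product_expansion\<close>.\<close>

lemma exp_times_lie_near_one:
  assumes g: "g \<in> G" "norm (g - 1) \<le> \<alpha>\<^sup>2 / 60"
  obtains x z where "x \<in> X" "z \<in> lie_set H" "g = exp x * exp z"
    "norm x \<le> 2 * norm (g - 1) / \<alpha>" "norm z \<le> 3 * norm (g - 1) / \<alpha>"
proof -
  define s where "s = 2 * norm (g - 1)"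
  have s: "0 \<le> s" "s \<le> \<alpha>\<^sup>2 / 30" using g by (auto simp: s_def)
  have s\<alpha>: "s / \<alpha> \<le> \<alpha> / 30" using s alpha by (simp add: field_simps power2_eq_square)
  have bd: "norm (P a) \<le> \<alpha> / 20" "norm (a - P a) \<le> \<alpha> / 20" "norm (P a) \<le> s / \<alpha>" "norm (a - P a) \<le> s / \<alpha> * (3/2)"
    if a: "skewadj a" "norm a \<le> s" for a
  proof -
    have 1: "norm (P a) \<le> s / \<alpha>" using P_norm'[OF a(1)] a(2) alpha by (meson divide_right_mono less_imp_le order_trans)
    then show "norm (P a) \<le> s / \<alpha>" "norm (P a) \<le> \<alpha> / 20" using s\<alpha> alpha by auto
    define t where "t = s / \<alpha>"
    have "norm (a - P a) \<le> s + t"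
      using norm_triangle_ineq4[of a "P a"] a(2) 1 unfolding t_def by linarith
    moreover have "s \<le> t / 2" unfolding t_def using s(1) alpha
      by (simp add: field_simps) (use mult_left_mono[of "\<alpha> * 2" 1 s] in \<open>simp add: mult_ac\<close>)
    ultimately have A: "norm (a - P a) \<le> t * (3/2)" by linarith
    then show "norm (a - P a) \<le> s / \<alpha> * (3/2)" by (simp only: t_def)
    have "t \<le> \<alpha> / 30" using s\<alpha> by (simp only: t_def)
    with A show "norm (a - P a) \<le> \<alpha> / 20" by linarith
  qed
  let ?F = "\<lambda>a. exp (P a) * exp (a - P a)"
  \<comment> \<open>The skew part keeps the iteration in the linear space of skew matrices. At a
    fixed point \<open>g\<close> and \<open>?F a\<close> have the same skew part, and being unitary
    and near 1 they coincide.\<close>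
  let ?T = "\<lambda>a. skew_part (g - (?F a - a))"
  let ?S = "{a::('a, 'n) cmat. skewadj a \<and> norm a \<le> s}"
  have lip: "norm (?T a - ?T a') \<le> 1/2 * norm (a - a')" if a: "a \<in> ?S" "a' \<in> ?S" for a a'
  proof -
    have "?T a - ?T a' = skew_part ((?F a' - a') - (?F a - a))"
      by (simp add: skew_part_diff[symmetric] algebra_simps)
    also have "norm \<dots> \<le> norm ((?F a' - a') - (?F a - a))" by (rule norm_skew_part_le)
    also have "\<dots> = norm ((exp (P a') * exp (a' - P a') - P a' - (a' - P a')) - (exp (P a) * exp (a - P a) - P a - (a - P a)))"
      by simp
    also have "\<dots> \<le> norm ((P a' + (a' - P a')) - (P a + (a - P a))) / 2"
      by (rule exp_product_expansion) (use a bd P_in P_compl in auto)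
    finally show ?thesis by (simp add: norm_minus_commute)
  qed
  have P0: "P 0 = 0" using P_lie[of 0] H_one by (simp add: lie_set_def)
  have S0: "0 \<in> ?S" using s by simp
  have "\<exists>!a\<in>?S. ?T a = a"
  proof (rule Banach_fix[where c="1/2"])
    have "continuous_on UNIV (\<lambda>a::('a, 'n) cmat. star a)" by (intro linear_continuous_on bounded_linear_star)
    then have "closed {a::('a, 'n) cmat. star a = - a}"
      by (intro closed_Collect_eq continuous_intros) auto
    moreover have "?S = {a. star a = - a} \<inter> cball 0 s" by (auto simp: skewadj_def)
    ultimately show "complete ?S"
      by (simp only: complete_eq_closed) (intro closed_Int closed_cball)
    show "?S \<noteq> {}" using S0 by blast
    show "?T ` ?S \<subseteq> ?S"
    proof safe
      fix a :: "('a, 'n) cmat" assume a: "skewadj a" "norm a \<le> s"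
      show "skewadj (?T a)" by (rule skew_part_skewadj)
      have "?T 0 = skew_part (g - 1)" by (simp add: P0)
      then have "norm (?T 0) \<le> s / 2" using norm_skew_part_le[of "g - 1"] by (simp add: s_def)
      moreover have "norm (?T a - ?T 0) \<le> 1/2 * norm (a - 0)" by (rule lip) (use a S0 in auto)
      moreover have "norm (?T a) \<le> norm (?T a - ?T 0) + norm (?T 0)"
        by (metis diff_add_cancel norm_triangle_ineq)
      ultimately show "norm (?T a) \<le> s" using a(2) by simp
    qed
  qed (use lip in \<open>auto simp: dist_norm\<close>)
  then obtain a where a: "skewadj a" "norm a \<le> s" "?T a = a" by auto
  have x: "P a \<in> X" and z: "a - P a \<in> lie_set H" using P_in P_compl a(1) by auto
  have "skew_part g - skew_part (?F a) + skew_part a = a" using a(3) by (simp only: skew_part_diff) (simp only: diff_diff_eq2 diff_add_eq)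
  then have "skew_part g = skew_part (?F a)" using skew_part_eq[OF a(1)] by simp
  then have eq: "g - star g = ?F a - star (?F a)" by (simp add: skew_part_def)
  have uF: "unitary (?F a)" using x z X_skew lie_skew by (intro unitary_mult unitary_exp) auto
  have "\<alpha>\<^sup>2 \<le> (1/2)\<^sup>2" by (rule power_mono) (use alpha in auto)
  then have \<alpha>2: "\<alpha>\<^sup>2 \<le> 1/4" by (simp add: power2_eq_square)
  have "norm ((exp (P a) * exp (a - P a) - P a - (a - P a)) - (exp 0 * exp 0 - 0 - 0)) \<le> norm ((P a + (a - P a)) - (0 + 0)) / 2"
  proof (rule exp_product_expansion)
    show "0 \<in> X" using P_in[of 0] by (simp add: P0)
    show "0 \<in> lie_set H" using H_one by (simp add: lie_set_def)
  qed (use x z a bd alpha in auto)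
  then have "norm (?F a - a - 1) \<le> norm a / 2" by simp
  moreover have "norm (?F a - 1) \<le> norm (?F a - a - 1) + norm a"
    using norm_triangle_ineq[of "?F a - a - 1" a] by simp
  ultimately have "norm (?F a - 1) < 1" using a(2) s \<alpha>2 by linarith
  moreover have "norm (g - 1) < 1" using g(2) \<alpha>2 by linarith
  ultimately have "g = ?F a" using unitary_eqI_skew_part[OF G_unitary[OF g(1)] _ uF _ eq] by blast
  then show ?thesis using that[OF x z] bd(3,4)[OF a(1,2)] by (simp add: s_def)
qed

text \<open>Both cosets pass near \<open>g\<close>, hence \<open>exp x * h\<close> is within
  \<open>2 * e\<close> of \<open>exp y\<close> for \<open>h = h1 * star h2\<close>. As
  \<open>2 * e\<close> and \<open>norm (exp x - exp y)\<close> are at most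
  \<open>\<alpha> / 80\<close>, \<open>norm (h - 1)\<close> is at most \<open>\<alpha> / 40\<close>,
  so \<open>h = exp z\<close> with \<open>norm z \<le> \<alpha> / 20\<close>, the radius of
  \<open>exp_product_expansion\<close>. This bounds \<open>x + z - y\<close> by
  \<open>4 * e\<close>, and \<open>P\<close> removes \<open>z\<close> at the cost of the factor
  \<open>1 / \<alpha>\<close>.\<close>

lemma coset_separation:
  assumes woven: "\<And>u. u \<in> H \<Longrightarrow> rho u 1 \<le> \<alpha> / 2 \<Longrightarrow> \<exists>z\<in>lie_set H. norm z < pi \<and> u = exp z"
    and x: "x \<in> X" "norm x \<le> \<alpha> / 320" and y: "y \<in> X" "norm y \<le> \<alpha> / 320"
    and h: "h1 \<in> H" "h2 \<in> H" and e: "e \<le> \<alpha> / 160"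
    and g: "norm (exp x * h1 - g) < e" "norm (exp y * h2 - g) < e"
  shows "norm (x - y) \<le> 4 * e / \<alpha>"
proof -
  define h where "h = h1 * star h2"
  have hH: "h \<in> H" using h by (simp add: h_def H_mult H_star)
  have u2: "unitary h2" using h H_sub G_unitary by blast
  have hG: "h \<in> G" using hH H_sub by blast
  have "norm (exp x * h1 - exp y * h2) < 2 * e"
    using norm_triangle_ineq4[of "exp x * h1 - g" "exp y * h2 - g"] g by simp
  moreover have "exp x * h - exp y = (exp x * h1 - exp y * h2) * star h2"
    using unitaryD(2)[OF u2] by (simp add: h_def left_diff_distrib mult.assoc)
  ultimately have d1: "norm (exp x * h - exp y) < 2 * e"
    using norm_mult_unitary[of "star h2"] u2 by simp
  have ux: "unitary (exp x)" using x X_skew unitary_exp by blast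
  have r: "\<alpha> / 320 \<le> 1/2" using alpha by simp
  have "norm (exp x - exp y) \<le> exp (\<alpha> / 320) * norm (x - y)" by (rule exp_lipschitz) (use x y in auto)
  also have "\<dots> \<le> 2 * (2 * (\<alpha> / 320))"
    using exp_le_quadratic_bound[of "\<alpha> / 320"] alpha norm_triangle_ineq4[of x y] x y by (intro mult_mono) auto
  finally have d2: "norm (exp x - exp y) \<le> \<alpha> / 80" by simp
  have "norm (h - 1) = norm (exp x * h - exp x)"
    using norm_unitary_mult[OF ux, of "h - 1"] by (simp add: right_diff_distrib)
  also have "\<dots> \<le> norm (exp x * h - exp y) + norm (exp x - exp y)"
    using norm_triangle_ineq4[of "exp x * h - exp y" "exp x - exp y"] by simp
  finally have h1: "norm (h - 1) \<le> \<alpha> / 40" using d1 d2 e by linarith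
  then have "rho h 1 \<le> 2 * norm (h - 1)" by (intro rho_near hG G_one) (use alpha in auto)
  then have "rho h 1 \<le> \<alpha> / 2" using h1 alpha by linarith
  then obtain z where z: "z \<in> lie_set H" "norm z < pi" "h = exp z" using woven[OF hH] by blast
  then have nz: "norm z \<le> \<alpha> / 20" using norm_le_norm_exp_minus_one[OF lie_skew[OF z(1)] z(2)] h1 by simp
  have L0: "0 \<in> lie_set H" using H_one by (simp add: lie_set_def)
  let ?w = "x + z - (y + 0)"
  have "norm ((exp x * exp z - x - z) - (exp y * exp 0 - y - 0)) \<le> norm ?w / 2"
    by (rule exp_product_expansion) (use x y z nz L0 alpha in auto)
  then have "norm ((exp x * h - exp y) - ?w) \<le> norm ?w / 2" by (simp add: z(3) algebra_simps)
  moreover have "norm ?w \<le> norm ((exp x * h - exp y) - ?w) + norm (exp x * h - exp y)"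
    using norm_triangle_ineq4[of "exp x * h - exp y" "(exp x * h - exp y) - ?w"] by simp
  ultimately have w: "norm ?w \<le> 4 * e" using d1 by linarith
  have sw: "skewadj ?w" using x y z X_skew lie_skew by (auto intro!: skewadj_add skewadj_diff)
  have w_eq: "?w = (x - y) - (- z)" by simp
  have mz: "- z \<in> lie_set H"
    using z(1) unfolding lie_set_def by (auto) (metis scaleR_minus_left)
  have "P ?w = P (x - y) - P (- z)"
    unfolding w_eq by (rule P_diff) (use x y X_skew lie_skew[OF mz] in \<open>auto intro: skewadj_diff\<close>)
  moreover have "P (- z) = 0" using mz by (rule P_lie)
  ultimately have "P ?w = P (x - y) - 0" by (simp only:)
  then have "P ?w = x - y" using P_diff P_X x y X_skew by simp
  then have "norm (x - y) \<le> norm ?w / \<alpha>" using P_norm'[OF sw] by simp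
  also have "\<dots> \<le> 4 * e / \<alpha>" using w alpha by (intro divide_right_mono) auto
  finally show ?thesis .
qed

text \<open>Cartan's argument: otherwise elements \<open>exp x\<^sub>j \<in> H\<close> with \<open>0 \<noteq> x\<^sub>j \<in> X\<close> tend to the identity, and a limit
  direction of the \<open>x\<^sub>j\<close> would lie both in the Lie algebra of \<open>H\<close> and in its complement \<open>X\<close>.\<close>

lemma woven_some:
  assumes cl: "\<And>u l. (\<And>j. u j \<in> H) \<Longrightarrow> u \<longlonglongrightarrow> l \<Longrightarrow> l \<in> G \<Longrightarrow> l \<in> H"
  shows "\<exists>\<theta>>0. \<forall>u\<in>H. rho u 1 \<le> \<theta> \<longrightarrow> (\<exists>z\<in>lie_set H. norm z < pi \<and> u = exp z)"
proof (rule ccontr)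
  assume "\<not> ?thesis"
  then have no: "\<And>\<theta>. \<theta> > 0 \<Longrightarrow> \<exists>u\<in>H. rho u 1 \<le> \<theta> \<and> (\<forall>z\<in>lie_set H. norm z < pi \<longrightarrow> u \<noteq> exp z)" by blast
  \<comment> \<open>Radii that tend to 0 within the domain of the chart.\<close>
  define d where "d = (\<lambda>j::nat. \<alpha>\<^sup>2 / 60 / real (Suc j))"
  have d: "0 < d j" "d j \<le> \<alpha>\<^sup>2 / 60" for j using alpha by (auto simp: d_def divide_le_eq field_simps)
  have "\<exists>x\<in>X. exp x \<in> H \<and> x \<noteq> 0 \<and> norm x \<le> 2 * d j / \<alpha>" for j
  proof -
    obtain u where u: "u \<in> H" "rho u 1 \<le> d j" "\<forall>z\<in>lie_set H. norm z < pi \<longrightarrow> u \<noteq> exp z"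
      using no[OF d(1)] by blast
    have uG: "u \<in> G" using u H_sub by blast
    have n: "norm (u - 1) \<le> d j" using rho_lower[OF uG G_one] u(2) by linarith
    obtain x z where xz: "x \<in> X" "z \<in> lie_set H" "u = exp x * exp z"
      "norm x \<le> 2 * norm (u - 1) / \<alpha>" "norm z \<le> 3 * norm (u - 1) / \<alpha>"
      using exp_times_lie_near_one[OF uG order_trans[OF n d(2)]] by blast
    have "u * exp (- z) = exp x" using exp_minus_mult[of "- z"] by (simp add: xz(3) mult.assoc)
    then have "exp x \<in> H" using H_mult[OF u(1) exp_uminus_lie[OF xz(2)]] by simp
    moreover have "norm z < pi"
    proof -
      have "3 * norm (u - 1) / \<alpha> \<le> 3 * (\<alpha>\<^sup>2 / 60) / \<alpha>" using n d(2)[of j] alpha by (intro divide_right_mono mult_left_mono) auto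
      also have "\<dots> < pi" using alpha pi_gt3 by (simp add: power2_eq_square)
      finally show ?thesis using xz(5) by linarith
    qed
    \<comment> \<open>Otherwise \<open>u = exp z\<close> with \<open>norm z < pi\<close>, against
      the choice of \<open>u\<close>.\<close>
    then have "x \<noteq> 0" using u(3) xz(2,3) by auto
    moreover have "norm x \<le> 2 * d j / \<alpha>"
      using xz(4) n alpha by (meson divide_right_mono less_imp_le mult_left_mono order_trans zero_le_numeral)
    ultimately show ?thesis using xz(1) by blast
  qed
  then obtain x where x: "\<And>j. x j \<in> X" "\<And>j. exp (x j) \<in> H" "\<And>j. x j \<noteq> 0" "\<And>j. norm (x j) \<le> 2 * d j / \<alpha>" by metis
  define v where "v = (\<lambda>j. (1 / norm (x j)) *\<^sub>R x j)"
  have nv: "norm (v j) = 1" for j using x(3) by (simp add: v_def)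
  have "bounded (range v)" using nv by (auto intro!: boundedI[of _ 1])
  then obtain l r where r: "strict_mono (r::nat\<Rightarrow>nat)" "(v \<circ> r) \<longlonglongrightarrow> l"
    using bounded_imp_convergent_subsequence by blast
  have x0: "(\<lambda>j. norm (x (r j))) \<longlonglongrightarrow> 0"
  proof -
    have "(\<lambda>j. 2 * (\<alpha>\<^sup>2 / 60) / \<alpha> * inverse (real (Suc j))) \<longlonglongrightarrow> 2 * (\<alpha>\<^sup>2 / 60) / \<alpha> * 0"
      by (intro tendsto_mult tendsto_const LIMSEQ_inverse_real_of_nat)
    moreover have "2 * (\<alpha>\<^sup>2 / 60) / \<alpha> * inverse (real (Suc j)) = 2 * d j / \<alpha>" for j
      by (simp only: d_def divide_inverse mult_ac)
    ultimately have "(\<lambda>j. 2 * d j / \<alpha>) \<longlonglongrightarrow> 0" by (simp only: mult_zero_right)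
    from this have "(\<lambda>j. norm (x j)) \<longlonglongrightarrow> 0"
      using Lim_null_comparison[of "\<lambda>j. norm (x j)" "\<lambda>j. 2 * d j / \<alpha>" sequentially] x(4) by simp
    from LIMSEQ_subseq_LIMSEQ[OF this r(1)] show ?thesis by (simp add: o_def)
  qed
  have skv: "skewadj (v j)" for j unfolding v_def using x(1) X_skew by blast
  have skl: "skewadj l"
  proof -
    have "(\<lambda>j. star ((v \<circ> r) j)) \<longlonglongrightarrow> star l" by (rule bounded_linear.tendsto[OF bounded_linear_star r(2)])
    moreover have "(\<lambda>j. star ((v \<circ> r) j)) = (\<lambda>j. - (v \<circ> r) j)" using skv by (simp add: skewadj_def)
    moreover have "(\<lambda>j. - (v \<circ> r) j) \<longlonglongrightarrow> - l" by (intro tendsto_minus r(2))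
    ultimately show ?thesis unfolding skewadj_def using LIMSEQ_unique by metis
  qed
  have lX: "P l = l"
  proof -
    have ex: "exp (t *\<^sub>R 0) \<in> H" for t :: real using H_one by simp
    have lb: "norm (P l - l) \<le> (1 / \<alpha> + 1) * norm (l - v j)" for j
    proof -
      have "P (v j) = v j" unfolding v_def by (intro P_X X_scale x(1))
      then have "P l - l = P (l - v j) - (l - v j)" using P_diff[OF skl skv] by simp
      also have "norm \<dots> \<le> norm (P (l - v j)) + norm (l - v j)" by (rule norm_triangle_ineq4)
      also have "\<dots> \<le> norm (l - v j) / \<alpha> + norm (l - v j)" using P_norm' skl skv by (intro add_mono) (auto intro: skewadj_diff)
      finally show ?thesis by (simp add: algebra_simps)
    qed
    have "(\<lambda>j. (1 / \<alpha> + 1) * norm (l - (v \<circ> r) j)) \<longlonglongrightarrow> (1 / \<alpha> + 1) * norm (l - l)"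
      by (intro tendsto_intros r(2))
    then have "norm (P l - l) \<le> (1 / \<alpha> + 1) * norm (l - l)"
      by (rule LIMSEQ_le_const) (use lb in auto)
    then show ?thesis by simp
  qed
  have "l \<in> lie_set H"
    unfolding lie_set_def
  proof (intro CollectI conjI skl allI)
    fix t :: real
    \<comment> \<open>Integer multiples of \<open>x (r j)\<close> approximate the corresponding
      multiple of the direction \<open>v\<close> up to \<open>norm (x (r j))\<close>, and their
      exponentials are integer powers of an element of \<open>H\<close>.\<close>
    define k where "k = (\<lambda>j. \<lfloor>t / norm (x (r j))\<rfloor>)"
    have powH: "u ^ m \<in> H" if "u \<in> H" for u m by (induction m) (auto intro: that H_one H_mult)
    have kH: "exp (of_int i *\<^sub>R x j) \<in> H" for i :: int and j
    proof (cases "i \<ge> 0")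
      case True
      then have "exp (of_int i *\<^sub>R x j) = exp (x j) ^ nat i" by (simp add: exp_power)
      then show ?thesis using powH x(2) by simp
    next
      case False
      have "exp (of_int i *\<^sub>R x j) = star (exp (x j)) ^ nat (- i)"
        unfolding star_exp_skewadj[OF X_skew[OF x(1)]] exp_power using False by simp
      then show ?thesis using powH x(2) H_star by simp
    qed
    have "(\<lambda>j. of_int (k j) *\<^sub>R x (r j)) \<longlonglongrightarrow> t *\<^sub>R l"
    proof -
      have "norm (of_int (k j) *\<^sub>R x (r j) - t *\<^sub>R (v \<circ> r) j) \<le> norm (x (r j))" for j
      proof -
        have "of_int (k j) *\<^sub>R x (r j) - t *\<^sub>R (v \<circ> r) j = (of_int (k j) - t / norm (x (r j))) *\<^sub>R x (r j)"
          by (simp add: v_def scaleR_diff_left)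
        moreover have "\<bar>of_int (k j) - t / norm (x (r j))\<bar> \<le> 1" unfolding k_def by linarith
        ultimately show ?thesis by (simp add: mult_left_le_one_le)
      qed
      then have "(\<lambda>j. of_int (k j) *\<^sub>R x (r j) - t *\<^sub>R (v \<circ> r) j) \<longlonglongrightarrow> 0"
        using Lim_null_comparison[OF _ x0, of "\<lambda>j. of_int (k j) *\<^sub>R x (r j) - t *\<^sub>R (v \<circ> r) j"] by simp
      moreover have "(\<lambda>j. t *\<^sub>R (v \<circ> r) j) \<longlonglongrightarrow> t *\<^sub>R l" by (intro tendsto_intros r(2))
      ultimately show ?thesis using tendsto_add by fastforce
    qed
    then have "(\<lambda>j. exp (of_int (k j) *\<^sub>R x (r j))) \<longlonglongrightarrow> exp (t *\<^sub>R l)" by (rule exp_tendsto)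
    then show "exp (t *\<^sub>R l) \<in> H" by (rule cl[rotated]) (use kH skl G_exp in auto)
  qed
  then have "l = 0" using P_lie lX by simp
  moreover have "norm l = 1"
  proof -
    have "(\<lambda>j. norm ((v \<circ> r) j)) \<longlonglongrightarrow> norm l" by (rule tendsto_norm[OF r(2)])
    then show ?thesis by (simp add: nv LIMSEQ_const_iff)
  qed
  ultimately show False by simp
qed

end

text \<open>A separated subset of largest cardinality is a net, and the bound \<open>B\<close>
  ensures that there is one.\<close>

lemma finite_net_exists:
  fixes A :: "'a::real_normed_vector set"
  assumes e: "0 < e" and b: "\<And>S. finite S \<Longrightarrow> S \<subseteq> A \<Longrightarrow> (\<forall>x\<in>S. \<forall>y\<in>S. x \<noteq> y \<longrightarrow> e \<le> norm (x - y)) \<Longrightarrow> real (card S) \<le> B"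
  obtains S where "finite S" "S \<subseteq> A" "real (card S) \<le> B" "\<And>x. x \<in> A \<Longrightarrow> \<exists>s\<in>S. norm (x - s) < e"
proof -
  let ?Q = "\<lambda>S. finite S \<and> S \<subseteq> A \<and> (\<forall>x\<in>S. \<forall>y\<in>S. x \<noteq> y \<longrightarrow> e \<le> norm (x - y))"
  obtain m :: nat where m: "B < real m" using reals_Archimedean2 by blast
  have bd: "card S < m" if "?Q S" for S
  proof -
    have "real (card S) \<le> B" by (rule b) (use that in auto)
    then show ?thesis using m by linarith
  qed
  have "\<exists>S. ?Q S \<and> (\<forall>T. ?Q T \<longrightarrow> card T \<le> card S)"
  proof (rule ex_has_greatest_nat[where P="?Q" and k="{}" and f=card and b=m])
    show "?Q {}" by simp
    show "\<forall>T. ?Q T \<longrightarrow> card T < m" using bd by blast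
  qed
  then obtain S where S: "?Q S" "\<And>T. ?Q T \<Longrightarrow> card T \<le> card S" by auto
  have "\<exists>s\<in>S. norm (x - s) < e" if x: "x \<in> A" for x
  proof (rule ccontr)
    assume "\<not> ?thesis"
    then have far: "\<And>s. s \<in> S \<Longrightarrow> e \<le> norm (x - s)" by (simp add: not_less)
    then have "x \<notin> S" using e by fastforce
    have "?Q (insert x S)" using S(1) x far by (auto simp: norm_minus_commute)
    then have "card (insert x S) \<le> card S" by (rule S(2))
    then show False using S(1) \<open>x \<notin> S\<close> by simp
  qed
  moreover have "real (card S) \<le> B" by (rule b) (use S(1) in auto)
  ultimately show ?thesis using that[of S] S(1) by simp
qed

section \<open>Lower and upper bounds for coverings of the coset space\<close>

context unitary_subgroup begin

text \<open>By \<open>coset_separation\<close> the points of the ball of radius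
  \<open>\<alpha> / 320\<close> in \<open>X\<close> whose cosets come within \<open>e\<close> of the
  same \<open>s\<close> are at mutual distance at most \<open>4 * e / \<alpha>\<close>. One of them
  is chosen as \<open>p s\<close>, or 0 if there is none. The balls of radius
  \<open>8 * e / \<alpha>\<close>, doubled to get a strict inequality, then cover, and the quotient
  of the radii is the constant 2560.\<close>

lemma covering_lower_bound:
  assumes crd: "coordinate_system b d R0" and X: "X = range (coordinate_system.comb b d)"
    and woven: "\<And>u. u \<in> H \<Longrightarrow> rho u 1 \<le> \<alpha> / 2 \<Longrightarrow> \<exists>z\<in>lie_set H. norm z < pi \<and> u = exp z"
    and S: "finite S" and e: "0 < e" "e \<le> \<alpha> / 160"
    and cov: "\<And>g. g \<in> G \<Longrightarrow> \<exists>s\<in>S. \<exists>h\<in>H. norm (g * h - s) < e"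
  shows "(\<alpha>\<^sup>2 / 2560 / e) ^ d \<le> real (card S)"
proof -
  interpret coordinate_system b d R0 by (rule crd)
  define A where "A = (\<lambda>s. {x \<in> X. norm x < \<alpha> / 320 \<and> (\<exists>h\<in>H. norm (exp x * h - s) < e)})"
  define p where "p = (\<lambda>s. if A s = {} then 0 else (SOME x. x \<in> A s))"
  have pA: "p s \<in> A s" if "A s \<noteq> {}" for s
    unfolding p_def using that by (auto intro: someI_ex)
  have "0 \<in> X" using X by (auto simp: comb_def intro!: image_eqI[of _ _ "\<lambda>_. 0"])
  then have pX: "p s \<in> X" for s using pA[of s] by (cases "A s = {}") (auto simp: p_def A_def)
  have "((\<alpha> / 320) / (8 * e / \<alpha>)) ^ d \<le> real (card S)"
  proof (rule covering_bound[OF S, of p])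
    show "p s \<in> range comb" for s using pX X by simp
    fix x assume x: "x \<in> range comb" "norm x < \<alpha> / 320"
    then have xX: "x \<in> X" using X by simp
    then have "exp x \<in> G" using G_exp X_skew by blast
    then obtain s h where s: "s \<in> S" "h \<in> H" "norm (exp x * h - s) < e" using cov by blast
    then have xA: "x \<in> A s" using x xX by (auto simp: A_def)
    then have "p s \<in> A s" using pA by blast
    then obtain h' where h': "h' \<in> H" "norm (exp (p s) * h' - s) < e" "p s \<in> X" "norm (p s) < \<alpha> / 320"
      by (auto simp: A_def)
    have "norm (x - p s) \<le> 4 * e / \<alpha>"
      by (rule coset_separation[OF woven]) (use xX x s h' e in auto)
    also have "\<dots> < 8 * e / \<alpha>" using e alpha by (simp add: field_simps)
    finally show "\<exists>s\<in>S. norm (x - p s) < 8 * e / \<alpha>" using s(1) by blast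
  qed (use alpha e in auto)
  also have "(\<alpha> / 320) / (8 * e / \<alpha>) = \<alpha>\<^sup>2 / 2560 / e" using alpha e by (simp add: field_simps power2_eq_square)
  finally show ?thesis .
qed

text \<open>Each coarse point is multiplied by the exponentials of a fine net \<open>T\<close> in
  \<open>X\<close>. The radius \<open>\<alpha> / 30\<close> is the chart's bound for
  \<open>norm (g' - 1) \<le> \<alpha>\<^sup>2 / 60\<close>. The mesh \<open>e / 8\<close> loses a
  factor 2 through \<open>exp\<close> and another through \<open>rho_near\<close>, which leaves
  \<open>e / 2\<close>. The size of \<open>T\<close> is at most
  \<open>((e + 8 * \<alpha> / 15) / e) ^ d\<close>.\<close>

lemma covering_upper_bound_from_net:
  assumes crd: "coordinate_system b d R0" and X: "X = range (coordinate_system.comb b d)"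
    and S0: "finite S0" "S0 \<subseteq> G" "\<And>g. g \<in> G \<Longrightarrow> \<exists>s\<in>S0. \<exists>h\<in>H. norm (g * h - s) \<le> \<alpha>\<^sup>2 / 60"
    and e: "0 < e" "e \<le> 1/2"
  obtains S where "finite S" "S \<subseteq> G" "real (card S) \<le> real (card S0) * (2 / e) ^ d"
    "\<And>g. g \<in> G \<Longrightarrow> \<exists>s\<in>S. \<exists>h\<in>H. rho s (g * h) < e"
proof -
  interpret coordinate_system b d R0 by (rule crd)
  have e8: "0 < e / 8" using e by simp
  obtain T where T: "finite T" "T \<subseteq> X \<inter> cball 0 (\<alpha> / 30)" "real (card T) \<le> (1 + 2 * (\<alpha> / 30) / (e / 8)) ^ d"
    "\<And>x. x \<in> X \<inter> cball 0 (\<alpha> / 30) \<Longrightarrow> \<exists>t\<in>T. norm (x - t) < e / 8"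
  proof (rule finite_net_exists[OF e8, of "X \<inter> cball 0 (\<alpha> / 30)" "(1 + 2 * (\<alpha> / 30) / (e / 8)) ^ d"])
    fix S :: "('a, 'n) cmat set"
    assume "finite S" "S \<subseteq> X \<inter> cball 0 (\<alpha> / 30)" "\<forall>x\<in>S. \<forall>y\<in>S. x \<noteq> y \<longrightarrow> e / 8 \<le> norm (x - y)"
    then show "real (card S) \<le> (1 + 2 * (\<alpha> / 30) / (e / 8)) ^ d"
      using X alpha e by (intro packing_bound) auto
  qed blast
  define S where "S = (\<lambda>(s, x). s * exp x) ` (S0 \<times> T)"
  have "real (card S) \<le> real (card (S0 \<times> T))" unfolding S_def by (intro of_nat_mono card_image_le finite_cartesian_product S0(1) T(1))
  also have "\<dots> = real (card S0) * real (card T)" by (simp add: card_cartesian_product)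
  also have "real (card T) \<le> (2 / e) ^ d"
  proof -
    have "1 + 2 * (\<alpha> / 30) / (e / 8) = (e + 8 * \<alpha> / 15) / e" using e by (simp add: field_simps)
    also have "\<dots> \<le> 2 / e" using e alpha by (intro divide_right_mono) auto
    finally have "(1 + 2 * (\<alpha> / 30) / (e / 8)) ^ d \<le> (2 / e) ^ d" using alpha e by (intro power_mono) auto
    then show ?thesis using T(3) by linarith
  qed
  finally have card: "real (card S) \<le> real (card S0) * (2 / e) ^ d" by (simp add: mult_left_mono)
  have SG: "S \<subseteq> G" using S0(2) T(2) G_exp X_skew by (auto simp: S_def intro!: G_mult)
  have "\<exists>s\<in>S. \<exists>h\<in>H. rho s (g * h) < e" if g: "g \<in> G" for g
  proof -
    obtain s h where s: "s \<in> S0" "h \<in> H" "norm (g * h - s) \<le> \<alpha>\<^sup>2 / 60" using S0(3)[OF g] by blast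
    have sG: "s \<in> G" and hG: "h \<in> G" using s S0(2) H_sub by auto
    have gh: "g * h \<in> G" using g hG by (rule G_mult)
    define g' where "g' = star s * (g * h)"
    have g': "g' \<in> G" "norm (g' - 1) \<le> \<alpha>\<^sup>2 / 60"
      using G_norm_star_mult[OF sG] s(3) sG gh by (auto simp: g'_def intro: G_mult G_star)
    have sg': "s * g' = g * h" using unitaryD(2)[OF G_unitary[OF sG]] by (simp add: g'_def flip: mult.assoc)
    obtain x z where xz: "x \<in> X" "z \<in> lie_set H" "g' = exp x * exp z" "norm x \<le> 2 * norm (g' - 1) / \<alpha>"
      using exp_times_lie_near_one[OF g'] by blast
    have "norm x \<le> \<alpha> / 30"
    proof -
      have "2 * norm (g' - 1) / \<alpha> \<le> 2 * (\<alpha>\<^sup>2 / 60) / \<alpha>" using g' alpha by (intro divide_right_mono mult_left_mono) auto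
      then show ?thesis using xz(4) alpha by (simp add: power2_eq_square)
    qed
    then obtain t where t: "t \<in> T" "norm (x - t) < e / 8" using T(4)[of x] xz(1) by auto
    then have tX: "t \<in> X" "norm t \<le> \<alpha> / 30" using T(2) by auto
    have hz: "h * exp (- z) \<in> H" using s(2) exp_uminus_lie[OF xz(2)] by (rule H_mult)
    have eq: "g * (h * exp (- z)) = s * exp x"
    proof -
      have "exp z * exp (- z) = 1" using exp_minus_mult[of "- z"] by simp
      then have "g' * exp (- z) = exp x" by (simp add: xz(3) mult.assoc)
      then show ?thesis by (metis mult.assoc sg')
    qed
    have "norm (s * exp t - s * exp x) = norm (exp t - exp x)"
      using norm_unitary_mult[OF G_unitary[OF sG], of "exp t - exp x"] by (simp add: right_diff_distrib)
    also have "\<dots> \<le> exp (1/2) * norm (t - x)"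
      by (rule exp_lipschitz) (use tX \<open>norm x \<le> \<alpha> / 30\<close> alpha in auto)
    also have "\<dots> \<le> 2 * (e / 8)"
      using exp_le_quadratic_bound[of "1/2"] t(2) by (intro mult_mono) (auto simp: norm_minus_commute)
    finally have n: "norm (s * exp t - s * exp x) \<le> e / 4" by simp
    have G2: "s * exp t \<in> G" "s * exp x \<in> G" using sG tX xz(1) X_skew by (auto intro!: G_mult G_exp)
    have "rho (s * exp t) (s * exp x) \<le> 2 * norm (s * exp t - s * exp x)" by (rule rho_near[OF G2]) (use n e in auto)
    then have "rho (s * exp t) (g * (h * exp (- z))) < e" using n e unfolding eq by linarith
    moreover have "s * exp t \<in> S" using s(1) t(1) by (auto simp: S_def)
    ultimately show ?thesis using hz by blast
  qed
  then show ?thesis using that[OF _ SG card] S0(1) T(1) by (auto simp: S_def)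
qed

lemma norm_projection_le:
  fixes Q :: "('a, 'n) cmat"
  assumes "star Q = Q" "Q * Q = Q"
  shows "norm Q \<le> 1"
proof (rule norm_cmat_leI)
  fix x
  have "inner (mapp Q x) (mapp Q x) = inner (mapp Q x) x"
    using inner_mapp_left[of Q x "mapp Q x"] assms by (metis inner_commute mapp_mult)
  also have "\<dots> \<le> norm (mapp Q x) * norm x" by (rule norm_cauchy_schwarz)
  finally have "norm (mapp Q x) * norm (mapp Q x) \<le> norm (mapp Q x) * norm x"
    by (simp add: dot_square_norm power2_eq_square)
  then show "norm (mapp Q x) \<le> 1 * norm x" by (cases "mapp Q x = 0") auto
qed

text \<open>If \<open>g\<close> nearly fixes the range of the projection \<open>Q\<close>, then the unitary factor of the block diagonal
  part of \<open>g\<close> fixes it exactly and is close to \<open>g\<close>.\<close>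

lemma near_element_fixing_projection:
  assumes w: "w \<in> G" and Pi: "star R = R" "R * R = R" and d: "norm (w * R - R) \<le> d" "d \<le> 1/2400"
  obtains p where "p \<in> G" "p * R = R" "R * p = R" "norm (w - p) \<le> 10 * d"
proof -
  have d0: "0 \<le> d" using d(1) norm_ge_zero order_trans by blast
  define Q where "Q = 1 - R"
  have Q: "star Q = Q" "Q * Q = Q" "Q * R = 0" "R * Q = 0" using Pi by (simp_all add: Q_def algebra_simps)
  have nQ: "norm Q \<le> 1" using norm_projection_le[OF Q(1,2)] .
  have uw: "unitary w" using G_unitary[OF w] .
  \<comment> \<open>The block of \<open>w\<close> on the range of \<open>R\<close> is replaced by
    the identity, and the off-diagonal blocks are dropped.\<close>
  define A where "A = Q * w * Q + R"
  have AP: "A * R = R" by (simp add: A_def distrib_right mult.assoc Q Pi)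
  have PA: "R * A = R" by (simp add: A_def distrib_left Q Pi flip: mult.assoc)
  have e2: "norm (R * w - R) \<le> d"
  proof -
    have "star (R * w - R) = star w * (R - w * R)"
      using unitaryD(1)[OF uw] by (simp add: Pi right_diff_distrib flip: mult.assoc)
    then have "norm (R * w - R) = norm (star w * (R - w * R))" by (metis norm_star)
    also have "\<dots> = norm (w * R - R)" using norm_unitary_mult[of "star w"] uw by (simp add: norm_minus_commute)
    finally show ?thesis using d by simp
  qed
  have "w - A = (w * R - R) + (R * w - R) * Q"
    using Pi by (simp add: A_def Q_def algebra_simps)
  also have "norm \<dots> \<le> d + d * 1"
    by (intro order_trans[OF norm_triangle_ineq] add_mono d order_trans[OF norm_mult_ineq] mult_mono e2 nQ d0 norm_ge_zero)
  finally have wA: "norm (w - A) \<le> 2 * d" by simp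
  have nA: "norm A \<le> 1 + 2 * d" using norm_triangle_ineq4[of w "w - A"] wA uw by simp
  define y where "y = star A * A - 1"
  have "y = star A * (A - w) + star (A - w) * w"
    using unitaryD(1)[OF uw] by (simp add: y_def algebra_simps)
  also have "norm \<dots> \<le> (1 + 2 * d) * (2 * d) + 2 * d * 1"
    using nA wA uw norm_star[of "A - w"] d0
    by (intro order_trans[OF norm_triangle_ineq] add_mono order_trans[OF norm_mult_ineq] mult_mono)
      (auto simp: norm_minus_commute simp del: star_diff)
  also have "\<dots> \<le> 5 * d" using d d0 mult_left_mono[of d "1/4" "d * 4"] by (simp add: algebra_simps)
  finally have ny: "norm y \<le> 5 * d" .
  then have y1: "norm y < 1" using d by linarith
  define B where "B = binser (-1/2) y"
  note P = polar_decomposition[of A, folded y_def, OF y1, folded B_def]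
  have yP: "y * R = 0"
  proof -
    have "star A * R = star (R * A)" by (simp add: Pi)
    then have "star A * A * R = R" using AP PA Pi(1) by (metis mult.assoc)
    then show ?thesis by (simp add: y_def left_diff_distrib)
  qed
  \<comment> \<open>On the range of \<open>R\<close> all powers \<open>y ^ k\<close> with
    \<open>k > 0\<close> vanish, so the series of \<open>B\<close> reduces to its first
    term.\<close>
  have BP: "B * R = R"
  proof -
    have "(\<lambda>k. (- 1 / 2 gchoose k) *\<^sub>R (y ^ k * R)) sums (B * R)"
      unfolding B_def by (rule binser_bounded_linear[OF bounded_linear_mult_left]) (use y1 in auto)
    moreover have "(\<lambda>k. (- 1 / 2 gchoose k :: real) *\<^sub>R (y ^ k * R)) = (\<lambda>k. if k = 0 then R else 0)"
    proof
      fix k show "(- 1 / 2 gchoose k :: real) *\<^sub>R (y ^ k * R) = (if k = 0 then R else 0)"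
        by (cases k) (auto simp: power_Suc2 mult.assoc yP simp del: power_Suc)
    qed
    moreover have "(\<lambda>k::nat. if k = 0 then R else 0) sums R" using sums_single[of 0 "\<lambda>_. R"] by (simp add: eq_commute)
    ultimately show ?thesis using sums_unique2 by metis
  qed
  define p where "p = A * B"
  have pP: "p * R = R" by (simp add: p_def mult.assoc BP AP)
  have "R * p = R * B" by (simp add: p_def PA flip: mult.assoc)
  also have "\<dots> = star (B * R)" by (simp add: P(2) Pi)
  finally have Pp: "R * p = R" by (simp add: BP Pi)
  have "norm (p - A) \<le> norm A * (norm y / (1 - norm y))" using P(5) by (simp add: p_def)
  also have "\<dots> \<le> (1 + 2 * d) * (6 * d)"
  proof (intro mult_mono nA)
    have "norm y / (1 - norm y) \<le> 5 * d / (1 - 5 * d)" using ny d d0 by (intro frac_le) auto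
    also have "\<dots> \<le> 6 * d" using d d0 mult_left_mono[of "5 / 6" "1 - 5 * d" "6 * d"] by (simp add: divide_le_eq)
    finally show "norm y / (1 - norm y) \<le> 6 * d" .
  qed (use d d0 y1 in auto)
  also have "\<dots> \<le> 7 * d" using d d0 mult_left_mono[of d "1/12" "d * 12"] by (simp add: algebra_simps)
  finally have "norm (p - A) \<le> 7 * d" .
  then have wp: "norm (w - p) \<le> 10 * d" using wA d0 norm_triangle_ineq4[of "w - A" "p - A"] by simp
  \<comment> \<open>\<open>10 * d\<close> is below 1, so \<open>G_near\<close> applies; for SO(n)
    this is what fixes the determinant.\<close>
  moreover have "p \<in> G" by (rule G_near[OF w]) (use P(1) wp d in \<open>auto simp: p_def\<close>)
  ultimately show ?thesis using that pP Pp by blast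
qed

text \<open>If \<open>g * Q\<close> is near \<open>r t * Q\<close>, then
  \<open>w = star (r t) * g\<close> nearly fixes the range of \<open>Q\<close> and is near some
  \<open>p\<close> that fixes it; this \<open>p\<close> belongs to \<open>H\<close>, and
  \<open>g * star p\<close> is near \<open>r t\<close>. The number of points depends only on the
  dimension of the space of the matrices \<open>M * Q\<close>.\<close>

lemma coarse_net:
  assumes Pi: "star Q = Q" "Q * Q = Q" and fix_in_H: "\<And>p. p \<in> G \<Longrightarrow> p * Q = Q \<Longrightarrow> Q * p = Q \<Longrightarrow> p \<in> H"
    and crd: "coordinate_system b D R0" and rng: "\<And>M. M * Q \<in> range (coordinate_system.comb b D)"
  obtains S0 where "finite S0" "S0 \<subseteq> G" "real (card S0) \<le> (1 + 1200 / \<alpha>\<^sup>2) ^ D"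
    "\<And>g. g \<in> G \<Longrightarrow> \<exists>s\<in>S0. \<exists>h\<in>H. norm (g * h - s) \<le> \<alpha>\<^sup>2 / 60"
proof -
  interpret coordinate_system b D R0 by (rule crd)
  \<comment> \<open>\<open>near_element_fixing_projection\<close> loses a factor 10, and
    \<open>\<alpha>\<^sup>2 / 60\<close> is the radius of the chart.\<close>
  define d where "d = \<alpha>\<^sup>2 / 600"
  have "\<alpha>\<^sup>2 \<le> (1/2)\<^sup>2" by (rule power_mono) (use alpha in auto)
  then have d: "0 < d" "d \<le> 1/2400" using alpha by (auto simp: d_def power2_eq_square)
  have deq: "1 + 2 * 1 / d = 1 + 1200 / \<alpha>\<^sup>2" by (simp add: d_def)
  let ?A = "(\<lambda>u. u * Q) ` G"
  obtain T where T: "finite T" "T \<subseteq> ?A" "real (card T) \<le> (1 + 2 * 1 / d) ^ D"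
    "\<And>x. x \<in> ?A \<Longrightarrow> \<exists>t\<in>T. norm (x - t) < d"
  proof (rule finite_net_exists[OF d(1), of ?A "(1 + 2 * 1 / d) ^ D"])
    fix S :: "('a, 'n) cmat set"
    assume S: "finite S" "S \<subseteq> ?A" "\<forall>x\<in>S. \<forall>y\<in>S. x \<noteq> y \<longrightarrow> d \<le> norm (x - y)"
    show "real (card S) \<le> (1 + 2 * 1 / d) ^ D"
    proof (rule packing_bound)
      show "S \<subseteq> range comb" using S(2) rng by auto
      fix x assume "x \<in> S"
      then obtain u where "u \<in> G" "x = u * Q" using S(2) by blast
      then show "norm x \<le> 1" using norm_unitary_mult[OF G_unitary] norm_projection_le[OF Pi] by simp
    qed (use S d in auto)
  qed blast
  have "\<exists>u. u \<in> G \<and> u * Q = t" if "t \<in> T" for t using T(2) that by blast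
  then obtain r where r: "\<And>t. t \<in> T \<Longrightarrow> r t \<in> G" "\<And>t. t \<in> T \<Longrightarrow> r t * Q = t" by metis
  have "\<exists>s\<in>r ` T. \<exists>h\<in>H. norm (g * h - s) \<le> \<alpha>\<^sup>2 / 60" if g: "g \<in> G" for g
  proof -
    obtain t where t: "t \<in> T" "norm (g * Q - t) < d" using T(4) g by blast
    define w where "w = star (r t) * g"
    have rt: "unitary (r t)" using r(1)[OF t(1)] G_unitary by blast
    have wG: "w \<in> G" unfolding w_def using r(1)[OF t(1)] g by (intro G_mult G_star)
    have "w * Q - Q = star (r t) * (g * Q - r t * Q)"
      using unitaryD(1)[OF rt] by (simp add: w_def right_diff_distrib flip: mult.assoc)
    then have "norm (w * Q - Q) \<le> d" using t r(2)[OF t(1)] norm_unitary_mult[of "star (r t)"] rt by simp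
    then obtain p where p: "p \<in> G" "p * Q = Q" "Q * p = Q" "norm (w - p) \<le> 10 * d"
      using near_element_fixing_projection[OF wG Pi _ d(2)] by blast
    have up: "unitary p" using p G_unitary by blast
    have pH: "star p \<in> H" using fix_in_H[OF p(1,2,3)] by (rule H_star)
    have "g * star p - r t = r t * ((w - p) * star p)"
      using unitaryD(2)[OF rt] unitaryD(2)[OF up]
      by (simp add: w_def left_diff_distrib right_diff_distrib flip: mult.assoc)
    then have "norm (g * star p - r t) = norm (w - p)"
      using norm_unitary_mult[OF rt] norm_mult_unitary[of "star p"] up by simp
    also have "\<dots> \<le> \<alpha>\<^sup>2 / 60" using p(4) by (simp add: d_def)
    finally show ?thesis using pH t(1) by blast
  qed
  moreover have "real (card (r ` T)) \<le> (1 + 1200 / \<alpha>\<^sup>2) ^ D"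
    using T(3) card_image_le[OF T(1), of r] unfolding deq by linarith
  moreover have "r ` T \<subseteq> G" using r(1) by blast
  ultimately show ?thesis using that[of "r ` T"] T(1) by blast
qed

end

section \<open>Dimensions and the orthogonal projection\<close>

lemma linear_entries: "linear (entries :: ('a::rc_field, 'n::finite) cmat \<Rightarrow> _)"
  by (rule bounded_linear.linear[OF bounded_linear_entries])

lemma linear_of_entries: "linear (of_entries :: 'a::rc_field^'n::finite^'n \<Rightarrow> _)"
  by (rule bounded_linear.linear[OF bounded_linear_of_entries])

lemma entries_simps [simp]:
  "entries (x + y) = entries x + entries y" "entries (x - y) = entries x - entries y"
  "entries (r *\<^sub>R x) = r *\<^sub>R entries x" "entries 0 = 0" "entries (- x) = - entries x"
  by (simp_all add: linear_add[OF linear_entries] linear_diff[OF linear_entries]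
      linear_scale[OF linear_entries] linear_0[OF linear_entries] linear_neg[OF linear_entries])

lemma entries_mem_iff: "entries A \<in> entries ` L \<longleftrightarrow> A \<in> L"
  by (auto simp: image_iff entries_inject)

text \<open>The coordinates with respect to a basis of \<open>W\<close> extend to linear functionals
  on a finite-dimensional space, which are bounded; their bounds add up to
  \<open>R0\<close>.\<close>

lemma coordinate_system_exists:
  fixes W :: "('a::rc_field^'n::finite^'n) set"
  assumes W: "Real_Vector_Spaces.subspace W"
  obtains b R0 where "coordinate_system b (dim W) R0"
    "range (coordinate_system.comb b (dim W)) = of_entries ` W"
proof -
  obtain B where B: "B \<subseteq> W" "independent B" "W \<subseteq> span B" "card B = dim W"
    using basis_exists by blast
  have finB: "finite B" using B(2) by (rule independent_imp_finite)
  have spB: "span B = W" using B W by (simp add: span_minimal subset_antisym)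
  define d where "d = dim W"
  obtain c where c: "bij_betw c {..<d} B"
    using ex_bij_betw_nat_finite[OF finB] B(4) by (auto simp: d_def atLeast0LessThan)
  have "\<exists>g :: _ \<Rightarrow> real. linear g \<and> (\<forall>j<d. g (c j) = (if j = i then 1 else 0))" for i
  proof -
    obtain g where g: "linear g" "\<forall>x\<in>B. g x = (if x = c i \<and> i < d then 1 else 0 :: real)"
      using linear_independent_extend[OF B(2), of "\<lambda>x. if x = c i \<and> i < d then 1 else 0"] by blast
    have "g (c j) = (if j = i then 1 else 0)" if "j < d" for j
    proof -
      have "c j \<in> B" using c that by (auto simp: bij_betw_def)
      moreover have "c j = c i \<and> i < d \<longleftrightarrow> j = i" using c that by (auto simp: bij_betw_def inj_on_def)
      ultimately show ?thesis using g(2) by simp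
    qed
    then show ?thesis using g(1) by (intro exI[of _ g]) auto
  qed
  then obtain g :: "nat \<Rightarrow> 'a^'n^'n \<Rightarrow> real" where g: "\<And>i. linear (g i)" "\<And>i j. j < d \<Longrightarrow> g i (c j) = (if j = i then 1 else 0)"
    by metis
  define b where "b = (\<lambda>i. of_entries (c i))"
  have bl: "bounded_linear (\<lambda>A. g i (entries A))" for i
    using bounded_linear_compose[OF _ bounded_linear_entries, of "g i"] g(1)[of i]
    by (simp add: linear_conv_bounded_linear)
  then have "\<exists>K. \<forall>A. \<bar>g i (entries A)\<bar> \<le> norm A * K" for i
    using bounded_linear.bounded[OF bl[of i]] by simp
  then obtain K where K: "\<And>i A. \<bar>g i (entries A)\<bar> \<le> norm A * K i" by metis
  have sum_entries: "entries (\<Sum>i<d. f i *\<^sub>R b i) = (\<Sum>i<d. f i *\<^sub>R c i)" for f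
    by (simp add: linear_sum[OF linear_entries] b_def of_entries_inverse)
  have crd: "coordinate_system b d (\<Sum>i<d. \<bar>K i\<bar>)"
  proof
    fix f :: "nat \<Rightarrow> real" and i assume i: "i < d"
    let ?v = "\<Sum>i<d. f i *\<^sub>R b i"
    have "g i (entries ?v) = (\<Sum>j<d. f j * g i (c j))"
      unfolding sum_entries by (simp add: linear_sum[OF g(1)] linear_scale[OF g(1)])
    also have "\<dots> = (\<Sum>j<d. if j = i then f j else 0)" by (intro sum.cong refl) (simp add: g(2))
    also have "\<dots> = f i" using i by simp
    finally have "\<bar>f i\<bar> \<le> norm ?v * K i" using K[of i ?v] by simp
    also have "\<dots> \<le> norm ?v * (\<Sum>i<d. \<bar>K i\<bar>)"
    proof (rule mult_left_mono)
      have "K i \<le> \<bar>K i\<bar>" by simp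
      also have "\<dots> \<le> (\<Sum>i<d. \<bar>K i\<bar>)" using i by (intro member_le_sum) auto
      finally show "K i \<le> (\<Sum>i<d. \<bar>K i\<bar>)" .
    qed simp
    finally show "\<bar>f i\<bar> \<le> (\<Sum>i<d. \<bar>K i\<bar>) * norm ?v" by (simp add: mult.commute)
  qed
  have "range (coordinate_system.comb b d) = of_entries ` W"
  proof (intro equalityI subsetI)
    fix x assume "x \<in> range (coordinate_system.comb b d)"
    then obtain f where f: "x = (\<Sum>i<d. f i *\<^sub>R b i)" unfolding coordinate_system.comb_def[OF crd] by blast
    have "(\<Sum>i<d. f i *\<^sub>R c i) \<in> W"
      using c B(1) W by (intro subspace_sum subspace_scale) (auto simp: bij_betw_def)
    moreover have "x = of_entries (\<Sum>i<d. f i *\<^sub>R c i)" using sum_entries[of f] f by (metis entries_inverse)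
    ultimately show "x \<in> of_entries ` W" by blast
  next
    fix x assume "x \<in> of_entries ` W"
    then obtain w where w: "w \<in> W" "x = of_entries w" by blast
    then obtain u where u: "w = (\<Sum>v\<in>B. u v *\<^sub>R v)" using spB span_finite[OF finB] by blast
    have "w = (\<Sum>i<d. u (c i) *\<^sub>R c i)" unfolding u by (rule sum.reindex_bij_betw[OF c, symmetric])
    then have "x = (\<Sum>i<d. u (c i) *\<^sub>R b i)"
      using w(2) by (simp add: linear_sum[OF linear_of_entries] linear_scale[OF linear_of_entries] b_def)
    then show "x \<in> range (coordinate_system.comb b d)" unfolding coordinate_system.comb_def[OF crd] by (intro range_eqI[of _ _ "\<lambda>i. u (c i)"])
  qed
  then show ?thesis using that[OF crd[unfolded d_def]] by (simp add: d_def)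
qed

section \<open>The Lie algebra as a subspace and the projection onto its complement\<close>

lemma lie_set_scale: "x \<in> lie_set H \<Longrightarrow> r *\<^sub>R x \<in> lie_set H"
  unfolding lie_set_def by auto

text \<open>Trotter products of elements of \<open>H\<close> lie in \<open>H\<close>, and
  \<open>H\<close> is closed in \<open>G\<close>, to which the limit belongs.\<close>

lemma lie_set_add:
  assumes G: "unitary_group G" and HG: "H \<subseteq> G"
    and H: "1 \<in> H" "\<And>u v. u \<in> H \<Longrightarrow> v \<in> H \<Longrightarrow> u * v \<in> H"
    and cl: "\<And>u l. (\<And>j. u j \<in> H) \<Longrightarrow> u \<longlonglongrightarrow> l \<Longrightarrow> l \<in> G \<Longrightarrow> l \<in> H"
    and x: "x \<in> lie_set H" and y: "y \<in> lie_set H"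
  shows "x + y \<in> lie_set H"
proof -
  have sk: "skewadj x" "skewadj y" using x y by (auto simp: lie_set_def)
  have powH: "u ^ m \<in> H" if "u \<in> H" for u m by (induction m) (auto intro: that H)
  have "exp (t *\<^sub>R (x + y)) \<in> H" for t
  proof -
    let ?x = "t *\<^sub>R x" and ?y = "t *\<^sub>R y"
    have lim: "(\<lambda>m. (exp ((1 / real (Suc m)) *\<^sub>R ?x) * exp ((1 / real (Suc m)) *\<^sub>R ?y)) ^ Suc m) \<longlonglongrightarrow> exp (?x + ?y)"
    proof (rule trotter_product)
      fix s :: real
      show "norm (exp (s *\<^sub>R ?x)) \<le> 1" "norm (exp (s *\<^sub>R ?y)) \<le> 1" "norm (exp (s *\<^sub>R (?x + ?y))) \<le> 1"
        using sk by (auto intro!: eq_refl norm_unitary unitary_exp skewadj_scaleR skewadj_add simp del: scaleR_add_right)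
    qed
    moreover have mem: "(exp ((1 / real (Suc m)) *\<^sub>R ?x) * exp ((1 / real (Suc m)) *\<^sub>R ?y)) ^ Suc m \<in> H" for m
      using x y by (intro powH H) (auto simp: lie_set_def)
    moreover have inG: "exp (?x + ?y) \<in> G" using sk unitary_group.G_exp[OF G] by (auto intro!: skewadj_scaleR skewadj_add)
    ultimately have "exp (?x + ?y) \<in> H" by (intro cl[OF mem lim inG])
    then show ?thesis by (simp add: scaleR_add_right)
  qed
  then show ?thesis using sk by (auto simp: lie_set_def)
qed

lemma subspace_skewadj: "Real_Vector_Spaces.subspace (entries ` {x. skewadj x})"
  by (intro linear_subspace_image linear_entries) (auto simp: real_vector.subspace_def)

text \<open>Orthogonality refers to the Euclidean inner product of the entries, which is the
  Hilbert-Schmidt product. The projection is defined on all matrices; when \<open>L\<close> consists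
  of skew matrices, it maps skew matrices to skew ones.\<close>

definition proj_compl :: "('a::rc_field, 'n::finite) cmat set \<Rightarrow> ('a, 'n) cmat \<Rightarrow> ('a, 'n) cmat" where
  "proj_compl L x = (SOME y. x - y \<in> L \<and> (\<forall>z\<in>L. inner (entries y) (entries z) = 0))"

lemma proj_compl:
  assumes L: "Real_Vector_Spaces.subspace (entries ` L)"
  shows "x - proj_compl L x \<in> L" "z \<in> L \<Longrightarrow> inner (entries (proj_compl L x)) (entries z) = 0"
proof -
  obtain y w0 where yz: "y \<in> span (entries ` L)" "\<And>w. w \<in> span (entries ` L) \<Longrightarrow> Linear_Algebra.orthogonal w0 w" "entries x = y + w0"
    using orthogonal_subspace_decomp_exists by blast
  then obtain y' where y': "y' \<in> L" "y = entries y'" using L by (metis imageE span_eq_iff)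
  have "x - of_entries w0 = y'"
    using yz(3) y'(2) by (metis add_diff_cancel_right' entries_inject entries_simps(2) of_entries_inverse UNIV_I)
  then have "\<exists>y. x - y \<in> L \<and> (\<forall>z\<in>L. inner (entries y) (entries z) = 0)"
    using y' yz(2) by (intro exI[of _ "of_entries w0"]) (auto simp: of_entries_inverse Linear_Algebra.orthogonal_def span_base)
  then have "x - proj_compl L x \<in> L \<and> (\<forall>z\<in>L. inner (entries (proj_compl L x)) (entries z) = 0)"
    unfolding proj_compl_def by (rule someI_ex)
  then show "x - proj_compl L x \<in> L" "z \<in> L \<Longrightarrow> inner (entries (proj_compl L x)) (entries z) = 0" by auto
qed

lemma proj_compl_unique:
  assumes L: "Real_Vector_Spaces.subspace (entries ` L)" and y: "x - y \<in> L" "\<And>z. z \<in> L \<Longrightarrow> inner (entries y) (entries z) = 0"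
  shows "proj_compl L x = y"
proof -
  have "entries (x - y) - entries (x - proj_compl L x) \<in> entries ` L"
    using subspace_diff[OF L] y(1) proj_compl(1)[OF L] by blast
  then have "entries (proj_compl L x - y) \<in> entries ` L" by simp
  then have d: "proj_compl L x - y \<in> L" by (simp only: entries_mem_iff)
  have "inner (entries (proj_compl L x - y)) (entries (proj_compl L x - y)) = 0"
    using proj_compl(2)[OF L d, of x] y(2)[OF d] by (simp add: inner_diff_left)
  then show ?thesis by (metis entries_inject entries_simps(4) inner_eq_zero_iff right_minus_eq)
qed

definition skew_compl :: "('a::rc_field, 'n::finite) cmat set \<Rightarrow> ('a, 'n) cmat set" where
  "skew_compl L = {x. skewadj x \<and> (\<forall>z\<in>L. inner (entries x) (entries z) = 0)}"

lemma skew_compl_entries: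
  "entries ` skew_compl L = {y \<in> entries ` {x. skewadj x}. \<forall>x\<in>entries ` L. Linear_Algebra.orthogonal x y}"
  by (auto simp: skew_compl_def Linear_Algebra.orthogonal_def inner_commute)

lemma dim_skew_compl:
  fixes L :: "('a::rc_field, 'n::finite) cmat set"
  assumes L: "Real_Vector_Spaces.subspace (entries ` L)" and sk: "\<And>x. x \<in> L \<Longrightarrow> skewadj x"
  shows "dim (entries ` skew_compl L) + dim (entries ` L) = dim (entries ` {x :: ('a, 'n) cmat. skewadj x})"
  unfolding skew_compl_entries
  by (rule dim_subspace_orthogonal_to_vectors) (use L sk subspace_skewadj in auto)

lemma subspace_skew_compl: "Real_Vector_Spaces.subspace (entries ` skew_compl L)"
proof -
  have "Real_Vector_Spaces.subspace (skew_compl L)"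
    by (auto simp: real_vector.subspace_def skew_compl_def inner_add_left)
  then show ?thesis by (rule linear_subspace_image[OF linear_entries])
qed

section \<open>Covering estimates for a subgroup with a given projection \<open>Q\<close>\<close>

lemma unitary_subgroup_intro:
  assumes G: "metric_unitary_group G rho" and HG: "H \<subseteq> G"
    and H: "1 \<in> H" "\<And>u v. u \<in> H \<Longrightarrow> v \<in> H \<Longrightarrow> u * v \<in> H" "\<And>u. u \<in> H \<Longrightarrow> star u \<in> H"
    and L: "Real_Vector_Spaces.subspace (entries ` lie_set H)"
    and \<kappa>: "\<And>x. skewadj x \<Longrightarrow> \<alpha> * norm (proj_compl (lie_set H) x) \<le> norm x" and \<alpha>: "0 < \<alpha>" "\<alpha> \<le> 1/2"
  shows "unitary_subgroup G rho H (skew_compl (lie_set H)) (proj_compl (lie_set H)) \<alpha>"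
proof (intro unitary_subgroup.intro unitary_subgroup_axioms.intro)
  let ?L = "lie_set H" and ?P = "proj_compl (lie_set H)"
  note P = proj_compl[OF L]
  have Lsk: "x \<in> ?L \<Longrightarrow> skewadj x" for x by (simp add: lie_set_def)
  show "x \<in> skew_compl ?L \<Longrightarrow> skewadj x" for x by (simp add: skew_compl_def)
  show "x \<in> skew_compl ?L \<Longrightarrow> r *\<^sub>R x \<in> skew_compl ?L" for x r by (auto simp: skew_compl_def)
  show "?P x \<in> skew_compl ?L" if x: "skewadj x" for x
  proof -
    have "skewadj (x - (x - ?P x))" using x Lsk[OF P(1)] by (rule skewadj_diff)
    then show ?thesis using P(2) by (simp add: skew_compl_def)
  qed
  show "x - ?P x \<in> ?L" if "skewadj x" for x by (rule P)
  show "?P (x - y) = ?P x - ?P y" for x y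
  proof (rule proj_compl_unique[OF L])
    have "entries (x - ?P x) - entries (y - ?P y) \<in> entries ` ?L" using subspace_diff[OF L] P(1) by blast
    then have "entries (x - y - (?P x - ?P y)) \<in> entries ` ?L" by (simp add: algebra_simps)
    then show "x - y - (?P x - ?P y) \<in> ?L" by (simp only: entries_mem_iff)
    show "inner (entries (?P x - ?P y)) (entries z) = 0" if "z \<in> ?L" for z
      using P(2)[OF that] by (simp add: inner_diff_left)
  qed
  have z: "0 \<in> ?L" using H(1) by (simp add: lie_set_def)
  show "?P x = x" if "x \<in> skew_compl ?L" for x
    by (rule proj_compl_unique[OF L]) (use that z in \<open>auto simp: skew_compl_def\<close>)
  show "?P x = 0" if "x \<in> ?L" for x
    by (rule proj_compl_unique[OF L]) (use that in auto)
qed (use assms in auto)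

text \<open>\<open>J\<close> compares the dimension of the space of the matrices
  \<open>M * Q\<close> with \<open>d\<close>. The coarse net has at most
  \<open>(1 + 1200 / \<alpha>\<^sup>2) ^ (J * d)\<close> points, and this exponential in
  \<open>d\<close> is absorbed into the upper constant.\<close>

theorem homogeneous_space_entropy:
  fixes G H :: "('a::rc_field, 'n::finite) cmat set"
  assumes G: "metric_unitary_group G rho" and HG: "H \<subseteq> G"
    and H: "1 \<in> H" "\<And>u v. u \<in> H \<Longrightarrow> v \<in> H \<Longrightarrow> u * v \<in> H" "\<And>u. u \<in> H \<Longrightarrow> star u \<in> H"
    and L: "Real_Vector_Spaces.subspace (entries ` lie_set H)"
    and \<kappa>: "\<And>x. skewadj x \<Longrightarrow> \<alpha> * norm (proj_compl (lie_set H) x) \<le> norm x" and \<alpha>: "0 < \<alpha>" "\<alpha> \<le> 1/2"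
    and woven: "\<And>u. u \<in> H \<Longrightarrow> rho u 1 \<le> \<alpha> / 2 \<Longrightarrow> \<exists>z\<in>lie_set H. norm z < pi \<and> u = exp z"
    and Pi: "star Q = Q" "Q * Q = Q" and fix_in_H: "\<And>p. p \<in> G \<Longrightarrow> p * Q = Q \<Longrightarrow> Q * p = Q \<Longrightarrow> p \<in> H"
    and d: "d = dim (entries ` {x :: ('a, 'n) cmat. skewadj x}) - dim (entries ` lie_set H)"
    and J: "dim (range (\<lambda>M. entries (M * Q))) \<le> J * d" and e: "0 < e" "e \<le> 65"
  shows "\<And>S. finite S \<Longrightarrow> (\<And>g. g \<in> G \<Longrightarrow> \<exists>s\<in>S. \<exists>h\<in>H. norm (g * h - s) < e) \<Longrightarrow>
      (\<alpha>\<^sup>2 / 2560 / e) ^ d \<le> real (card S)"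
    "\<exists>S. finite S \<and> S \<subseteq> G \<and> real (card S) \<le> (260 * (1 + 1200 / \<alpha>\<^sup>2) ^ J / e) ^ d \<and>
      (\<forall>g\<in>G. \<exists>s\<in>S. \<exists>h\<in>H. rho s (g * h) < e)"
proof -
  let ?L = "lie_set H"
  interpret unitary_subgroup G rho H "skew_compl ?L" "proj_compl ?L" \<alpha>
    by (rule unitary_subgroup_intro) (use assms in auto)
  have sk: "x \<in> ?L \<Longrightarrow> skewadj x" for x by (simp add: lie_set_def)
  have dX0: "dim (entries ` skew_compl ?L) + dim (entries ` ?L) = dim (entries ` {x :: ('a, 'n) cmat. skewadj x})"
    by (rule dim_skew_compl[OF L sk])
  have dX: "dim (entries ` skew_compl ?L) = d" unfolding d by (rule add_implies_diff[OF dX0])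
  obtain b R0 where b: "coordinate_system b d R0" "range (coordinate_system.comb b d) = of_entries ` entries ` skew_compl ?L"
    using coordinate_system_exists[OF subspace_skew_compl[of ?L]] dX by metis
  have X: "skew_compl ?L = range (coordinate_system.comb b d)" unfolding b(2) by (simp add: image_image entries_inverse)
  show "(\<alpha>\<^sup>2 / 2560 / e) ^ d \<le> real (card S)"
    if S: "finite S" "\<And>g. g \<in> G \<Longrightarrow> \<exists>s\<in>S. \<exists>h\<in>H. norm (g * h - s) < e" for S
  proof (cases "e \<le> \<alpha> / 160")
    case True
    show ?thesis by (rule covering_lower_bound[OF b(1) X woven S(1) e(1) True S(2)])
  next
    \<comment> \<open>Beyond the range of \<open>covering_lower_bound\<close> the left-hand side is
      at most 1, since \<open>\<alpha>\<^sup>2 / 2560 \<le> \<alpha> / 160\<close>.\<close>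
    case False
    have "\<alpha>\<^sup>2 / 2560 / e \<le> 1"
    proof -
      have "\<alpha>\<^sup>2 / 2560 \<le> \<alpha> / 160" using \<alpha> mult_right_mono[of \<alpha> 16 \<alpha>] by (simp add: power2_eq_square)
      then show ?thesis using False e by (simp add: divide_le_eq)
    qed
    then have "(\<alpha>\<^sup>2 / 2560 / e) ^ d \<le> 1" using e by (intro power_le_one) auto
    also have "1 \<le> real (card S)"
    proof -
      have "S \<noteq> {}" using S(2)[OF G_one] by blast
      then show ?thesis using S(1) by (simp add: Suc_le_eq card_gt_0_iff)
    qed
    finally show ?thesis by simp
  qed
  show "\<exists>S. finite S \<and> S \<subseteq> G \<and> real (card S) \<le> (260 * (1 + 1200 / \<alpha>\<^sup>2) ^ J / e) ^ d \<and>
      (\<forall>g\<in>G. \<exists>s\<in>S. \<exists>h\<in>H. rho s (g * h) < e)"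
  proof -
    let ?W = "range (\<lambda>M. entries (M * Q))"
    have "linear (\<lambda>M. entries (M * Q))"
      by (rule linearI) (simp_all add: distrib_right)
    then have W: "Real_Vector_Spaces.subspace ?W" by (intro linear_subspace_image) auto
    obtain b' R' where b': "coordinate_system b' (dim ?W) R'" "range (coordinate_system.comb b' (dim ?W)) = of_entries ` ?W"
      using coordinate_system_exists[OF W] by blast
    have rng: "M * Q \<in> range (coordinate_system.comb b' (dim ?W))" for M
      unfolding b'(2) by (simp add: image_image entries_inverse)
    obtain S0 where S0: "finite S0" "S0 \<subseteq> G" "real (card S0) \<le> (1 + 1200 / \<alpha>\<^sup>2) ^ dim ?W"
      "\<And>g. g \<in> G \<Longrightarrow> \<exists>s\<in>S0. \<exists>h\<in>H. norm (g * h - s) \<le> \<alpha>\<^sup>2 / 60"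
      using coarse_net[OF Pi fix_in_H b'(1) rng] by blast
    let ?C = "(1 + 1200 / \<alpha>\<^sup>2) ^ J"
    have C1: "1 \<le> 1 + 1200 / \<alpha>\<^sup>2" by simp
    have "real (card S0) \<le> (1 + 1200 / \<alpha>\<^sup>2) ^ (J * d)"
      using S0(3) power_increasing[OF J C1] by linarith
    then have cS0: "real (card S0) \<le> ?C ^ d" by (simp add: power_mult)
    \<comment> \<open>The fine net is built for radii up to 1/2. For larger \<open>e\<close> one has
      \<open>2 / e' = 4\<close>, and \<open>4 \<le> 260 / e\<close> because
      \<open>e \<le> 65\<close>.\<close>
    define e' where "e' = min e (1/2)"
    have e': "0 < e'" "e' \<le> 1/2" "e' \<le> e" using e by (auto simp: e'_def)
    obtain S where S: "finite S" "S \<subseteq> G" "real (card S) \<le> real (card S0) * (2 / e') ^ d"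
      "\<And>g. g \<in> G \<Longrightarrow> \<exists>s\<in>S. \<exists>h\<in>H. rho s (g * h) < e'"
      using covering_upper_bound_from_net[OF b(1) X S0(1,2,4) e'(1,2)] by blast
    have "2 / e' \<le> 260 / e" using e by (auto simp: e'_def min_def field_simps)
    then have "(2 / e') ^ d \<le> (260 / e) ^ d" using e' by (intro power_mono) auto
    then have "real (card S) \<le> ?C ^ d * (260 / e) ^ d"
      using S(3) cS0 e e' by (meson mult_mono order_trans zero_le_power divide_nonneg_pos less_imp_le of_nat_0_le_iff zero_le_numeral)
    also have "\<dots> = (260 * ?C / e) ^ d" by (simp add: mult.commute flip: power_mult_distrib)
    finally have "real (card S) \<le> (260 * ?C / e) ^ d" .
    moreover have "\<forall>g\<in>G. \<exists>s\<in>S. \<exists>h\<in>H. rho s (g * h) < e" using S(4) e'(3) by (meson less_le_trans)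
    ultimately show ?thesis using S(1,2) by blast
  qed
qed

section \<open>Matrices indexed by numbers and by a finite type\<close>

text \<open>An arbitrary enumeration of the index type; it identifies the matrices of size
  \<open>CARD('n)\<close> indexed by numbers with those of type \<open>cmat\<close>.\<close>

definition ix :: "'n::finite \<Rightarrow> nat" where
  "ix = (SOME f. bij_betw f UNIV {..<CARD('n)})"

lemma bij_ix: "bij_betw (ix :: 'n::finite \<Rightarrow> nat) UNIV {..<CARD('n)}"
proof -
  obtain h :: "'n \<Rightarrow> nat" where "bij_betw h UNIV {0..<CARD('n)}"
    using ex_bij_betw_finite_nat[OF finite] by blast
  then have "\<exists>f :: 'n \<Rightarrow> nat. bij_betw f UNIV {..<CARD('n)}" by (auto simp: atLeast0LessThan)
  then show ?thesis unfolding ix_def by (rule someI_ex)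
qed

lemma ix_less [simp]: "ix (i::'n::finite) < CARD('n)"
  using bij_betwE[OF bij_ix] by auto

lemma inj_ix: "inj ix"
  using bij_ix by (rule bij_betw_imp_inj_on)

lemma ix_eq_iff [simp]: "ix i = ix j \<longleftrightarrow> i = j"
  using inj_ix by (rule inj_eq)

lemma inv_ix [simp]: "inv_into UNIV ix (ix i) = i"
  by (rule inv_f_f[OF inj_ix])

lemma ix_cases: assumes "k < CARD('n)" obtains i :: "'n::finite" where "k = ix i"
proof -
  have "k \<in> range (ix :: 'n \<Rightarrow> nat)" using bij_betw_imp_surj_on[OF bij_ix] assms by blast
  then show ?thesis using that by blast
qed

lemma sum_ix: "(\<Sum>i\<in>UNIV. f (ix (i::'n::finite))) = (\<Sum>k<CARD('n). f k)"
  by (rule sum.reindex_bij_betw[OF bij_ix])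

definition toV :: "'a::rc_field Matrix.vec \<Rightarrow> 'a^'n::finite" where
  "toV v = vec_lambda (\<lambda>i. vec_index v (ix i))"

definition fromV :: "'a::rc_field^'n::finite \<Rightarrow> 'a Matrix.vec" where
  "fromV x = Matrix.vec CARD('n) (\<lambda>i. vec_nth x (inv_into UNIV ix i))"

definition toM :: "'a::rc_field Matrix.mat \<Rightarrow> ('a, 'n::finite) cmat" where
  "toM A = of_entries (vec_lambda (\<lambda>i. vec_lambda (\<lambda>j. A $$ (ix i, ix j))))"

definition fromM :: "('a::rc_field, 'n::finite) cmat \<Rightarrow> 'a Matrix.mat" where
  "fromM M = Matrix.mat CARD('n) CARD('n) (\<lambda>(i, j). vec_nth (vec_nth (entries M) (inv_into UNIV ix i)) (inv_into UNIV ix j))"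

definition entry :: "('a::rc_field, 'n::finite) cmat \<Rightarrow> 'n \<Rightarrow> 'n \<Rightarrow> 'a" where
  "entry M i j = vec_nth (vec_nth (entries M) i) j"

lemma toV_nth [simp]: "vec_nth (toV v) i = vec_index v (ix i)"
  by (simp add: toV_def)

lemma entry_toM [simp]: "entry (toM A) i j = A $$ (ix i, ix j)"
  by (simp add: entry_def toM_def of_entries_inverse)

lemma entry_eqI: "(\<And>i j. entry A i j = entry B i j) \<Longrightarrow> A = B"
  unfolding entry_def
  by (subst entries_inject[symmetric]) (simp add: Finite_Cartesian_Product.vec_eq_iff)

lemma entry_simps:
  "entry (A + B) i j = entry A i j + entry B i j" "entry (A - B) i j = entry A i j - entry B i j"
  "entry (- A) i j = - entry A i j" "entry (r *\<^sub>R A) i j = r *\<^sub>R entry A i j" "entry 0 i j = 0"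
  "entry 1 i j = (if i = j then 1 else 0)" "entry (A * B) i j = (\<Sum>k\<in>UNIV. entry A i k * entry B k j)"
  "entry (star A) i j = conjugate (entry A j i)"
  unfolding entry_def
  by (transfer; simp add: Finite_Cartesian_Product.mat_def matrix_matrix_mult_def)+

lemma bounded_linear_entry: "bounded_linear (\<lambda>A. entry A i j)"
  using norm_entry_le[folded entry_def] by (intro bounded_linear_intro[where K=1]) (auto simp: entry_simps)

lemma fromM_carrier [simp]: "fromM (M :: ('a::rc_field, 'n::finite) cmat) \<in> carrier_mat CARD('n) CARD('n)"
  by (simp add: fromM_def)

lemma fromM_index: "fromM (M :: ('a::rc_field, 'n::finite) cmat) $$ (ix i, ix j) = entry M i j"
  by (simp add: fromM_def entry_def)

lemma toM_fromM [simp]: "toM (fromM M) = M"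
  by (rule entry_eqI) (simp add: fromM_index)

lemma index_mat_eqI:
  assumes "A \<in> carrier_mat CARD('n) CARD('n)" "B \<in> carrier_mat CARD('n) CARD('n)"
    and "\<And>(i::'n::finite) (j::'n). A $$ (ix i, ix j) = B $$ (ix i, ix j)"
  shows "A = B"
proof (rule eq_matI)
  fix i j assume "i < dim_row B" "j < dim_col B"
  then obtain k l :: 'n where "i = ix k" "j = ix l" using assms(2) by (metis carrier_matD ix_cases)
  then show "A $$ (i, j) = B $$ (i, j)" using assms(3)[of k l] by simp
qed (use assms in auto)

lemma fromM_toM: "A \<in> carrier_mat CARD('n) CARD('n) \<Longrightarrow> fromM (toM A :: ('a::rc_field, 'n::finite) cmat) = A"
  by (rule index_mat_eqI[where 'n='n]) (auto simp: fromM_index)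

lemma toM_inject:
  "A \<in> carrier_mat CARD('n) CARD('n) \<Longrightarrow> B \<in> carrier_mat CARD('n) CARD('n) \<Longrightarrow>
    (toM A :: ('a::rc_field, 'n::finite) cmat) = toM B \<longleftrightarrow> A = B"
  by (metis fromM_toM)

context
  fixes A :: "'a::rc_field Matrix.mat"
  assumes A: "A \<in> carrier_mat CARD('n::finite) CARD('n)"
begin

lemma toM_uminus: "(toM (- A) :: ('a, 'n) cmat) = - toM A"
  by (rule entry_eqI) (use A in \<open>simp add: entry_simps\<close>)

lemma toM_smult: "(toM (of_real r \<cdot>\<^sub>m A) :: ('a, 'n) cmat) = r *\<^sub>R toM A"
  by (rule entry_eqI) (use A in \<open>simp add: entry_simps scaleR_conv_of_real[where 'a='a]\<close>)

lemma toM_adjoint: "(toM (mat_adjoint A) :: ('a, 'n) cmat) = star (toM A)"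
  by (rule entry_eqI) (use A in \<open>simp add: entry_simps mat_adjoint_def mat_of_rows_index\<close>)

lemma toV_mult:
  assumes v: "v \<in> carrier_vec CARD('n)"
  shows "toV (A *\<^sub>v v) = mapp (toM A :: ('a, 'n) cmat) (toV v)"
proof -
  have "mapp M x = vec_lambda (\<lambda>i. \<Sum>j\<in>UNIV. entry M i j * vec_nth x j)" for M :: "('a, 'n) cmat" and x
    unfolding entry_def by transfer (simp add: matrix_vector_mult_def)
  then show ?thesis using A v
    by (simp add: Finite_Cartesian_Product.vec_eq_iff scalar_prod_def atLeast0LessThan sum_ix[of "\<lambda>k. A $$ (_, k) * vec_index v k"])
qed

lemma toM_power: "(toM (A ^\<^sub>m k) :: ('a, 'n) cmat) = toM A ^ k"
proof (induction k)
  case 0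
  have "dim_row A = CARD('n)" using A by simp
  then show ?case by (intro entry_eqI) (simp add: entry_simps)
next
  case (Suc k)
  have "(toM (A ^\<^sub>m k * A) :: ('a, 'n) cmat) = toM (A ^\<^sub>m k) * toM A"
    by (rule entry_eqI)
      (use A pow_carrier_mat[OF A, of k] in \<open>simp add: entry_simps scalar_prod_def atLeast0LessThan sum_ix[of "\<lambda>l. (A ^\<^sub>m k) $$ (_, l) * A $$ (l, _)"]\<close>)
  then show ?case using Suc by (simp add: power_Suc2 del: power_Suc)
qed

end

lemma adjoint_carrier: "A \<in> carrier_mat m n \<Longrightarrow> mat_adjoint A \<in> carrier_mat n m"
  by (auto simp: mat_adjoint_def mat_of_rows_def)

context
  fixes A B :: "'a::rc_field Matrix.mat"
  assumes A: "A \<in> carrier_mat CARD('n::finite) CARD('n)" and B: "B \<in> carrier_mat CARD('n) CARD('n)"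
begin

lemma toM_add: "(toM (A + B) :: ('a, 'n) cmat) = toM A + toM B"
  by (rule entry_eqI) (use A B in \<open>simp add: entry_simps\<close>)

lemma toM_diff: "(toM (A - B) :: ('a, 'n) cmat) = toM A - toM B"
  by (rule entry_eqI) (use A B in \<open>simp add: entry_simps\<close>)

lemma toM_mult: "(toM (A * B) :: ('a, 'n) cmat) = toM A * toM B"
  by (rule entry_eqI)
    (use A B in \<open>simp add: entry_simps scalar_prod_def atLeast0LessThan sum_ix[of "\<lambda>k. A $$ (_, k) * B $$ (k, _)"]\<close>)

end

context
  fixes v :: "'a::rc_field Matrix.vec"
  assumes v: "v \<in> carrier_vec CARD('n::finite)"
begin

lemma toV_add: "w \<in> carrier_vec CARD('n) \<Longrightarrow> (toV (v + w) :: 'a^'n) = toV v + toV w"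
  using v by (simp add: Finite_Cartesian_Product.vec_eq_iff)

lemma toV_smult: "(toV (c \<cdot>\<^sub>v v) :: 'a^'n) = c *s toV v"
  using v by (simp add: Finite_Cartesian_Product.vec_eq_iff)

lemma norm_toV: "norm (toV v :: 'a^'n) = vnorm v"
  using v by (simp add: norm_vec_def vnorm_def L2_set_def sum_ix[of "\<lambda>k. (norm (vec_index v k))\<^sup>2"])

end

lemma toM_one [simp]: "(toM (1\<^sub>m CARD('n)) :: ('a::rc_field, 'n::finite) cmat) = 1"
  by (rule entry_eqI) (simp add: entry_simps)

lemma toM_zero [simp]: "(toM (0\<^sub>m CARD('n) CARD('n)) :: ('a::rc_field, 'n::finite) cmat) = 0"
  by (rule entry_eqI) (simp add: entry_simps)

lemma fromV_carrier [simp]: "fromV (x :: 'a::rc_field^'n::finite) \<in> carrier_vec CARD('n)"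
  by (simp add: fromV_def)

lemma toV_fromV [simp]: "toV (fromV x) = x"
  by (simp add: Finite_Cartesian_Product.vec_eq_iff fromV_def)

lemma toV_inject:
  assumes "v \<in> carrier_vec CARD('n)" "w \<in> carrier_vec CARD('n)" "(toV v :: 'a::rc_field^'n::finite) = toV w"
  shows "v = w"
proof (rule eq_vecI)
  fix i assume "i < dim_vec w"
  then obtain k :: 'n where "i = ix k" using assms(2) by (metis carrier_vecD ix_cases)
  then show "vec_index v i = vec_index w i" using assms(3) by (metis toV_nth)
qed (use assms in auto)

section \<open>Norm, exponential, inner product, Lie algebra and topology in both pictures\<close>

lemma opnorm_eq_norm:
  assumes A: "A \<in> carrier_mat CARD('n) CARD('n)"
  shows "opnorm A = norm (toM A :: ('a::rc_field, 'n::finite) cmat)"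
proof -
  let ?M = "toM A :: ('a, 'n) cmat"
  let ?X = "{x \<in> carrier_vec (dim_col A). vnorm x \<le> 1}"
  have X: "x \<in> ?X \<longleftrightarrow> x \<in> carrier_vec CARD('n) \<and> norm (toV x :: 'a^'n) \<le> 1" for x
    using A norm_toV[of x, where 'n='n] by auto
  have val: "vnorm (A *\<^sub>v x) = norm (mapp ?M (toV x))" if "x \<in> ?X" for x
  proof -
    have x: "x \<in> carrier_vec CARD('n)" using that X by blast
    show ?thesis using norm_toV[of "A *\<^sub>v x", where 'n='n] toV_mult[OF A x] A x by (metis mult_mat_vec_carrier)
  qed
  have up: "vnorm (A *\<^sub>v x) \<le> norm ?M" if "x \<in> ?X" for x
  proof -
    have "norm (mapp ?M (toV x)) \<le> norm ?M * 1"
      using that X by (intro order_trans[OF norm_mapp_le] mult_left_mono) auto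
    then show ?thesis using val[OF that] by simp
  qed
  have bdd: "bdd_above ((\<lambda>x. vnorm (A *\<^sub>v x)) ` ?X)" using up by (intro bdd_aboveI2) auto
  have zero: "fromV (0 :: 'a^'n) \<in> ?X" by (simp add: X del: mem_Collect_eq)
  have "opnorm A \<le> norm ?M" unfolding opnorm_def by (rule cSUP_least) (use zero up in auto)
  moreover have "norm ?M \<le> opnorm A"
  proof (rule norm_cmat_leI)
    fix x :: "'a^'n"
    show "norm (mapp ?M x) \<le> opnorm A * norm x"
    proof (cases "x = 0")
      case False
      let ?y = "(1 / norm x) *\<^sub>R x"
      have y: "fromV ?y \<in> ?X" using False by (simp add: X del: mem_Collect_eq)
      have "norm (mapp ?M ?y) \<le> opnorm A"
        using cSUP_upper[OF y bdd] val[OF y] by (simp add: opnorm_def)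
      moreover have "mapp ?M ?y = (1 / norm x) *\<^sub>R mapp ?M x"
        by (rule linear_scale[OF bounded_linear.linear[OF bounded_linear_mapp]])
      ultimately show ?thesis using False by (simp add: field_simps)
    qed simp
  qed
  ultimately show ?thesis by simp
qed

text \<open>Taking an entry is a bounded linear map, so the entries of the norm-convergent series
  are the sums of the entries.\<close>

lemma toM_mat_exp:
  assumes A: "A \<in> carrier_mat CARD('n) CARD('n)"
  shows "toM (mat_exp A) = exp (toM A :: ('a::rc_field, 'n::finite) cmat)"
proof (rule entry_eqI)
  fix i j :: 'n
  let ?M = "toM A :: ('a, 'n) cmat"
  have "(\<lambda>k. entry (?M ^ k /\<^sub>R fact k) i j) sums entry (exp ?M) i j"
    by (rule bounded_linear.sums[OF bounded_linear_entry exp_converges])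
  moreover have "entry (?M ^ k /\<^sub>R fact k) i j = (A ^\<^sub>m k) $$ (ix i, ix j) / fact k" for k
    unfolding toM_power[OF A, symmetric]
    by (simp add: entry_simps scaleR_conv_of_real[where 'a='a] divide_inverse mult.commute)
  ultimately show "entry (toM (mat_exp A)) i j = entry (exp ?M) i j"
    using A by (simp add: mat_exp_def sums_iff)
qed

lemma mat_exp_carrier: "A \<in> carrier_mat n n \<Longrightarrow> mat_exp A \<in> carrier_mat n n"
  by (simp add: mat_exp_def)

text \<open>Orthogonality, complements and projections may therefore be treated in the Euclidean
  space of the entries.\<close>

lemma hs_inner_eq:
  assumes A: "A \<in> carrier_mat CARD('n) CARD('n)" and B: "B \<in> carrier_mat CARD('n) CARD('n)"
  shows "hs_inner A B = inner (entries (toM A :: ('a::rc_field, 'n::finite) cmat)) (entries (toM B :: ('a, 'n) cmat))"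
proof -
  have "mat_trace (A * mat_adjoint B) = (\<Sum>i<CARD('n). \<Sum>k<CARD('n). A $$ (i, k) * conjugate (B $$ (i, k)))"
    unfolding mat_trace_def using A B adjoint_carrier[OF B]
    by (intro sum.cong) (auto simp: scalar_prod_def atLeast0LessThan mat_adjoint_def mat_of_rows_index intro!: sum.cong)
  also have "\<dots> = (\<Sum>i\<in>(UNIV::'n set). \<Sum>k\<in>(UNIV::'n set). A $$ (ix i, ix k) * conjugate (B $$ (ix i, ix k)))"
    by (simp add: sum_ix[of "\<lambda>k. A $$ (_, k) * conjugate (B $$ (_, k))"]
        sum_ix[of "\<lambda>i. \<Sum>k<CARD('n). A $$ (i, k) * conjugate (B $$ (i, k))"])
  finally have "hs_inner A B = (\<Sum>i\<in>(UNIV::'n set). \<Sum>k\<in>(UNIV::'n set). inner (A $$ (ix i, ix k)) (B $$ (ix i, ix k)))"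
    by (simp add: hs_inner_def inner_sum_left flip: inner_eq_mult_conjugate)
  moreover have "vec_nth (vec_nth (entries (toM C :: ('a, 'n) cmat)) i) j = C $$ (ix i, ix j)" for C i j
    using entry_toM[of C i j] by (simp only: entry_def)
  ultimately show ?thesis by (simp add: inner_vec_def)
qed

lemma toM_lie_algebra:
  fixes H :: "'a::rc_field Matrix.mat set"
  assumes H: "H \<subseteq> carrier_mat CARD('n) CARD('n)"
  shows "toM ` lie_algebra CARD('n) H = (lie_set (toM ` H) :: ('a, 'n::finite) cmat set)"
proof -
  have mem: "(toM A :: ('a, 'n) cmat) \<in> toM ` H \<longleftrightarrow> A \<in> H" if "A \<in> carrier_mat CARD('n) CARD('n)" for A
    using H that toM_inject[where 'n='n] by (metis (no_types, opaque_lifting) image_iff subset_iff)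
  have sk: "A \<in> skew CARD('n) \<longleftrightarrow> skewadj (toM A :: ('a, 'n) cmat)" if A: "A \<in> carrier_mat CARD('n) CARD('n)" for A
    using A toM_inject[where 'n='n, OF adjoint_carrier[OF A], of "- A"]
    by (simp add: skew_def skewadj_def toM_adjoint[OF A] toM_uminus[OF A])
  have iff: "A \<in> lie_algebra CARD('n) H \<longleftrightarrow> (toM A :: ('a, 'n) cmat) \<in> lie_set (toM ` H)"
    if A: "A \<in> carrier_mat CARD('n) CARD('n)" for A
  proof -
    have "mat_exp (of_real t \<cdot>\<^sub>m A) \<in> H \<longleftrightarrow> exp (t *\<^sub>R (toM A :: ('a, 'n) cmat)) \<in> toM ` H" for t
    proof -
      have c: "of_real t \<cdot>\<^sub>m A \<in> carrier_mat CARD('n) CARD('n)" using A by simp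
      show ?thesis using mem[OF mat_exp_carrier[OF c]] by (simp add: toM_mat_exp[OF c] toM_smult[OF A])
    qed
    then show ?thesis using sk[OF A] by (simp add: lie_algebra_def lie_set_def)
  qed
  show ?thesis
  proof (intro equalityI subsetI)
    fix x :: "('a, 'n) cmat" assume "x \<in> toM ` lie_algebra CARD('n) H"
    then show "x \<in> lie_set (toM ` H)" using iff by (auto simp: lie_algebra_def skew_def)
  next
    fix x :: "('a, 'n) cmat" assume "x \<in> lie_set (toM ` H)"
    then have "fromM x \<in> lie_algebra CARD('n) H" using iff[of "fromM x"] by simp
    then show "x \<in> toM ` lie_algebra CARD('n) H" by (intro image_eqI[of _ _ "fromM x"]) auto
  qed
qed

text \<open>The topology is that of the entries, so entrywise convergence suffices. Closedness is
  relative to \<open>G\<close>, whence the assumption on the limit.\<close>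

lemma closedin_limit:
  fixes H G :: "'a::rc_field Matrix.mat set"
  assumes cl: "closedin (subtopology (mat_topology CARD('n)) G) H"
    and G: "G \<subseteq> carrier_mat CARD('n) CARD('n)"
    and u: "\<And>j::nat. u j \<in> toM ` H" "u \<longlonglongrightarrow> (l :: ('a, 'n::finite) cmat)" and l: "l \<in> toM ` G"
  shows "l \<in> toM ` H"
proof -
  let ?n = "CARD('n)" and ?I = "{..<CARD('n)} \<times> {..<CARD('n)}"
  let ?f = "\<lambda>A :: 'a Matrix.mat. \<lambda>ij\<in>?I. A $$ ij"
  let ?T = "product_topology (\<lambda>_. euclidean :: 'a topology) ?I"
  obtain T where T: "closedin (mat_topology ?n) T" "H = T \<inter> G" using cl by (auto simp: closedin_subtopology)
  have HG: "H \<subseteq> carrier_mat ?n ?n" using T(2) G by blast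
  have lG: "fromM l \<in> G" using l G fromM_toM by force
  have uH: "fromM (u j) \<in> H" for j using u(1)[of j] HG fromM_toM by force
  have top: "topspace (mat_topology ?n) = carrier_mat ?n ?n"
    by (auto simp: mat_topology_def topspace_pullback_topology)
  obtain U where U: "openin ?T U" "carrier_mat ?n ?n - T = ?f -` U \<inter> carrier_mat ?n ?n"
    using T(1) unfolding closedin_def top by (auto simp: mat_topology_def openin_pullback_topology)
  have lim: "limitin ?T (\<lambda>j. ?f (fromM (u j))) (?f (fromM l)) sequentially"
    unfolding limitin_componentwise
  proof (intro conjI ballI)
    fix ij assume ij: "ij \<in> ?I"
    then obtain i j :: 'n where i: "ij = (ix i, ix j)" by (metis ix_cases lessThan_iff mem_Sigma_iff prod.collapse)
    have "(\<lambda>k. entry (u k) i j) \<longlonglongrightarrow> entry l i j"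
      by (rule bounded_linear.tendsto[OF bounded_linear_entry u(2)])
    then show "limitin euclidean (\<lambda>c. ?f (fromM (u c)) ij) (?f (fromM l) ij) sequentially"
      using ij by (simp add: i fromM_index)
  qed auto
  have "fromM l \<in> T"
  proof (rule ccontr)
    assume "fromM l \<notin> T"
    then have "fromM l \<in> carrier_mat ?n ?n - T" by simp
    then have "?f (fromM l) \<in> U" unfolding U(2) by simp
    then have "eventually (\<lambda>j. ?f (fromM (u j)) \<in> U) sequentially"
      using lim U(1) unfolding limitin_def by blast
    then obtain j where "?f (fromM (u j)) \<in> U" by (meson eventually_sequentially le_refl)
    then have "fromM (u j) \<in> ?f -` U \<inter> carrier_mat ?n ?n" by simp
    then have "fromM (u j) \<notin> T" unfolding U(2)[symmetric] by simp
    then show False using uH[of j] T(2) by blast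
  qed
  then have "fromM l \<in> H" using lG T(2) by blast
  then show ?thesis by (intro image_eqI[of _ _ "fromM l"]) auto
qed

section \<open>The intrinsic metric\<close>

lemma curve_deriv_carrier [simp]: "curve_deriv n \<gamma> t \<in> carrier_mat n n"
  by (simp add: curve_deriv_def)

lemma curve_length_nonneg:
  fixes \<gamma> :: "real \<Rightarrow> 'a::rc_field Matrix.mat"
  shows "0 \<le> curve_length CARD('n::finite) \<gamma>"
proof -
  have "0 \<le> opnorm (curve_deriv CARD('n) \<gamma> t)" for t
    using opnorm_eq_norm[OF curve_deriv_carrier, where 'n='n, of \<gamma> t] by simp
  then show ?thesis unfolding curve_length_def set_lebesgue_integral_def by (intro Bochner_Integration.integral_nonneg) auto
qed

text \<open>Enumerating a division turns it into a family of disjoint open intervals as in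
  \<open>abs_cont_curve\<close>. Passing from the operator norm to the Euclidean norm costs a factor
  \<open>B\<close>, which is compensated in the choice of \<delta>.\<close>

lemma ac_on_entries:
  fixes \<gamma> :: "real \<Rightarrow> 'a::rc_field Matrix.mat"
  assumes ac: "abs_cont_curve \<gamma>" and car: "\<And>t. t \<in> {0..1} \<Longrightarrow> \<gamma> t \<in> carrier_mat CARD('n::finite) CARD('n)"
  shows "ac_on 0 1 (\<lambda>t. entries (toM (\<gamma> t) :: ('a, 'n) cmat))"
  unfolding ac_on_def
proof (intro allI impI)
  fix e :: real assume e: "0 < e"
  let ?c = "\<lambda>t. entries (toM (\<gamma> t) :: ('a, 'n) cmat)"
  obtain B where B: "0 < B" "\<And>M :: ('a, 'n) cmat. norm (entries M) \<le> norm M * B"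
    using bounded_linear.pos_bounded[OF bounded_linear_entries] by blast
  have eB: "0 < e / B" using e B by simp
  obtain d where d: "d > 0" "\<forall>(m::nat) a b. (\<forall>i<m. 0 \<le> a i \<and> a i \<le> b i \<and> b i \<le> 1) \<and>
      disjoint_family_on (\<lambda>i. {a i<..<b i}) {..<m} \<and> (\<Sum>i<m. b i - a i) < d \<longrightarrow>
      (\<Sum>i<m. opnorm (\<gamma> (b i) - \<gamma> (a i))) < e / B"
    using ac[unfolded abs_cont_curve_def, THEN spec, of "e / B", THEN mp, OF eB] by (elim exE conjE)
  have "(\<Sum>K\<in>\<D>. norm (increment ?c K)) < e"
    if D: "\<D> division_of T" and T: "T \<subseteq> {0..1}" and s: "sum (measure lborel) \<D> < d" for \<D> T
  proof -
    have fin: "finite \<D>" using D by (rule division_of_finite)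
    obtain h where h: "bij_betw h {..<card \<D>} \<D>"
      using ex_bij_betw_nat_finite[OF fin] by (auto simp: atLeast0LessThan)
    define a where "a = (\<lambda>i. Inf (h i))"
    define b where "b = (\<lambda>i. Sup (h i))"
    have hD: "h i \<in> \<D>" if "i < card \<D>" for i using h that by (auto simp: bij_betw_def)
    have ab: "a i \<le> b i" "h i = {a i..b i}" "0 \<le> a i" "b i \<le> 1" if i: "i < card \<D>" for i
    proof -
      obtain u v where uv: "h i = cbox u v" using division_ofD(4)[OF D hD[OF i]] by blast
      have "h i \<noteq> {}" using division_ofD(3)[OF D hD[OF i]] .
      then have le: "u \<le> v" using uv by (simp add: box_real)
      then have "a i = u" "b i = v" using uv by (simp_all add: a_def b_def box_real)
      then show *: "a i \<le> b i" "h i = {a i..b i}" using le uv by (simp_all add: box_real)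
      have "h i \<subseteq> {0..1}" using division_ofD(2)[OF D hD[OF i]] T by blast
      then show "0 \<le> a i" "b i \<le> 1" using * by auto
    qed
    have "(\<Sum>i<card \<D>. b i - a i) = (\<Sum>i<card \<D>. measure lborel (h i))"
      by (intro sum.cong refl) (simp add: ab(1,2))
    also have "\<dots> = sum (measure lborel) \<D>" by (rule sum.reindex_bij_betw[OF h])
    finally have sd: "(\<Sum>i<card \<D>. b i - a i) < d" using s by simp
    have dj: "disjoint_family_on (\<lambda>i. {a i<..<b i}) {..<card \<D>}"
      unfolding disjoint_family_on_def
    proof (intro ballI impI)
      fix i j assume i: "i \<in> {..<card \<D>}" "j \<in> {..<card \<D>}" "i \<noteq> j"
      then have "h i \<noteq> h j" using h by (auto simp: bij_betw_def inj_on_def)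
      then have "interior (h i) \<inter> interior (h j) = {}"
        using division_ofD(5)[OF D hD hD] i by simp
      then show "{a i<..<b i} \<inter> {a j<..<b j} = {}" using ab(2)[of i] ab(2)[of j] i
        by (simp add: interior_atLeastAtMost_real)
    qed
    have "(\<Sum>K\<in>\<D>. norm (increment ?c K)) = (\<Sum>i<card \<D>. norm (increment ?c (h i)))"
      by (rule sum.reindex_bij_betw[OF h, symmetric])
    also have "\<dots> \<le> (\<Sum>i<card \<D>. opnorm (\<gamma> (b i) - \<gamma> (a i)) * B)"
    proof (rule sum_mono)
      fix i assume "i \<in> {..<card \<D>}"
      then have i: "i < card \<D>" by simp
      have c: "\<gamma> (b i) \<in> carrier_mat CARD('n) CARD('n)" "\<gamma> (a i) \<in> carrier_mat CARD('n) CARD('n)"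
        using ab(1,3,4)[OF i] by (auto intro!: car)
      have "increment ?c (h i) = entries (toM (\<gamma> (b i) - \<gamma> (a i)) :: ('a, 'n) cmat)"
        using ab(1,2)[OF i]
        by (simp add: toM_diff[OF c] linear_diff[OF bounded_linear.linear[OF bounded_linear_entries]])
      moreover have "opnorm (\<gamma> (b i) - \<gamma> (a i)) = norm (toM (\<gamma> (b i) - \<gamma> (a i)) :: ('a, 'n) cmat)"
        using c by (intro opnorm_eq_norm) auto
      ultimately show "norm (increment ?c (h i)) \<le> opnorm (\<gamma> (b i) - \<gamma> (a i)) * B" using B(2) by simp
    qed
    also have "\<dots> = (\<Sum>i<card \<D>. opnorm (\<gamma> (b i) - \<gamma> (a i))) * B" by (rule sum_distrib_right[symmetric])
    also have "\<dots> < e / B * B"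
      by (rule mult_strict_right_mono[OF d(2)[THEN spec, THEN spec, THEN spec, THEN mp]]) (use ab dj sd B in auto)
    finally show ?thesis using B by simp
  qed
  then show "\<exists>d>0. \<forall>\<D> T. \<D> division_of T \<longrightarrow> T \<subseteq> {0..1} \<longrightarrow> sum (measure lborel) \<D> < d \<longrightarrow>
      (\<Sum>K\<in>\<D>. norm (increment ?c K)) < e" using d(1) by blast
qed

text \<open>The derivative is integrable as a Euclidean vector, whose norm is not the operator norm.
  The integral estimate is therefore applied to the derivative evaluated at a vector
  \<open>x\<close> that attains the norm of \<open>?A\<close>; pointwise this is at most the
  operator norm of the derivative.\<close>

lemma norm_le_curve_length:
  fixes \<gamma> :: "real \<Rightarrow> 'a::rc_field Matrix.mat"
  assumes ac: "abs_cont_curve \<gamma>" and car: "\<And>t. t \<in> {0..1} \<Longrightarrow> \<gamma> t \<in> carrier_mat CARD('n::finite) CARD('n)"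
  shows "norm (toM (\<gamma> 1) - toM (\<gamma> 0) :: ('a, 'n) cmat) \<le> curve_length CARD('n) \<gamma>"
proof -
  let ?c = "\<lambda>t. entries (toM (\<gamma> t) :: ('a, 'n) cmat)"
  let ?A = "toM (\<gamma> 1) - toM (\<gamma> 0) :: ('a, 'n) cmat"
  have ace: "ac_on 0 1 ?c" by (rule ac_on_entries[OF ac]) (rule car)
  obtain N g where N: "negligible N" and der: "\<And>t. t \<in> {0..1} - N \<Longrightarrow> (?c has_vector_derivative g t) (at t)"
    and ai: "g absolutely_integrable_on {0..1}" and int: "integral {0..1} g = ?c 1 - ?c 0"
    by (rule ac_on_absolutely_integrable_derivative[of 0 1 ?c, OF ace]) auto
  \<comment> \<open>Two forms of the speed: \<open>?h\<close> is accessible to measurability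
    arguments, \<open>?k\<close> is the integrand of \<open>curve_length\<close>. They agree on
    \<open>{0..1}\<close> off a null set.\<close>
  let ?h = "\<lambda>t. norm (of_entries (g t))" and ?k = "\<lambda>t. opnorm (curve_deriv CARD('n) \<gamma> t)"
  obtain B where B: "\<And>E :: 'a^'n^'n. norm (of_entries E) \<le> norm E * B"
    using bounded_linear.pos_bounded[OF bounded_linear_of_entries] by blast
  have kh: "?k t = ?h t" if t: "t \<in> {0..1} - N" for t
  proof -
    have "toM (curve_deriv CARD('n) \<gamma> t) = of_entries (g t)"
    proof (rule entry_eqI)
      fix i j :: 'n
      have bl: "bounded_linear (\<lambda>E :: 'a^'n^'n. vec_nth (vec_nth E i) j)"
        by (rule bounded_linear_compose[OF bounded_linear_vec_nth bounded_linear_vec_nth])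
      have "((\<lambda>t. vec_nth (vec_nth (?c t) i) j) has_vector_derivative vec_nth (vec_nth (g t) i) j) (at t)"
        by (rule bounded_linear.has_vector_derivative[OF bl der[OF t]])
      then have "((\<lambda>s. \<gamma> s $$ (ix i, ix j)) has_vector_derivative vec_nth (vec_nth (g t) i) j) (at t)"
        by (simp add: entry_toM[unfolded entry_def])
      then show "entry (toM (curve_deriv CARD('n) \<gamma> t)) i j = entry (of_entries (g t)) i j"
        by (simp add: curve_deriv_def vector_derivative_at) (simp add: entry_def of_entries_inverse)
    qed
    then show ?thesis using opnorm_eq_norm[OF curve_deriv_carrier, where 'n='n, of \<gamma> t] by simp
  qed
  have meas: "?h \<in> borel_measurable (lebesgue_on {0..1})"
  proof -
    have "g \<in> borel_measurable (lebesgue_on {0..1})"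
      using ai by (intro integrable_imp_measurable set_lebesgue_integral_eq_integral(1))
    moreover have "(\<lambda>E :: 'a^'n^'n. norm (of_entries E)) \<in> borel_measurable borel"
      by (intro borel_measurable_continuous_onI continuous_on_norm linear_continuous_on bounded_linear_of_entries)
    ultimately show ?thesis by (rule measurable_compose)
  qed
  have hai: "?h absolutely_integrable_on {0..1}"
  proof (rule measurable_bounded_by_integrable_imp_absolutely_integrable[OF meas])
    have "(\<lambda>t. norm (g t)) integrable_on {0..1}"
      using absolutely_integrable_norm[OF ai] set_lebesgue_integral_eq_integral(1) by (auto simp: o_def)
    then show "(\<lambda>t. norm (g t) * B) integrable_on {0..1}" by (rule integrable_on_mult_left)
    show "norm (?h t) \<le> norm (g t) * B" for t using B by simp
  qed simp
  have kai: "?k absolutely_integrable_on {0..1}"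
    by (rule absolutely_integrable_spike[OF hai N]) (use kh in auto)
  have "curve_length CARD('n) \<gamma> = integral {0..1} ?k"
    unfolding curve_length_def by (rule set_lebesgue_integral_eq_integral(2)[OF kai])
  also have "\<dots> = integral {0..1} ?h" by (rule integral_spike[OF N]) (use kh in auto)
  finally have len: "curve_length CARD('n) \<gamma> = integral {0..1} ?h" .
  obtain x where x: "norm x = 1" "norm (mapp ?A x) = norm ?A" using norm_cmat_attained by blast
  have bl: "bounded_linear (\<lambda>E :: 'a^'n^'n. mapp (of_entries E) x)"
    by (rule bounded_linear_compose[OF bounded_bilinear.bounded_linear_left[OF bounded_bilinear_mapp] bounded_linear_of_entries])
  have gi: "g integrable_on {0..1}" using ai by (rule set_lebesgue_integral_eq_integral(1))
  have "integral {0..1} ((\<lambda>E. mapp (of_entries E) x) \<circ> g) = mapp (of_entries (integral {0..1} g)) x"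
    by (rule integral_linear[OF gi bl])
  also have "\<dots> = mapp ?A x"
    unfolding int
    by (simp add: linear_diff[OF bounded_linear.linear[OF bounded_linear_of_entries]] entries_inverse)
  finally have eq: "integral {0..1} ((\<lambda>E. mapp (of_entries E) x) \<circ> g) = mapp ?A x" .
  have "norm (integral {0..1} ((\<lambda>E. mapp (of_entries E) x) \<circ> g)) \<le> integral {0..1} ?h"
  proof (rule integral_norm_bound_integral)
    show "((\<lambda>E. mapp (of_entries E) x) \<circ> g) integrable_on {0..1}" by (rule integrable_linear[OF gi bl])
    show "?h integrable_on {0..1}" using hai by (rule set_lebesgue_integral_eq_integral(1))
    show "norm (((\<lambda>E. mapp (of_entries E) x) \<circ> g) t) \<le> ?h t" for t
      using norm_mapp_le[of "of_entries (g t)" x] x(1) by simp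
  qed
  then show ?thesis unfolding eq len using x(2) by simp
qed

section \<open>Upper bound for the intrinsic metric along exponential paths\<close>

definition cmat_dist :: "'a::rc_field Matrix.mat monoid \<Rightarrow> ('a, 'n::finite) cmat \<Rightarrow> ('a, 'n) cmat \<Rightarrow> real" where
  "cmat_dist Gr u v = group_dist CARD('n) Gr (fromM u) (fromM v)"

lemma lipschitz_curve:
  fixes F :: "real \<Rightarrow> ('a::rc_field, 'n::finite) cmat"
  assumes der: "\<And>t. (F has_vector_derivative F' t) (at t)" and K: "\<And>t. norm (F' t) \<le> K"
  shows "abs_cont_curve (\<lambda>t. fromM (F t))" "curve_length CARD('n) (\<lambda>t. fromM (F t)) \<le> K"
proof -
  have K0: "0 \<le> K" using K[of 0] norm_ge_zero order_trans by blast
  have lip: "norm (F b - F a) \<le> K * (b - a)" if "a \<le> b" for a b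
  proof -
    have "norm (F b - F a) \<le> K * norm (b - a)"
    proof (rule differentiable_bound[where S=UNIV and f'="\<lambda>t s. s *\<^sub>R F' t"])
      show "(F has_derivative (\<lambda>s. s *\<^sub>R F' t)) (at t within UNIV)" for t
        using der[of t] by (simp add: has_vector_derivative_def)
      show "onorm (\<lambda>s. s *\<^sub>R F' t) \<le> K" for t
        using mult_right_mono[OF K[of t] abs_ge_zero] by (intro onorm_le) (simp add: mult.commute)
    qed auto
    then show ?thesis using that by simp
  qed
  have op: "opnorm (fromM (F b) - fromM (F a)) = norm (F b - F a)" for a b
  proof -
    have c: "fromM (F b) - fromM (F a) \<in> carrier_mat CARD('n) CARD('n)" by (rule minus_carrier_mat) simp
    show ?thesis using opnorm_eq_norm[OF c] by (simp add: toM_diff[OF fromM_carrier fromM_carrier])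
  qed
  show "abs_cont_curve (\<lambda>t. fromM (F t))"
    unfolding abs_cont_curve_def op
  proof (intro allI impI)
    fix e :: real assume e: "0 < e"
    show "\<exists>\<delta>>0. \<forall>(m::nat) a b. (\<forall>i<m. 0 \<le> a i \<and> a i \<le> b i \<and> b i \<le> 1) \<and>
        disjoint_family_on (\<lambda>i. {a i<..<b i}) {..<m} \<and> (\<Sum>i<m. b i - a i) < \<delta> \<longrightarrow>
        (\<Sum>i<m. norm (F (b i) - F (a i))) < e"
    proof (intro exI[of _ "e / (K + 1)"] conjI allI impI)
      fix m :: nat and a b :: "nat \<Rightarrow> real"
      assume *: "(\<forall>i<m. 0 \<le> a i \<and> a i \<le> b i \<and> b i \<le> 1) \<and>
        disjoint_family_on (\<lambda>i. {a i<..<b i}) {..<m} \<and> (\<Sum>i<m. b i - a i) < e / (K + 1)"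
      have "(\<Sum>i<m. norm (F (b i) - F (a i))) \<le> (\<Sum>i<m. K * (b i - a i))"
        by (intro sum_mono lip) (use * in auto)
      also have "\<dots> = K * (\<Sum>i<m. b i - a i)" by (simp add: sum_distrib_left)
      also have "\<dots> \<le> K * (e / (K + 1))" using * K0 by (intro mult_left_mono) auto
      also have "\<dots> < e" using K0 e by (simp add: field_simps)
      finally show "(\<Sum>i<m. norm (F (b i) - F (a i))) < e" .
    qed (use e K0 in simp)
  qed
  have cd: "opnorm (curve_deriv CARD('n) (\<lambda>t. fromM (F t)) t) \<le> K" for t
  proof -
    have "toM (curve_deriv CARD('n) (\<lambda>t. fromM (F t)) t) = F' t"
    proof (rule entry_eqI)
      fix i j :: 'n
      have "((\<lambda>t. entry (F t) i j) has_vector_derivative entry (F' t) i j) (at t)"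
        by (rule bounded_linear.has_vector_derivative[OF bounded_linear_entry der])
      then show "entry (toM (curve_deriv CARD('n) (\<lambda>t. fromM (F t)) t)) i j = entry (F' t) i j"
        by (simp add: curve_deriv_def fromM_index vector_derivative_at)
    qed
    then show ?thesis using opnorm_eq_norm[OF curve_deriv_carrier, where 'n='n, of "\<lambda>t. fromM (F t)" t] K[of t] by simp
  qed
  show "curve_length CARD('n) (\<lambda>t. fromM (F t)) \<le> K"
  proof (cases "set_integrable lebesgue {0..1} (\<lambda>t. opnorm (curve_deriv CARD('n) (\<lambda>t. fromM (F t)) t))")
    case True
    have "curve_length CARD('n) (\<lambda>t. fromM (F t)) \<le> (LINT t:{0..1::real}|lebesgue. K)"
      unfolding curve_length_def by (rule set_integral_mono[OF True]) (use cd in \<open>auto simp: set_integrable_def\<close>)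
    also have "\<dots> = K" by (simp add: set_lebesgue_integral_def)
    finally show ?thesis .
  next
    \<comment> \<open>The integral of a non-integrable function is 0 by convention, so the bound
      persists.\<close>
    case False
    then have "curve_length CARD('n) (\<lambda>t. fromM (F t)) = 0"
      unfolding curve_length_def set_lebesgue_integral_def set_integrable_def by (rule not_integrable_integral_eq)
    then show ?thesis using K0 by simp
  qed
qed

text \<open>The path runs from \<open>v * (exp x * exp y)\<close> at \<open>t = 0\<close> to
  \<open>v\<close> at \<open>t = 1\<close>. Unitary factors preserve norms, so its speed is at most
  \<open>norm x + norm y\<close>. It is considered for all real \<open>t\<close>, which gives
  two-sided derivatives at both ends.\<close>

lemma exp_path_deriv:
  fixes v x y :: "('a::rc_field, 'n::finite) cmat"
  assumes v: "unitary v" and sk: "skewadj x" "skewadj y"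
  obtains F' where "\<And>t. ((\<lambda>t. v * (exp ((1 - t) *\<^sub>R x) * exp ((1 - t) *\<^sub>R y))) has_vector_derivative F' t) (at t)"
    "\<And>t. norm (F' t) \<le> norm x + norm y"
proof -
  have ed: "((\<lambda>t. exp ((1 - t) *\<^sub>R z)) has_vector_derivative - (exp ((1 - t) *\<^sub>R z) * z)) (at t)"
    for z :: "('a, 'n) cmat" and t
  proof -
    have "((\<lambda>t. exp (t *\<^sub>R z)) has_vector_derivative exp ((1 - t) *\<^sub>R z) * z) (at (1 - t))"
      by (rule exp_scaleR_has_vector_derivative_right)
    moreover have "((\<lambda>t. 1 - t) has_vector_derivative - 1) (at t)"
      by (auto intro!: derivative_eq_intros)
    ultimately show ?thesis using vector_diff_chain_at[of "\<lambda>t. 1 - t" "- 1" t "\<lambda>t. exp (t *\<^sub>R z)"] by (simp add: o_def)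
  qed
  let ?E = "\<lambda>z t. exp ((1 - t) *\<^sub>R z)"
  have "((\<lambda>t. v * (?E x t * ?E y t)) has_vector_derivative
      v * (?E x t * - (?E y t * y) + - (?E x t * x) * ?E y t)) (at t)" for t
    by (rule bounded_linear.has_vector_derivative[OF bounded_linear_mult_right])
      (rule bounded_bilinear.has_vector_derivative[OF bounded_bilinear_mult ed ed])
  moreover have "norm (v * (?E x t * - (?E y t * y) + - (?E x t * x) * ?E y t)) \<le> norm x + norm y" for t
  proof -
    have u: "unitary (?E x t)" "unitary (?E y t)" using sk by (auto intro!: unitary_exp)
    have "norm (?E x t * - (?E y t * y)) = norm y" using u by (simp add: norm_unitary_mult)
    moreover have "norm (- (?E x t * x) * ?E y t) = norm x" using u by (simp add: norm_unitary_mult norm_mult_unitary)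
    ultimately show ?thesis
      using norm_triangle_ineq[of "?E x t * - (?E y t * y)" "- (?E x t * x) * ?E y t"] norm_unitary_mult[OF v] by simp
  qed
  ultimately show ?thesis by (rule that)
qed

lemma metric_unitary_group_cmat_dist:
  fixes Gr :: "'a::rc_field Matrix.mat monoid"
  assumes car: "carrier Gr \<subseteq> carrier_mat CARD('n) CARD('n)"
    and G: "unitary_group (toM ` carrier Gr :: ('a, 'n::finite) cmat set)"
  shows "metric_unitary_group (toM ` carrier Gr :: ('a, 'n) cmat set) (cmat_dist Gr)"
proof (intro metric_unitary_group.intro metric_unitary_group_axioms.intro G)
  interpret unitary_group "toM ` carrier Gr :: ('a, 'n) cmat set" by (rule G)
  let ?G = "toM ` carrier Gr :: ('a, 'n) cmat set"
  let ?L = "\<lambda>u v. {curve_length CARD('n) \<gamma> | \<gamma>. abs_cont_curve \<gamma> \<and> \<gamma> ` {0..1} \<subseteq> carrier Gr \<and> \<gamma> 0 = u \<and> \<gamma> 1 = v}"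
  have mem: "fromM w \<in> carrier Gr" if "w \<in> ?G" for w using that car fromM_toM by fastforce
  have path: "\<exists>l\<in>?L (fromM (v * (exp x * exp y))) (fromM v). l \<le> norm x + norm y"
    if v: "v \<in> ?G" and sk: "skewadj x" "skewadj y" for v x y
  proof -
    let ?F = "\<lambda>t. v * (exp ((1 - t) *\<^sub>R x) * exp ((1 - t) *\<^sub>R y))"
    obtain F' where F': "\<And>t. (?F has_vector_derivative F' t) (at t)" "\<And>t. norm (F' t) \<le> norm x + norm y"
      using exp_path_deriv[OF G_unitary[OF v] sk] by blast
    have "?F t \<in> ?G" for t using v sk by (auto intro!: G_mult G_exp)
    then have "(\<lambda>t. fromM (?F t)) ` {0..1} \<subseteq> carrier Gr" using mem by blast
    then have "curve_length CARD('n) (\<lambda>t. fromM (?F t)) \<in> ?L (fromM (v * (exp x * exp y))) (fromM v)"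
      using lipschitz_curve(1)[OF F'] by (intro CollectI exI[of _ "\<lambda>t. fromM (?F t)"]) auto
    then show ?thesis using lipschitz_curve(2)[OF F'] by blast
  qed
  show "cmat_dist Gr (v * (exp x * exp y)) v \<le> norm x + norm y"
    if v: "v \<in> ?G" and sk: "skewadj x" "skewadj y" for v x y :: "('a, 'n) cmat"
  proof -
    obtain l where l: "l \<in> ?L (fromM (v * (exp x * exp y))) (fromM v)" "l \<le> norm x + norm y"
      using path[OF v sk] by blast
    have "bdd_below (?L (fromM (v * (exp x * exp y))) (fromM v))"
      by (rule bdd_belowI[of _ 0]) (use curve_length_nonneg[where 'n='n] in auto)
    then have "cmat_dist Gr (v * (exp x * exp y)) v \<le> l"
      unfolding cmat_dist_def group_dist_def by (rule cInf_lower[OF l(1)])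
    then show ?thesis using l(2) by simp
  qed
  show "norm (u - v) \<le> cmat_dist Gr u v" if u: "u \<in> ?G" and v: "v \<in> ?G" for u v :: "('a, 'n) cmat"
    unfolding cmat_dist_def group_dist_def
  proof (rule cInf_greatest)
    \<comment> \<open>An infimum over the empty set would be unspecified; \<open>G_exp_exp\<close>
      provides at least one path.\<close>
    have "star v * u \<in> ?G" using u v by (intro G_mult G_star)
    then obtain x y where xy: "skewadj x" "skewadj y" "star v * u = exp x * exp y" using G_exp_exp by metis
    have "v * star v = 1" using unitaryD(2)[OF G_unitary[OF v]] .
    then have "v * (exp x * exp y) = u" by (simp flip: xy(3) mult.assoc)
    then show "?L (fromM u) (fromM v) \<noteq> {}" using path[OF v xy(1,2)] by auto
    fix l assume "l \<in> ?L (fromM u) (fromM v)"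
    then obtain \<gamma> where \<gamma>: "l = curve_length CARD('n) \<gamma>" "abs_cont_curve \<gamma>" "\<gamma> ` {0..1} \<subseteq> carrier Gr"
      "\<gamma> 0 = fromM u" "\<gamma> 1 = fromM v" by blast
    have "norm (toM (\<gamma> 1) - toM (\<gamma> 0) :: ('a, 'n) cmat) \<le> curve_length CARD('n) \<gamma>"
      by (rule norm_le_curve_length[OF \<gamma>(2)]) (use \<gamma>(3) car in blast)
    then show "norm (u - v) \<le> l" using \<gamma> by (simp add: norm_minus_commute)
  qed
qed

lemma dim_fromM [simp]: "dim_row (fromM (M :: ('a::rc_field, 'n::finite) cmat)) = CARD('n)" "dim_col (fromM M) = CARD('n)"
  by (simp_all add: fromM_def)

section \<open>Rank one matrices\<close>

lemma mapp_nth: "vec_nth (mapp M x) i = (\<Sum>j\<in>UNIV. entry M i j * vec_nth x j)"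
  unfolding entry_def by transfer (simp add: matrix_vector_mult_def)

definition outer :: "'a::rc_field^'n::finite \<Rightarrow> 'a^'n \<Rightarrow> ('a, 'n) cmat" where
  "outer a b = of_entries (vec_lambda (\<lambda>i. vec_lambda (\<lambda>j. vec_nth a i * conjugate (vec_nth b j))))"

lemma entry_outer [simp]: "entry (outer a b) i j = vec_nth a i * conjugate (vec_nth b j)"
  by (simp add: outer_def entry_def of_entries_inverse)

lemma star_outer [simp]: "star (outer a b) = outer b a"
  by (rule entry_eqI) (simp add: entry_simps conjugate_dist_mul mult.commute)

lemma mapp_outer: "mapp (outer a b) x = (\<Sum>j\<in>UNIV. vec_nth x j * conjugate (vec_nth b j)) *s a"
  by (simp add: Finite_Cartesian_Product.vec_eq_iff mapp_nth sum_distrib_left sum_distrib_right mult_ac)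

lemma mapp_outer_real: "mapp (outer a b) x = inner b x *\<^sub>R (a :: real^'n::finite)"
  by (simp add: mapp_outer inner_vec_def Finite_Cartesian_Product.vec_eq_iff mult.commute)

section \<open>The unitary group\<close>

lemma toM_U_group: "toM ` carrier (U_group CARD('n)) = {u :: (complex, 'n::finite) cmat. unitary u}"
proof (intro equalityI subsetI)
  fix u :: "(complex, 'n) cmat" assume "u \<in> toM ` carrier (U_group CARD('n))"
  then obtain A where A: "A \<in> carrier_mat CARD('n) CARD('n)" "mat_adjoint A * A = 1\<^sub>m CARD('n)" "u = toM A"
    by (auto simp: U_group_def)
  have "star u * u = toM (mat_adjoint A * A)"
    by (simp add: A(3) toM_mult[OF adjoint_carrier[OF A(1)] A(1)] toM_adjoint[OF A(1)])
  then show "u \<in> {u. unitary u}" by (simp add: A(2) unitary_def)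
next
  fix u :: "(complex, 'n) cmat" assume u: "u \<in> {u. unitary u}"
  have "toM (mat_adjoint (fromM u) * fromM u) = star u * u"
    by (simp add: toM_mult[OF adjoint_carrier[OF fromM_carrier] fromM_carrier] toM_adjoint[OF fromM_carrier])
  also have "\<dots> = toM (1\<^sub>m CARD('n))" using u by (simp add: unitary_def)
  finally have "mat_adjoint (fromM u) * fromM u = 1\<^sub>m CARD('n)"
    using toM_inject[OF mult_carrier_mat[OF adjoint_carrier[OF fromM_carrier[of u]] fromM_carrier[of u]] one_carrier_mat] by blast
  then show "u \<in> toM ` carrier (U_group CARD('n))"
    by (intro image_eqI[of _ _ "fromM u"]) (auto simp: U_group_def)
qed

lemma toM_scalar_mult:
  assumes A: "A \<in> carrier_mat CARD('n::finite) CARD('n)"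
  shows "mapp (toM (c \<cdot>\<^sub>m A) :: ('a::rc_field, 'n) cmat) x = c *s mapp (toM A) x"
  by (use A in \<open>simp add: Finite_Cartesian_Product.vec_eq_iff mapp_nth sum_distrib_left mult.assoc\<close>)

lemma norm_scalar_vector: "norm (c *s x) = norm c * norm (x :: 'a::rc_field^'n::finite)"
  by (simp add: norm_vec_def L2_set_def norm_mult power_mult_distrib real_sqrt_mult flip: sum_distrib_left)

lemma finite_eigenvalues:
  assumes A: "(A :: complex Matrix.mat) \<in> carrier_mat n n"
  shows "finite {k. eigenvalue A k}"
proof -
  have "char_poly A \<noteq> 0" using degree_monic_char_poly[OF A] by auto
  then show ?thesis by (simp add: eigenvalue_root_char_poly[OF A] poly_roots_finite)
qed

text \<open>There are only finitely many eigenvalues, so some small rotation \<open>cis t\<close>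
  moves none of them to -1.\<close>

lemma unitary_dense:
  fixes u :: "(complex, 'n::finite) cmat"
  assumes u: "unitary u" and e: "0 < e"
  shows "\<exists>v. unitary v \<and> norm (u - v) < e \<and> (\<forall>x. mapp v x = - x \<longrightarrow> x = 0)"
proof -
  define A where "A = fromM u"
  have A: "A \<in> carrier_mat CARD('n) CARD('n)" "toM A = u" by (simp_all add: A_def)
  have ic: "isCont cis 0" unfolding cis_conv_exp[abs_def] by (intro continuous_intros)
  obtain d where d: "d > 0" "\<And>t. \<bar>t\<bar> < d \<Longrightarrow> norm (cis t - 1) < e"
    using ic e unfolding continuous_at_eps_delta by (auto simp: dist_norm)
  \<comment> \<open>The bound 1 keeps \<open>t\<close> below \<open>pi\<close>, where
    \<open>cos\<close> is injective, so the interval yields infinitely many candidates.\<close>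
  let ?I = "{0<..<min d 1} :: real set"
  have inj: "inj_on (\<lambda>t. - cis (- t)) ?I"
  proof (rule inj_onI)
    fix s t :: real assume st: "s \<in> ?I" "t \<in> ?I" "- cis (- s) = - cis (- t)"
    then have "Re (cis (- s)) = Re (cis (- t))" by simp
    then have c: "cos s = cos t" by simp
    have "0 \<le> s" "s \<le> pi" "0 \<le> t" "t \<le> pi" using st(1,2) pi_gt3 by auto
    then show "s = t" using c by (rule cos_inj_pi)
  qed
  have "infinite ?I" using d by (simp add: infinite_Ioo)
  then have "infinite ((\<lambda>t. - cis (- t)) ` ?I)" using inj finite_imageD by blast
  then have "\<not> (\<lambda>t. - cis (- t)) ` ?I \<subseteq> {k. eigenvalue A k}" using finite_eigenvalues[OF A(1)] finite_subset by blast
  then obtain t where t: "t \<in> ?I" "\<not> eigenvalue A (- cis (- t))" by blast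
  define v :: "(complex, 'n) cmat" where "v = toM (cis t \<cdot>\<^sub>m A)"
  have vx: "mapp v x = cis t *s mapp u x" for x unfolding v_def by (simp add: toM_scalar_mult[OF A(1)] A(2))
  have "star v = toM (cis (- t) \<cdot>\<^sub>m mat_adjoint A)"
    by (rule entry_eqI) (use A(1) in \<open>simp add: v_def entry_simps mat_adjoint_def mat_of_rows_index cis_cnj\<close>)
  then have svx: "mapp (star v) x = cis (- t) *s mapp (star u) x" for x
    by (simp add: toM_scalar_mult[OF adjoint_carrier[OF A(1)]] toM_adjoint[OF A(1)] A(2))
  have "mapp (star v * v) x = mapp 1 x" for x
  proof -
    have "mapp (star u) (c *s y) = c *s mapp (star u) y" for c y
      by (simp add: Finite_Cartesian_Product.vec_eq_iff mapp_nth sum_distrib_left mult_ac)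
    then have "mapp (star v * v) x = (cis (- t) * cis t) *s mapp (star u * u) x"
      by (simp add: svx vx Finite_Cartesian_Product.vec_eq_iff)
    then show ?thesis using unitaryD(1)[OF u] by (simp add: cis_mult Finite_Cartesian_Product.vec_eq_iff del: mapp_mult)
  qed
  then have uv: "unitary v" unfolding unitary_def by (rule cmat_eqI)
  have "norm (u - v) \<le> norm (cis t - 1)"
  proof (rule norm_cmat_leI)
    fix x
    have "mapp (u - v) x = (1 - cis t) *s mapp u x"
      by (simp add: vx Finite_Cartesian_Product.vec_eq_iff algebra_simps)
    then have "norm (mapp (u - v) x) = norm (1 - cis t) * norm x"
      by (simp only: norm_scalar_vector norm_mapp_unitary[OF u])
    then show "norm (mapp (u - v) x) \<le> norm (cis t - 1) * norm x" by (simp only: norm_minus_commute order_refl)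
  qed
  also have "\<dots> < e" using t(1) by (intro d(2)) auto
  finally have n: "norm (u - v) < e" .
  have "x = 0" if x: "mapp v x = - x" for x
  proof (rule ccontr)
    assume x0: "x \<noteq> 0"
    have "mapp u x = (cis (- t) * cis t) *s mapp u x" by (simp add: cis_mult Finite_Cartesian_Product.vec_eq_iff)
    also have "\<dots> = cis (- t) *s mapp v x" by (simp add: vx Finite_Cartesian_Product.vec_eq_iff)
    also have "\<dots> = - cis (- t) *s x" by (simp add: x Finite_Cartesian_Product.vec_eq_iff)
    finally have ux: "mapp u x = - cis (- t) *s x" .
    have "toV (A *\<^sub>v fromV x) = (toV (- cis (- t) \<cdot>\<^sub>v fromV x) :: complex^'n)"
      using ux by (simp add: toV_mult[OF A(1) fromV_carrier] A(2) toV_smult[OF fromV_carrier])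
    then have "A *\<^sub>v fromV x = - cis (- t) \<cdot>\<^sub>v fromV x"
      using A(1) by (intro toV_inject[where 'n='n]) (auto intro: mult_mat_vec_carrier)
    moreover have "fromV x \<noteq> 0\<^sub>v CARD('n)"
    proof
      assume "fromV x = 0\<^sub>v CARD('n)"
      then have "x = toV (0\<^sub>v CARD('n))" by (metis toV_fromV)
      then show False using x0 by (simp add: Finite_Cartesian_Product.vec_eq_iff)
    qed
    ultimately have "eigenvalue A (- cis (- t))"
      using A(1) unfolding eigenvalue_def eigenvector_def by (intro exI[of _ "fromV x"]) auto
    then show False using t(2) by simp
  qed
  then show ?thesis using uv n by blast
qed

lemma unitary_group_U: "unitary_group (toM ` carrier (U_group CARD('n)) :: (complex, 'n::finite) cmat set)"
  unfolding toM_U_group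
  by (rule unitary_group.intro) (use unitary_dense in \<open>auto intro: unitary_mult unitary_exp\<close>)

section \<open>The special orthogonal group\<close>

definition cdet :: "('a::rc_field, 'n::finite) cmat \<Rightarrow> 'a" where
  "cdet u = Determinant.det (fromM u)"

lemma fromM_mult: "fromM (u * v :: ('a::rc_field, 'n::finite) cmat) = fromM u * fromM v"
  using fromM_toM[OF mult_carrier_mat[OF fromM_carrier[of u] fromM_carrier[of v]]]
    toM_mult[OF fromM_carrier[of u] fromM_carrier[of v]] by simp

lemma fromM_one: "fromM (1 :: ('a::rc_field, 'n::finite) cmat) = 1\<^sub>m CARD('n)"
  by (metis fromM_toM one_carrier_mat toM_one)

lemma cdet_mult: "cdet (u * v) = cdet u * cdet v"
  unfolding cdet_def fromM_mult by (rule det_mult[OF fromM_carrier fromM_carrier])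

lemma cdet_one: "cdet 1 = 1"
  by (simp add: cdet_def fromM_one)

lemma cdet_star: "cdet (star u) = cdet (u :: (real, 'n::finite) cmat)"
proof -
  have "fromM (star u) = transpose_mat (fromM u)"
    by (rule index_mat_eqI[where 'n='n]) (auto simp: fromM_index entry_simps)
  then show ?thesis unfolding cdet_def using det_transpose[OF fromM_carrier] by metis
qed

lemma cdet_unitary: "unitary u \<Longrightarrow> cdet (u :: (real, 'n::finite) cmat) = 1 \<or> cdet u = - 1"
  using cdet_mult[of "star u" u] by (auto simp: unitary_def cdet_one cdet_star square_eq_1_iff)

lemma cdet_zero_kernel:
  assumes "cdet (u :: ('a::rc_field, 'n::finite) cmat) = 0"
  obtains x where "x \<noteq> 0" "mapp u x = 0"
proof -
  obtain v where v: "v \<in> carrier_vec CARD('n)" "v \<noteq> 0\<^sub>v CARD('n)" "fromM u *\<^sub>v v = 0\<^sub>v CARD('n)"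
    using assms det_0_iff_vec_prod_zero_field[OF fromM_carrier, of u] by (auto simp: cdet_def)
  have z: "(toV (0\<^sub>v CARD('n)) :: 'a^'n) = 0" by (simp add: Finite_Cartesian_Product.vec_eq_iff)
  have "(toV v :: 'a^'n) \<noteq> 0" using toV_inject[OF v(1) zero_carrier_vec] v(2) z by metis
  moreover have "mapp u (toV v) = 0" using toV_mult[OF fromM_carrier v(1), of u] v(3) z by simp
  ultimately show ?thesis using that by blast
qed

text \<open>Since \<open>star w * (1 + w) = star (1 + w)\<close>, taking determinants gives
  \<open>- cdet (1 + w) = cdet (1 + w)\<close>.\<close>

lemma cdet_minus_one_eigenvector:
  assumes w: "unitary (w :: (real, 'n::finite) cmat)" and d: "cdet w = - 1"
  obtains x where "x \<noteq> 0" "mapp w x = - x"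
proof -
  have "star w * (1 + w) = star (1 + w)" using unitaryD(1)[OF w] by (simp add: distrib_left add.commute)
  then have "cdet (star w) * cdet (1 + w) = cdet (1 + w)" by (metis cdet_mult cdet_star)
  then have "cdet (1 + w) = 0" by (simp add: cdet_star d)
  then obtain x where "x \<noteq> 0" "mapp (1 + w) x = 0" by (rule cdet_zero_kernel)
  then show ?thesis using that[of x] by (simp add: add_eq_0_iff)
qed

lemma toM_SO_group: "toM ` carrier (SO_group CARD('n)) = {u :: (real, 'n::finite) cmat. unitary u \<and> cdet u = 1}"
proof -
  have adj: "transpose_mat A = mat_adjoint A" if "A \<in> carrier_mat CARD('n) CARD('n)" for A :: "real Matrix.mat"
    by (rule eq_matI) (use that in \<open>auto simp: mat_adjoint_def mat_of_rows_index\<close>)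
  show ?thesis
  proof (intro equalityI subsetI)
    fix u :: "(real, 'n) cmat" assume "u \<in> toM ` carrier (SO_group CARD('n))"
    then obtain A where A: "A \<in> carrier_mat CARD('n) CARD('n)" "transpose_mat A * A = 1\<^sub>m CARD('n)"
      "Determinant.det A = 1" "u = toM A"
      by (auto simp: SO_group_def)
    have "star u * u = toM (mat_adjoint A * A)"
      by (simp add: A(4) toM_mult[OF adjoint_carrier[OF A(1)] A(1)] toM_adjoint[OF A(1)])
    moreover have "cdet u = 1" using A(3) by (simp add: cdet_def A(4) fromM_toM[OF A(1)])
    ultimately show "u \<in> {u. unitary u \<and> cdet u = 1}" by (simp add: A(2) unitary_def flip: adj[OF A(1)])
  next
    fix u :: "(real, 'n) cmat" assume u: "u \<in> {u. unitary u \<and> cdet u = 1}"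
    have "toM (mat_adjoint (fromM u) * fromM u) = star u * u"
      by (simp add: toM_mult[OF adjoint_carrier[OF fromM_carrier] fromM_carrier] toM_adjoint[OF fromM_carrier])
    also have "\<dots> = toM (1\<^sub>m CARD('n))" using u by (simp add: unitary_def)
    finally have "mat_adjoint (fromM u) * fromM u = 1\<^sub>m CARD('n)"
      using toM_inject[OF mult_carrier_mat[OF adjoint_carrier[OF fromM_carrier[of u]] fromM_carrier[of u]] one_carrier_mat] by blast
    then show "u \<in> toM ` carrier (SO_group CARD('n))"
      using u by (intro image_eqI[of _ _ "fromM u"]) (auto simp: SO_group_def cdet_def adj)
  qed
qed

text \<open>If \<open>v\<close> had determinant -1, then \<open>star u * v\<close> would have the
  eigenvalue -1 and \<open>u - v\<close> norm at least 2.\<close>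

lemma special_orthogonal_near:
  assumes u: "unitary (u :: (real, 'n::finite) cmat)" "cdet u = 1" and v: "unitary v" and n: "norm (u - v) < 1"
  shows "cdet v = 1"
proof (rule ccontr)
  assume "cdet v \<noteq> 1"
  then have "cdet (star u * v) = - 1" using cdet_unitary[OF v] by (simp add: cdet_mult cdet_star u)
  moreover have w: "unitary (star u * v)" using u v by (simp add: unitary_mult)
  ultimately obtain x where x: "x \<noteq> 0" "mapp (star u * v) x = - x" using cdet_minus_one_eigenvector by blast
  have "star u * (u - v) = 1 - star u * v" using unitaryD(1)[OF u(1)] by (simp add: right_diff_distrib)
  then have "norm (1 - star u * v) < 1" using norm_unitary_mult[of "star u" "u - v"] u n by simp
  moreover have "mapp (1 - star u * v) x = 2 *\<^sub>R x" using x(2) by (simp add: scaleR_2 del: mapp_mult)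
  then have "2 * norm x \<le> norm (1 - star u * v) * norm x" using norm_mapp_le[of "1 - star u * v" x] by simp
  ultimately show False using x(1) by simp
qed

section \<open>Reflections and the removal of the eigenvalue -1\<close>

definition reflection :: "real^'n::finite \<Rightarrow> (real, 'n) cmat" where
  "reflection a = 1 - 2 *\<^sub>R outer a a"

lemma mapp_reflection: "mapp (reflection a) x = x - (2 * inner a x) *\<^sub>R a"
  by (simp add: reflection_def mapp_outer_real)

lemma star_reflection: "star (reflection a) = reflection a"
  by (simp add: reflection_def)

lemma reflection_square:
  assumes "norm a = 1" shows "reflection a * reflection a = 1"
proof (rule cmat_eqI)
  fix x
  have "inner a (mapp (reflection a) x) = - inner a x"
    using assms norm_eq_1[of a] by (simp add: mapp_reflection inner_diff_right)
  then have "mapp (reflection a) (mapp (reflection a) x) = mapp (reflection a) x + (2 * inner a x) *\<^sub>R a"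
    by (subst mapp_reflection) simp
  then show "mapp (reflection a * reflection a) x = mapp 1 x" by (simp add: mapp_reflection)
qed

lemma unitary_reflection: "norm a = 1 \<Longrightarrow> unitary (reflection a)"
  by (simp add: unitary_def star_reflection reflection_square)

lemma cdet_reflection_axis: "cdet (reflection (axis k 1 :: real^'n::finite)) = - 1"
proof -
  let ?R = "reflection (axis k 1 :: real^'n)"
  have ent: "fromM ?R $$ (ix i, ix j) = (if i = j then if i = k then - 1 else 1 else 0)" for i j
    by (simp add: fromM_index reflection_def entry_simps axis_def)
  have car: "fromM ?R \<in> carrier_mat CARD('n) CARD('n)" by simp
  have ut: "upper_triangular (fromM ?R)"
  proof (rule upper_triangularI)
    fix i j assume ij: "j < i" "i < dim_row (fromM ?R)"
    then have "i < CARD('n)" "j < CARD('n)" using car by auto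
    then obtain k l :: 'n where "i = ix k" "j = ix l" by (metis ix_cases)
    then show "fromM ?R $$ (i, j) = 0" using ij(1) ent[of k l] by auto
  qed
  then have "cdet ?R = (\<Prod>i = 0..<dim_row (fromM ?R). fromM ?R $$ (i, i))"
    unfolding cdet_def using det_upper_triangular[OF ut car] by (simp only: prod_list_diag_prod)
  also have "\<dots> = (\<Prod>i<CARD('n). fromM ?R $$ (i, i))" by (simp add: atLeast0LessThan)
  also have "\<dots> = (\<Prod>i\<in>(UNIV::'n set). fromM ?R $$ (ix i, ix i))" by (rule prod.reindex_bij_betw[OF bij_ix, symmetric])
  also have "\<dots> = - 1" by (simp add: ent)
  finally show ?thesis .
qed

text \<open>The reflection in the normalized difference \<open>c\<close> of a coordinate vector and
  \<open>a\<close> maps the former to the latter, hence conjugates the one reflection to the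
  other.\<close>

lemma cdet_reflection:
  assumes a: "norm (a :: real^'n::finite) = 1"
  shows "cdet (reflection a) = - 1"
proof -
  define k :: 'n where "k = undefined"
  let ?e = "axis k 1 :: real^'n"
  show ?thesis
  proof (cases "a = ?e")
    case False
    define c where "c = (1 / norm (?e - a)) *\<^sub>R (?e - a)"
    have n0: "norm (?e - a) \<noteq> 0" using False by simp
    have c: "norm c = 1" using n0 by (simp add: c_def)
    have ia: "inner a a = 1" "inner ?e ?e = 1" "inner a ?e = inner ?e a"
      using a norm_eq_1[of a] norm_eq_1[of ?e] inner_commute by auto
    have "(norm (?e - a))\<^sup>2 = 2 - 2 * inner ?e a"
      by (simp add: power2_norm_eq_inner inner_diff_left inner_diff_right ia)
    moreover have "inner (?e - a) ?e = 1 - inner ?e a" by (simp add: inner_diff_left ia)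
    ultimately have sq: "2 * inner (?e - a) ?e = (norm (?e - a))\<^sup>2" by simp
    have ga: "mapp (reflection c) ?e = a"
    proof -
      have "(2 * inner c ?e) *\<^sub>R c = (2 * inner (?e - a) ?e / (norm (?e - a))\<^sup>2) *\<^sub>R (?e - a)"
        by (simp add: c_def power2_eq_square)
      also have "\<dots> = ?e - a" unfolding sq using n0 by simp
      finally show ?thesis by (simp add: mapp_reflection)
    qed
    have "reflection a = reflection c * reflection ?e * reflection c"
    proof (rule cmat_eqI)
      fix x
      have "inner ?e (mapp (reflection c) x) = inner a x"
        using inner_mapp_left[of "reflection c" ?e x] by (simp add: ga star_reflection)
      then have "mapp (reflection c * reflection ?e * reflection c) x
          = mapp (reflection c * reflection c) x - (2 * inner a x) *\<^sub>R mapp (reflection c) ?e"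
        by (simp add: mapp_reflection[of ?e] linear_scale[OF bounded_linear.linear[OF bounded_linear_mapp]])
      then show "mapp (reflection a) x = mapp (reflection c * reflection ?e * reflection c) x"
        by (simp add: ga reflection_square[OF c] mapp_reflection[of a] del: mapp_mult)
    qed
    then have "cdet (reflection a) = cdet (reflection c * reflection c) * cdet (reflection ?e)"
      by (simp add: cdet_mult)
    then show ?thesis by (simp add: reflection_square[OF c] cdet_one cdet_reflection_axis)
  qed (simp add: cdet_reflection_axis)
qed

text \<open>\<open>u * reflection a\<close> has determinant -1 and fixes \<open>a\<close>. It has an
  eigenvector for -1, which is orthogonal to \<open>a\<close> since the map is an isometry; there
  the reflection acts trivially.\<close>

lemma minus_one_eigenvector_pair:
  assumes u: "unitary (u :: (real, 'n::finite) cmat)" "cdet u = 1" and a: "norm a = 1" "mapp u a = - a"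
  obtains b where "norm b = 1" "mapp u b = - b" "inner a b = 0"
proof -
  let ?w = "u * reflection a"
  have w: "unitary ?w" "cdet ?w = - 1"
    using u a unitary_reflection[OF a(1)] by (auto simp: cdet_mult cdet_reflection unitary_mult)
  then obtain x where x: "x \<noteq> 0" "mapp ?w x = - x" by (rule cdet_minus_one_eigenvector)
  have wa: "mapp ?w a = a" using a by (simp add: mapp_reflection flip: power2_norm_eq_inner) (simp add: scaleR_2)
  have "inner (mapp ?w a) (mapp ?w x) = inner a x"
    using inner_mapp_left[of ?w a "mapp ?w x"] unitaryD(1)[OF w(1)] by (metis mapp_mult mapp_one)
  then have o: "inner a x = 0" using wa x(2) by (simp del: mapp_mult)
  then have "mapp u x = - x" using x(2) by (simp add: mapp_reflection)
  then show ?thesis using that[of "(1 / norm x) *\<^sub>R x"] x(1) o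
    by (simp add: linear_scale[OF bounded_linear.linear[OF bounded_linear_mapp]])
qed

lemma exp_mapp_kernel:
  assumes "mapp A x = 0" shows "mapp (exp A) x = x"
proof -
  have "(\<lambda>k. mapp (A ^ k /\<^sub>R fact k) x) sums mapp (exp A) x"
    by (rule bounded_linear.sums[OF bounded_bilinear.bounded_linear_left[OF bounded_bilinear_mapp] exp_converges])
  moreover have "(\<lambda>k. mapp (A ^ k /\<^sub>R fact k) x) = (\<lambda>k. if k = 0 then x else 0)"
  proof
    fix k show "mapp (A ^ k /\<^sub>R fact k) x = (if k = 0 then x else 0)"
      by (cases k) (simp_all add: power_Suc2 assms del: power_Suc)
  qed
  moreover have "(\<lambda>k::nat. if k = 0 then x else 0) sums x" using sums_single[of 0 "\<lambda>_. x"] by (simp add: eq_commute)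
  ultimately show ?thesis using sums_unique2 by metis
qed

lemma exp_commuting:
  fixes A Q :: "'a::{real_normed_algebra_1,banach}"
  assumes "A * Q = Q * A" shows "exp A * Q = Q * exp A"
proof -
  have "(\<lambda>k. A ^ k /\<^sub>R fact k * Q) sums (exp A * Q)"
    by (rule bounded_linear.sums[OF bounded_linear_mult_left exp_converges])
  moreover have "(\<lambda>k. Q * (A ^ k /\<^sub>R fact k)) sums (Q * exp A)"
    by (rule bounded_linear.sums[OF bounded_linear_mult_right exp_converges])
  moreover have "A ^ k /\<^sub>R fact k * Q = Q * (A ^ k /\<^sub>R fact k)" for k
    using power_commuting_commutes[OF assms, of k] by simp
  ultimately show ?thesis using sums_unique2 by simp
qed

text \<open>\<open>Y\<close> generates the rotations of the plane of \<open>a\<close> and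
  \<open>b\<close>, on which \<open>u\<close> is -1. On this plane
  \<open>u * exp (s *\<^sub>R Y)\<close> is the negative of a nontrivial rotation and has no
  eigenvector for -1; on the orthogonal complement it agrees with \<open>u\<close>.\<close>

lemma rotate_minus_one_eigenspace:
  fixes u :: "(real, 'n::finite) cmat"
  assumes u: "unitary u" and a: "norm a = 1" "mapp u a = - a" and b: "norm b = 1" "mapp u b = - b" "inner a b = 0"
    and s: "0 < s" "s < 1"
  defines "Y \<equiv> outer b a - outer a b"
  shows "skewadj Y" "norm Y \<le> 1"
    "mapp (u * exp (s *\<^sub>R Y)) x = - x \<Longrightarrow> mapp u x = - x \<and> inner a x = 0"
proof -
  have Yx: "mapp Y x = inner a x *\<^sub>R b - inner b x *\<^sub>R a" for x by (simp add: Y_def mapp_outer_real)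
  show sk: "skewadj Y" by (simp add: skewadj_def Y_def)
  have aa: "inner a a = 1" "inner b b = 1" "inner b a = 0"
    using a b by (simp_all add: norm_eq_1 inner_commute)
  \<comment> \<open>The projection onto the plane; it commutes with \<open>Y\<close>, and
    \<open>u * Q = Q * u = - Q\<close>.\<close>
  define Q where "Q = outer a a + outer b b"
  have Qx: "mapp Q x = inner a x *\<^sub>R a + inner b x *\<^sub>R b" for x by (simp add: Q_def mapp_outer_real)
  have nY: "(norm (mapp Y x))\<^sup>2 = (inner a x)\<^sup>2 + (inner b x)\<^sup>2" for x
    unfolding power2_norm_eq_inner Yx by (simp add: inner_diff_left inner_diff_right aa b(3) power2_eq_square)
  have nQ: "inner x (mapp Q x) = (inner a x)\<^sup>2 + (inner b x)\<^sup>2" for x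
    by (simp add: Qx inner_add_right power2_eq_square inner_commute)
  have nQ2: "(norm (mapp Q x))\<^sup>2 = (inner a x)\<^sup>2 + (inner b x)\<^sup>2" for x
    unfolding power2_norm_eq_inner Qx by (simp add: inner_add_left inner_add_right aa b(3) power2_eq_square)
  show nY1: "norm Y \<le> 1"
  proof (rule norm_cmat_leI)
    fix x
    have "norm (mapp Q x) * norm (mapp Q x) \<le> norm x * norm (mapp Q x)"
      using nQ[of x] nQ2[of x] norm_cauchy_schwarz[of x "mapp Q x"] by (simp add: power2_eq_square)
    then have "norm (mapp Q x) \<le> norm x" by (cases "mapp Q x = 0") auto
    moreover have "norm (mapp Y x) = norm (mapp Q x)" using nY[of x] nQ2[of x] by (metis norm_ge_zero power2_eq_imp_eq)
    ultimately show "norm (mapp Y x) \<le> 1 * norm x" by simp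
  qed
  have nY2: "norm Y = 1"
  proof -
    have "norm (mapp Y a) \<le> norm Y * norm a" by (rule norm_mapp_le)
    then show ?thesis using nY1 a b aa by (simp add: Yx)
  qed
  have YQ: "Y * Q = Q * Y"
    by (rule cmat_eqI) (simp add: Yx Qx inner_add_right inner_diff_right aa b(3))
  have EQ: "exp (s *\<^sub>R Y) * Q = Q * exp (s *\<^sub>R Y)" by (rule exp_commuting) (simp add: YQ)
  have uQ: "u * Q = - Q"
    by (rule cmat_eqI) (simp add: Qx a b linear_scale[OF bounded_linear.linear[OF bounded_linear_mapp]])
  have Qu: "Q * u = - Q"
  proof -
    have "star u * (u * Q) = Q" using unitaryD(1)[OF u] by (simp flip: mult.assoc)
    then have "star u * Q = - Q" unfolding uQ by (simp add: minus_equation_iff)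
    then have "star (star u * Q) = - star Q" by simp
    moreover have "star Q = Q" by (simp add: Q_def)
    ultimately show ?thesis by simp
  qed
  assume x: "mapp (u * exp (s *\<^sub>R Y)) x = - x"
  let ?y = "mapp Q x"
  have "mapp (exp (s *\<^sub>R Y)) ?y = ?y"
  proof -
    have "mapp (Q * (u * exp (s *\<^sub>R Y))) x = - ?y" using x by simp
    moreover have "Q * (u * exp (s *\<^sub>R Y)) = - (exp (s *\<^sub>R Y) * Q)" by (simp add: EQ Qu flip: mult.assoc)
    ultimately show ?thesis by (simp del: mapp_mult) (simp)
  qed
  have y0: "?y = 0"
  proof (rule ccontr)
    assume "?y \<noteq> 0"
    define v where "v = (1 / norm ?y) *\<^sub>R ?y"
    have v: "norm v = 1" using \<open>?y \<noteq> 0\<close> by (simp add: v_def)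
    have ev: "mapp (exp (s *\<^sub>R Y)) v = v"
      using \<open>mapp (exp (s *\<^sub>R Y)) ?y = ?y\<close> by (simp add: v_def linear_scale[OF bounded_linear.linear[OF bounded_linear_mapp]])
    have QQ: "mapp Q v = v"
      by (simp add: v_def linear_scale[OF bounded_linear.linear[OF bounded_linear_mapp]])
        (simp add: Qx inner_add_right aa b(3))
    have nYv: "norm (mapp Y v) = 1" using nY[of v] nQ2[of v] QQ v by (metis norm_ge_zero power2_eq_imp_eq zero_le_one)
    have "mapp (exp (s *\<^sub>R Y)) v = cos (norm (s *\<^sub>R Y)) *\<^sub>R v + (sin (norm (s *\<^sub>R Y)) / norm (s *\<^sub>R Y)) *\<^sub>R mapp (s *\<^sub>R Y) v"
      by (rule exp_skewadj_top_vector) (use sk v nYv nY2 s in auto)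
    then have "inner (mapp (exp (s *\<^sub>R Y)) v) v = cos s"
      using s v by (simp add: nY2 inner_add_left inner_skewadj_self[OF sk] norm_eq_1)
    then have "cos s = 1" using ev v by (simp add: norm_eq_1)
    moreover have "cos s < cos 0" using s pi_gt3 by (intro cos_monotone_0_pi) auto
    ultimately show False by simp
  qed
  then have ab0: "inner a x = 0" "inner b x = 0" using nQ2[of x] by (simp_all add: sum_power2_eq_zero_iff)
  then have "mapp (exp (s *\<^sub>R Y)) x = x" by (intro exp_mapp_kernel) (simp add: Yx)
  then show "mapp u x = - x \<and> inner a x = 0" using x ab0 by simp
qed

text \<open>Induction on the dimension of the eigenspace of -1: a small rotation of a plane inside
  it removes \<open>a\<close> and adds nothing. The determinant is preserved because the
  perturbation has norm below 1.\<close>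

lemma special_orthogonal_dense:
  fixes u :: "(real, 'n::finite) cmat"
  assumes "unitary u" "cdet u = 1" "0 < e"
  shows "\<exists>v. unitary v \<and> cdet v = 1 \<and> norm (u - v) < e \<and> (\<forall>x. mapp v x = - x \<longrightarrow> x = 0)"
  using assms
proof (induction "dim {x. mapp u x = - x}" arbitrary: u e rule: less_induct)
  case less
  show ?case
  proof (cases "\<forall>x. mapp u x = - x \<longrightarrow> x = 0")
    case False
    then obtain x where x: "mapp u x = - x" "x \<noteq> 0" by blast
    define a where "a = (1 / norm x) *\<^sub>R x"
    have a: "norm a = 1" "mapp u a = - a"
      using x by (auto simp: a_def linear_scale[OF bounded_linear.linear[OF bounded_linear_mapp]])
    obtain b where b: "norm b = 1" "mapp u b = - b" "inner a b = 0"
      using minus_one_eigenvector_pair[OF less.prems(1,2) a] by blast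
    define s where "s = min (1/4) (e / 8)"
    have s: "0 < s" "s < 1" "s \<le> e / 8" "s \<le> 1/4" using less.prems(3) by (auto simp: s_def)
    define Y where "Y = outer b a - outer a b"
    note rot = rotate_minus_one_eigenspace[OF less.prems(1) a b s(1,2), folded Y_def]
    define v where "v = u * exp (s *\<^sub>R Y)"
    have uE: "unitary (exp (s *\<^sub>R Y))" using rot(1) by (auto intro: unitary_exp)
    have uv: "unitary v" unfolding v_def by (rule unitary_mult[OF less.prems(1) uE])
    have "u - v = u * (1 - exp (s *\<^sub>R Y))" by (simp add: v_def right_diff_distrib)
    then have "norm (u - v) = norm (exp (s *\<^sub>R Y) - 1)"
      using norm_unitary_mult[OF less.prems(1)] by (simp add: norm_minus_commute)
    also have "\<dots> \<le> 2 * norm (s *\<^sub>R Y)"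
      by (rule norm_exp_minus_one_le[of _ s]) (use rot(2) s mult_left_mono[of "norm Y" 1 s] in auto)
    also have "\<dots> \<le> 2 * s" using rot(2) s mult_left_mono[of "norm Y" 1 s] by simp
    finally have n0: "norm (u - v) \<le> 2 * s" .
    then have n: "norm (u - v) \<le> e / 4" using s by simp
    have "2 * s \<le> 1 / 2" using s by simp
    then have cv: "cdet v = 1" using special_orthogonal_near[OF less.prems(1,2) uv] n0 by simp
    have sub: "Real_Vector_Spaces.subspace {x. mapp w x = - x}" for w :: "(real, 'n) cmat"
      by (auto simp: real_vector.subspace_def linear_scale[OF bounded_linear.linear[OF bounded_linear_mapp]])
    have "dim {x. mapp v x = - x} < dim {x. mapp u x = - x}"
    proof -
      have "{x. mapp v x = - x} \<subset> {x. mapp u x = - x}"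
      proof
        show "{x. mapp v x = - x} \<subseteq> {x. mapp u x = - x}" using rot(3) by (auto simp: v_def)
        have "a \<notin> {x. mapp v x = - x}" using rot(3)[of a] a(1) by (auto simp: v_def norm_eq_1 simp del: mapp_mult)
        then show "{x. mapp v x = - x} \<noteq> {x. mapp u x = - x}" using a(2) by blast
      qed
      then show ?thesis by (intro dim_psubset) (simp only: span_eq_iff[THEN iffD2, OF sub])
    qed
    then obtain w where w: "unitary w" "cdet w = 1" "norm (v - w) < e / 2" "\<forall>x. mapp w x = - x \<longrightarrow> x = 0"
      using less.hyps[OF _ uv cv, of "e / 2"] less.prems(3) by auto
    have "norm (u - w) < e"
      using norm_triangle_ineq[of "u - v" "v - w"] n w(3) less.prems(3) by simp
    then show ?thesis using w by blast
  qed (use less.prems in auto)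
qed

lemma unitary_group_SO: "unitary_group (toM ` carrier (SO_group CARD('n)) :: (real, 'n::finite) cmat set)"
  unfolding toM_SO_group
proof (rule unitary_group.intro)
  show "exp x \<in> {u. unitary u \<and> cdet u = 1}" if x: "skewadj x" for x :: "(real, 'n) cmat"
  proof -
    have h: "unitary (exp ((1/2) *\<^sub>R x))" using x by (auto intro: unitary_exp)
    \<comment> \<open>The square of an orthogonal matrix has determinant 1.\<close>
    have "exp x = exp ((1/2) *\<^sub>R x) * exp ((1/2) *\<^sub>R x)"
      by (subst exp_add_commuting[symmetric]) (simp_all flip: scaleR_add_left)
    then have "cdet (exp x) = 1" using cdet_unitary[OF h] by (auto simp: cdet_mult)
    then show ?thesis using x by (simp add: unitary_exp)
  qed
  show "v \<in> {u. unitary u \<and> cdet u = 1}"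
    if "u \<in> {u. unitary u \<and> cdet u = 1}" "unitary v" "norm (u - v) < 1" for u v :: "(real, 'n) cmat"
    using special_orthogonal_near that by blast
  show "\<exists>v\<in>{u. unitary u \<and> cdet u = 1}. norm (u - v) < e \<and> (\<forall>x. mapp v x = - x \<longrightarrow> x = 0)"
    if "u \<in> {u. unitary u \<and> cdet u = 1}" "0 < e" for u :: "(real, 'n) cmat" and e
    using special_orthogonal_dense[of u e] that by blast
qed (auto simp: cdet_mult cdet_star cdet_one intro: unitary_mult)

section \<open>Dimensions\<close>

text \<open>On one side the dimension is the least size of a generating set of a carrier, on the
  other the size of a basis in a type. An injective linear map carries generating sets over in both
  directions; \<open>B\<close> secures finite dimension.\<close>

lemma vectorspace_dim_eq:
  fixes V :: "('k::field, 'm, 'x) module_scheme" and \<phi> :: "'m \<Rightarrow> 'v::ab_group_add" and scale :: "'k \<Rightarrow> 'v \<Rightarrow> 'v"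
  assumes V: "vectorspace class_ring V" and W: "vector_space scale" and inj: "inj_on \<phi> (carrier V)"
    and add: "\<And>x y. x \<in> carrier V \<Longrightarrow> y \<in> carrier V \<Longrightarrow> \<phi> (x \<oplus>\<^bsub>V\<^esub> y) = \<phi> x + \<phi> y"
    and smult: "\<And>c x. x \<in> carrier V \<Longrightarrow> \<phi> (c \<odot>\<^bsub>V\<^esub> x) = scale c (\<phi> x)"
    and B: "finite B" "\<phi> ` carrier V \<subseteq> Modules.module.span scale B"
  shows "vectorspace.dim class_ring V = vector_space.dim scale (\<phi> ` carrier V)"
proof -
  interpret V: vectorspace class_ring V by (rule V)
  interpret W: vector_space scale by (rule W)
  let ?S = "\<phi> ` carrier V"
  have z: "\<phi> \<zero>\<^bsub>V\<^esub> = 0" using add[OF V.zero_closed V.zero_closed] by simp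
  have fn: "a \<in> A \<rightarrow> carrier class_ring" for a :: "'m \<Rightarrow> 'k" and A by (simp add: class_ring_simps)
  have lc: "\<phi> (V.lincomb a A) = (\<Sum>v\<in>A. scale (a v) (\<phi> v))" if "finite A" "A \<subseteq> carrier V" for a A
    using that
  proof (induction A rule: finite_induct)
    case empty
    then show ?case by (simp add: V.lincomb_def z)
  next
    case (insert v A)
    have v: "v \<in> carrier V" and A: "A \<subseteq> carrier V" using insert.prems by auto
    have "V.lincomb a (insert v A) = (a v \<odot>\<^bsub>V\<^esub> v) \<oplus>\<^bsub>V\<^esub> V.lincomb a A"
      using V.lincomb_insert[OF insert.hyps(1) A fn insert.hyps(2) v] by simp
    then show ?case using insert.IH[OF A] insert.hyps add[OF V.smult_closed[OF _ v] V.lincomb_closed[OF A fn]] smult[OF v]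
      by (simp add: class_ring_simps)
  qed
  have spc: "V.span A \<subseteq> carrier V" if "A \<subseteq> carrier V" for A
    using that fn by (auto simp: V.span_def intro!: V.lincomb_closed)
  have sp: "\<phi> ` V.span A = W.span (\<phi> ` A)" if A: "finite A" "A \<subseteq> carrier V" for A
  proof (intro equalityI subsetI)
    fix w assume "w \<in> \<phi> ` V.span A"
    then obtain a where "w = \<phi> (V.lincomb a A)" using V.finite_span[OF A] by auto
    then show "w \<in> W.span (\<phi> ` A)"
      by (simp add: lc[OF A]) (intro W.span_sum W.span_scale W.span_base imageI)
  next
    fix w assume "w \<in> W.span (\<phi> ` A)"
    then obtain u where "w = (\<Sum>v\<in>\<phi> ` A. scale (u v) v)" using W.span_finite[of "\<phi> ` A"] A(1) by auto
    also have "\<dots> = (\<Sum>v\<in>A. scale (u (\<phi> v)) (\<phi> v))"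
      using inj_on_subset[OF inj A(2)] by (simp add: sum.reindex)
    also have "\<dots> = \<phi> (V.lincomb (u \<circ> \<phi>) A)" by (simp add: lc[OF A])
    finally show "w \<in> \<phi> ` V.span A" unfolding V.finite_span[OF A] using fn by blast
  qed
  have subS: "W.subspace ?S"
  proof (rule W.subspaceI)
    show "0 \<in> ?S" by (intro image_eqI[of _ \<phi> "\<zero>\<^bsub>V\<^esub>"]) (simp_all add: z)
    show "x + y \<in> ?S" if xS: "x \<in> ?S" and yS: "y \<in> ?S" for x y
    proof -
      obtain v where x: "x = \<phi> v" "v \<in> carrier V" using xS by (rule imageE)
      obtain w where y: "y = \<phi> w" "w \<in> carrier V" using yS by (rule imageE)
      have v: "v \<in> carrier V" "w \<in> carrier V" "x = \<phi> v" "y = \<phi> w" by (fact x y)+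
      then show ?thesis using V.add.m_closed[OF v(1,2)]
        by (intro image_eqI[of _ \<phi> "v \<oplus>\<^bsub>V\<^esub> w"]) (simp_all add: add)
    qed
    show "scale c x \<in> ?S" if xS: "x \<in> ?S" for c x
    proof -
      obtain v where x: "x = \<phi> v" "v \<in> carrier V" using xS by (rule imageE)
      have v: "v \<in> carrier V" "x = \<phi> v" by (fact x)+
      have "c \<odot>\<^bsub>V\<^esub> v \<in> carrier V" by (rule V.smult_closed) (use v in \<open>simp_all add: class_ring_simps\<close>)
      then show ?thesis using v by (intro image_eqI[of _ \<phi> "c \<odot>\<^bsub>V\<^esub> v"]) (simp_all add: smult)
    qed
  qed
  obtain Bs where Bs: "Bs \<subseteq> ?S" "W.independent Bs" "?S \<subseteq> W.span Bs" "card Bs = W.dim ?S"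
    using W.basis_exists by blast
  have fB: "finite Bs" using W.independent_span_bound[OF B(1) Bs(2)] Bs(1) B(2) by blast
  define A where "A = inv_into (carrier V) \<phi> ` Bs"
  have "finite A" using fB by (simp add: A_def)
  moreover have "A \<subseteq> carrier V"
  proof
    fix a assume "a \<in> A"
    then obtain w where "w \<in> Bs" "a = inv_into (carrier V) \<phi> w" by (auto simp: A_def)
    then show "a \<in> carrier V" using inv_into_into[of w \<phi> "carrier V"] Bs(1) by blast
  qed
  moreover have "\<phi> ` A = Bs" unfolding A_def by (rule image_inv_into_cancel[OF refl Bs(1)])
  moreover have "card A = card Bs" unfolding A_def by (rule card_image[OF inj_on_inv_into[OF Bs(1)]])
  ultimately have A: "finite A" "A \<subseteq> carrier V" "\<phi> ` A = Bs" "card A = card Bs" by blast+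
  have "W.span Bs = ?S" using Bs(3) W.span_minimal[OF Bs(1) subS] by blast
  then have "\<phi> ` V.span A = \<phi> ` carrier V" using sp[OF A(1,2)] A(3) by simp
  then have gen: "V.span A = carrier V" using inj_on_image_eq_iff[OF inj spc[OF A(2)] subset_refl] by blast
  show ?thesis unfolding V.dim_def
  proof (rule Least_equality)
    show "\<exists>A. finite A \<and> card A = W.dim ?S \<and> A \<subseteq> carrier V \<and> V.gen_set A" using A gen Bs(4) by auto
    fix m assume "\<exists>A. finite A \<and> card A = m \<and> A \<subseteq> carrier V \<and> V.gen_set A"
    then obtain C where C: "finite C" "card C = m" "C \<subseteq> carrier V" "V.span C = carrier V" by blast
    have "W.dim ?S \<le> card (\<phi> ` C)" by (rule W.dim_le_card) (use sp[OF C(1,3)] C in auto)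
    also have "\<dots> \<le> m" using card_image_le[OF C(1)] C(2) by simp
    finally show "W.dim ?S \<le> m" .
  qed
qed

lemma real_dim_eq:
  fixes W :: "'a::rc_field Matrix.mat set"
  assumes W: "W \<subseteq> carrier_mat CARD('n) CARD('n)"
    and sub: "Real_Vector_Spaces.subspace (entries ` toM ` W :: ('a^'n::finite^'n) set)"
  shows "real_dim CARD('n) W = dim (entries ` toM ` W :: ('a^'n^'n) set)"
proof -
  let ?n = "CARD('n)"
  let ?f = "\<lambda>A. entries (toM A :: ('a, 'n) cmat)"
  have im: "entries ` toM ` W = ?f ` W" by (simp add: image_image)
  have mem: "A \<in> W" if "A \<in> carrier_mat ?n ?n" "?f A \<in> ?f ` W" for A
    using that W toM_inject[where 'n='n and 'a='a] by (auto simp: entries_inject)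
  have cl: "x + y \<in> W" "of_real r \<cdot>\<^sub>m x \<in> W" "0\<^sub>m ?n ?n \<in> W" if "x \<in> W" "y \<in> W" for x y and r :: real
  proof -
    have c: "x \<in> carrier_mat ?n ?n" "y \<in> carrier_mat ?n ?n" using that W by auto
    show "x + y \<in> W"
      by (rule mem) (use c that subspace_add[OF sub[unfolded im]] in \<open>auto simp: toM_add[OF c] intro!: imageI\<close>)
    show "of_real r \<cdot>\<^sub>m x \<in> W"
      by (rule mem) (use c that subspace_scale[OF sub[unfolded im]] in \<open>auto simp: toM_smult[OF c(1)]\<close>)
    show "0\<^sub>m ?n ?n \<in> W"
      by (rule mem) (use subspace_0[OF sub[unfolded im]] in auto)
  qed
  have ne: "W \<noteq> {}" using subspace_0[OF sub] by auto
  interpret F: vectorspace "class_ring :: real ring" "real_mat_module ?n (carrier_mat ?n ?n :: 'a Matrix.mat set)"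
    by (rule vectorspace_real_mat_module)
  have "VectorSpace.subspace class_ring W (real_mat_module ?n (carrier_mat ?n ?n :: 'a Matrix.mat set))"
  proof (intro subspace.intro submodule.intro)
    show "vectorspace (class_ring :: real ring) (real_mat_module ?n (carrier_mat ?n ?n :: 'a Matrix.mat set))" ..
    show "Module.module (class_ring :: real ring) (real_mat_module ?n (carrier_mat ?n ?n :: 'a Matrix.mat set))" ..
  qed (use W cl ne in \<open>auto simp: real_mat_module_def\<close>)
  then have "vectorspace class_ring ((real_mat_module ?n (carrier_mat ?n ?n))\<lparr>carrier := W\<rparr>)"
    by (rule F.subspace_is_vs)
  then have vs: "vectorspace (class_ring :: real ring) (real_mat_module ?n W)" by (simp add: real_mat_module_def)
  have "vectorspace.dim (class_ring :: real ring) (real_mat_module ?n W) = vector_space.dim scaleR (?f ` carrier (real_mat_module ?n W))"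
  proof (rule vectorspace_dim_eq[OF vs real_vector.vector_space_axioms])
    show "inj_on ?f (carrier (real_mat_module ?n W))"
      using W toM_inject[where 'n='n and 'a='a] by (auto simp: inj_on_def entries_inject real_mat_module_def)
    show "finite (Basis :: ('a^'n^'n) set)" by simp
    show "?f ` carrier (real_mat_module ?n W) \<subseteq> Modules.module.span scaleR Basis"
      by (simp flip: span_raw_def)
  next
    fix x y assume "x \<in> carrier (real_mat_module ?n W)" "y \<in> carrier (real_mat_module ?n W)"
    then have c: "x \<in> carrier_mat ?n ?n" "y \<in> carrier_mat ?n ?n" using W by (auto simp: real_mat_module_def)
    show "?f (x \<oplus>\<^bsub>real_mat_module ?n W\<^esub> y) = ?f x + ?f y" by (simp add: real_mat_module_def toM_add[OF c])
  next
    fix r :: real and x assume "x \<in> carrier (real_mat_module ?n W)"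
    then have c: "x \<in> carrier_mat ?n ?n" using W by (auto simp: real_mat_module_def)
    show "?f (r \<odot>\<^bsub>real_mat_module ?n W\<^esub> x) = r *\<^sub>R ?f x" by (simp add: real_mat_module_def toM_smult[OF c])
  qed
  then show ?thesis unfolding real_dim_def im dim_raw_def by (simp add: real_mat_module_def)
qed

lemma vec_subspace_dim_eq:
  fixes E :: "'a::rc_field Matrix.vec set"
  assumes E: "vec_subspace CARD('n) E"
  shows "vec_subspace_dim CARD('n) E = vec.dim (toV ` E :: ('a^'n::finite) set)"
proof -
  let ?V = "module_vec TYPE('a) CARD('n)"
  interpret F: vec_space "TYPE('a)" "CARD('n)" .
  have sub: "VectorSpace.subspace class_ring E ?V" using E by (simp add: vec_subspace_def)
  then have vs: "vectorspace class_ring (?V\<lparr>carrier := E\<rparr>)" by (rule F.subspace_is_vs)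
  have Ec: "E \<subseteq> carrier_vec CARD('n)" using sub by (auto simp: subspace_def submodule_def module_vec_simps)
  have "vectorspace.dim class_ring (?V\<lparr>carrier := E\<rparr>) = vec.dim ((toV :: _ \<Rightarrow> 'a^'n) ` carrier (?V\<lparr>carrier := E\<rparr>))"
  proof (rule vectorspace_dim_eq[OF vs vec.vector_space_axioms])
    show "inj_on (toV :: _ \<Rightarrow> 'a^'n) (carrier (?V\<lparr>carrier := E\<rparr>))"
      using Ec toV_inject[where 'n='n] by (auto intro!: inj_onI)
    show "finite (cart_basis :: ('a^'n) set)" by (rule finite_cart_basis)
    show "(toV :: _ \<Rightarrow> 'a^'n) ` carrier (?V\<lparr>carrier := E\<rparr>) \<subseteq> vec.span cart_basis" by (simp add: vec.span_Basis)
  next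
    fix x y assume "x \<in> carrier (?V\<lparr>carrier := E\<rparr>)" "y \<in> carrier (?V\<lparr>carrier := E\<rparr>)"
    then have c: "x \<in> carrier_vec CARD('n)" "y \<in> carrier_vec CARD('n)" using Ec by auto
    show "(toV (x \<oplus>\<^bsub>?V\<lparr>carrier := E\<rparr>\<^esub> y) :: 'a^'n) = toV x + toV y"
      using toV_add[OF c] by (simp add: module_vec_simps)
  next
    fix r :: 'a and x assume "x \<in> carrier (?V\<lparr>carrier := E\<rparr>)"
    then have c: "x \<in> carrier_vec CARD('n)" using Ec by auto
    show "(toV (r \<odot>\<^bsub>?V\<lparr>carrier := E\<rparr>\<^esub> x) :: 'a^'n) = r *s toV x"
      using toV_smult[OF c] by (simp add: module_vec_simps)
  qed
  then show ?thesis by (simp add: vec_subspace_dim_def)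
qed

section \<open>Closed subgroups in matrix form\<close>

text \<open>The type \<open>'n\<close> only serves to have the index set of size \<open>n\<close> as a type.\<close>

locale matrix_homogeneous_space =
  fixes Gr :: "'a::rc_field Matrix.mat monoid" and H :: "'a Matrix.mat set" and G K :: "('a, 'n::finite) cmat set"
  assumes Gr: "carrier Gr \<subseteq> carrier_mat CARD('n) CARD('n)" "mult Gr = (*)" "one Gr = 1\<^sub>m CARD('n)"
    and G_def: "G = toM ` carrier Gr" and K_def: "K = toM ` H" and UG: "unitary_group G"
    and H_subgroup: "subgroup H Gr" and H_closed: "closedin (subtopology (mat_topology CARD('n)) (carrier Gr)) H"
begin

sublocale metric_unitary_group G "cmat_dist Gr"
  unfolding G_def by (rule metric_unitary_group_cmat_dist[OF Gr(1) UG[unfolded G_def]])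

lemma H_carrier: "H \<subseteq> carrier Gr" "H \<subseteq> carrier_mat CARD('n) CARD('n)"
  using subgroup.subset[OF H_subgroup] Gr(1) by auto

lemma mem_G: "A \<in> carrier Gr \<Longrightarrow> toM A \<in> G" "u \<in> G \<Longrightarrow> fromM u \<in> carrier Gr"
  using Gr(1) fromM_toM[where 'n='n and 'a='a] by (auto simp: G_def)

lemma mem_K: "A \<in> H \<Longrightarrow> toM A \<in> K" "u \<in> K \<Longrightarrow> fromM u \<in> H"
  using H_carrier(2) fromM_toM[where 'n='n and 'a='a] by (auto simp: K_def subset_iff)

lemma K_sub: "K \<subseteq> G"
  using H_carrier(1) by (auto simp: K_def G_def)

lemma K_one: "1 \<in> K"
  using subgroup.one_closed[OF H_subgroup] Gr(3) mem_K(1) by (metis toM_one)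

lemma K_mult: "u \<in> K \<Longrightarrow> v \<in> K \<Longrightarrow> u * v \<in> K"
proof -
  assume "u \<in> K" "v \<in> K"
  then have "fromM u * fromM v \<in> H" using subgroup.m_closed[OF H_subgroup] Gr(2) mem_K(2) by metis
  then have "toM (fromM (u * v)) \<in> K" unfolding fromM_mult by (rule mem_K(1))
  then show ?thesis by simp
qed

lemma K_star: "star u \<in> K" if u: "u \<in> K"
proof -
  have uG: "u \<in> G" using u K_sub by blast
  note uu = unitaryD[OF G_unitary[OF uG]]
  have "m_inv Gr (fromM u) = fromM (star u)"
    unfolding m_inv_def
  proof (rule the_equality)
    show "fromM (star u) \<in> carrier Gr \<and> fromM u \<otimes>\<^bsub>Gr\<^esub> fromM (star u) = \<one>\<^bsub>Gr\<^esub> \<and> fromM (star u) \<otimes>\<^bsub>Gr\<^esub> fromM u = \<one>\<^bsub>Gr\<^esub>"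
      using uu mem_G(2)[OF G_star[OF uG]] by (simp add: Gr(2,3) fromM_one flip: fromM_mult)
    fix y assume y: "y \<in> carrier Gr \<and> fromM u \<otimes>\<^bsub>Gr\<^esub> y = \<one>\<^bsub>Gr\<^esub> \<and> y \<otimes>\<^bsub>Gr\<^esub> fromM u = \<one>\<^bsub>Gr\<^esub>"
    then have yc: "y \<in> carrier_mat CARD('n) CARD('n)" using Gr(1) by blast
    have "(toM (y * fromM u) :: ('a, 'n) cmat) = 1" using y Gr(2,3) toM_one by metis
    then have "toM y * u = 1" by (simp add: toM_mult[OF yc fromM_carrier])
    then have "toM y * (u * star u) = star u" by (simp flip: mult.assoc)
    then have "toM y = star u" using uu(2) by simp
    then show "y = fromM (star u)" using fromM_toM[OF yc] by metis
  qed
  then have "fromM (star u) \<in> H" using subgroup.m_inv_closed[OF H_subgroup mem_K(2)[OF u]] by simp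
  then show ?thesis using mem_K(1)[of "fromM (star u)"] by simp
qed

lemma K_closed: "(\<And>j. u j \<in> K) \<Longrightarrow> u \<longlonglongrightarrow> l \<Longrightarrow> l \<in> G \<Longrightarrow> l \<in> K"
  using closedin_limit[OF H_closed Gr(1), of u l] by (simp add: K_def G_def)

abbreviation "L \<equiv> lie_set K"

lemma subspace_L: "Real_Vector_Spaces.subspace (entries ` L)"
proof -
  have z: "0 \<in> L" using K_one by (simp add: lie_set_def)
  have add: "x + y \<in> L" if "x \<in> L" "y \<in> L" for x y
    by (rule lie_set_add[OF UG K_sub K_one]) (fact K_mult K_closed that)+
  have "Real_Vector_Spaces.subspace L"
    unfolding real_vector.subspace_def
    using z add lie_set_scale by blast
  then show ?thesis by (rule linear_subspace_image[OF linear_entries])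
qed

lemma L_skew: "x \<in> L \<Longrightarrow> skewadj x"
  by (simp add: lie_set_def)

section \<open>Lie algebra, orthogonal complement and \<kappa> of the subgroup in matrix
  form\<close>

lemma toM_lie: "toM ` lie_algebra CARD('n) H = L"
  using toM_lie_algebra[OF H_carrier(2)] by (simp add: K_def)

lemma lie_algebra_carrier: "lie_algebra n W \<subseteq> carrier_mat n n"
  by (auto simp: lie_algebra_def skew_def)

lemma group_dim_eq:
  "group_dim CARD('n) H = dim (entries ` L)"
  "group_dim CARD('n) (carrier Gr) = dim (entries ` {x :: ('a, 'n) cmat. skewadj x})"
proof -
  show "group_dim CARD('n) H = dim (entries ` L)"
    unfolding group_dim_def using real_dim_eq[OF lie_algebra_carrier] subspace_L toM_lie by metis
  have "lie_set G = {x :: ('a, 'n) cmat. skewadj x}" using G_exp by (auto simp: lie_set_def)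
  then have "toM ` lie_algebra CARD('n) (carrier Gr) = {x :: ('a, 'n) cmat. skewadj x}"
    using toM_lie_algebra[OF Gr(1)] by (simp add: G_def)
  then show "group_dim CARD('n) (carrier Gr) = dim (entries ` {x :: ('a, 'n) cmat. skewadj x})"
    unfolding group_dim_def using real_dim_eq[OF lie_algebra_carrier] subspace_skewadj by metis
qed

lemma skew_iff: "A \<in> skew CARD('n) \<longleftrightarrow> A \<in> carrier_mat CARD('n) CARD('n) \<and> skewadj (toM A :: ('a, 'n) cmat)"
proof (cases "A \<in> carrier_mat CARD('n) CARD('n)")
  case True
  have u: "- A \<in> carrier_mat CARD('n) CARD('n)" using True by simp
  show ?thesis using True toM_inject[OF adjoint_carrier[OF True] u]
    by (simp add: skew_def skewadj_def toM_adjoint[OF True] toM_uminus[OF True])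
qed (simp add: skew_def)

lemma lie_complement_iff:
  assumes A: "A \<in> carrier_mat CARD('n) CARD('n)"
  shows "A \<in> lie_complement CARD('n) H \<longleftrightarrow> toM A \<in> skew_compl L"
proof -
  have "hs_inner A h = inner (entries (toM A :: ('a, 'n) cmat)) (entries (toM h :: ('a, 'n) cmat))" if "h \<in> lie_algebra CARD('n) H" for h
    using hs_inner_eq[OF A] lie_algebra_carrier that by blast
  then have "(\<forall>h\<in>lie_algebra CARD('n) H. hs_inner A h = 0) \<longleftrightarrow> (\<forall>z\<in>L. inner (entries (toM A :: ('a, 'n) cmat)) (entries z) = 0)"
    unfolding toM_lie[symmetric] by simp
  then show ?thesis using A by (simp add: lie_complement_def skew_compl_def skew_iff)
qed

lemma proj_compl_in: "skewadj x \<Longrightarrow> proj_compl L x \<in> skew_compl L"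
proof -
  assume x: "skewadj x"
  have "skewadj (x - (x - proj_compl L x))" by (rule skewadj_diff[OF x L_skew[OF proj_compl(1)[OF subspace_L]]])
  then show ?thesis using proj_compl(2)[OF subspace_L] by (simp add: skew_compl_def)
qed

text \<open>Uniqueness holds because the difference of two candidates lies in the complement and is
  orthogonal to it.\<close>

lemma complement_proj_eq:
  assumes A: "A \<in> skew CARD('n)"
  shows "complement_proj CARD('n) H A = fromM (proj_compl L (toM A))"
  unfolding complement_proj_def
proof (rule the_equality)
  let ?P = "proj_compl L (toM A) :: ('a, 'n) cmat"
  have Ac: "A \<in> carrier_mat CARD('n) CARD('n)" and As: "skewadj (toM A :: ('a, 'n) cmat)" using A skew_iff by auto
  have hs: "hs_inner (A - y) z = inner (entries (toM A) - entries (toM y)) (entries (toM z :: ('a, 'n) cmat))"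
    if "y \<in> carrier_mat CARD('n) CARD('n)" "z \<in> carrier_mat CARD('n) CARD('n)" for y z
    using hs_inner_eq[OF minus_carrier_mat[OF that(1)] that(2), of A] by (simp add: toM_diff[OF Ac that(1)])
  have car: "z \<in> carrier_mat CARD('n) CARD('n)" if "z \<in> lie_complement CARD('n) H" for z
    using that by (auto simp: lie_complement_def skew_def)
  show "fromM ?P \<in> lie_complement CARD('n) H \<and> (\<forall>z\<in>lie_complement CARD('n) H. hs_inner (A - fromM ?P) z = 0)"
  proof
    show "fromM ?P \<in> lie_complement CARD('n) H" using proj_compl_in[OF As] lie_complement_iff[OF fromM_carrier, of ?P] by simp
    show "\<forall>z\<in>lie_complement CARD('n) H. hs_inner (A - fromM ?P) z = 0"
    proof
      fix z assume z: "z \<in> lie_complement CARD('n) H"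
      have "toM z \<in> skew_compl L" using z lie_complement_iff[OF car[OF z]] by simp
      then have "inner (entries (toM z :: ('a, 'n) cmat)) (entries (toM A - ?P)) = 0"
        using proj_compl(1)[OF subspace_L, of "toM A"] by (auto simp: skew_compl_def)
      then show "hs_inner (A - fromM ?P) z = 0" by (simp add: hs[OF fromM_carrier car[OF z]] inner_commute)
    qed
  qed
  fix y assume y: "y \<in> lie_complement CARD('n) H \<and> (\<forall>z\<in>lie_complement CARD('n) H. hs_inner (A - y) z = 0)"
  have yc: "y \<in> carrier_mat CARD('n) CARD('n)" using y car by blast
  let ?d = "toM y - ?P"
  have d: "?d \<in> skew_compl L"
  proof -
    have "toM y \<in> skew_compl L" using y lie_complement_iff[OF yc] by simp
    then have "entries (toM y) - entries ?P \<in> entries ` skew_compl L"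
      using subspace_diff[OF subspace_skew_compl] proj_compl_in[OF As] by blast
    then have "entries ?d \<in> entries ` skew_compl L" by simp
    then show ?thesis by (simp only: entries_mem_iff)
  qed
  then have "fromM ?d \<in> lie_complement CARD('n) H" using lie_complement_iff[OF fromM_carrier, of ?d] by simp
  then have "hs_inner (A - y) (fromM ?d) = 0" using y by blast
  then have 1: "inner (entries (toM A) - entries (toM y)) (entries ?d) = 0" by (simp only: hs[OF yc fromM_carrier] toM_fromM)
  have 2: "inner (entries ?d) (entries (toM A - ?P)) = 0"
    using d proj_compl(1)[OF subspace_L, of "toM A"] by (auto simp: skew_compl_def)
  have "inner (entries ?d) (entries ?d) = 0"
    using 1 2 by (simp add: inner_diff_left inner_diff_right inner_commute)
  then have "entries ?d = 0" by simp
  then have "toM y = ?P" by (simp add: entries_inject)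
  then show "y = fromM ?P" using fromM_toM[OF yc] by metis
qed

lemma proj_compl_scale: "proj_compl L (r *\<^sub>R x) = r *\<^sub>R proj_compl L x"
proof (rule proj_compl_unique[OF subspace_L])
  have "r *\<^sub>R x - r *\<^sub>R proj_compl L x = r *\<^sub>R (x - proj_compl L x)" by (simp add: scaleR_right_diff_distrib)
  then show "r *\<^sub>R x - r *\<^sub>R proj_compl L x \<in> L" using lie_set_scale[OF proj_compl(1)[OF subspace_L]] by simp
  show "inner (entries (r *\<^sub>R proj_compl L x)) (entries z) = 0" if "z \<in> L" for z
    using proj_compl(2)[OF subspace_L that] by simp
qed

text \<open>The supremum in \<open>kappa\<close> bounds its members only if the set is bounded. The
  projection is a contraction in the Euclidean norm, so equivalence of norms suffices; the factors
  \<open>B1\<close> and \<open>B2\<close> may depend on \<open>n\<close> but do not enter the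
  conclusion.\<close>

lemma kappa_bound:
  assumes \<alpha>: "0 < \<alpha>" and k: "\<alpha> \<le> inverse (kappa CARD('n) H)" and x: "skewadj x"
  shows "\<alpha> * norm (proj_compl L x) \<le> norm x"
proof -
  let ?X = "{x \<in> skew CARD('n). opnorm x \<le> 1} :: 'a Matrix.mat set"
  \<comment> \<open>\<open>inverse 0 = 0\<close>, so a positive lower bound on the inverse makes
    \<open>kappa\<close> itself positive.\<close>
  have kp: "0 < kappa CARD('n) H" using k \<alpha> by (metis inverse_positive_iff_positive less_le_trans)
  have val: "opnorm (complement_proj CARD('n) H A) = norm (proj_compl L (toM A))" if "A \<in> skew CARD('n)" for A
    unfolding complement_proj_eq[OF that] using opnorm_eq_norm[OF fromM_carrier] by simp
  obtain B1 where B1: "0 < B1" "\<And>M :: ('a, 'n) cmat. norm (entries M) \<le> norm M * B1"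
    using bounded_linear.pos_bounded[OF bounded_linear_entries] by blast
  obtain B2 where B2: "0 < B2" "\<And>E :: 'a^'n^'n. norm (of_entries E) \<le> norm E * B2"
    using bounded_linear.pos_bounded[OF bounded_linear_of_entries] by blast
  have pb: "norm (proj_compl L y) \<le> norm y * B1 * B2" for y
  proof -
    let ?p = "entries (proj_compl L y)"
    have "inner ?p (entries (y - proj_compl L y)) = 0" using proj_compl[OF subspace_L] by blast
    then have "inner ?p ?p = inner ?p (entries y)" by (simp add: inner_diff_right)
    also have "\<dots> \<le> norm ?p * norm (entries y)" by (rule norm_cauchy_schwarz)
    finally have "norm ?p * norm ?p \<le> norm ?p * norm (entries y)" by (simp add: dot_square_norm power2_eq_square)
    then have "norm ?p \<le> norm (entries y)" by (cases "?p = 0") auto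
    also have "\<dots> \<le> norm y * B1" by (rule B1(2))
    finally have "norm ?p * B2 \<le> norm y * B1 * B2" using B2(1) by (intro mult_right_mono) auto
    then show ?thesis using B2(2)[of ?p] by (simp add: entries_inverse)
  qed
  have bdd: "bdd_above ((\<lambda>A. opnorm (complement_proj CARD('n) H A)) ` ?X)"
  proof (rule bdd_aboveI2)
    fix A assume A: "A \<in> ?X"
    then have "norm (toM A :: ('a, 'n) cmat) \<le> 1"
      using opnorm_eq_norm[where 'n='n, of A] skew_iff[of A] by simp
    then have "norm (toM A :: ('a, 'n) cmat) * B1 * B2 \<le> 1 * B1 * B2" using B1(1) B2(1) by (intro mult_right_mono) auto
    then show "opnorm (complement_proj CARD('n) H A) \<le> B1 * B2" using val A pb[of "toM A"] by simp
  qed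
  show ?thesis
  proof (cases "x = 0")
    case True
    have "proj_compl L 0 = 0" using proj_compl_scale[of 0 0] by simp
    then show ?thesis using True by simp
  next
    case False
    let ?y = "(1 / norm x) *\<^sub>R x"
    have y: "fromM ?y \<in> ?X" "fromM ?y \<in> skew CARD('n)"
      using x False opnorm_eq_norm[OF fromM_carrier[of ?y]] skew_iff[of "fromM ?y"] by auto
    have "norm (proj_compl L ?y) \<le> kappa CARD('n) H"
      using cSUP_upper[OF y(1) bdd] val[OF y(2)] by (simp add: kappa_def)
    then have "norm (proj_compl L x) \<le> kappa CARD('n) H * norm x"
      using False by (simp add: proj_compl_scale divide_le_eq)
    then have "\<alpha> * norm (proj_compl L x) \<le> (\<alpha> * kappa CARD('n) H) * norm x"
      using \<alpha> by (simp add: mult.assoc)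
    also have "\<alpha> * kappa CARD('n) H \<le> 1" using k kp by (simp add: field_simps)
    finally show ?thesis by (simp add: mult_right_mono)
  qed
qed

end

section \<open>Orthonormal families\<close>

text \<open>The Hermitian form with values in the scalars. Its real part is \<open>inner\<close>;
  orthogonality over the complex numbers needs all of it.\<close>

definition hform :: "'a::rc_field^'n::finite \<Rightarrow> 'a^'n \<Rightarrow> 'a" where
  "hform x y = (\<Sum>j\<in>UNIV. vec_nth x j * conjugate (vec_nth y j))"

lemma hform_simps:
  "hform (x + y) z = hform x z + hform y z" "hform (x - y) z = hform x z - hform y z"
  "hform (c *s x) z = c * hform x z" "hform x (c *s z) = conjugate c * hform x z" "hform 0 z = 0"
  by (simp_all add: hform_def sum.distrib sum_subtractf sum_distrib_left algebra_simps conjugate_dist_mul)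

lemma hform_sum: "hform (sum f S) z = (\<Sum>s\<in>S. hform (f s) z)"
  by (induction S rule: infinite_finite_induct) (auto simp: hform_simps)

lemma conjugate_hform: "conjugate (hform x y) = hform y x"
  by (simp add: hform_def sum_conjugate conjugate_dist_mul mult.commute)

lemma inner_hform: "inner x y = inner (hform x y) 1"
  by (simp add: inner_vec_def hform_def inner_sum_left) (simp flip: inner_eq_mult_conjugate)

lemma hform_self: "hform x x = of_real ((norm x)\<^sup>2)"
proof -
  have "hform x x = (\<Sum>j\<in>UNIV. of_real ((norm (vec_nth x j))\<^sup>2))"
    by (simp add: hform_def mult_conjugate)
  then show ?thesis by (simp add: norm_vec_def L2_set_def sum_nonneg)
qed

lemma mapp_outer_hform: "mapp (outer a b) x = hform x b *s a"
  by (simp add: mapp_outer hform_def)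

lemma mapp_scalar: "mapp M (c *s x) = c *s mapp M x"
  by (simp add: Finite_Cartesian_Product.vec_eq_iff mapp_nth sum_distrib_left mult_ac)

definition orthonormal :: "('a::rc_field^'n::finite) set \<Rightarrow> bool" where
  "orthonormal S \<longleftrightarrow> finite S \<and> (\<forall>x\<in>S. \<forall>y\<in>S. hform x y = (if x = y then 1 else 0))"

lemma orthonormal_card_le:
  assumes S: "orthonormal (S :: ('a::rc_field^'n::finite) set)"
  shows "card S \<le> DIM('a^'n)"
proof -
  have "pairwise Linear_Algebra.orthogonal S"
    using S by (auto simp: pairwise_def Linear_Algebra.orthogonal_def orthonormal_def inner_hform[where 'a='a])
  moreover have "0 \<notin> S"
  proof
    assume "0 \<in> S"
    then have "hform 0 (0 :: 'a^'n) = 1" using S by (simp add: orthonormal_def)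
    then show False by (simp add: hform_simps)
  qed
  ultimately have "independent S" by (rule pairwise_orthogonal_independent)
  then have "card S \<le> dim (UNIV :: ('a^'n) set)" by (intro independent_card_le_dim) auto
  then show ?thesis by simp
qed

lemma orthonormal_residual:
  assumes S: "orthonormal S" and t: "t \<in> S"
  shows "hform (x - (\<Sum>s\<in>S. hform x s *s s)) t = 0"
proof -
  have "(\<Sum>s\<in>S. hform (hform x s *s s) t) = (\<Sum>s\<in>S. if s = t then hform x t else 0)"
    using S t by (intro sum.cong) (auto simp: hform_simps orthonormal_def)
  then show ?thesis using S t by (simp add: hform_simps hform_sum orthonormal_def)
qed

text \<open>Orthonormal sets are linearly independent over the reals, which bounds their size. A
  largest one inside \<open>V\<close> spans \<open>V\<close>, for otherwise a normalized residual
  could be added.\<close>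

lemma orthonormal_spanning_exists:
  fixes V :: "('a::rc_field^'n::finite) set"
  assumes V: "vec.subspace V"
  obtains S where "orthonormal S" "S \<subseteq> V" "V \<subseteq> vec.span S"
proof -
  let ?P = "\<lambda>S. orthonormal S \<and> S \<subseteq> V"
  have "\<exists>S. ?P S \<and> (\<forall>T. ?P T \<longrightarrow> card T \<le> card S)"
  proof (rule ex_has_greatest_nat[where P="?P" and k="{}" and f=card and b="DIM('a^'n) + 1"])
    show "?P {}" by (simp add: orthonormal_def)
    show "\<forall>T. ?P T \<longrightarrow> card T < DIM('a^'n) + 1" using orthonormal_card_le by (metis less_Suc_eq_le Suc_eq_plus1)
  qed
  then obtain S where S: "orthonormal S" "S \<subseteq> V" and max: "\<And>T. orthonormal T \<Longrightarrow> T \<subseteq> V \<Longrightarrow> card T \<le> card S"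
    by auto
  have fin: "finite S" using S(1) by (simp add: orthonormal_def)
  have "V \<subseteq> vec.span S"
  proof
    fix x assume x: "x \<in> V"
    show "x \<in> vec.span S"
    proof (rule ccontr)
      assume nx: "x \<notin> vec.span S"
      let ?p = "\<Sum>s\<in>S. hform x s *s s"
      have p: "?p \<in> vec.span S" by (intro vec.span_sum vec.span_scale vec.span_base)
      have pV: "?p \<in> V" using V S(2) by (intro vec.subspace_sum vec.subspace_scale) auto
      let ?y = "x - ?p"
      have y0: "?y \<noteq> 0" using nx p by auto
      define w where "w = of_real (1 / norm ?y) *s ?y"
      have wV: "w \<in> V" unfolding w_def using V x pV by (intro vec.subspace_scale vec.subspace_diff)
      have ws: "hform w s = 0" if "s \<in> S" for s
        using orthonormal_residual[OF S(1) that, of x] by (simp only: w_def hform_simps(3) mult_zero_right)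
      have sw: "hform s w = 0" if "s \<in> S" for s using ws[OF that] conjugate_hform[of w s] by simp
      have "hform w w = of_real (1 / norm ?y) * (of_real (1 / norm ?y) * of_real ((norm ?y)\<^sup>2))"
        unfolding w_def hform_simps(3) hform_simps(4) conjugate_of_real by (simp only: hform_self)
      also have "\<dots> = of_real (1 / norm ?y * (1 / norm ?y * (norm ?y)\<^sup>2))" by (simp only: of_real_mult)
      also have "1 / norm ?y * (1 / norm ?y * (norm ?y)\<^sup>2) = 1" using y0 by (simp add: power2_eq_square)
      finally have ww: "hform w w = 1" by simp
      have "w \<notin> S" using ws[of w] ww by auto
      moreover have "orthonormal (insert w S)" using S(1) ws sw ww \<open>w \<notin> S\<close> by (auto simp: orthonormal_def)
      moreover have "insert w S \<subseteq> V" using wV S(2) by simp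
      ultimately have "card (insert w S) \<le> card S" using max by blast
      then show False using fin \<open>w \<notin> S\<close> by simp
    qed
  qed
  then show ?thesis using that S by blast
qed

lemma inner_entries_outer: "inner (entries (outer a b)) (entries M) = inner a (mapp M b)"
proof -
  have "inner (entries (outer a b)) (entries M)
      = (\<Sum>i\<in>UNIV. \<Sum>j\<in>UNIV. inner (vec_nth a i * conjugate (vec_nth b j)) (entry M i j))"
    by (simp add: inner_vec_def entry_def outer_def of_entries_inverse)
  also have "\<dots> = (\<Sum>i\<in>UNIV. \<Sum>j\<in>UNIV. inner (vec_nth a i) (entry M i j * vec_nth b j))"
  proof (intro sum.cong refl)
    fix i j
    have "inner (conjugate (vec_nth b j) * vec_nth a i) (entry M i j) = inner (vec_nth a i) (conjugate (conjugate (vec_nth b j)) * entry M i j)"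
      by (rule inner_mult_left_conjugate)
    then show "inner (vec_nth a i * conjugate (vec_nth b j)) (entry M i j) = inner (vec_nth a i) (entry M i j * vec_nth b j)"
      by (simp add: mult.commute)
  qed
  also have "\<dots> = inner a (mapp M b)" by (simp add: inner_vec_def mapp_nth inner_sum_right)
  finally show ?thesis .
qed

text \<open>The matrices \<open>w a\<^sup>* - a w\<^sup>*\<close> with \<open>a \<in> S\<close> and \<open>w\<close> in a real basis of the lines through \<open>T\<close>
  are skew, pairwise orthogonal, and orthogonal to all matrices leaving the span of \<open>S\<close> invariant.\<close>

lemma dim_skew_compl_ge:
  fixes L :: "('a::rc_field, 'n::finite) cmat set"
  assumes S: "orthonormal S" and T: "orthonormal T" and st: "\<And>s t. s \<in> S \<Longrightarrow> t \<in> T \<Longrightarrow> hform s t = 0"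
    and L: "\<And>z. z \<in> L \<Longrightarrow> skewadj z" "\<And>z s t c. z \<in> L \<Longrightarrow> s \<in> S \<Longrightarrow> t \<in> T \<Longrightarrow> inner (c *s t) (mapp z s) = 0"
  shows "DIM('a) * (card S * card T) \<le> dim (entries ` skew_compl L)"
proof -
  let ?I = "(Basis :: 'a set) \<times> (S \<times> T)"
  define X :: "'a \<times> ('a^'n) \<times> ('a^'n) \<Rightarrow> ('a, 'n) cmat"
    where "X = (\<lambda>(c, s, t). outer (c *s t) s - outer s (c *s t))"
  have ts: "hform t s = 0" if "s \<in> S" "t \<in> T" for s t
    using st[OF that] conjugate_hform[of s t] by simp
  have orth: "inner (entries (X p)) (entries (X q)) = (if p = q then 2 else 0)" if pq: "p \<in> ?I" "q \<in> ?I" for p q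
  proof -
    obtain c s t c' s' t' where e: "p = (c, s, t)" "q = (c', s', t')" by (metis prod_cases3)
    then have m: "c \<in> Basis" "s \<in> S" "t \<in> T" "c' \<in> Basis" "s' \<in> S" "t' \<in> T" using pq by auto
    have z: "hform s' t = 0" "hform t s' = 0" "hform s t' = 0" "hform t' s = 0" using m st ts by auto
    have ss: "hform s s' = (if s = s' then 1 else 0)" "hform t t' = (if t = t' then 1 else 0)"
      "hform s' s = (if s = s' then 1 else 0)"
      using m S T by (auto simp: orthonormal_def)
    have i1: "inner (c *s t) (hform s s' *s (c' *s t')) = (if p = q then 1 else 0)"
    proof -
      have "inner (c *s t) (c' *s t) = inner c c'" if "t = t'"
        using ss(2) that by (subst inner_hform) (simp add: hform_simps inner_eq_mult_conjugate[of c c'] mult.commute)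
      moreover have "inner (c *s t) (c' *s t') = 0" if "t \<noteq> t'"
        using ss(2) that by (subst inner_hform) (simp add: hform_simps)
      ultimately show ?thesis using ss(1) m(1,4) by (cases "t = t'") (auto simp: e inner_Basis)
    qed
    have i2: "inner s (hform (c *s t) (c' *s t') *s s') = (if p = q then 1 else 0)"
    proof -
      have "inner s (k *s s') = (if s = s' then inner k 1 else 0)" for k
        using ss(3) by (subst inner_commute, subst inner_hform) (auto simp: hform_simps)
      moreover have "inner (hform (c *s t) (c' *s t')) 1 = (if t = t' then inner c c' else 0)"
        using ss(2) by (simp add: hform_simps inner_eq_mult_conjugate[of c c'] mult.commute)
      ultimately show ?thesis using m(1,4) by (auto simp: e inner_Basis)
    qed
    have "inner (entries (X p)) (entries (X q)) = inner (c *s t) (mapp (X q) s) - inner s (mapp (X q) (c *s t))"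
      by (simp add: X_def e(1) inner_diff_left flip: inner_entries_outer)
    also have "mapp (X q) s = hform s s' *s (c' *s t')"
      by (simp add: X_def e(2) mapp_outer_hform hform_simps z)
    also have "mapp (X q) (c *s t) = - (hform (c *s t) (c' *s t') *s s')"
      by (simp add: X_def e(2) mapp_outer_hform hform_simps(3,4) z)
    finally show ?thesis using i1 i2 by simp
  qed
  have mem: "X p \<in> skew_compl L" if "p \<in> ?I" for p
  proof -
    obtain c s t where e: "p = (c, s, t)" by (metis prod_cases3)
    then have m: "s \<in> S" "t \<in> T" using that by auto
    have "inner (entries (X p)) (entries z) = 0" if z: "z \<in> L" for z
    proof -
      have "inner s (mapp z (c *s t)) = inner (mapp (star z) s) (c *s t)" using inner_mapp_left[of "star z" s "c *s t"] by simp
      also have "\<dots> = - inner (c *s t) (mapp z s)" using L(1)[OF z] by (simp add: skewadj_def inner_commute)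
      finally show ?thesis using L(2)[OF z m, of c] by (simp add: X_def e inner_diff_left inner_entries_outer)
    qed
    moreover have "skewadj (X p)" by (simp add: X_def e skewadj_def)
    ultimately show ?thesis by (simp add: skew_compl_def)
  qed
  let ?B = "(\<lambda>p. entries (X p)) ` ?I"
  have inj: "inj_on (\<lambda>p. entries (X p)) ?I"
  proof (rule inj_onI)
    fix p q assume p: "p \<in> ?I" "q \<in> ?I" "entries (X p) = entries (X q)"
    then show "p = q" using orth[OF p(1,2)] orth[OF p(1,1)] by (metis zero_neq_numeral)
  qed
  have "pairwise Linear_Algebra.orthogonal ?B"
    unfolding pairwise_def
  proof (intro ballI impI)
    fix x y assume "x \<in> ?B" "y \<in> ?B" "x \<noteq> y"
    then obtain p q where p: "p \<in> ?I" "q \<in> ?I" "x = entries (X p)" "y = entries (X q)" by blast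
    then have "p \<noteq> q" using \<open>x \<noteq> y\<close> by blast
    then show "Linear_Algebra.orthogonal x y" using orth[OF p(1,2)] p by (simp add: Linear_Algebra.orthogonal_def)
  qed
  moreover have "0 \<notin> ?B"
  proof
    assume "0 \<in> ?B"
    then obtain p where p: "p \<in> ?I" "0 = entries (X p)" by blast
    then show False using orth[OF p(1,1)] by (metis inner_zero_left zero_neq_numeral)
  qed
  ultimately have "independent ?B" by (rule pairwise_orthogonal_independent)
  moreover have "?B \<subseteq> entries ` skew_compl L" using mem by blast
  ultimately have "card ?B \<le> dim (entries ` skew_compl L)" by (intro independent_card_le_dim)
  then show ?thesis by (simp add: card_image[OF inj] card_cartesian_product)
qed

text \<open>Differentiation of \<open>exp (t *\<^sub>R z)\<close> at \<open>t = 0\<close> transfers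
  vanishing matrix coefficients from the group to its Lie algebra.\<close>

lemma lie_set_offdiagonal:
  fixes K :: "('a::rc_field, 'n::finite) cmat set"
  assumes z: "z \<in> lie_set K" and K: "\<And>u. u \<in> K \<Longrightarrow> inner w (mapp u s) = 0"
  shows "inner w (mapp z s) = 0"
proof -
  have bl: "bounded_linear (\<lambda>M. inner w (mapp M s))"
    by (rule bounded_linear_compose[OF bounded_linear_inner_right bounded_bilinear.bounded_linear_left[OF bounded_bilinear_mapp]])
  have "((\<lambda>t. exp (t *\<^sub>R z)) has_vector_derivative exp (0 *\<^sub>R z) * z) (at 0)"
    by (rule exp_scaleR_has_vector_derivative_right)
  from bounded_linear.has_vector_derivative[OF bl this]
  have "((\<lambda>t. inner w (mapp (exp (t *\<^sub>R z)) s)) has_vector_derivative inner w (mapp z s)) (at 0)" by simp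
  moreover have "(\<lambda>t. inner w (mapp (exp (t *\<^sub>R z)) s)) = (\<lambda>t. 0)" using K z by (auto simp: lie_set_def)
  ultimately have "((\<lambda>t::real. 0) has_vector_derivative inner w (mapp z s)) (at 0)" by simp
  then show ?thesis using vector_derivative_unique_at[OF _ has_vector_derivative_const] by blast
qed

lemma dim_cmat_le: "dim (W :: ('a::rc_field^'n::finite^'n) set) \<le> DIM('a) * (CARD('n) * CARD('n))"
  using dim_subset_UNIV[of W] by (simp add: mult_ac)

section \<open>Projections onto the span of an orthonormal set, and dimension counts\<close>

definition projection :: "('a::rc_field^'n::finite) set \<Rightarrow> ('a, 'n) cmat" where
  "projection T = (\<Sum>t\<in>T. outer t t)"

lemma mapp_sum_left: "mapp (sum f T) x = (\<Sum>t\<in>T. mapp (f t) x)"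
  by (induction T rule: infinite_finite_induct) auto

lemma mapp_projection: "mapp (projection T) x = (\<Sum>t\<in>T. hform x t *s t)"
  by (simp add: projection_def mapp_sum_left mapp_outer_hform)

lemma star_projection: "star (projection T) = projection T"
  unfolding projection_def by (induction T rule: infinite_finite_induct) auto

lemma mapp_projection_span:
  assumes T: "orthonormal T" and x: "x \<in> vec.span T"
  shows "mapp (projection T) x = x"
proof -
  have "x - mapp (projection T) x = 0"
    using x
  proof (induction rule: vec.span_induct_alt)
    case base
    then show ?case by simp
  next
    case (step c t y)
    have "mapp (projection T) t = (\<Sum>s\<in>T. if s = t then t else 0)"
      unfolding mapp_projection using T step.hyps
      by (intro sum.cong) (auto simp: orthonormal_def)
    then have "mapp (projection T) t = t" using T step.hyps by (simp add: orthonormal_def)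
    then show ?case using step.IH by (simp add: mapp_scalar algebra_simps)
  qed
  then show ?thesis by simp
qed

lemma projection_square:
  assumes T: "orthonormal T" shows "projection T * projection T = projection T"
proof (rule cmat_eqI)
  fix x
  have "mapp (projection T) x \<in> vec.span T"
    unfolding mapp_projection by (intro vec.span_sum vec.span_scale vec.span_base)
  then show "mapp (projection T * projection T) x = mapp (projection T) x"
    by (simp add: mapp_projection_span[OF T])
qed

text \<open>\<open>M * projection T\<close> is the sum of \<open>outer (mapp M t) t\<close> over
  \<open>t \<in> T\<close>, so it depends on one vector for each \<open>t\<close>.\<close>

lemma dim_mult_projection_le:
  fixes T :: "('a::rc_field^'n::finite) set"
  assumes T: "orthonormal T"
  shows "dim (range (\<lambda>M. entries (M * projection T))) \<le> DIM('a) * (CARD('n) * card T)"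
proof -
  let ?B = "(\<lambda>(b, t). entries (outer b t)) ` ((Basis :: ('a^'n) set) \<times> T)"
  have fin: "finite T" using T by (simp add: orthonormal_def)
  have "range (\<lambda>M. entries (M * projection T)) \<subseteq> span ?B"
  proof (intro subsetI)
    fix x assume "x \<in> range (\<lambda>M. entries (M * projection T))"
    then obtain M where M: "x = entries (M * projection T)" by blast
    have o: "entries (outer a t) = (\<Sum>b\<in>Basis. inner a b *\<^sub>R entries (outer b t))" for a t :: "'a^'n"
    proof -
      have lin: "linear (\<lambda>a :: 'a^'n. entries (outer a t))"
        by (rule linearI) (simp_all add: outer_def of_entries_inverse Finite_Cartesian_Product.vec_eq_iff distrib_right)
      have "entries (outer (\<Sum>b\<in>Basis. inner a b *\<^sub>R b) t) = (\<Sum>b\<in>Basis. inner a b *\<^sub>R entries (outer b t))"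
        by (subst linear_sum[OF lin]) (simp only: linear_scale[OF lin])
      then show ?thesis by (simp add: euclidean_representation)
    qed
    have "M * projection T = (\<Sum>t\<in>T. outer (mapp M t) t)"
    proof (rule cmat_eqI)
      fix x show "mapp (M * projection T) x = mapp (\<Sum>t\<in>T. outer (mapp M t) t) x"
        by (simp add: mapp_projection mapp_sum_left mapp_outer_hform mapp_scalar
            linear_sum[OF bounded_linear.linear[OF bounded_linear_mapp]])
    qed
    then have "x = (\<Sum>t\<in>T. entries (outer (mapp M t) t))"
      by (simp add: M linear_sum[OF linear_entries])
    also have "\<dots> = (\<Sum>t\<in>T. \<Sum>b\<in>Basis. inner (mapp M t) b *\<^sub>R entries (outer b t))"
      by (intro sum.cong refl o)
    finally have eq: "x = (\<Sum>t\<in>T. \<Sum>b\<in>Basis. inner (mapp M t) b *\<^sub>R entries (outer b t))" .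
    show "x \<in> span ?B" unfolding eq by (intro span_sum span_scale span_base) auto
  qed
  then have "dim (range (\<lambda>M. entries (M * projection T))) \<le> card ?B"
    by (rule dim_le_card) (use fin in auto)
  also have "\<dots> \<le> card ((Basis :: ('a^'n) set) \<times> T)" by (rule card_image_le) (use fin in auto)
  also have "\<dots> = DIM('a) * (CARD('n) * card T)" by (simp add: card_cartesian_product)
  finally show ?thesis .
qed

text \<open>\<open>dim_skew_compl_ge\<close> with \<open>L = {}\<close> and the coordinate vectors
  split into two halves gives \<open>(n div 2) * (n - n div 2)\<close> as a lower bound, up to the
  factor \<open>DIM('a)\<close>. The case \<open>n = 1\<close> is excluded, as there are no nonzero
  real skew matrices of that size.\<close>

lemma dim_skewadj_ge:
  assumes "2 \<le> CARD('n)"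
  shows "DIM('a) * (CARD('n) * CARD('n)) \<le> 8 * dim (entries ` {x :: ('a::rc_field, 'n::finite) cmat. skewadj x})"
proof -
  let ?n = "CARD('n)"
  obtain I :: "'n set" where I: "card I = ?n div 2" using obtain_subset_with_card_n[of "?n div 2" "UNIV :: 'n set"] by auto
  define A :: "'n set \<Rightarrow> ('a^'n) set" where "A = (\<lambda>I. (\<lambda>i. axis i 1) ` I)"
  have h: "hform (axis i 1) (axis j 1 :: 'a^'n) = (if i = j then 1 else 0)" for i j
    by (simp add: hform_def axis_def if_distrib[of conjugate] if_distrib[of "\<lambda>x. _ * x"] cong: if_cong)
  have inj: "inj (\<lambda>i. axis i 1 :: 'a^'n)" by (rule injI) (simp add: axis_eq_axis)
  have o: "orthonormal (A I)" for I unfolding orthonormal_def A_def by (auto simp: h axis_eq_axis)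
  have cA: "card (A I) = card I" for I unfolding A_def by (rule card_image[OF inj_on_subset[OF inj]]) simp
  have "DIM('a) * (card (A I) * card (A (- I))) \<le> dim (entries ` skew_compl ({} :: ('a, 'n) cmat set))"
    by (rule dim_skew_compl_ge[OF o o]) (auto simp: A_def h)
  then have le: "DIM('a) * ((?n div 2) * (?n - ?n div 2)) \<le> dim (entries ` {x :: ('a, 'n) cmat. skewadj x})"
    by (simp add: cA I Compl_eq_Diff_UNIV card_Diff_subset skew_compl_def)
  have "?n * ?n \<le> 8 * ((?n div 2) * (?n - ?n div 2))"
  proof -
    obtain m where m: "?n = 2 * m \<or> ?n = 2 * m + 1" using oddE evenE by (metis add.commute)
    then have m1: "1 \<le> m" using assms by auto
    then have "m \<le> m * m" by simp
    then show ?thesis using m m1 by (auto simp: algebra_simps)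
  qed
  then have "DIM('a) * (?n * ?n) \<le> DIM('a) * (8 * ((?n div 2) * (?n - ?n div 2)))" by (rule mult_left_mono) simp
  also have "\<dots> = 8 * (DIM('a) * ((?n div 2) * (?n - ?n div 2)))" by (rule mult.left_commute)
  also have "\<dots> \<le> 8 * dim (entries ` {x :: ('a, 'n) cmat. skewadj x})" using le by (rule mult_left_mono) simp
  finally show ?thesis .
qed

section \<open>Covering numbers of matrix homogeneous spaces\<close>

context matrix_homogeneous_space begin

lemma group_dist_eq:
  "A \<in> carrier Gr \<Longrightarrow> B \<in> carrier Gr \<Longrightarrow>
    group_dist CARD('n) Gr A B = cmat_dist Gr (toM A :: ('a, 'n) cmat) (toM B)"
  using Gr(1) fromM_toM[where 'n='n and 'a='a] by (simp add: cmat_dist_def subset_iff)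

lemma wovenD:
  assumes w: "woven CARD('n) Gr H \<theta>" and u: "u \<in> K" "cmat_dist Gr u 1 \<le> \<theta>"
  shows "\<exists>z\<in>L. norm z < pi \<and> u = exp z"
proof -
  have "group_dist CARD('n) Gr (fromM u) (1\<^sub>m CARD('n)) \<le> \<theta>" using u(2) by (simp add: cmat_dist_def fromM_one)
  then obtain x where x: "x \<in> lie_algebra CARD('n) H" "opnorm x < pi" "fromM u = mat_exp x"
    using w mem_K(2)[OF u(1)] by (auto simp: woven_def)
  have xc: "x \<in> carrier_mat CARD('n) CARD('n)" using x(1) lie_algebra_carrier by blast
  have "u = toM (mat_exp x)" using x(3) by (metis toM_fromM)
  then have "u = exp (toM x)" by (simp add: toM_mat_exp[OF xc])
  moreover have "toM x \<in> L" using x(1) toM_lie by blast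
  moreover have "norm (toM x :: ('a, 'n) cmat) < pi" using x(2) opnorm_eq_norm[OF xc] by simp
  ultimately show ?thesis by blast
qed

lemma wovenI:
  assumes w: "\<And>u. u \<in> K \<Longrightarrow> cmat_dist Gr u 1 \<le> \<theta> \<Longrightarrow> \<exists>z\<in>L. norm z < pi \<and> u = exp z"
  shows "woven CARD('n) Gr H \<theta>"
  unfolding woven_def
proof (intro ballI impI)
  fix A assume A: "A \<in> H" "group_dist CARD('n) Gr A (1\<^sub>m CARD('n)) \<le> \<theta>"
  have Ac: "A \<in> carrier Gr" "A \<in> carrier_mat CARD('n) CARD('n)" using A(1) H_carrier by auto
  have "1\<^sub>m CARD('n) \<in> carrier Gr" using mem_G(2)[OF G_one] by (simp add: fromM_one)
  then have "cmat_dist Gr (toM A :: ('a, 'n) cmat) 1 \<le> \<theta>" using A(2) group_dist_eq[OF Ac(1)] by simp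
  then obtain z where z: "z \<in> L" "norm z < pi" "toM A = exp z" using w[OF mem_K(1)[OF A(1)]] by blast
  then obtain x where x: "x \<in> lie_algebra CARD('n) H" "z = toM x" using toM_lie by blast
  have xc: "x \<in> carrier_mat CARD('n) CARD('n)" using x(1) lie_algebra_carrier by blast
  have "(toM A :: ('a, 'n) cmat) = toM (mat_exp x)" using z(3) x(2) by (simp add: toM_mat_exp[OF xc])
  then have "A = mat_exp x" using toM_inject[OF Ac(2) mat_exp_carrier[OF xc]] by simp
  moreover have "opnorm x < pi" using z(2) x(2) opnorm_eq_norm[OF xc] by simp
  ultimately show "\<exists>x\<in>lie_algebra CARD('n) H. opnorm x < pi \<and> A = mat_exp x" using x(1) by blast
qed

section \<open>Cosets and their distances\<close>

lemma coset_elem: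
  assumes "a \<in> carrier Gr"
  shows "u \<in> a <#\<^bsub>Gr\<^esub> H \<longleftrightarrow> (\<exists>h\<in>K. u \<in> carrier_mat CARD('n) CARD('n) \<and> toM u = toM a * h)"
proof
  have ac: "a \<in> carrier_mat CARD('n) CARD('n)" using assms Gr(1) by blast
  {
    assume "u \<in> a <#\<^bsub>Gr\<^esub> H"
    then obtain h where h: "h \<in> H" "u = a * h" by (auto simp: l_coset_def Gr(2))
    have hc: "h \<in> carrier_mat CARD('n) CARD('n)" using h(1) H_carrier by blast
    have "u \<in> carrier_mat CARD('n) CARD('n)" using h(2) mult_carrier_mat[OF ac hc] by simp
    moreover have "toM u = toM a * (toM h :: ('a, 'n) cmat)" using h(2) toM_mult[OF ac hc] by simp
    ultimately show "\<exists>h\<in>K. u \<in> carrier_mat CARD('n) CARD('n) \<and> toM u = toM a * h" using mem_K(1)[OF h(1)] by blast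
  }
  assume "\<exists>h\<in>K. u \<in> carrier_mat CARD('n) CARD('n) \<and> toM u = toM a * h"
  then obtain h where h: "h \<in> K" "u \<in> carrier_mat CARD('n) CARD('n)" "toM u = toM a * h" by blast
  have "toM u = (toM (a * fromM h) :: ('a, 'n) cmat)" using h(3) toM_mult[OF ac fromM_carrier[of h]] by simp
  then have "u = a * fromM h" using toM_inject[OF h(2) mult_carrier_mat[OF ac fromM_carrier[of h]]] by simp
  then show "u \<in> a <#\<^bsub>Gr\<^esub> H" using mem_K(2)[OF h(1)] by (auto simp: l_coset_def Gr(2))
qed

lemma coset_dist_le:
  assumes a: "a \<in> carrier Gr" and b: "b \<in> carrier Gr" and h: "h \<in> K"
  shows "coset_dist CARD('n) Gr (a <#\<^bsub>Gr\<^esub> H) (b <#\<^bsub>Gr\<^esub> H) \<le> cmat_dist Gr (toM a) (toM b * h)"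
proof -
  let ?X = "{group_dist CARD('n) Gr u v | u v. u \<in> a <#\<^bsub>Gr\<^esub> H \<and> v \<in> b <#\<^bsub>Gr\<^esub> H}"
  have in_carrier: "u \<in> carrier Gr" if c: "c \<in> carrier Gr" and u: "u \<in> c <#\<^bsub>Gr\<^esub> H" for c u
  proof -
    obtain k where k: "k \<in> K" "u \<in> carrier_mat CARD('n) CARD('n)" "toM u = toM c * k" using u coset_elem[OF c] by blast
    have "toM u \<in> G" using k G_mult[OF mem_G(1)[OF c]] K_sub by (metis subsetD)
    then show ?thesis using mem_G(2) fromM_toM[OF k(2)] by metis
  qed
  have "bdd_below ?X"
  proof (rule bdd_belowI[of _ 0])
    fix d assume "d \<in> ?X"
    then obtain u v where uv: "u \<in> a <#\<^bsub>Gr\<^esub> H" "v \<in> b <#\<^bsub>Gr\<^esub> H" "d = group_dist CARD('n) Gr u v" by blast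
    then have c: "u \<in> carrier Gr" "v \<in> carrier Gr" using in_carrier a b by auto
    show "0 \<le> d" using rho_lower[OF mem_G(1)[OF c(1)] mem_G(1)[OF c(2)]] norm_ge_zero order_trans
      unfolding uv(3) group_dist_eq[OF c] by blast
  qed
  moreover have "group_dist CARD('n) Gr a (fromM (toM b * h)) \<in> ?X"
  proof -
    have "a \<in> a <#\<^bsub>Gr\<^esub> H" using coset_elem[OF a, of a] a Gr(1) K_one by force
    moreover have "fromM (toM b * h) \<in> b <#\<^bsub>Gr\<^esub> H" using coset_elem[OF b, of "fromM (toM b * h)"] h by force
    ultimately show ?thesis by blast
  qed
  ultimately have "coset_dist CARD('n) Gr (a <#\<^bsub>Gr\<^esub> H) (b <#\<^bsub>Gr\<^esub> H) \<le> group_dist CARD('n) Gr a (fromM (toM b * h))"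
    unfolding coset_dist_def by (intro cInf_lower)
  moreover have "a \<in> carrier_mat CARD('n) CARD('n)" using a Gr(1) by blast
  ultimately show ?thesis by (simp add: cmat_dist_def fromM_toM)
qed

text \<open>Closeness is known for some representatives of both cosets. Right multiplication by an
  element of \<open>K\<close> moves the first one back to \<open>a\<close>, and the norm is
  invariant under it.\<close>

lemma coset_dist_lessD:
  assumes a: "a \<in> carrier Gr" and b: "b \<in> carrier Gr"
    and less: "coset_dist CARD('n) Gr (a <#\<^bsub>Gr\<^esub> H) (b <#\<^bsub>Gr\<^esub> H) < e"
  shows "\<exists>h\<in>K. norm (toM b * h - toM a) < e"
proof -
  let ?X = "{group_dist CARD('n) Gr u v | u v. u \<in> a <#\<^bsub>Gr\<^esub> H \<and> v \<in> b <#\<^bsub>Gr\<^esub> H}"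
  have "a \<in> a <#\<^bsub>Gr\<^esub> H" "b \<in> b <#\<^bsub>Gr\<^esub> H"
    using coset_elem[OF a, of a] coset_elem[OF b, of b] a b Gr(1) K_one by force+
  then have ne: "?X \<noteq> {}" by blast
  obtain d where "d \<in> ?X" "d < e" using cInf_lessD[OF ne less[unfolded coset_dist_def]] by (elim bexE)
  then obtain u v where uv: "u \<in> a <#\<^bsub>Gr\<^esub> H" "v \<in> b <#\<^bsub>Gr\<^esub> H" "group_dist CARD('n) Gr u v < e" by blast
  obtain h where h: "h \<in> K" "u \<in> carrier_mat CARD('n) CARD('n)" "toM u = toM a * h" using uv(1) coset_elem[OF a] by blast
  obtain k where k: "k \<in> K" "v \<in> carrier_mat CARD('n) CARD('n)" "toM v = toM b * k" using uv(2) coset_elem[OF b] by blast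
  have ab: "toM a * h \<in> G" "toM b * k \<in> G" using mem_G(1) a b h(1) k(1) K_sub by (auto intro!: G_mult)
  have "norm (toM a * h - toM b * k) \<le> cmat_dist Gr (toM a * h) (toM b * k)" by (rule rho_lower[OF ab])
  also have "\<dots> = group_dist CARD('n) Gr u v"
    unfolding cmat_dist_def h(3)[symmetric] k(3)[symmetric] by (simp add: fromM_toM h(2) k(2))
  finally have n: "norm (toM a * h - toM b * k) < e" using uv(3) by simp
  have uh: "unitary h" using h(1) K_sub G_unitary by blast
  have "(toM b * k - toM a * h) * star h = toM b * (k * star h) - toM a"
    using unitaryD(2)[OF uh] by (simp add: left_diff_distrib mult.assoc)
  then have "norm (toM b * (k * star h) - toM a) < e"
    using n norm_mult_unitary[of "star h" "toM b * k - toM a * h"] uh by (simp add: norm_minus_commute)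
  then show ?thesis using K_mult[OF k(1) K_star[OF h(1)]] by blast
qed

lemma lcosets_eq: "lcosets\<^bsub>Gr\<^esub> H = (\<lambda>a. a <#\<^bsub>Gr\<^esub> H) ` carrier Gr"
  by (auto simp: LCOSETS_def)

lemma quotient_diam_le: "quotient_diam CARD('n) Gr H \<le> 65"
  unfolding quotient_diam_def
proof (rule cSup_least)
  have "fromM (1 :: ('a, 'n) cmat) \<in> carrier Gr" by (rule mem_G(2)[OF G_one])
  then show "{coset_dist CARD('n) Gr E F | E F. E \<in> lcosets\<^bsub>Gr\<^esub> H \<and> F \<in> lcosets\<^bsub>Gr\<^esub> H} \<noteq> {}"
    by (auto simp: lcosets_eq)
  fix x assume "x \<in> {coset_dist CARD('n) Gr E F | E F. E \<in> lcosets\<^bsub>Gr\<^esub> H \<and> F \<in> lcosets\<^bsub>Gr\<^esub> H}"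
  then obtain a b where ab: "a \<in> carrier Gr" "b \<in> carrier Gr" "x = coset_dist CARD('n) Gr (a <#\<^bsub>Gr\<^esub> H) (b <#\<^bsub>Gr\<^esub> H)"
    by (auto simp: lcosets_eq)
  have "x \<le> cmat_dist Gr (toM a :: ('a, 'n) cmat) (toM b * 1)" unfolding ab(3) by (rule coset_dist_le[OF ab(1,2) K_one])
  also have "\<dots> \<le> 65" using rho_le_65[OF mem_G(1)[OF ab(1)] mem_G(1)[OF ab(2)]] by simp
  finally show "x \<le> 65" .
qed

theorem covering_number_bounds:
  assumes \<alpha>: "0 < \<alpha>" "\<alpha> \<le> 1/2" and \<theta>: "\<alpha> \<le> theta CARD('n) Gr H" and \<kappa>: "\<alpha> \<le> inverse (kappa CARD('n) H)"
    and \<epsilon>: "0 < \<epsilon>" "\<epsilon> \<le> quotient_diam CARD('n) Gr H"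
    and Q: "star Q = Q" "Q * Q = Q" "\<And>p. p \<in> G \<Longrightarrow> p * Q = Q \<Longrightarrow> Q * p = Q \<Longrightarrow> p \<in> K"
    and J: "dim (range (\<lambda>M. entries (M * Q))) \<le> J * quotient_dim CARD('n) Gr H"
  shows "ereal ((\<alpha>\<^sup>2 / 2560 / \<epsilon>) ^ quotient_dim CARD('n) Gr H) \<le> ereal_of_enat (covering_number CARD('n) Gr H \<epsilon>)"
    and "ereal_of_enat (covering_number CARD('n) Gr H \<epsilon>) \<le> ereal ((260 * (1 + 1200 / \<alpha>\<^sup>2) ^ J / \<epsilon>) ^ quotient_dim CARD('n) Gr H)"
proof -
  let ?d = "quotient_dim CARD('n) Gr H" and ?N = "covering_number CARD('n) Gr H \<epsilon>"
  let ?C = "{S. finite S \<and> S \<subseteq> lcosets\<^bsub>Gr\<^esub> H \<and> lcosets\<^bsub>Gr\<^esub> H \<subseteq> (\<Union>E\<in>S. quotient_ball CARD('n) Gr H E \<epsilon>)}"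
  have N: "?N = Inf ((\<lambda>S. enat (card S)) ` ?C)" by (simp add: covering_number_def)
  have kb: "\<alpha> * norm (proj_compl L x) \<le> norm x" if "skewadj x" for x by (rule kappa_bound[OF \<alpha>(1) \<kappa> that])
  interpret S: unitary_subgroup G "cmat_dist Gr" K "skew_compl L" "proj_compl L" \<alpha>
    by (rule unitary_subgroup_intro[OF metric_unitary_group_axioms K_sub K_one]) (fact K_mult K_star subspace_L kb \<alpha>)+
  have woven: "\<exists>z\<in>L. norm z < pi \<and> u = exp z" if u: "u \<in> K" "cmat_dist Gr u 1 \<le> \<alpha> / 2" for u
  proof (cases "H = {1\<^sub>m CARD('n)}")
    case True
    then have "u = 1" using mem_K(2)[OF u(1)] by (metis singletonD toM_fromM toM_one)
    moreover have "0 \<in> L" using K_one by (simp add: lie_set_def)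
    ultimately show ?thesis by (intro bexI[of _ 0]) auto
  next
    case False
    let ?T = "{\<theta>. \<theta> > 0 \<and> woven CARD('n) Gr H \<theta>}"
    \<comment> \<open>The supremum defining \<open>theta\<close> would be unspecified over the empty
      set; Cartan's argument shows that some positive value occurs.\<close>
    have ex: "\<exists>t>0. \<forall>u\<in>K. cmat_dist Gr u 1 \<le> t \<longrightarrow> (\<exists>z\<in>L. norm z < pi \<and> u = exp z)"
      by (rule S.woven_some) (fact K_closed)
    obtain t where t: "t > 0" "\<forall>u\<in>K. cmat_dist Gr u 1 \<le> t \<longrightarrow> (\<exists>z\<in>L. norm z < pi \<and> u = exp z)"
      using ex by blast
    then have "t \<in> ?T" using wovenI[of t] by blast
    then have ne: "?T \<noteq> {}" by blast
    \<comment> \<open>The supremum need not be attained, so the argument works with a value strictly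
      below \<alpha>.\<close>
    have "\<alpha> / 2 < Sup ?T" using \<theta> \<alpha> False by (simp add: theta_def)
    then obtain \<theta> where "\<theta> \<in> ?T" "\<alpha> / 2 < \<theta>" using less_cSupE[OF _ ne] by blast
    then show ?thesis using wovenD[of \<theta> u] u by simp
  qed
  have d: "?d = dim (entries ` {x :: ('a, 'n) cmat. skewadj x}) - dim (entries ` L)"
    by (simp add: quotient_dim_def group_dim_eq)
  have e65: "\<epsilon> \<le> 65" using \<epsilon>(2) quotient_diam_le by simp
  have lower: "(\<alpha>\<^sup>2 / 2560 / \<epsilon>) ^ ?d \<le> real (card S0)"
    if fin: "finite S0" and cov: "\<And>g. g \<in> G \<Longrightarrow> \<exists>s\<in>S0. \<exists>h\<in>K. norm (g * h - s) < \<epsilon>" for S0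
    by (rule homogeneous_space_entropy(1)[OF metric_unitary_group_axioms K_sub K_one, where Q=Q and J=J])
      (fact K_mult K_star subspace_L kb \<alpha> woven Q d J \<epsilon>(1) e65 fin cov)+
  have upper: "\<exists>S. finite S \<and> S \<subseteq> G \<and> real (card S) \<le> (260 * (1 + 1200 / \<alpha>\<^sup>2) ^ J / \<epsilon>) ^ ?d \<and>
      (\<forall>g\<in>G. \<exists>s\<in>S. \<exists>h\<in>K. cmat_dist Gr s (g * h) < \<epsilon>)"
    by (rule homogeneous_space_entropy(2)[OF metric_unitary_group_axioms K_sub K_one, where Q=Q and J=J])
      (fact K_mult K_star subspace_L kb \<alpha> woven Q d J \<epsilon>(1) e65)+
  show "ereal ((\<alpha>\<^sup>2 / 2560 / \<epsilon>) ^ ?d) \<le> ereal_of_enat ?N"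
  proof (cases "?C = {}")
    \<comment> \<open>Without a finite cover the covering number is
      \<open>\<infinity>\<close>.\<close>
    case True
    have "?N = \<infinity>" unfolding N True by (simp add: Inf_enat_def)
    then show ?thesis by simp
  next
    case False
    then obtain S1 where S1: "S1 \<in> ?C" by (meson ex_in_conv)
    have "Inf ((\<lambda>S. enat (card S)) ` ?C) \<in> (\<lambda>S. enat (card S)) ` ?C" by (rule wellorder_InfI[OF imageI[OF S1]])
    then obtain S where "Inf ((\<lambda>S. enat (card S)) ` ?C) = enat (card S)" "S \<in> ?C" by (rule imageE)
    then have S: "S \<in> ?C" "?N = enat (card S)" using N by simp_all
    define r where "r = (\<lambda>E. SOME a. a \<in> carrier Gr \<and> E = a <#\<^bsub>Gr\<^esub> H)"
    have r: "r E \<in> carrier Gr" "E = r E <#\<^bsub>Gr\<^esub> H" if "E \<in> S" for E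
    proof -
      have "\<exists>a. a \<in> carrier Gr \<and> E = a <#\<^bsub>Gr\<^esub> H" using S(1) that by (auto simp: lcosets_eq)
      then have "r E \<in> carrier Gr \<and> E = r E <#\<^bsub>Gr\<^esub> H" unfolding r_def by (rule someI_ex)
      then show "r E \<in> carrier Gr" "E = r E <#\<^bsub>Gr\<^esub> H" by auto
    qed
    let ?S' = "(\<lambda>E. toM (r E) :: ('a, 'n) cmat) ` S"
    have fin: "finite S" using S(1) by blast
    have "(\<alpha>\<^sup>2 / 2560 / \<epsilon>) ^ ?d \<le> real (card ?S')"
    proof (rule lower)
      fix g assume g: "g \<in> G"
      have gc: "fromM g \<in> carrier Gr" by (rule mem_G(2)[OF g])
      then have "fromM g <#\<^bsub>Gr\<^esub> H \<in> lcosets\<^bsub>Gr\<^esub> H" by (auto simp: lcosets_eq)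
      then obtain E where E: "E \<in> S" "fromM g <#\<^bsub>Gr\<^esub> H \<in> quotient_ball CARD('n) Gr H E \<epsilon>" using S(1) by blast
      then have "coset_dist CARD('n) Gr (r E <#\<^bsub>Gr\<^esub> H) (fromM g <#\<^bsub>Gr\<^esub> H) < \<epsilon>"
        using r(2)[OF E(1)] by (simp add: quotient_ball_def)
      then obtain h where "h \<in> K" "norm (g * h - toM (r E)) < \<epsilon>"
        using coset_dist_lessD[OF r(1)[OF E(1)] gc] by auto
      then show "\<exists>s\<in>?S'. \<exists>h\<in>K. norm (g * h - s) < \<epsilon>" using E(1) by blast
    qed (rule finite_imageI[OF fin])
    also have "real (card ?S') \<le> real (card S)" using card_image_le[OF fin] by simp
    finally show ?thesis using S(2) by simp
  qed
  obtain S where S: "finite S" "S \<subseteq> G" "real (card S) \<le> (260 * (1 + 1200 / \<alpha>\<^sup>2) ^ J / \<epsilon>) ^ ?d"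
    "\<forall>g\<in>G. \<exists>s\<in>S. \<exists>h\<in>K. cmat_dist Gr s (g * h) < \<epsilon>"
    using upper by blast
  let ?S' = "(\<lambda>s. fromM s <#\<^bsub>Gr\<^esub> H) ` S"
  have "?S' \<in> ?C"
  proof (intro CollectI conjI)
    show "finite ?S'" using S(1) by simp
    show sub: "?S' \<subseteq> lcosets\<^bsub>Gr\<^esub> H" using S(2) mem_G(2) by (auto simp: lcosets_eq)
    show "lcosets\<^bsub>Gr\<^esub> H \<subseteq> (\<Union>E\<in>?S'. quotient_ball CARD('n) Gr H E \<epsilon>)"
    proof
      fix F assume F: "F \<in> lcosets\<^bsub>Gr\<^esub> H"
      then obtain b where b: "b \<in> carrier Gr" "F = b <#\<^bsub>Gr\<^esub> H" by (auto simp: lcosets_eq)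
      obtain s h where s: "s \<in> S" "h \<in> K" "cmat_dist Gr s (toM b * h) < \<epsilon>" using S(4) mem_G(1)[OF b(1)] by blast
      have "coset_dist CARD('n) Gr (fromM s <#\<^bsub>Gr\<^esub> H) F \<le> cmat_dist Gr (toM (fromM s)) (toM b * h)"
        unfolding b(2) by (rule coset_dist_le[OF mem_G(2) b(1) s(2)]) (use s(1) S(2) in blast)
      then have "F \<in> quotient_ball CARD('n) Gr H (fromM s <#\<^bsub>Gr\<^esub> H) \<epsilon>" using s(3) F by (simp add: quotient_ball_def)
      then show "F \<in> (\<Union>E\<in>?S'. quotient_ball CARD('n) Gr H E \<epsilon>)" using s(1) by blast
    qed
  qed
  then have "?N \<le> enat (card ?S')" unfolding N by (intro Inf_lower imageI)
  then have "ereal_of_enat ?N \<le> ereal_of_enat (enat (card ?S'))" by (simp only: ereal_of_enat_le_iff)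
  also have "\<dots> = ereal (real (card ?S'))" by simp
  also have "\<dots> \<le> ereal (real (card S))" using card_image_le[OF S(1)] by simp
  also have "\<dots> \<le> ereal ((260 * (1 + 1200 / \<alpha>\<^sup>2) ^ J / \<epsilon>) ^ ?d)" using S(3) by simp
  finally show "ereal_of_enat ?N \<le> ereal ((260 * (1 + 1200 / \<alpha>\<^sup>2) ^ J / \<epsilon>) ^ ?d)" .
qed

end

section \<open>Reducing subspaces\<close>

lemma adjoint_index: "A \<in> carrier_mat m k \<Longrightarrow> i < k \<Longrightarrow> j < m \<Longrightarrow> mat_adjoint A $$ (i, j) = conjugate (A $$ (j, i))"
  by (simp add: mat_adjoint_def mat_of_rows_index)

lemma row_adjoint: "A \<in> carrier_mat m k \<Longrightarrow> i < k \<Longrightarrow> row (mat_adjoint A) i = conjugate (col A i)"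
  using adjoint_carrier[of A m k] by (intro eq_vecI) (auto simp: adjoint_index)

lemma mat_adjoint_mult:
  fixes A B :: "'a::rc_field Matrix.mat"
  assumes A: "A \<in> carrier_mat m k" and B: "B \<in> carrier_mat k l"
  shows "mat_adjoint (A * B) = mat_adjoint B * mat_adjoint A"
proof (rule eq_matI)
  have dims: "dim_row (mat_adjoint A) = k" "dim_col (mat_adjoint A) = m" "dim_row (mat_adjoint B) = l" "dim_col (mat_adjoint B) = k"
    "dim_row (mat_adjoint (A * B)) = l" "dim_col (mat_adjoint (A * B)) = m"
    using adjoint_carrier[OF A] adjoint_carrier[OF B] adjoint_carrier[OF mult_carrier_mat[OF A B]] by auto
  fix i j assume "i < dim_row (mat_adjoint B * mat_adjoint A)" "j < dim_col (mat_adjoint B * mat_adjoint A)"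
  then have ij: "i < l" "j < m" by (simp_all add: dims)
  show "mat_adjoint (A * B) $$ (i, j) = (mat_adjoint B * mat_adjoint A) $$ (i, j)"
    using ij A B by (simp add: adjoint_index[OF mult_carrier_mat[OF A B]] adjoint_index[OF A] adjoint_index[OF B] dims
        scalar_prod_def sum_conjugate conjugate_dist_mul mult.commute)
next
  show "dim_row (mat_adjoint (A * B)) = dim_row (mat_adjoint B * mat_adjoint A)"
    "dim_col (mat_adjoint (A * B)) = dim_col (mat_adjoint B * mat_adjoint A)"
    using adjoint_carrier[OF A] adjoint_carrier[OF B] adjoint_carrier[OF mult_carrier_mat[OF A B]] by auto
qed

lemma mat_adjoint_adjoint: "A \<in> carrier_mat m k \<Longrightarrow> mat_adjoint (mat_adjoint A) = (A :: 'a::rc_field Matrix.mat)"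
  by (rule eq_matI) (use adjoint_carrier[of A m k] adjoint_carrier[of "mat_adjoint A" k m] in \<open>auto simp: adjoint_index[of _ k m] adjoint_index[of A m k]\<close>)

text \<open>Conjugating by the unitary matrix with columns \<open>A\<close>, \<open>B\<close> makes \<open>P\<close> block triangular.\<close>

lemma det_block:
  fixes A B P :: "'a::rc_field Matrix.mat"
  assumes A: "A \<in> carrier_mat n k" and B: "B \<in> carrier_mat n (n - k)" and kn: "k \<le> n" and P: "P \<in> carrier_mat n n"
    and AA: "mat_adjoint A * A = 1\<^sub>m k" and BB: "mat_adjoint B * B = 1\<^sub>m (n - k)"
    and BA: "mat_adjoint B * A = 0\<^sub>m (n - k) k"
    and PB: "P * B = B" and BPA: "mat_adjoint B * (P * A) = 0\<^sub>m (n - k) k"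
  shows "Determinant.det P = Determinant.det (mat_adjoint A * (P * A))"
proof -
  define W where "W = Matrix.mat n n (\<lambda>(i, j). if j < k then A $$ (i, j) else B $$ (i, j - k))"
  have W: "W \<in> carrier_mat n n" by (simp add: W_def)
  have colW: "col W j = (if j < k then col A j else col B (j - k))" if "j < n" for j
    using that A B kn by (intro eq_vecI) (auto simp: W_def)
  have block: "mat_adjoint W * (X * W) = four_block_mat (mat_adjoint A * (X * A)) (mat_adjoint A * (X * B))
      (mat_adjoint B * (X * A)) (mat_adjoint B * (X * B))" if X: "X \<in> carrier_mat n n" for X
  proof -
    have c: "X * A \<in> carrier_mat n k" "X * B \<in> carrier_mat n (n - k)" "X * W \<in> carrier_mat n n"
      using X A B W by auto
    note adj = adjoint_carrier[OF A] adjoint_carrier[OF B] adjoint_carrier[OF W]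
    show ?thesis
    proof (rule eq_matI)
      fix i j
      assume "i < dim_row (four_block_mat (mat_adjoint A * (X * A)) (mat_adjoint A * (X * B)) (mat_adjoint B * (X * A)) (mat_adjoint B * (X * B)))"
        "j < dim_col (four_block_mat (mat_adjoint A * (X * A)) (mat_adjoint A * (X * B)) (mat_adjoint B * (X * A)) (mat_adjoint B * (X * B)))"
      then have ij: "i < n" "j < n" using adj c kn A B by auto
      have 1: "(mat_adjoint W * (X * W)) $$ (i, j) = conjugate (col W i) \<bullet> (X *\<^sub>v col W j)"
      proof -
        have "(mat_adjoint W * (X * W)) $$ (i, j) = row (mat_adjoint W) i \<bullet> col (X * W) j"
          by (rule index_mult_mat(1)) (use ij adj(3) c(3) in auto)
        then show ?thesis by (simp only: row_adjoint[OF W ij(1)] col_mult2[OF X W ij(2)])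
      qed
      have dims: "dim_row (mat_adjoint A) = k" "dim_row (mat_adjoint B) = n - k" "dim_col A = k" "dim_col B = n - k"
        "dim_col (X * A) = k" "dim_col (X * B) = n - k"
        using adj A B c by auto
      show "(mat_adjoint W * (X * W)) $$ (i, j) = four_block_mat (mat_adjoint A * (X * A)) (mat_adjoint A * (X * B))
          (mat_adjoint B * (X * A)) (mat_adjoint B * (X * B)) $$ (i, j)"
        unfolding 1 using ij kn
        by (auto simp: colW dims row_adjoint[OF A] row_adjoint[OF B] col_mult2[OF X A] col_mult2[OF X B] not_less)
    qed (use adj c kn A B W in auto)
  qed
  have AB: "mat_adjoint A * B \<in> carrier_mat k (n - k)" using adjoint_carrier[OF A] B by auto
  have aPA: "mat_adjoint A * (P * A) \<in> carrier_mat k k" using adjoint_carrier[OF A] A P by auto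
  have "Determinant.det (mat_adjoint W * (P * W)) = Determinant.det (mat_adjoint A * (P * A)) * Determinant.det (1\<^sub>m (n - k))"
    unfolding block[OF P] PB BB
    by (rule det_four_block_mat_lower_left_zero[OF aPA AB BPA]) simp
  then have dP: "Determinant.det (mat_adjoint W) * (Determinant.det P * Determinant.det W) = Determinant.det (mat_adjoint A * (P * A))"
    using det_mult[OF adjoint_carrier[OF W] mult_carrier_mat[OF P W]] det_mult[OF P W] by simp
  have "Determinant.det (mat_adjoint W * (1\<^sub>m n * W)) = Determinant.det (mat_adjoint A * (1\<^sub>m n * A)) * Determinant.det (1\<^sub>m (n - k))"
    unfolding block[OF one_carrier_mat] left_mult_one_mat[OF A] left_mult_one_mat[OF B] AA BB
    by (rule det_four_block_mat_lower_left_zero[OF one_carrier_mat AB BA]) simp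
  then have "Determinant.det (mat_adjoint W) * Determinant.det W = 1"
    using det_mult[OF adjoint_carrier[OF W] W] by (simp add: left_mult_one_mat[OF A] left_mult_one_mat[OF W] AA)
  then show ?thesis using dP by (metis mult.left_commute mult.right_neutral)
qed

lemma hform_toV:
  assumes "v \<in> carrier_vec CARD('n)" "w \<in> carrier_vec CARD('n)"
  shows "hform (toV v :: 'a::rc_field^'n::finite) (toV w) = v \<bullet>c w"
  using assms by (simp add: hform_def scalar_prod_def atLeast0LessThan sum_ix[of "\<lambda>k. vec_index v k * conjugate (vec_index w k)"])

lemma hform_mapp: "hform (mapp M x) y = hform x (mapp (star M) y)"
proof -
  have "hform (mapp M x) y = (\<Sum>i\<in>UNIV. \<Sum>j\<in>UNIV. entry M i j * vec_nth x j * conjugate (vec_nth y i))"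
    by (simp add: hform_def mapp_nth sum_distrib_right)
  also have "\<dots> = (\<Sum>j\<in>UNIV. \<Sum>i\<in>UNIV. entry M i j * vec_nth x j * conjugate (vec_nth y i))" by (rule sum.swap)
  also have "\<dots> = hform x (mapp (star M) y)"
    by (simp add: hform_def mapp_nth sum_conjugate conjugate_dist_mul entry_simps sum_distrib_left mult_ac)
  finally show ?thesis .
qed

section \<open>The projection \<open>Q\<close> in each of the three cases\<close>

context matrix_homogeneous_space begin

lemma quotient_dim_eq: "quotient_dim CARD('n) Gr H = dim (entries ` skew_compl L)"
  using dim_skew_compl[OF subspace_L L_skew] by (simp add: quotient_dim_def group_dim_eq)

text \<open>For \<open>d = 0\<close> the projection vanishes and \<open>kappa\<close> is 0. As
  \<open>inverse 0 = 0\<close>, this contradicts the lower bound \<alpha>.\<close>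

lemma quotient_dim_pos:
  assumes "0 < \<alpha>" "\<alpha> \<le> inverse (kappa CARD('n) H)"
  shows "1 \<le> quotient_dim CARD('n) Gr H"
proof (rule ccontr)
  assume "\<not> 1 \<le> quotient_dim CARD('n) Gr H"
  then have "dim (entries ` skew_compl L) = 0" unfolding quotient_dim_eq by linarith
  then have sub: "entries ` skew_compl L \<subseteq> {0}" by (simp only: dim_eq_0)
  have "proj_compl L x = 0" if x: "skewadj x" for x
  proof -
    have "entries (proj_compl L x) = entries 0" using sub proj_compl_in[OF x] by auto
    then show ?thesis by (simp only: entries_inject)
  qed
  then have val: "opnorm (complement_proj CARD('n) H A) = 0" if "A \<in> skew CARD('n)" for A
    using that skew_iff[of A] opnorm_eq_norm[OF fromM_carrier, of "proj_compl L (toM A)"] by (simp add: complement_proj_eq)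
  let ?X = "{x \<in> skew CARD('n). opnorm x \<le> 1} :: 'a Matrix.mat set"
  have zc: "(0\<^sub>m CARD('n) CARD('n) :: 'a Matrix.mat) \<in> carrier_mat CARD('n) CARD('n)" by simp
  have "0\<^sub>m CARD('n) CARD('n) \<in> ?X"
    using skew_iff[of "0\<^sub>m CARD('n) CARD('n)"] opnorm_eq_norm[OF zc] by simp
  then have "(\<lambda>A. opnorm (complement_proj CARD('n) H A)) ` ?X = {0}" using val by (auto simp: image_iff)
  then have "kappa CARD('n) H = 0" by (simp add: kappa_def)
  then show False using assms by simp
qed

text \<open>The input to the upper bound that is obtained differently in the cases (a), (b) and (c);
  \<open>J\<close> has to be bounded in terms of \<alpha>.\<close>

definition coarse_projection :: "nat \<Rightarrow> bool" where
  "coarse_projection J \<longleftrightarrow> (\<exists>Q :: ('a, 'n) cmat. star Q = Q \<and> Q * Q = Q \<and>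
     (\<forall>p\<in>G. p * Q = Q \<longrightarrow> Q * p = Q \<longrightarrow> p \<in> K) \<and>
     dim (range (\<lambda>M. entries (M * Q))) \<le> J * quotient_dim CARD('n) Gr H)"

text \<open>Only the identity satisfies \<open>p * 1 = 1\<close>, so \<open>Q = 1\<close> is
  admissible once the dimension of the full matrix space is at most \<open>J\<close> times that of
  the quotient.\<close>

lemma coarse_projection_one:
  assumes "DIM('a) * (CARD('n) * CARD('n)) \<le> J * quotient_dim CARD('n) Gr H"
  shows "coarse_projection J"
  unfolding coarse_projection_def
proof (intro exI[of _ 1] conjI ballI impI)
  show "dim (range (\<lambda>M :: ('a, 'n) cmat. entries (M * 1))) \<le> J * quotient_dim CARD('n) Gr H"
    by (rule order_trans[OF dim_cmat_le assms])
qed (use K_one in auto)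

text \<open>The full matrix space has dimension at most 8 times that of the group by
  \<open>dim_skewadj_ge\<close>, and the group has dimension at most \<open>d / \<alpha>\<close> by
  hypothesis. For \<open>n = 1\<close> the matrix space has dimension at most 2, and
  \<open>d \<ge> 1\<close> suffices.\<close>

lemma coarse_projection_small_dim:
  assumes \<alpha>: "0 < \<alpha>" "\<alpha> \<le> 1/2" and k: "\<alpha> \<le> inverse (kappa CARD('n) H)" and J: "8 / \<alpha> \<le> real J"
    and small: "real (group_dim CARD('n) H) \<le> (1 - \<alpha>) * real (group_dim CARD('n) (carrier Gr))"
  shows "coarse_projection J"
proof (rule coarse_projection_one)
  let ?d = "quotient_dim CARD('n) Gr H" and ?D = "DIM('a) * (CARD('n) * CARD('n))"
  have d1: "1 \<le> ?d" by (rule quotient_dim_pos[OF \<alpha>(1) k])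
  have "real ?D \<le> 8 / \<alpha> * real ?d"
  proof (cases "2 \<le> CARD('n)")
    case True
    let ?g = "group_dim CARD('n) (carrier Gr)"
    have "?D \<le> 8 * ?g" using dim_skewadj_ge[OF True, where 'a='a] by (simp add: group_dim_eq)
    then have "real ?D \<le> 8 * real ?g" by (metis of_nat_le_iff of_nat_mult of_nat_numeral)
    moreover have "\<alpha> * real ?g \<le> real ?d" using small by (simp add: quotient_dim_def algebra_simps)
    then have "real ?g \<le> real ?d / \<alpha>" using \<alpha>(1) by (simp add: pos_le_divide_eq mult.commute)
    ultimately show ?thesis by simp
  next
    case False
    then have "CARD('n) = 1" using zero_less_card_finite[where 'a='n] by linarith
    then have "?D \<le> 2" using card_Basis_le_2[where 'a='a] by simp
    then have "real ?D \<le> 2" by (metis of_nat_le_iff of_nat_numeral)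
    also have "2 \<le> 8 / \<alpha> * 1" using \<alpha> by (simp add: pos_le_divide_eq)
    also have "\<dots> \<le> 8 / \<alpha> * real ?d" using d1 \<alpha>(1) by (intro mult_left_mono) auto
    finally show ?thesis .
  qed
  also have "\<dots> \<le> real J * real ?d" using J by (intro mult_right_mono) auto
  finally have "real ?D \<le> real (J * ?d)" by simp
  then show "?D \<le> J * ?d" by (simp only: of_nat_le_iff)
qed

text \<open>\<open>S\<close> and \<open>T\<close> are orthonormal bases of the subspace and of its
  complement. Elements of \<open>H\<close> preserve the subspace, so their Lie algebra has no
  entries from \<open>S\<close> to \<open>T\<close>, and \<open>dim_skew_compl_ge\<close> bounds
  \<open>d\<close> from below. For the sizes of \<open>S\<close> and \<open>T\<close> the stated
  inequalities suffice.\<close>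

lemma reducing_families:
  assumes E: "reducing_subspace CARD('n) H E"
  obtains S T :: "('a^'n) set" where "orthonormal S" "orthonormal T"
    "toV ` orth_compl CARD('n) E \<subseteq> vec.span T"
    "vec_subspace_dim CARD('n) E \<le> card S" "CARD('n) \<le> vec_subspace_dim CARD('n) E + card T"
    "vec_subspace_dim CARD('n) E \<le> CARD('n)"
    "DIM('a) * (card S * card T) \<le> quotient_dim CARD('n) Gr H"
    "\<And>x :: 'a^'n. \<exists>y\<in>toV ` E. \<exists>z\<in>toV ` orth_compl CARD('n) E. x = y + z"
    "\<And>y z. y \<in> toV ` E \<Longrightarrow> z \<in> toV ` orth_compl CARD('n) E \<Longrightarrow> hform y (z :: 'a^'n) = 0"
proof -
  let ?n = "CARD('n)"
  let ?V = "toV ` E :: ('a^'n) set" and ?V' = "toV ` orth_compl ?n E :: ('a^'n) set"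
  have vs: "vec_subspace ?n E" and inv: "invariant_under H E" using E by (auto simp: reducing_subspace_def)
  have sub: "submodule class_ring E (module_vec TYPE('a) ?n)"
    using vs by (simp add: vec_subspace_def subspace_def)
  have Ec: "E \<subseteq> carrier_vec ?n" using submodule.subset[OF sub] by (simp add: module_vec_simps)
  have V: "vec.subspace ?V"
  proof (rule vec.subspaceI)
    have "0\<^sub>v ?n \<in> E" using submodule.zero_closed[OF sub] by (simp add: module_vec_simps)
    then show "0 \<in> ?V" by (intro image_eqI[of _ _ "0\<^sub>v ?n"]) (simp_all add: Finite_Cartesian_Product.vec_eq_iff)
    fix x y assume "x \<in> ?V" "y \<in> ?V"
    then obtain v w where v: "v \<in> E" "w \<in> E" "x = toV v" "y = toV w" by blast
    have "v + w \<in> E" using submodule.m_closed[OF sub v(1,2)] by (simp add: module_vec_simps)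
    moreover have vc: "v \<in> carrier_vec ?n" "w \<in> carrier_vec ?n" using v Ec by auto
    moreover have "x + y = toV (v + w)" unfolding v(3,4) by (rule toV_add[OF vc, symmetric])
    ultimately show "x + y \<in> ?V" by blast
  next
    fix c x assume "x \<in> ?V"
    then obtain v where v: "v \<in> E" "x = toV v" by blast
    have "c \<cdot>\<^sub>v v \<in> E" using submodule.smult_closed[OF sub _ v(1), of c] by (simp add: module_vec_simps class_ring_simps)
    moreover have "c *s x = toV (c \<cdot>\<^sub>v v)" using toV_smult[of v c, where 'n='n] v Ec by auto
    ultimately show "c *s x \<in> ?V" by blast
  qed
  have V': "y \<in> ?V' \<longleftrightarrow> (\<forall>x\<in>?V. hform y x = 0)" for y
  proof
    assume "y \<in> ?V'"
    then show "\<forall>x\<in>?V. hform y x = 0" using Ec by (auto simp: orth_compl_def hform_toV subset_iff)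
  next
    assume y: "\<forall>x\<in>?V. hform y x = 0"
    have "fromV y \<bullet>c w = 0" if "w \<in> E" for w
      using y that Ec hform_toV[OF fromV_carrier[of y], of w] by auto
    then have "fromV y \<in> orth_compl ?n E" by (simp add: orth_compl_def)
    then show "y \<in> ?V'" by (intro image_eqI[of _ _ "fromV y"]) simp_all
  qed
  have V's: "vec.subspace ?V'"
    by (rule vec.subspaceI) (auto simp: V' hform_simps)
  obtain S where S: "orthonormal S" "S \<subseteq> ?V" "?V \<subseteq> vec.span S" by (rule orthonormal_spanning_exists[OF V])
  obtain T where T: "orthonormal T" "T \<subseteq> ?V'" "?V' \<subseteq> vec.span T" by (rule orthonormal_spanning_exists[OF V's])
  have vz: "hform y z = 0" if "y \<in> ?V" "z \<in> ?V'" for y z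
    using V'[of z] that conjugate_hform[of z y] by auto
  have dec: "\<exists>y\<in>?V. \<exists>z\<in>?V'. x = y + z" for x
  proof -
    let ?p = "\<Sum>s\<in>S. hform x s *s s"
    have p: "?p \<in> ?V" using V S(2) by (intro vec.subspace_sum vec.subspace_scale) auto
    have "vec.subspace {y. hform y (x - ?p) = 0}" by (rule vec.subspaceI) (auto simp: hform_simps)
    moreover have "S \<subseteq> {y. hform y (x - ?p) = 0}"
    proof
      fix s assume "s \<in> S"
      then show "s \<in> {y. hform y (x - ?p) = 0}"
        using orthonormal_residual[OF S(1), of s x] conjugate_hform[of "x - ?p" s] by simp
    qed
    ultimately have sp: "vec.span S \<subseteq> {y. hform y (x - ?p) = 0}" by (intro vec.span_minimal)
    have "hform (x - ?p) y = 0" if "y \<in> ?V" for y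
    proof -
      have "hform y (x - ?p) = 0" using sp S(3) that by blast
      then show ?thesis using conjugate_hform[of y "x - ?p"] by simp
    qed
    then have "x - ?p \<in> ?V'" using V' by blast
    then show ?thesis using p by (intro bexI[of _ ?p] bexI[of _ "x - ?p"]) auto
  qed
  have fS: "finite S" and fT: "finite T" using S(1) T(1) by (auto simp: orthonormal_def)
  have k: "vec_subspace_dim ?n E = vec.dim ?V" by (rule vec_subspace_dim_eq[OF vs])
  have kS: "vec_subspace_dim ?n E \<le> card S" unfolding k by (rule vec.dim_le_card[OF S(3) fS])
  have kn: "vec_subspace_dim ?n E \<le> ?n" unfolding k using vec.dim_subset[OF subset_UNIV, of ?V] unfolding vec_dim_card .
  have nT: "?n \<le> vec_subspace_dim ?n E + card T"
  proof -
    obtain B where B: "B \<subseteq> ?V" "vec.independent B" "?V \<subseteq> vec.span B" "card B = vec.dim ?V" using vec.basis_exists by blast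
    have fB: "finite B" using B(2) by (rule vec.finiteI_independent)
    have "UNIV \<subseteq> vec.span (B \<union> T)"
    proof
      fix x :: "'a^'n"
      obtain y z where yz: "y \<in> ?V" "z \<in> ?V'" "x = y + z" using dec by blast
      have "y \<in> vec.span (B \<union> T)" using yz(1) B(3) vec.span_mono[of B "B \<union> T"] by blast
      moreover have "z \<in> vec.span (B \<union> T)" using yz(2) T(3) vec.span_mono[of T "B \<union> T"] by blast
      ultimately show "x \<in> vec.span (B \<union> T)" unfolding yz(3) by (rule vec.span_add)
    qed
    then have "vec.dim (UNIV :: ('a^'n) set) \<le> card (B \<union> T)" by (rule vec.dim_le_card) (use fB fT in simp)
    also have "\<dots> \<le> card B + card T" by (rule card_Un_le)
    finally show ?thesis by (simp only: vec_dim_card k B(4))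
  qed
  have st: "hform s t = 0" if "s \<in> S" "t \<in> T" for s t using vz that S(2) T(2) by blast
  have "DIM('a) * (card S * card T) \<le> dim (entries ` skew_compl L)"
  proof (rule dim_skew_compl_ge[OF S(1) T(1) st L_skew])
    fix z s t c assume z: "z \<in> L" "s \<in> S" "t \<in> T"
    show "inner (c *s t) (mapp z s) = 0"
    proof (rule lie_set_offdiagonal[OF z(1)])
      fix u assume u: "u \<in> K"
      obtain v where v: "v \<in> E" "s = toV v" using z(2) S(2) by blast
      have "fromM u *\<^sub>v v \<in> E" using inv mem_K(2)[OF u] v(1) by (auto simp: invariant_under_def)
      moreover have "v \<in> carrier_vec ?n" using v(1) Ec by blast
      then have "toV (fromM u *\<^sub>v v) = mapp u s" using toV_mult[OF fromM_carrier[of u], of v] v(2) by simp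
      ultimately have "mapp u s \<in> ?V" by (metis imageI)
      then have "hform t (mapp u s) = 0" using z(3) T(2) V' by blast
      then show "inner (c *s t) (mapp u s) = 0" by (simp add: inner_hform[of "c *s t"] hform_simps)
    qed
  qed
  then show ?thesis using that[OF S(1) T(1) T(3) kS nT kn _ dec vz] by (simp add: quotient_dim_eq)
qed

text \<open>\<open>d\<close> is at least \<open>DIM('a) * (k * (n - k))\<close>, which in the
  balanced range is comparable to the dimension of the full matrix space.\<close>

lemma coarse_projection_balanced:
  assumes \<alpha>: "0 < \<alpha>" "\<alpha> \<le> 1/2" and J: "8 / \<alpha> \<le> real J" and E: "reducing_subspace CARD('n) H E"
    and k: "\<alpha> * real CARD('n) \<le> real (vec_subspace_dim CARD('n) E)" "real (vec_subspace_dim CARD('n) E) \<le> (1 - \<alpha>) * real CARD('n)"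
  shows "coarse_projection J"
proof (rule coarse_projection_one)
  let ?n = "CARD('n)" and ?k = "vec_subspace_dim CARD('n) E" and ?d = "quotient_dim CARD('n) Gr H"
  obtain S T :: "('a^'n) set" where ST: "?k \<le> card S" "?n \<le> ?k + card T" "?k \<le> ?n" "DIM('a) * (card S * card T) \<le> ?d"
    by (rule reducing_families[OF E])
  let ?m = "?n - ?k"
  have "?k * ?m \<le> card S * card T" using ST by (intro mult_le_mono) auto
  then have "DIM('a) * (?k * ?m) \<le> ?d" using ST(4) by (meson le_trans mult_le_mono2)
  then have "real (DIM('a) * (?k * ?m)) \<le> real ?d" by (simp only: of_nat_le_iff)
  then have dkm: "real DIM('a) * (real ?k * real ?m) \<le> real ?d" by simp
  define x where "x = real ?n"
  define y where "y = real ?k"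
  define z where "z = real ?m"
  have yz: "y + z = x" "\<alpha> * x \<le> y" "\<alpha> * x \<le> z" "0 \<le> x" "0 \<le> y" "0 \<le> z"
    using k ST(3) by (auto simp: x_def y_def z_def algebra_simps of_nat_diff)
  \<comment> \<open>The larger of \<open>y\<close> and \<open>z\<close> is at least
    \<open>x / 2\<close>, the smaller at least \<open>\<alpha> * x\<close>.\<close>
  have "\<alpha> * (x * x) \<le> 2 * (y * z)"
  proof (cases "x \<le> 2 * y")
    case True
    have "x * (\<alpha> * x) \<le> 2 * y * z" using True yz \<alpha> by (intro mult_mono) auto
    then show ?thesis by (simp add: mult_ac)
  next
    case False
    then have "x \<le> 2 * z" using yz(1) by simp
    then have "(\<alpha> * x) * x \<le> y * (2 * z)" using yz \<alpha> by (intro mult_mono) auto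
    then show ?thesis by (simp add: mult_ac)
  qed
  then have "x * x \<le> 2 / \<alpha> * (y * z)" using \<alpha>(1) by (simp add: pos_le_divide_eq mult.commute)
  then have "real DIM('a) * (x * x) \<le> real DIM('a) * (2 / \<alpha> * (y * z))" by (rule mult_left_mono) simp
  also have "\<dots> = 2 / \<alpha> * (real DIM('a) * (y * z))" by (rule mult.left_commute)
  also have "\<dots> \<le> 2 / \<alpha> * real ?d" using dkm \<alpha>(1) by (intro mult_left_mono) (auto simp: y_def z_def)
  also have "\<dots> \<le> 8 / \<alpha> * real ?d" using \<alpha>(1) by (intro mult_right_mono divide_right_mono) auto
  also have "\<dots> \<le> real J * real ?d" using J by (intro mult_right_mono) auto
  finally have "real (DIM('a) * (?n * ?n)) \<le> real (J * ?d)" by (simp add: x_def)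
  then show "DIM('a) * (?n * ?n) \<le> J * ?d" by (simp only: of_nat_le_iff)
qed

text \<open>An element of \<open>G\<close> that fixes the complement of \<open>E\<close> has the
  blocks \<open>?M\<close> and 1. By the product structure some element of \<open>H\<close> has the
  same blocks, hence is equal to it. The dimension count compares \<open>n * card T\<close> with
  \<open>card S * card T\<close>, where \<open>card S \<ge> \<alpha> * n\<close>.\<close>

lemma coarse_projection_full_block:
  assumes \<alpha>: "0 < \<alpha>" "\<alpha> \<le> 1/2" and J: "8 / \<alpha> \<le> real J" and E: "reducing_subspace CARD('n) H E"
    and k: "vec_subspace_dim CARD('n) E = k" "\<alpha> * real CARD('n) \<le> real k"
    and split: "splits_full_block Grf CARD('n) H E k" and Grf: "Gr = Grf CARD('n)"
    and one: "\<And>m. one (Grf m) = 1\<^sub>m m"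
    and blk: "\<And>M P. M \<in> carrier_mat k k \<Longrightarrow> mat_adjoint M * M = 1\<^sub>m k \<Longrightarrow> P \<in> carrier Gr \<Longrightarrow>
        Determinant.det M = Determinant.det P \<Longrightarrow> M \<in> carrier (Grf k)"
  shows "coarse_projection J"
proof -
  let ?n = "CARD('n)" and ?d = "quotient_dim CARD('n) Gr H"
  let ?V = "toV ` E :: ('a^'n) set" and ?V' = "toV ` orth_compl ?n E :: ('a^'n) set"
  obtain S T :: "('a^'n) set" where T: "orthonormal T" "?V' \<subseteq> vec.span T" and kS: "k \<le> card S" and kn: "k \<le> ?n"
    and dST: "DIM('a) * (card S * card T) \<le> ?d"
    and dec: "\<And>x :: 'a^'n. \<exists>y\<in>?V. \<exists>z\<in>?V'. x = y + z"
    and orth: "\<And>y z. y \<in> ?V \<Longrightarrow> z \<in> ?V' \<Longrightarrow> hform y z = 0"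
    using reducing_families[OF E] unfolding k(1) by metis
  obtain A B H0 where A: "A \<in> carrier_mat ?n k" "mat_adjoint A * A = 1\<^sub>m k" "(\<lambda>x. A *\<^sub>v x) ` carrier_vec k = E"
    and B: "B \<in> carrier_mat ?n (?n - k)" "mat_adjoint B * B = 1\<^sub>m (?n - k)" "(\<lambda>x. B *\<^sub>v x) ` carrier_vec (?n - k) = orth_compl ?n E"
    and H0: "subgroup H0 (Grf (?n - k))"
    and iso: "(\<lambda>u. (mat_adjoint A * u * A, mat_adjoint B * u * B))
          \<in> iso (Gr\<lparr>carrier := H\<rparr>) (Grf k \<times>\<times> (Grf (?n - k))\<lparr>carrier := H0\<rparr>)"
    using split unfolding splits_full_block_def Grf by blast
  note aA = adjoint_carrier[OF A(1)] and aB = adjoint_carrier[OF B(1)]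
  have Ec: "E \<subseteq> carrier_vec ?n" using A(1,3) by auto
  have inv: "invariant_under H E" "invariant_under H (orth_compl ?n E)" using E by (auto simp: reducing_subspace_def)
  let ?Q = "projection T"
  have "p \<in> K" if p: "p \<in> G" "p * ?Q = ?Q" for p
  proof -
    let ?P = "fromM p"
    have fixed: "mapp p z = z" if z: "z \<in> ?V'" for z
    proof -
      have "mapp ?Q z = z" by (rule mapp_projection_span[OF T(1)]) (use T(2) z in blast)
      then show ?thesis using p(2) by (metis mapp_mult)
    qed
    \<comment> \<open>\<open>star p\<close> fixes the complement as well, so images of vectors in
      \<open>E\<close> stay orthogonal to the complement.\<close>
    have pV: "mapp p x \<in> ?V" if x: "x \<in> ?V" for x
    proof -
      obtain y z where yz: "y \<in> ?V" "z \<in> ?V'" "mapp p x = y + z" using dec by blast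
      have "mapp (star p * p) z = z" using unitaryD(1)[OF G_unitary[OF p(1)]] by (simp del: mapp_mult)
      then have "mapp (star p) z = z" using fixed[OF yz(2)] by simp
      then have "hform (mapp p x) z = 0" using orth[OF x yz(2)] by (simp add: hform_mapp)
      then have "hform z z = 0" using yz(3) orth[OF yz(1,2)] by (simp add: hform_simps)
      then have "z = 0" by (simp add: hform_self)
      then show ?thesis using yz by simp
    qed
    have PE: "?P *\<^sub>v v \<in> E" if v: "v \<in> E" for v
    proof -
      have vc: "v \<in> carrier_vec ?n" using v Ec by blast
      have "toV (?P *\<^sub>v v) \<in> ?V" using pV[OF imageI[OF v]] toV_mult[OF fromM_carrier[of p] vc] by simp
      then obtain w where w: "w \<in> E" "(toV (?P *\<^sub>v v) :: 'a^'n) = toV w" by blast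
      have "?P *\<^sub>v v = w" by (rule toV_inject[OF _ _ w(2)]) (use w(1) Ec vc in \<open>auto intro!: mult_mat_vec_carrier[OF fromM_carrier]\<close>)
      then show ?thesis using w(1) by simp
    qed
    have PE': "?P *\<^sub>v v = v" if v: "v \<in> orth_compl ?n E" for v
    proof -
      have vc: "v \<in> carrier_vec ?n" using v by (simp add: orth_compl_def)
      have "(toV (?P *\<^sub>v v) :: 'a^'n) = toV v" using fixed[OF imageI[OF v]] toV_mult[OF fromM_carrier[of p] vc] by simp
      then show ?thesis by (intro toV_inject[where 'n='n]) (use vc in \<open>auto intro!: mult_mat_vec_carrier[OF fromM_carrier]\<close>)
    qed
    have colA: "col A j \<in> E" if j: "j < k" for j
    proof -
      have "col A j = A *\<^sub>v unit_vec k j"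
        using A(1) j by (intro eq_vecI) (auto simp: scalar_prod_right_unit)
      then show ?thesis using A(3) by (metis imageI unit_vec_carrier)
    qed
    have colB: "col B j \<in> orth_compl ?n E" if j: "j < ?n - k" for j
    proof -
      have "col B j = B *\<^sub>v unit_vec (?n - k) j"
        using B(1) j by (intro eq_vecI) (auto simp: scalar_prod_right_unit)
      then show ?thesis using B(3) by (metis imageI unit_vec_carrier)
    qed
    have Bz: "mat_adjoint B * X = 0\<^sub>m (?n - k) k" if X: "X \<in> carrier_mat ?n k" "\<And>j. j < k \<Longrightarrow> col X j \<in> E" for X
    proof (rule eq_matI)
      fix i j assume "i < dim_row (0\<^sub>m (?n - k) k :: 'a Matrix.mat)" "j < dim_col (0\<^sub>m (?n - k) k :: 'a Matrix.mat)"
      then have ij: "i < ?n - k" "j < k" by auto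
      have c: "col B i \<in> carrier_vec ?n" "col X j \<in> carrier_vec ?n"
        using B(1) X(1) unfolding carrier_vec_def carrier_mat_def by simp_all
      have "hform (toV (col X j) :: 'a^'n) (toV (col B i)) = 0" by (rule orth[OF imageI[OF X(2)[OF ij(2)]] imageI[OF colB[OF ij(1)]]])
      then have "col X j \<bullet>c col B i = 0" using hform_toV[OF c(2,1)] by simp
      moreover have "conjugate (col B i) \<bullet> col X j = col X j \<bullet>c col B i"
        by (rule comm_scalar_prod[of _ ?n]) (use c in simp_all)
      ultimately have bx: "conjugate (col B i) \<bullet> col X j = 0" by simp
      have "(mat_adjoint B * X) $$ (i, j) = row (mat_adjoint B) i \<bullet> col X j"
        by (rule index_mult_mat(1)) (use ij aB X(1) in auto)
      then show "(mat_adjoint B * X) $$ (i, j) = 0\<^sub>m (?n - k) k $$ (i, j)"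
        using ij by (simp add: row_adjoint[OF B(1) ij(1)] bx)
    qed (use aB X(1) in auto)
    have PA: "?P * A \<in> carrier_mat ?n k" using A(1) mult_carrier_mat[OF fromM_carrier[of p]] by blast
    have colPA: "col (?P * A) j = ?P *\<^sub>v col A j" if "j < k" for j by (rule col_mult2[OF fromM_carrier A(1) that])
    let ?M = "mat_adjoint A * (?P * A)"
    have M: "?M \<in> carrier_mat k k" using aA PA by auto
    have AM: "A * ?M = ?P * A"
    proof (rule mat_col_eqI)
      fix j assume "j < dim_col (?P * A)"
      then have j: "j < k" using PA by auto
      obtain y where y: "y \<in> carrier_vec k" "?P *\<^sub>v col A j = A *\<^sub>v y" using PE[OF colA[OF j]] A(3) by blast
      have "col (A * ?M) j = A *\<^sub>v (mat_adjoint A *\<^sub>v (A *\<^sub>v y))"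
        using j by (simp add: col_mult2[OF A(1) M] col_mult2[OF aA PA] colPA y(2))
      also have "mat_adjoint A *\<^sub>v (A *\<^sub>v y) = y"
        using assoc_mult_mat_vec[OF aA A(1) y(1)] A(2) y(1) by simp
      finally show "col (A * ?M) j = col (?P * A) j" by (simp add: colPA[OF j] y(2))
    qed (use A(1) M PA in auto)
    have adjP: "mat_adjoint ?P * ?P = 1\<^sub>m ?n"
    proof -
      have "(toM (mat_adjoint ?P * ?P) :: ('a, 'n) cmat) = toM (1\<^sub>m ?n)"
        using unitaryD(1)[OF G_unitary[OF p(1)]]
        by (simp add: toM_mult[OF adjoint_carrier[OF fromM_carrier] fromM_carrier] toM_adjoint[OF fromM_carrier])
      then show ?thesis
        using toM_inject[OF mult_carrier_mat[OF adjoint_carrier[OF fromM_carrier[of p]] fromM_carrier[of p]] one_carrier_mat] by blast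
    qed
    have MM: "mat_adjoint ?M * ?M = 1\<^sub>m k"
    proof -
      note aPA = adjoint_carrier[OF PA]
      have "mat_adjoint ?M = mat_adjoint (?P * A) * A"
        using mat_adjoint_mult[OF aA PA] mat_adjoint_adjoint[OF A(1)] by simp
      then have "mat_adjoint ?M * ?M = mat_adjoint (?P * A) * (?P * A)"
        using assoc_mult_mat[OF aPA A(1) M] AM by simp
      also have "mat_adjoint (?P * A) = mat_adjoint A * mat_adjoint ?P" by (rule mat_adjoint_mult[OF fromM_carrier A(1)])
      also have "mat_adjoint A * mat_adjoint ?P * (?P * A) = mat_adjoint A * (mat_adjoint ?P * (?P * A))"
        by (rule assoc_mult_mat[OF aA adjoint_carrier[OF fromM_carrier] PA])
      also have "mat_adjoint ?P * (?P * A) = mat_adjoint ?P * ?P * A"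
        by (rule assoc_mult_mat[OF adjoint_carrier[OF fromM_carrier] fromM_carrier A(1), symmetric])
      finally show ?thesis using A(1,2) by (simp add: adjP)
    qed
    have PB: "?P * B = B"
    proof (rule mat_col_eqI)
      fix j assume "j < dim_col B"
      then have j: "j < ?n - k" using B(1) by auto
      show "col (?P * B) j = col B j" using col_mult2[OF fromM_carrier B(1) j] PE'[OF colB[OF j]] by simp
    qed (use B(1) in \<open>auto simp: fromM_def\<close>)
    \<comment> \<open>The second diagonal block is the identity, so the block on \<open>E\<close>
      carries the whole determinant; for SO(n) this places \<open>?M\<close> in SO(k).\<close>
    have "Determinant.det ?P = Determinant.det ?M"
      by (rule det_block[OF A(1) B(1) kn fromM_carrier A(2) B(2) Bz[OF A(1) colA] PB Bz[OF PA]])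
        (use colPA PE colA in auto)
    then have MG: "?M \<in> carrier (Grf k)" using blk[OF M MM mem_G(2)[OF p(1)]] by simp
    have "1\<^sub>m (?n - k) \<in> H0" using subgroup.one_closed[OF H0] by (simp add: one)
    then have "(?M, 1\<^sub>m (?n - k)) \<in> (\<lambda>u. (mat_adjoint A * u * A, mat_adjoint B * u * B)) ` H"
      using iso MG by (auto simp: iso_def bij_betw_def DirProd_def)
    then obtain u where u: "u \<in> H" "mat_adjoint A * u * A = ?M" "mat_adjoint B * u * B = 1\<^sub>m (?n - k)" by force
    have uc: "u \<in> carrier_mat ?n ?n" using u(1) H_carrier by blast
    \<comment> \<open>Both \<open>E\<close> and its complement are invariant under \<open>u\<close>,
      so \<open>u\<close> is determined by its two compressions.\<close>
    have uE: "u *\<^sub>v v = ?P *\<^sub>v v" if v: "v \<in> E" for v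
    proof -
      obtain y where y: "y \<in> carrier_vec k" "v = A *\<^sub>v y" using v A(3) by blast
      have vc: "v \<in> carrier_vec ?n" using v Ec by blast
      obtain y1 where y1: "y1 \<in> carrier_vec k" "u *\<^sub>v v = A *\<^sub>v y1" using inv(1) u(1) v A(3) by (auto simp: invariant_under_def)
      obtain y2 where y2: "y2 \<in> carrier_vec k" "?P *\<^sub>v v = A *\<^sub>v y2" using PE[OF v] A(3) by blast
      have red: "mat_adjoint A *\<^sub>v (A *\<^sub>v w) = w" if "w \<in> carrier_vec k" for w
        using assoc_mult_mat_vec[OF aA A(1) that] A(2) that by simp
      have "y1 = mat_adjoint A *\<^sub>v (u *\<^sub>v (A *\<^sub>v y))" using red[OF y1(1)] y1(2) y(2) by simp
      also have "\<dots> = (mat_adjoint A * u * A) *\<^sub>v y"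
        using assoc_mult_mat_vec[OF mult_carrier_mat[OF aA uc] A(1) y(1)] assoc_mult_mat_vec[OF aA uc vc] y(2) by simp
      also have "\<dots> = ?M *\<^sub>v y" using u(2) by simp
      also have "\<dots> = mat_adjoint A *\<^sub>v (?P *\<^sub>v v)"
        using assoc_mult_mat_vec[OF aA PA y(1)] assoc_mult_mat_vec[OF fromM_carrier A(1) y(1)] y(2) by simp
      also have "\<dots> = y2" using red[OF y2(1)] y2(2) by simp
      finally show ?thesis using y1(2) y2(2) by simp
    qed
    have uE': "u *\<^sub>v v = v" if v: "v \<in> orth_compl ?n E" for v
    proof -
      obtain y where y: "y \<in> carrier_vec (?n - k)" "v = B *\<^sub>v y" using v B(3) by blast
      have vc: "v \<in> carrier_vec ?n" using v by (simp add: orth_compl_def)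
      have "u *\<^sub>v v \<in> orth_compl ?n E" using inv(2) u(1) v by (simp add: invariant_under_def)
      then obtain y1 where y1: "y1 \<in> carrier_vec (?n - k)" "u *\<^sub>v v = B *\<^sub>v y1" using B(3) by blast
      have "y1 = mat_adjoint B *\<^sub>v (B *\<^sub>v y1)" using assoc_mult_mat_vec[OF aB B(1) y1(1)] B(2) y1(1) by simp
      also have "\<dots> = mat_adjoint B *\<^sub>v (u *\<^sub>v (B *\<^sub>v y))" using y1(2) y(2) by simp
      also have "\<dots> = (mat_adjoint B * u * B) *\<^sub>v y"
        using assoc_mult_mat_vec[OF mult_carrier_mat[OF aB uc] B(1) y(1)] assoc_mult_mat_vec[OF aB uc vc] y(2) by simp
      also have "\<dots> = y" using u(3) y(1) by simp
      finally show ?thesis using y1(2) y(2) by simp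
    qed
    have "toM u = p"
    proof (rule cmat_eqI)
      fix x :: "'a^'n"
      obtain v w where vw: "v \<in> E" "w \<in> orth_compl ?n E" "x = toV v + toV w" using dec[of x] by blast
      have vc: "v \<in> carrier_vec ?n" "w \<in> carrier_vec ?n" using vw Ec by (auto simp: orth_compl_def)
      show "mapp (toM u) x = mapp p x"
        using toV_mult[OF uc vc(1)] toV_mult[OF uc vc(2)]
          toV_mult[OF fromM_carrier[of p] vc(1)] toV_mult[OF fromM_carrier[of p] vc(2)]
        by (simp add: vw(3) uE[OF vw(1)] uE'[OF vw(2)] PE'[OF vw(2)])
    qed
    then show "p \<in> K" using mem_K(1)[OF u(1)] by simp
  qed
  \<comment> \<open>\<open>n \<le> card S / \<alpha>\<close> turns the dimension bound
    \<open>DIM('a) * (n * card T)\<close> into \<open>d / \<alpha>\<close>.\<close>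
  moreover have "dim (range (\<lambda>M. entries (M * ?Q))) \<le> J * ?d"
  proof -
    have "dim (range (\<lambda>M. entries (M * ?Q))) \<le> DIM('a) * (?n * card T)" by (rule dim_mult_projection_le[OF T(1)])
    then have "real (dim (range (\<lambda>M. entries (M * ?Q)))) \<le> real (DIM('a) * (?n * card T))" by (simp only: of_nat_le_iff)
    also have "\<dots> = real ?n * real (DIM('a) * card T)" by simp
    also have "\<dots> \<le> (1 / \<alpha> * real (card S)) * real (DIM('a) * card T)"
    proof (rule mult_right_mono)
      have "\<alpha> * real ?n \<le> real (card S)" using k(2) kS by linarith
      then show "real ?n \<le> 1 / \<alpha> * real (card S)" using \<alpha>(1) by (simp add: pos_le_divide_eq mult.commute)
    qed simp
    also have "\<dots> = 1 / \<alpha> * real (DIM('a) * (card S * card T))" by simp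
    also have "\<dots> \<le> 1 / \<alpha> * real ?d" using dST \<alpha>(1) by (intro mult_left_mono) (simp_all only: of_nat_le_iff, simp_all)
    also have "\<dots> \<le> 8 / \<alpha> * real ?d" using \<alpha>(1) by (intro mult_right_mono divide_right_mono) auto
    also have "\<dots> \<le> real J * real ?d" using J by (intro mult_right_mono) auto
    finally have "real (dim (range (\<lambda>M. entries (M * ?Q)))) \<le> real (J * ?d)" by simp
    then show ?thesis by (simp only: of_nat_le_iff)
  qed
  ultimately show ?thesis
    unfolding coarse_projection_def
    by (intro exI[of _ ?Q] conjI star_projection projection_square[OF T(1)] ballI impI) auto
qed

end

section \<open>The metric entropy estimate\<close>

definition entropy_lower :: "real \<Rightarrow> real" where
  "entropy_lower \<alpha> = \<alpha>\<^sup>2 / 2560"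

text \<open>The exponent is a value of \<open>J\<close> that serves all three cases. The largest
  requirement comes from (a), where \<open>dim_skewadj_ge\<close> contributes the factor 8.\<close>

definition entropy_upper :: "real \<Rightarrow> real" where
  "entropy_upper \<alpha> = 260 * (1 + 1200 / \<alpha>\<^sup>2) ^ nat \<lceil>8 / \<alpha>\<rceil>"

definition entropy_bounds ::
    "(nat \<Rightarrow> 'a::{conjugatable_ordered_field,real_normed_field,real_inner} Matrix.mat monoid) \<Rightarrow> real \<Rightarrow> nat \<Rightarrow> 'a Matrix.mat set \<Rightarrow> bool" where
  "entropy_bounds Grf \<alpha> n H \<longleftrightarrow>
     (closed_connected_subgroup n (Grf n) H \<longrightarrow>
      Min {theta n (Grf n) H, quotient_diam n (Grf n) H, inverse (kappa n H)} \<ge> \<alpha> \<longrightarrow>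
      small_dim Grf \<alpha> n H \<or> balanced_reducing \<alpha> n H \<or> full_block_reducing Grf \<alpha> n H \<longrightarrow>
      (\<forall>\<epsilon>::real. 0 < \<epsilon> \<and> \<epsilon> \<le> quotient_diam n (Grf n) H \<longrightarrow>
         ereal ((entropy_lower \<alpha> / \<epsilon>) ^ quotient_dim n (Grf n) H)
           \<le> ereal_of_enat (covering_number n (Grf n) H \<epsilon>) \<and>
         ereal_of_enat (covering_number n (Grf n) H \<epsilon>)
           \<le> ereal ((entropy_upper \<alpha> / \<epsilon>) ^ quotient_dim n (Grf n) H)))"

text \<open>\<open>blk\<close> links the groups of different sizes, as case (c) requires: a unitary
  block with the determinant of an element of the large group lies in the small group.\<close>

lemma entropy_bounds_unitary_group:
  fixes Grf :: "nat \<Rightarrow> 'a::rc_field Matrix.mat monoid"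
  assumes UG: "unitary_group (toM ` carrier (Grf CARD('n)) :: ('a, 'n::finite) cmat set)"
    and Grf: "\<And>m. carrier (Grf m) \<subseteq> carrier_mat m m" "\<And>m. mult (Grf m) = (*)" "\<And>m. one (Grf m) = 1\<^sub>m m"
    and blk: "\<And>k M P. M \<in> carrier_mat k k \<Longrightarrow> mat_adjoint M * M = 1\<^sub>m k \<Longrightarrow> P \<in> carrier (Grf CARD('n)) \<Longrightarrow>
        Determinant.det M = Determinant.det P \<Longrightarrow> M \<in> carrier (Grf k)"
    and \<alpha>: "0 < \<alpha>" "\<alpha> \<le> 1/2"
  shows "entropy_bounds Grf \<alpha> CARD('n) H"
  unfolding entropy_bounds_def
proof (intro impI)
  let ?n = "CARD('n)" and ?J = "nat \<lceil>8 / \<alpha>\<rceil>"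
  assume sub: "closed_connected_subgroup ?n (Grf ?n) H"
    and "\<alpha> \<le> Min {theta ?n (Grf ?n) H, quotient_diam ?n (Grf ?n) H, inverse (kappa ?n H)}"
    and cases: "small_dim Grf \<alpha> ?n H \<or> balanced_reducing \<alpha> ?n H \<or> full_block_reducing Grf \<alpha> ?n H"
  then have \<theta>: "\<alpha> \<le> theta ?n (Grf ?n) H" and \<kappa>: "\<alpha> \<le> inverse (kappa ?n H)" by auto
  interpret matrix_homogeneous_space "Grf ?n" H "toM ` carrier (Grf ?n) :: ('a, 'n) cmat set" "toM ` H :: ('a, 'n) cmat set"
  proof (rule matrix_homogeneous_space.intro)
    show "subgroup H (Grf ?n)" "closedin (subtopology (mat_topology ?n) (carrier (Grf ?n))) H"
      using sub by (simp_all add: closed_connected_subgroup_def)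
  qed (fact Grf UG refl)+
  have J: "8 / \<alpha> \<le> real ?J" using \<alpha>(1) by (simp add: real_nat_ceiling_ge)
  have "coarse_projection ?J"
    using cases
  proof (elim disjE)
    assume "small_dim Grf \<alpha> ?n H"
    then show ?thesis by (intro coarse_projection_small_dim[OF \<alpha> \<kappa> J]) (simp add: small_dim_def)
  next
    assume "balanced_reducing \<alpha> ?n H"
    then show ?thesis using coarse_projection_balanced[OF \<alpha> J] by (auto simp: balanced_reducing_def)
  next
    assume "full_block_reducing Grf \<alpha> ?n H"
    then obtain E k where E: "reducing_subspace ?n H E" "vec_subspace_dim ?n E = k" "\<alpha> * real ?n \<le> real k"
      "splits_full_block Grf ?n H E k"
      unfolding full_block_reducing_def by blast
    show ?thesis by (rule coarse_projection_full_block[OF \<alpha> J E refl Grf(3)]) (fact blk)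
  qed
  then obtain Q :: "('a, 'n) cmat" where Q: "star Q = Q" "Q * Q = Q"
    "\<And>p. p \<in> toM ` carrier (Grf ?n) \<Longrightarrow> p * Q = Q \<Longrightarrow> Q * p = Q \<Longrightarrow> p \<in> toM ` H"
    "dim (range (\<lambda>M. entries (M * Q))) \<le> ?J * quotient_dim ?n (Grf ?n) H"
    unfolding coarse_projection_def by blast
  show "\<forall>\<epsilon>::real. 0 < \<epsilon> \<and> \<epsilon> \<le> quotient_diam ?n (Grf ?n) H \<longrightarrow>
         ereal ((entropy_lower \<alpha> / \<epsilon>) ^ quotient_dim ?n (Grf ?n) H)
           \<le> ereal_of_enat (covering_number ?n (Grf ?n) H \<epsilon>) \<and>
         ereal_of_enat (covering_number ?n (Grf ?n) H \<epsilon>)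
           \<le> ereal ((entropy_upper \<alpha> / \<epsilon>) ^ quotient_dim ?n (Grf ?n) H)"
  proof (intro allI impI)
    fix \<epsilon> :: real assume \<epsilon>: "0 < \<epsilon> \<and> \<epsilon> \<le> quotient_diam ?n (Grf ?n) H"
    show "ereal ((entropy_lower \<alpha> / \<epsilon>) ^ quotient_dim ?n (Grf ?n) H)
           \<le> ereal_of_enat (covering_number ?n (Grf ?n) H \<epsilon>) \<and>
         ereal_of_enat (covering_number ?n (Grf ?n) H \<epsilon>)
           \<le> ereal ((entropy_upper \<alpha> / \<epsilon>) ^ quotient_dim ?n (Grf ?n) H)"
      unfolding entropy_lower_def entropy_upper_def
      by (intro conjI covering_number_bounds[OF \<alpha> \<theta> \<kappa> conjunct1[OF \<epsilon>] conjunct2[OF \<epsilon>] Q])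
  qed
qed

lemma entropy_bounds_U:
  assumes "0 < \<alpha>" "\<alpha> \<le> 1/2"
  shows "entropy_bounds U_group \<alpha> CARD('n::finite) H"
  by (rule entropy_bounds_unitary_group[where 'a=complex and 'n='n and Grf=U_group, OF unitary_group_U]) (use assms in \<open>auto simp: U_group_def\<close>)

lemma entropy_bounds_SO:
  assumes "0 < \<alpha>" "\<alpha> \<le> 1/2"
  shows "entropy_bounds SO_group \<alpha> CARD('n::finite) H"
proof (rule entropy_bounds_unitary_group[where 'a=real and 'n='n and Grf=SO_group, OF unitary_group_SO])
  fix k and M P :: "real Matrix.mat"
  assume M: "M \<in> carrier_mat k k" "mat_adjoint M * M = 1\<^sub>m k" "P \<in> carrier (SO_group CARD('n))"
    "Determinant.det M = Determinant.det P"
  have "transpose_mat M = mat_adjoint M"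
    by (rule eq_matI) (use M(1) in \<open>auto simp: mat_adjoint_def mat_of_rows_index\<close>)
  then show "M \<in> carrier (SO_group k)" using M by (simp add: SO_group_def)
qed (use assms in \<open>auto simp: SO_group_def\<close>)

text \<open>
  Sizes are numbers in the theorem but types in the development. If some size violated the
  theorem, one such size would be the cardinality of the following type.
\<close>

definition valid_size :: "nat \<Rightarrow> bool" where
  "valid_size n \<longleftrightarrow> (\<forall>\<alpha>. 0 < \<alpha> \<longrightarrow> \<alpha> \<le> 1/2 \<longrightarrow>
     (\<forall>H. entropy_bounds U_group \<alpha> n H) \<and> (\<forall>H. entropy_bounds SO_group \<alpha> n H))"

definition critical_size :: nat where
  "critical_size = (SOME n. 1 \<le> n \<and> (valid_size n \<longrightarrow> (\<forall>m\<ge>1. valid_size m)))"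

lemma critical_size: "1 \<le> critical_size" "valid_size critical_size \<Longrightarrow> 1 \<le> m \<Longrightarrow> valid_size m"
proof -
  \<comment> \<open>A size that violates the estimates if there is one, and any positive size
    otherwise.\<close>
  have "\<exists>n. 1 \<le> n \<and> (valid_size n \<longrightarrow> (\<forall>m\<ge>1. valid_size m))" by blast
  then have "1 \<le> critical_size \<and> (valid_size critical_size \<longrightarrow> (\<forall>m\<ge>1. valid_size m))"
    unfolding critical_size_def by (rule someI_ex)
  then show "1 \<le> critical_size" "valid_size critical_size \<Longrightarrow> 1 \<le> m \<Longrightarrow> valid_size m" by blast+
qed

typedef critical_index = "{..<critical_size}"
  using critical_size(1) by (intro exI[of _ 0]) simp

instance critical_index :: finite
proof
  have eq: "(UNIV :: critical_index set) = Abs_critical_index ` {..<critical_size}"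
    by (rule type_definition.univ[OF type_definition_critical_index])
  show "finite (UNIV :: critical_index set)" unfolding eq by (intro finite_imageI finite_lessThan)
qed

lemma valid_size: "1 \<le> n \<Longrightarrow> valid_size n"
proof (rule critical_size(2))
  have c: "CARD(critical_index) = critical_size"
    using type_definition.card[OF type_definition_critical_index] by simp
  show "valid_size critical_size"
    unfolding valid_size_def
    using entropy_bounds_U[where 'n=critical_index, unfolded c] entropy_bounds_SO[where 'n=critical_index, unfolded c] by blast
qed

theorem theorem11:
  fixes \<alpha> :: real
  assumes "0 < \<alpha>" and "\<alpha> \<le> 1 / 2"
  shows "\<exists>c>0. \<exists>C>0.
    (\<forall>n\<ge>1. \<forall>H :: complex mat set.
      closed_connected_subgroup n (U_group n) H \<longrightarrow>
      Min {theta n (U_group n) H, quotient_diam n (U_group n) H, inverse (kappa n H)} \<ge> \<alpha> \<longrightarrow>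
      small_dim U_group \<alpha> n H \<or> balanced_reducing \<alpha> n H \<or> full_block_reducing U_group \<alpha> n H \<longrightarrow>
      (\<forall>\<epsilon>::real. 0 < \<epsilon> \<and> \<epsilon> \<le> quotient_diam n (U_group n) H \<longrightarrow>
         ereal ((c / \<epsilon>) ^ quotient_dim n (U_group n) H)
           \<le> ereal_of_enat (covering_number n (U_group n) H \<epsilon>) \<and>
         ereal_of_enat (covering_number n (U_group n) H \<epsilon>)
           \<le> ereal ((C / \<epsilon>) ^ quotient_dim n (U_group n) H))) \<and>
    (\<forall>n\<ge>1. \<forall>H :: real mat set.
      closed_connected_subgroup n (SO_group n) H \<longrightarrow>
      Min {theta n (SO_group n) H, quotient_diam n (SO_group n) H, inverse (kappa n H)} \<ge> \<alpha> \<longrightarrow>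
      small_dim SO_group \<alpha> n H \<or> balanced_reducing \<alpha> n H \<or> full_block_reducing SO_group \<alpha> n H \<longrightarrow>
      (\<forall>\<epsilon>::real. 0 < \<epsilon> \<and> \<epsilon> \<le> quotient_diam n (SO_group n) H \<longrightarrow>
         ereal ((c / \<epsilon>) ^ quotient_dim n (SO_group n) H)
           \<le> ereal_of_enat (covering_number n (SO_group n) H \<epsilon>) \<and>
         ereal_of_enat (covering_number n (SO_group n) H \<epsilon>)
           \<le> ereal ((C / \<epsilon>) ^ quotient_dim n (SO_group n) H)))"
proof -
  have pos: "0 < entropy_lower \<alpha>" "0 < entropy_upper \<alpha>"
    using assms by (auto simp: entropy_lower_def entropy_upper_def intro!: mult_pos_pos zero_less_power add_pos_nonneg)
  have U: "entropy_bounds U_group \<alpha> n H" and SO: "entropy_bounds SO_group \<alpha> n H'" if "1 \<le> n" for n H H'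
    using valid_size[OF that] assms by (simp_all add: valid_size_def)
  then have U: "\<forall>n\<ge>1. \<forall>H :: complex mat set. entropy_bounds U_group \<alpha> n H"
    and SO: "\<forall>n\<ge>1. \<forall>H :: real mat set. entropy_bounds SO_group \<alpha> n H" by blast+
  show ?thesis
    by (rule exI[of _ "entropy_lower \<alpha>"], rule conjI[OF pos(1)], rule exI[of _ "entropy_upper \<alpha>"], rule conjI[OF pos(2)])
      (rule conjI[OF U[unfolded entropy_bounds_def] SO[unfolded entropy_bounds_def]])
qed

end
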